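(* Let $\Theta$ and $\Xi$ be Polish spaces, $\nu\in\mathcal P(\Theta)$, $\chi\in\mathcal P(\Xi\times\Xi)$ and $d>0$. The marked unimodular Galton–Watson tree with seed $\mathrm P^*_{\nu,\chi,d}$ is a minimizer of the rate functions $\bar I^u_d$ and $\bar I^{\rm ER}_d$ on $\mathcal P(\bar{\mathcal G}_*(\Theta,\Xi))$.
   Context: **Marked graphs.** Graphs are simple, locally finite, with finite or countable vertex set; $[n]=\{1,\dots,n\}$. Polish spaces $\Theta,\Xi$ carry complete separable metrics $d_\Theta,d_\Xi$; $\Xi\times\Xi$ carries the maximum metric. A marked graph is a graph $(V,E)$ with a mark $\tau(v)\in\Theta$ for each $v\in V$ and a mark $\xi(u,v)\in\Xi$ for each oriented edge $(u,v)$, $\{u,v\}\in E$. $\bar{\mathcal G}_*=\bar{\mathcal G}_*(\Theta,\Xi)$ is the set of connected rooted marked graphs $[G,o]$ up to isomorphism (bijections preserving edges, marks and root). $(G,o)_r$ is the rooted marked subgraph induced by the vertices at graph distance at most $r$ from $o$. The distance between $[G,o]$ and $[G',o']$ is the infimum of $\frac1{1+r}+\delta$ over $r\in\{0,1,\dots\}$, $\delta>0$ such that there is a root-preserving isomorphism $\Psi$ between the underlying graphs of $(G,o)_r$ and $(G',o')_r$ with $d_\Theta(\tau(v),\tau'(\Psi(v)))<\delta$ and $d_\Xi(\xi(u,v),\xi'(\Psi(u),\Psi(v)))<\delta$ for all vertices $v$ and oriented edges $(u,v)$ of $(G,o)_r$. $\mathcal P(\bar{\mathcal G}_* )$ carries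 the weak topology, metrized e.g. by the bounded Lipschitz metric or the Lévy–Prokhorov metric $d_{LP}$. For a finite marked graph $G$ with vertex set $V$, $U(G)=\frac1{|V|}\sum_{v\in V}\delta_{[G(v),v]}$, where $G(v)$ is the connected component of $v$. **The tree.** The seed $\mathrm P^*_{\nu,\chi,d}$ is the law of the marked tree of depth one whose root has Poisson$(d)$ many children, with i.i.d. vertex marks of law $\nu$ and, independently for each edge $\{u,v\}$, a pair $(X^1,X^2)\sim\chi$ assigned to the two orientations, $(\xi(u,v),\xi(v,u))=(X^1,X^2)$ or $(X^2,X^1)$ with probability $\frac12$ each. The marked unimodular Galton–Watson tree with this seed is the law of the rooted Galton–Watson tree with Poisson$(d)$ offspring distribution and marks assigned to all vertices and edges independently in this way. **BC entropy (finite mark spaces $\Theta,\Xi$, with $\Xi$ totally ordered).** For a finite marked graph $G$, $u_G(\theta)$ is the number of vertices with mark $\theta$ and $m_G(x,x')=m_G(x',x)$ is the number of (unoriented) edges whose two oriented marks are $x$ and $x'$ in some order. For symmetric $\vec m$ let $\|\vec m\|_1=\sum_{x\le x'}m(x,x')$. Let $\vec d=(d_{x,x'})$ be symmetric, nonnegative, not identically $0$, and $Q\in\mathcal P(\Theta)$. A sequence $(\vec m^{(n)},\vec u^{(n)})$ of count vectors is adapted to $(\vec d,Q)$ if $\|\vec m^{(n)}\|_1\le\binom n2$, $\sum_\theta u^{(n)}(\theta)=n$, $m^{(n)}(x,x)/n\to d_{x,x}/2$, $m^{(n)}(x,x')/n\to d_{x,x'}$ for $x\ne x'$, $u^{(n)}(\theta)/n\to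 Q(\theta)$, $m^{(n)}(x,x')=0$ for all $n$ if $d_{x,x'}=0$, and $u^{(n)}(\theta)=0$ for all $n$ if $Q(\theta)=0$. $\mathcal G^{(n)}_{\vec m,\vec u}$ is the set of marked graphs $G$ on $[n]$ with $\vec m_G=\vec m^{(n)}$, $\vec u_G=\vec u^{(n)}$. The BC entropy is $$\Sigma_{\vec d,Q}(\mu)=\lim_{\varepsilon\downarrow0}\limsup_{n\to\infty}\frac1n\Big(\log\big|\{G\in\mathcal G^{(n)}_{\vec m,\vec u}:d_{LP}(U(G),\mu)<\varepsilon\}\big|-\|\vec m^{(n)}\|_1\log n\Big)$$ for any adapted sequence. (Known, by Delgosha and Anantharam: for mean root degree in $(0,\infty)$ it does not depend on the adapted sequence and limsup may be replaced by liminf.) Let $s(a)=\frac a2-\frac a2\log a$ for $a>0$, $s(0)=0$, $s(\vec d)=\sum_{x,x'}s(d_{x,x'})$, $H(Q)=-\sum_\theta Q(\theta)\log Q(\theta)$, $H(\cdot|\cdot)$ relative entropy. **Rate functions for finite marks.** $\Pi(\mu)\in\mathcal P(\Theta)$ is the law of the root mark; $\deg^{x,x'}(\mu)$ is the $\mu$-expected number of neighbors $v$ of the root $o$ with $\xi(v,o)=x$, $\xi(o,v)=x'$; $\vec{\deg}(\mu)=(\deg^{x,x'}(\mu))_{x,x'}$; $\deg(\mu)$ is the expected root degree. With $\Xi^2_\le=\{(x,x'):x\le x'\}$, $P(\vec{\deg}(\mu))\in\mathcal P(\Xi^2_\le)$ has mass $\deg^{x,x}(\mu)/\deg(\mu)$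 at $(x,x)$ and $2\deg^{x,x'}(\mu)/\deg(\mu)$ at $(x,x')$, $x<x'$. $\chi_\le\in\mathcal P(\Xi^2_\le)$ is the law of the increasing rearrangement of a $\chi$-distributed pair. For $d>0$, $I^u_d(\mu)=+\infty$ unless $\deg(\mu)=d$ and $\vec{\deg}(\mu)$ is symmetric, and otherwise $$I^u_d(\mu)=H(\Pi(\mu))+s(\vec{\deg}(\mu))-\Sigma_{\vec{\deg}(\mu),\Pi(\mu)}(\mu)+\tfrac d2H\big(P(\vec{\deg}(\mu))\,|\,\chi_\le\big)+H(\Pi(\mu)|\nu);$$ also $I^{\rm ER}_d(\mu)=I^u_{\deg(\mu)}(\mu)+\frac12\big(\deg(\mu)\log\frac{\deg(\mu)}d-\deg(\mu)+d\big)$, with the conventions $I^u_0(\mu)=H(\Pi(\mu)|\nu)$ if $\deg(\mu)=0$, $0\log0=0$, and $I^{\rm ER}_d(\mu)=+\infty$ if $\deg(\mu)=\infty$. **Rate functions in general.** A tagged partition of a set $X$ is a finite Borel partition $A_1,\dots,A_\ell$ with tags $a_i\in A_i$; its projection maps each point of $A_i$ to $a_i$. A pair of tagged partitions $\{(A_i,a_i)\}_{i\le\ell}$ of $\Theta$ and $\{(B_j,b_j)\}_{j\le\ell'}$ of $\Xi$ is $(\epsilon,\delta)$-good with respect to $(\nu,\chi)$ if $\mathrm{diam}(A_i)\le\epsilon$ for $i\le\ell-1$, $\mathrm{diam}(B_i\times B_j)\le\epsilon$ for $i,j\le\ell'-1$, $\nu(A_\ell)<\delta$ and $\chi((B_{\ell'}\times\Xi)\cup(\Xi\times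 B_{\ell'}))<\delta$. For each $k\ge1$ fix a $(\frac1{2k},e^{-k^2})$-good pair; let $\Theta_k,\Xi_k$ be the finite sets of tags and $\nu^k\in\mathcal P(\Theta_k)$, $\chi^k\in\mathcal P(\Xi_k\times\Xi_k)$ the push-forwards of $\nu,\chi$ under the projections. $I^{u,k}_d$ and $I^{{\rm ER},k}_d$ are the functions $I^u_d$, $I^{\rm ER}_d$ for mark spaces $\Theta_k,\Xi_k$ and laws $\nu^k,\chi^k$, extended by $+\infty$ to measures in $\mathcal P(\bar{\mathcal G}_*(\Theta,\Xi))$ not supported on $\bar{\mathcal G}_*(\Theta_k,\Xi_k)$. With $B_\delta(\mu)$ the ball of radius $\delta$, $$\bar I^u_d(\mu)=\limsup_{\delta\to0}\limsup_{k\to\infty}\inf_{\rho\in B_\delta(\mu)}I^{u,k}_d(\rho),\qquad \bar I^{\rm ER}_d(\mu)=\limsup_{\delta\to0}\limsup_{k\to\infty}\inf_{\rho\in B_\delta(\mu)}I^{{\rm ER},k}_d(\rho).$$ These are the rate functions of the large deviation principles for $U(G_n)$ when $G_n$ has i.i.d. marks and underlying graph uniform with $m_n\sim dn/2$ edges, respectively Erdős–Rényi $G(n,d/n)$. *)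

theory Defs
  imports "HOL-Probability.Probability"
begin

section \<open>Marked graphs\<close>

record ('v, 'a, 'b) mgraph =
  verts :: "'v set"
  edges :: "'v set set"
  vmark :: "'v \<Rightarrow> 'a"
  emark :: "'v \<Rightarrow> 'v \<Rightarrow> 'b"  \<comment> \<open>\<open>emark G u v\<close> is the mark of the oriented edge \<open>(u, v)\<close>\<close>

definition simple_graph :: "('v, 'a, 'b) mgraph \<Rightarrow> bool" where
  "simple_graph G \<longleftrightarrow> (\<forall>e\<in>edges G. e \<subseteq> verts G \<and> card e = 2)"

definition locally_finite :: "('v, 'a, 'b) mgraph \<Rightarrow> bool" where
  "locally_finite G \<longleftrightarrow> (\<forall>v\<in>verts G. finite {u. {v, u} \<in> edges G})"

definition adj :: "('v, 'a, 'b) mgraph \<Rightarrow> ('v \<times> 'v) set" where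
  "adj G = {(u, v). {u, v} \<in> edges G}"

definition induced :: "('v, 'a, 'b) mgraph \<Rightarrow> 'v set \<Rightarrow> ('v, 'a, 'b) mgraph" where
  "induced G W = G\<lparr>verts := W, edges := {e\<in>edges G. e \<subseteq> W}\<rparr>"

definition component :: "('v, 'a, 'b) mgraph \<Rightarrow> 'v \<Rightarrow> ('v, 'a, 'b) mgraph" where
  "component G v = induced G {w. (v, w) \<in> (adj G)\<^sup>*}"

definition gball :: "('v, 'a, 'b) mgraph \<Rightarrow> 'v \<Rightarrow> nat \<Rightarrow> 'v set" where
  "gball G a r = {v\<in>verts G. \<exists>n\<le>r. (a, v) \<in> adj G ^^ n}"

type_synonym ('v, 'a, 'b) rgraph = "('v, 'a, 'b) mgraph \<times> 'v"

definition rooted_connected :: "('v, 'a, 'b) rgraph \<Rightarrow> bool" where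
  "rooted_connected X \<longleftrightarrow> (case X of (G, a) \<Rightarrow>
     simple_graph G \<and> locally_finite G \<and> a \<in> verts G \<and>
     (\<forall>u\<in>verts G. \<forall>v\<in>verts G. (u, v) \<in> (adj G)\<^sup>*))"

definition root_nbhd :: "nat \<Rightarrow> ('v, 'a, 'b) rgraph \<Rightarrow> ('v, 'a, 'b) rgraph" where
  "root_nbhd r X = (case X of (G, a) \<Rightarrow> (induced G (gball G a r), a))"

definition graph_iso ::
  "('v \<Rightarrow> 'w) \<Rightarrow> ('v, 'a, 'b) mgraph \<Rightarrow> ('w, 'a, 'b) mgraph \<Rightarrow> bool" where
  "graph_iso \<Psi> G H \<longleftrightarrow> bij_betw \<Psi> (verts G) (verts H) \<and>
     (\<forall>u\<in>verts G. \<forall>v\<in>verts G. {u, v} \<in> edges G \<longleftrightarrow> {\<Psi> u, \<Psi> v} \<in> edges H)"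

text \<open>Root-preserving graph isomorphisms under which corresponding vertex marks are related by
  \<open>R\<close> and corresponding oriented edge marks by \<open>S\<close>.\<close>

definition marked_iso :: "('a \<Rightarrow> 'a \<Rightarrow> bool) \<Rightarrow> ('b \<Rightarrow> 'b \<Rightarrow> bool) \<Rightarrow>
    ('v \<Rightarrow> 'w) \<Rightarrow> ('v, 'a, 'b) rgraph \<Rightarrow> ('w, 'a, 'b) rgraph \<Rightarrow> bool" where
  "marked_iso R S \<Psi> X Y \<longleftrightarrow> (case X of (G, a) \<Rightarrow> case Y of (H, b) \<Rightarrow>
     graph_iso \<Psi> G H \<and> \<Psi> a = b \<and>
     (\<forall>v\<in>verts G. R (vmark G v) (vmark H (\<Psi> v))) \<and>
     (\<forall>u v. {u, v} \<in> edges G \<longrightarrow> S (emark G u v) (emark H (\<Psi> u) (\<Psi> v))))"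

definition isomorphic :: "('v, 'a, 'b) rgraph \<Rightarrow> ('w, 'a, 'b) rgraph \<Rightarrow> bool" where
  "isomorphic X Y \<longleftrightarrow> rooted_connected X \<and> rooted_connected Y \<and> (\<exists>\<Psi>. marked_iso (=) (=) \<Psi> X Y)"

definition near :: "nat \<Rightarrow> real \<Rightarrow>
    ('v, 'a::metric_space, 'b::metric_space) rgraph \<Rightarrow> ('w, 'a, 'b) rgraph \<Rightarrow> bool" where
  "near r \<delta> X Y \<longleftrightarrow> (\<exists>\<Psi>. marked_iso (\<lambda>s t. dist s t < \<delta>) (\<lambda>s t. dist s t < \<delta>) \<Psi>
     (root_nbhd r X) (root_nbhd r Y))"

definition local_dist ::
  "('v, 'a::metric_space, 'b::metric_space) rgraph \<Rightarrow> ('w, 'a, 'b) rgraph \<Rightarrow> real" where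
  "local_dist X Y = Inf {1 / (1 + real r) + \<delta> | r \<delta>. 0 < \<delta> \<and> near r \<delta> X Y}"

lemma graph_iso_inv:
  assumes "graph_iso \<Psi> G H" shows "graph_iso (inv_into (verts G) \<Psi>) H G"
proof -
  let ?i = "inv_into (verts G) \<Psi>"
  have b: "bij_betw \<Psi> (verts G) (verts H)" using assms by (simp add: graph_iso_def)
  have b': "bij_betw ?i (verts H) (verts G)" using b by (rule bij_betw_inv_into)
  have "{u, v} \<in> edges H \<longleftrightarrow> {?i u, ?i v} \<in> edges G" if "u \<in> verts H" "v \<in> verts H" for u v
  proof -
    have "?i u \<in> verts G" "?i v \<in> verts G" using b' that by (auto simp: bij_betw_def)
    moreover have "\<Psi> (?i u) = u" "\<Psi> (?i v) = v"
      using b that by (auto simp: bij_betw_inv_into_right)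
    ultimately show ?thesis using assms by (metis graph_iso_def)
  qed
  then show ?thesis using b' by (simp add: graph_iso_def)
qed

lemma edge_verts: "simple_graph G \<Longrightarrow> {u, v} \<in> edges G \<Longrightarrow> u \<in> verts G \<and> v \<in> verts G"
  by (auto simp: simple_graph_def)

lemma marked_iso_trans:
  assumes "marked_iso R S \<Psi> X Y" "marked_iso R' S' \<Phi> Y Z" "simple_graph (fst X)"
    and "\<And>a b c. R a b \<Longrightarrow> R' b c \<Longrightarrow> R'' a c" "\<And>a b c. S a b \<Longrightarrow> S' b c \<Longrightarrow> S'' a c"
  shows "marked_iso R'' S'' (\<Phi> \<circ> \<Psi>) X Z"
proof -
  obtain G a H b K c where X: "X = (G, a)" "Y = (H, b)" "Z = (K, c)"
    by (metis surj_pair)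
  have 1: "graph_iso \<Psi> G H" "\<Psi> a = b" "\<And>v. v \<in> verts G \<Longrightarrow> R (vmark G v) (vmark H (\<Psi> v))"
    "\<And>u v. {u, v} \<in> edges G \<Longrightarrow> S (emark G u v) (emark H (\<Psi> u) (\<Psi> v))"
    using assms(1) by (auto simp: marked_iso_def X)
  have 2: "graph_iso \<Phi> H K" "\<Phi> b = c" "\<And>v. v \<in> verts H \<Longrightarrow> R' (vmark H v) (vmark K (\<Phi> v))"
    "\<And>u v. {u, v} \<in> edges H \<Longrightarrow> S' (emark H u v) (emark K (\<Phi> u) (\<Phi> v))"
    using assms(2) by (auto simp: marked_iso_def X)
  have m: "\<Psi> v \<in> verts H" if "v \<in> verts G" for v
    using 1(1) that by (auto simp: graph_iso_def bij_betw_def)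
  have e: "{\<Psi> u, \<Psi> v} \<in> edges H" if "{u, v} \<in> edges G" for u v
    using 1(1) that edge_verts[of G u v] assms(3) by (auto simp: graph_iso_def X)
  have g: "graph_iso (\<Phi> \<circ> \<Psi>) G K"
    using 1(1) 2(1) m by (auto simp: graph_iso_def intro: bij_betw_trans)
  show ?thesis
    using g 1 2 m e assms(4,5) unfolding marked_iso_def X by fastforce
qed

lemma marked_iso_sym:
  assumes "marked_iso R S \<Psi> X Y" "simple_graph (fst Y)" "snd X \<in> verts (fst X)"
    and "\<And>a b. R a b \<Longrightarrow> R' b a" "\<And>a b. S a b \<Longrightarrow> S' b a"
  shows "marked_iso R' S' (inv_into (verts (fst X)) \<Psi>) Y X"
proof -
  obtain G a H b where X: "X = (G, a)" "Y = (H, b)"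
    by (metis surj_pair)
  let ?i = "inv_into (verts G) \<Psi>"
  have 1: "graph_iso \<Psi> G H" "\<Psi> a = b" "\<And>v. v \<in> verts G \<Longrightarrow> R (vmark G v) (vmark H (\<Psi> v))"
    "\<And>u v. {u, v} \<in> edges G \<Longrightarrow> S (emark G u v) (emark H (\<Psi> u) (\<Psi> v))"
    using assms(1) by (auto simp: marked_iso_def X)
  have b: "bij_betw \<Psi> (verts G) (verts H)" using 1(1) by (simp add: graph_iso_def)
  have i: "graph_iso ?i H G" by (rule graph_iso_inv[OF 1(1)])
  have ii: "?i v \<in> verts G" "\<Psi> (?i v) = v" if "v \<in> verts H" for v
    using that b by (auto simp: bij_betw_inv_into_right bij_betw_def inv_into_into)
  have e: "{?i u, ?i v} \<in> edges G" if "{u, v} \<in> edges H" for u v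
    using i that edge_verts[of H u v] assms(2) by (auto simp: graph_iso_def X)
  have "?i b = a" using assms(3) b 1(2) by (auto simp: X bij_betw_def)
  moreover have "R' (vmark H v) (vmark G (?i v))" if "v \<in> verts H" for v
    using 1(3)[OF ii(1)[OF that]] ii(2)[OF that] assms(4) by simp
  moreover have "S' (emark H u v) (emark G (?i u) (?i v))" if "{u, v} \<in> edges H" for u v
  proof -
    have "u \<in> verts H" "v \<in> verts H" using edge_verts[of H u v] assms(2) that by (auto simp: X)
    then show ?thesis using 1(4)[OF e[OF that]] ii(2) assms(5) by simp
  qed
  ultimately show ?thesis using i by (simp add: marked_iso_def X)
qed

lemma relpow_verts:
  assumes "simple_graph G" "a \<in> verts G" "(a, v) \<in> adj G ^^ n" shows "v \<in> verts G"
  using assms(3)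
proof (induction n arbitrary: v)
  case 0 then show ?case using assms by simp
next
  case (Suc n) then show ?case using edge_verts[OF assms(1)] by (auto simp: adj_def)
qed

lemma iso_relpow:
  assumes "graph_iso \<Psi> G H" "simple_graph G" "(a, v) \<in> adj G ^^ n"
  shows "(\<Psi> a, \<Psi> v) \<in> adj H ^^ n"
  using assms(3)
proof (induction n arbitrary: v)
  case 0 then show ?case by simp
next
  case (Suc n)
  then obtain w where w: "(a, w) \<in> adj G ^^ n" "{w, v} \<in> edges G" by (auto simp: adj_def)
  then have "{\<Psi> w, \<Psi> v} \<in> edges H"
    using assms edge_verts[of G w v] by (auto simp: graph_iso_def)
  then show ?case using Suc.IH[OF w(1)] by (auto simp: adj_def)
qed

lemma iso_gball:
  assumes "graph_iso \<Psi> G H" "simple_graph G" "simple_graph H" "a \<in> verts G"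
  shows "\<Psi> ` gball G a r = gball H (\<Psi> a) r"
proof
  have m: "\<Psi> v \<in> verts H" if "v \<in> verts G" for v
    using assms(1) that by (auto simp: graph_iso_def bij_betw_def)
  show "\<Psi> ` gball G a r \<subseteq> gball H (\<Psi> a) r"
    using iso_relpow[OF assms(1,2)] m by (fastforce simp: gball_def)
  show "gball H (\<Psi> a) r \<subseteq> \<Psi> ` gball G a r"
  proof
    fix w assume "w \<in> gball H (\<Psi> a) r"
    then obtain n where w: "w \<in> verts H" "n \<le> r" "(\<Psi> a, w) \<in> adj H ^^ n"
      by (auto simp: gball_def)
    let ?i = "inv_into (verts G) \<Psi>"
    have b: "bij_betw \<Psi> (verts G) (verts H)" using assms by (simp add: graph_iso_def)
    have "(?i (\<Psi> a), ?i w) \<in> adj G ^^ n"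
      by (rule iso_relpow[OF graph_iso_inv[OF assms(1)] assms(3) w(3)])
    moreover have "?i (\<Psi> a) = a" using b assms(4) by (auto simp: bij_betw_def)
    moreover have "\<Psi> (?i w) = w" "?i w \<in> verts G" using b w(1)
      by (auto simp: bij_betw_inv_into_right bij_betw_def inv_into_into)
    ultimately show "w \<in> \<Psi> ` gball G a r" using w(2)
      by (intro image_eqI[of _ _ "?i w"]) (auto simp: gball_def)
  qed
qed

lemma simple_graph_induced: "simple_graph G \<Longrightarrow> simple_graph (induced G W)"
  by (auto simp: simple_graph_def induced_def)

lemma induced_simps [simp]:
  "verts (induced G W) = W" "edges (induced G W) = {e\<in>edges G. e \<subseteq> W}"
  "vmark (induced G W) = vmark G" "emark (induced G W) = emark G"
  by (simp_all add: induced_def)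

lemma gball_subset: "gball G a r \<subseteq> verts G"
  by (auto simp: gball_def)

lemma root_in_gball: "a \<in> verts G \<Longrightarrow> a \<in> gball G a r"
  by (auto simp: gball_def intro!: exI[of _ 0])

lemma gball_mono: "r \<le> R \<Longrightarrow> gball G a r \<subseteq> gball G a R"
  by (auto simp: gball_def intro: order_trans)

lemma graph_iso_induced:
  assumes "graph_iso \<Psi> G H" "W \<subseteq> verts G"
  shows "graph_iso \<Psi> (induced G W) (induced H (\<Psi> ` W))"
  using assms unfolding graph_iso_def bij_betw_def by (auto intro: inj_on_subset)

lemma marked_iso_nbhd:
  assumes "marked_iso R S \<Psi> X Y" "simple_graph (fst X)" "simple_graph (fst Y)"
    "snd X \<in> verts (fst X)"
  shows "marked_iso R S \<Psi> (root_nbhd r X) (root_nbhd r Y)"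
proof -
  obtain G a H b where X: "X = (G, a)" "Y = (H, b)"
    by (metis surj_pair)
  have 1: "graph_iso \<Psi> G H" "\<Psi> a = b" using assms(1) by (auto simp: marked_iso_def X)
  have "\<Psi> ` gball G a r = gball H b r"
    using iso_gball[of \<Psi> G H a r] 1 assms by (simp add: X)
  then have "graph_iso \<Psi> (induced G (gball G a r)) (induced H (gball H b r))"
    using graph_iso_induced[OF 1(1) gball_subset[of G a r]] by simp
  then show ?thesis
    using assms(1) gball_subset[of G a r] by (auto simp: marked_iso_def root_nbhd_def X)
qed

lemma gball_induced:
  assumes "simple_graph G" "a \<in> verts G" "r \<le> R"
  shows "gball (induced G (gball G a R)) a r = gball G a r"
proof -
  let ?K = "induced G (gball G a R)"
  have 1: "(a, v) \<in> adj G ^^ n" if "(a, v) \<in> adj ?K ^^ n" for v n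
    using that
  proof (induction n arbitrary: v)
    case (Suc n) then show ?case by (auto simp: adj_def)
  qed simp
  have 2: "(a, v) \<in> adj ?K ^^ n" if "(a, v) \<in> adj G ^^ n" "n \<le> R" for v n
    using that
  proof (induction n arbitrary: v)
    case (Suc n)
    then obtain w where w: "(a, w) \<in> adj G ^^ n" "{w, v} \<in> edges G" by (auto simp: adj_def)
    have "n \<le> R" using Suc by simp
    then have "w \<in> gball G a R" using w relpow_verts[OF assms(1,2) w(1)]
      by (auto simp: gball_def)
    moreover have "v \<in> gball G a R" using Suc.prems relpow_verts[OF assms(1,2) Suc.prems(1)]
      unfolding gball_def by blast
    ultimately have "(w, v) \<in> adj ?K" using w by (simp add: adj_def)
    then show ?case using Suc.IH[OF w(1) \<open>n \<le> R\<close>] by auto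
  qed simp
  have "gball G a r \<subseteq> gball ?K a r"
    using 2 assms(3) gball_mono[OF assms(3), of G a] unfolding gball_def by fastforce
  moreover have "gball ?K a r \<subseteq> gball G a r"
    using 1 gball_subset[of G a R] by (auto simp: gball_def)
  ultimately show ?thesis by blast
qed

lemma root_nbhd_root_nbhd:
  assumes "simple_graph (fst X)" "snd X \<in> verts (fst X)" "r \<le> R"
  shows "root_nbhd r (root_nbhd R X) = root_nbhd r X"
proof -
  obtain G a where X: "X = (G, a)" by (metis surj_pair)
  have "induced (induced G (gball G a R)) (gball G a r) = induced G (gball G a r)"
    proof -
    have "{e \<in> edges G. e \<subseteq> gball G a R \<and> e \<subseteq> gball G a r} = {e \<in> edges G. e \<subseteq> gball G a r}"
      using gball_mono[OF assms(3), of G a] by blast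
    then show ?thesis by (simp add: induced_def)
  qed
  then show ?thesis using gball_induced[of G a r R] assms by (simp add: X root_nbhd_def)
qed

lemma simple_root_nbhd: "simple_graph (fst X) \<Longrightarrow> simple_graph (fst (root_nbhd r X))"
  by (cases X) (simp add: root_nbhd_def simple_graph_induced)

lemma root_root_nbhd:
  "snd X \<in> verts (fst X) \<Longrightarrow> snd (root_nbhd r X) \<in> verts (fst (root_nbhd r X))"
  by (cases X) (simp add: root_nbhd_def root_in_gball)

lemma rooted_connectedD:
  "rooted_connected X \<Longrightarrow> simple_graph (fst X)" "rooted_connected X \<Longrightarrow> snd X \<in> verts (fst X)"
  by (auto simp: rooted_connected_def)

lemma marked_iso_nbhd_le:
  assumes "marked_iso R S \<Psi> (root_nbhd n X) (root_nbhd n Y)" "rooted_connected X"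
    "rooted_connected Y" "r \<le> n"
  shows "marked_iso R S \<Psi> (root_nbhd r X) (root_nbhd r Y)"
proof -
  have "marked_iso R S \<Psi> (root_nbhd r (root_nbhd n X)) (root_nbhd r (root_nbhd n Y))"
    using assms(2,3) by (intro marked_iso_nbhd[OF assms(1)] simple_root_nbhd root_root_nbhd)
      (auto dest: rooted_connectedD)
  then show ?thesis using assms by (simp add: root_nbhd_root_nbhd rooted_connectedD)
qed

lemma near_le:
  assumes "near n \<delta> X Y" "rooted_connected X" "rooted_connected Y" "r \<le> n" "\<delta> \<le> \<epsilon>"
  shows "near r \<epsilon> X Y"
proof -
  obtain \<Psi> where "marked_iso (\<lambda>s t. dist s t < \<delta>) (\<lambda>s t. dist s t < \<delta>) \<Psi> (root_nbhd r X) (root_nbhd r Y)"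
    using assms marked_iso_nbhd_le unfolding near_def by blast
  then have "marked_iso (\<lambda>s t. dist s t < \<epsilon>) (\<lambda>s t. dist s t < \<epsilon>) \<Psi> (root_nbhd r X) (root_nbhd r Y)"
    using assms(5) unfolding marked_iso_def by (auto split: prod.splits intro: less_le_trans)
  then show ?thesis unfolding near_def by blast
qed

lemma near_sym:
  assumes "near r \<delta> X Y" "rooted_connected X" "rooted_connected Y"
  shows "near r \<delta> Y X"
proof -
  obtain \<Psi> where "marked_iso (\<lambda>s t. dist s t < \<delta>) (\<lambda>s t. dist s t < \<delta>) \<Psi> (root_nbhd r X) (root_nbhd r Y)"
    using assms(1) unfolding near_def by blast
  from marked_iso_sym[OF this] show ?thesis unfolding near_def
    using assms rooted_connectedD simple_root_nbhd root_root_nbhd by (metis (lifting) dist_commute)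
qed

lemma near_trans:
  assumes "near r \<delta> X Y" "near r \<epsilon> Y Z" "rooted_connected X"
  shows "near r (\<delta> + \<epsilon>) X Z"
proof -
  obtain \<Psi> where 1: "marked_iso (\<lambda>s t. dist s t < \<delta>) (\<lambda>s t. dist s t < \<delta>) \<Psi> (root_nbhd r X) (root_nbhd r Y)"
    using assms(1) unfolding near_def by blast
  obtain \<Phi> where 2: "marked_iso (\<lambda>s t. dist s t < \<epsilon>) (\<lambda>s t. dist s t < \<epsilon>) \<Phi> (root_nbhd r Y) (root_nbhd r Z)"
    using assms(2) unfolding near_def by blast
  have "marked_iso (\<lambda>s t. dist s t < \<delta> + \<epsilon>) (\<lambda>s t. dist s t < \<delta> + \<epsilon>) (\<Phi> \<circ> \<Psi>) (root_nbhd r X) (root_nbhd r Z)"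
    by (rule marked_iso_trans[OF 1 2])
      (auto simp: assms(3) rooted_connectedD simple_root_nbhd
        intro: dist_triangle_lt le_less_trans[OF dist_triangle add_strict_mono])
  then show ?thesis unfolding near_def by blast
qed

lemma near_iso:
  assumes "isomorphic X X'" "near r \<delta> X' Y" shows "near r \<delta> X Y"
proof -
  obtain \<Psi> where "marked_iso (=) (=) \<Psi> X X'" and rc: "rooted_connected X" "rooted_connected X'"
    using assms(1) unfolding isomorphic_def by blast
  then have 1: "marked_iso (=) (=) \<Psi> (root_nbhd r X) (root_nbhd r X')"
    by (intro marked_iso_nbhd) (auto dest: rooted_connectedD)
  obtain \<Phi> where 2: "marked_iso (\<lambda>s t. dist s t < \<delta>) (\<lambda>s t. dist s t < \<delta>) \<Phi> (root_nbhd r X') (root_nbhd r Y)"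
    using assms(2) unfolding near_def by blast
  have "marked_iso (\<lambda>s t. dist s t < \<delta>) (\<lambda>s t. dist s t < \<delta>) (\<Phi> \<circ> \<Psi>) (root_nbhd r X) (root_nbhd r Y)"
    by (rule marked_iso_trans[OF 1 2]) (auto simp: rc rooted_connectedD simple_root_nbhd)
  then show ?thesis unfolding near_def by blast
qed

lemma isomorphic_sym: "isomorphic X Y \<Longrightarrow> isomorphic Y X"
  unfolding isomorphic_def using marked_iso_sym[of "(=)" "(=)" _ X Y "(=)" "(=)"] rooted_connectedD
  by (metis (full_types))

lemma isomorphic_trans: "isomorphic X Y \<Longrightarrow> isomorphic Y Z \<Longrightarrow> isomorphic X Z"
  unfolding isomorphic_def
  using marked_iso_trans[of "(=)" "(=)" _ X Y "(=)" "(=)" _ Z "(=)" "(=)"] rooted_connectedD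
  by (metis (full_types))

lemma isomorphic_refl: "rooted_connected X \<Longrightarrow> isomorphic X X"
  unfolding isomorphic_def marked_iso_def graph_iso_def
  by (auto intro!: exI[of _ id] split: prod.splits)

lemma near_cong:
  assumes "isomorphic X X'" "isomorphic Y Y'" shows "near r \<delta> X Y \<longleftrightarrow> near r \<delta> X' Y'"
proof -
  have rc: "rooted_connected X" "rooted_connected X'" "rooted_connected Y" "rooted_connected Y'"
    using assms by (auto simp: isomorphic_def)
  show ?thesis
    using near_iso[OF assms(1)] near_iso[OF assms(2)] near_iso[OF isomorphic_sym[OF assms(1)]]
      near_iso[OF isomorphic_sym[OF assms(2)]] near_sym rc by metis
qed

lemma local_dist_cong:
  assumes "isomorphic X X'" "isomorphic Y Y'" shows "local_dist X Y = local_dist X' Y'"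
  unfolding local_dist_def near_cong[OF assms] by simp

lemma near_0:
  assumes "rooted_connected X" "rooted_connected Y"
  shows "\<exists>\<delta>>0. near 0 \<delta> X Y"
proof -
  obtain G a H b where X: "X = (G, a)" "Y = (H, b)" by (metis surj_pair)
  have a: "a \<in> verts G" "b \<in> verts H" "simple_graph G" "simple_graph H"
    using assms by (auto simp: X rooted_connected_def)
  have g: "gball G a 0 = {a}" "gball H b 0 = {b}" using a by (auto simp: gball_def)
  let ?d = "dist (vmark G a) (vmark H b) + 1"
  have "marked_iso (\<lambda>s t. dist s t < ?d) (\<lambda>s t. dist s t < ?d) (\<lambda>_. b) (root_nbhd 0 X) (root_nbhd 0 Y)"
  proof -
    have "\<not> e \<subseteq> {a}" if "e \<in> edges G" for e
      using a(3) that card_mono[of "{a}" e] by (fastforce simp: simple_graph_def)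
    moreover have "\<not> e \<subseteq> {b}" if "e \<in> edges H" for e
      using a(4) that card_mono[of "{b}" e] by (fastforce simp: simple_graph_def)
    ultimately show ?thesis
      by (auto simp: marked_iso_def graph_iso_def root_nbhd_def X g bij_betw_def)
  qed
  then show ?thesis unfolding near_def by (intro exI[of _ ?d]) (auto intro: add_nonneg_pos)
qed

lemma local_dist_less_iff:
  assumes "rooted_connected X" "rooted_connected Y"
  shows "local_dist X Y < c \<longleftrightarrow> (\<exists>r \<delta>. 0 < \<delta> \<and> near r \<delta> X Y \<and> 1 / (1 + real r) + \<delta> < c)"
proof -
  let ?S = "{1 / (1 + real r) + \<delta> | r \<delta>. 0 < \<delta> \<and> near r \<delta> X Y}"
  have "?S \<noteq> {}" using near_0[OF assms] by blast
  moreover have "bdd_below ?S" by (intro bdd_belowI[of _ 0]) auto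
  ultimately show ?thesis unfolding local_dist_def by (subst cInf_less_iff) auto
qed

lemma local_dist_nonneg:
  assumes "rooted_connected X" "rooted_connected Y" shows "0 \<le> local_dist X Y"
proof (rule ccontr)
  assume "\<not> 0 \<le> local_dist X Y"
  then obtain r \<delta> where "(0::real) < \<delta>" "1 / (1 + real r) + \<delta> < 0"
    using local_dist_less_iff[OF assms, of 0] by force
  moreover have "0 \<le> 1 / (1 + real r)" by simp
  ultimately show False by linarith
qed

lemma local_dist_self:
  assumes "rooted_connected X" shows "local_dist X X = 0"
proof -
  have "local_dist X X \<le> 0 + e" if "e > 0" for e
  proof -
    obtain r where "inverse (real (Suc r)) < e / 2" using reals_Archimedean[OF half_gt_zero[OF \<open>e > 0\<close>]] by blast
    then have r: "1 / (1 + real r) + e / 2 < e" by (simp add: inverse_eq_divide)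
    obtain G a where nb: "root_nbhd r X = (G, a)" by (metis surj_pair)
    have "marked_iso (\<lambda>s t. dist s t < e / 2) (\<lambda>s t. dist s t < e / 2) id (root_nbhd r X) (root_nbhd r X)"
      unfolding nb using that by (simp add: marked_iso_def graph_iso_def)
    then have "near r (e / 2) X X" unfolding near_def by (rule exI[of _ id])
    then have "local_dist X X < e" using r that
      by (subst local_dist_less_iff[OF assms assms]) (intro exI[of _ r] exI[of _ "e / 2"], simp)
    then show ?thesis by simp
  qed
  then have "local_dist X X \<le> 0" by (rule field_le_epsilon)
  then show ?thesis using local_dist_nonneg[OF assms assms] by simp
qed

lemma local_dist_sym:
  assumes "rooted_connected X" "rooted_connected Y" shows "local_dist X Y = local_dist Y X"
  unfolding local_dist_def using near_sym assms by metis

lemma local_dist_triangle: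
  assumes "rooted_connected X" "rooted_connected Y" "rooted_connected Z"
  shows "local_dist X Z \<le> local_dist X Y + local_dist Y Z"
proof (rule field_le_epsilon)
  fix e :: real assume "0 < e"
  then have "local_dist X Y < local_dist X Y + e/2" "local_dist Y Z < local_dist Y Z + e/2" by auto
  then obtain r \<delta> r' \<delta>' where h: "0 < \<delta>" "near r \<delta> X Y" "1 / (1 + real r) + \<delta> < local_dist X Y + e/2"
     "0 < \<delta>'" "near r' \<delta>' Y Z" "1 / (1 + real r') + \<delta>' < local_dist Y Z + e/2"
    using assms by (metis local_dist_less_iff)
  let ?m = "min r r'"
  have "near ?m (\<delta> + \<delta>') X Z"
    using near_trans[OF near_le near_le] h assms by (meson min.cobounded1 min.cobounded2 order_refl)
  moreover have "1 / (1 + real ?m) \<le> 1 / (1 + real r) + 1 / (1 + real r')"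
    by (cases "r \<le> r'") (auto simp: min_def)
  ultimately have "local_dist X Z < local_dist X Y + local_dist Y Z + e"
    using h assms(1,3) by (subst local_dist_less_iff) (auto intro!: exI[of _ ?m] exI[of _ "\<delta> + \<delta>'"])
  then show "local_dist X Z \<le> local_dist X Y + local_dist Y Z + e" by simp
qed

lemma gball_Suc:
  assumes "simple_graph G" "a \<in> verts G"
  shows "gball G a (Suc r) \<subseteq> gball G a r \<union> (\<Union>u\<in>gball G a r. {v. {u, v} \<in> edges G})"
proof
  fix v assume "v \<in> gball G a (Suc r)"
  then obtain n where n: "n \<le> Suc r" "(a, v) \<in> adj G ^^ n" "v \<in> verts G" by (auto simp: gball_def)
  show "v \<in> gball G a r \<union> (\<Union>u\<in>gball G a r. {v. {u, v} \<in> edges G})"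
  proof (cases n)
    case 0 then show ?thesis using n by (auto simp: gball_def)
  next
    case (Suc k)
    then obtain w where w: "(a, w) \<in> adj G ^^ k" "{w, v} \<in> edges G" using n by (auto simp: adj_def)
    then have "w \<in> gball G a r" using relpow_verts[OF assms w(1)] n Suc unfolding gball_def by auto
    then show ?thesis using w by blast
  qed
qed

lemma finite_gball:
  assumes "rooted_connected (G, a)" shows "finite (gball G a r)"
proof (induction r)
  case 0
  have "gball G a 0 \<subseteq> {a}" by (auto simp: gball_def)
  then show ?case using finite_subset by blast
next
  case (Suc r)
  have a: "simple_graph G" "a \<in> verts G" "locally_finite G"
    using assms by (auto simp: rooted_connected_def)
  have "finite {v. {u, v} \<in> edges G}" if "u \<in> gball G a r" for u
    using a(3) that gball_subset[of G a r] by (auto simp: locally_finite_def)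
  then show ?case using Suc finite_subset[OF gball_Suc[OF a(1,2)]] by blast
qed

lemma marked_iso_restrict:
  assumes "verts (fst X) \<subseteq> W" "simple_graph (fst X)" "snd X \<in> verts (fst X)"
  shows "marked_iso R S (restrict \<Psi> W) X Y \<longleftrightarrow> marked_iso R S \<Psi> X Y"
proof -
  obtain G a H b where X: "X = (G, a)" "Y = (H, b)" by (metis surj_pair)
  have v: "\<And>v. v \<in> verts G \<Longrightarrow> v \<in> W" using assms by (auto simp: X)
  have e: "\<And>u v. {u, v} \<in> edges G \<Longrightarrow> u \<in> W \<and> v \<in> W"
    using assms v edge_verts[of G] by (auto simp: X)
  have "bij_betw (restrict \<Psi> W) (verts G) (verts H) \<longleftrightarrow> bij_betw \<Psi> (verts G) (verts H)"
    by (rule bij_betw_cong) (use v in auto)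
  then show ?thesis
    using v e assms(3) by (auto simp: marked_iso_def graph_iso_def X)
qed

text \<open>Local finiteness and a compactness argument turn isomorphisms of all finite neighbourhoods
  into an isomorphism of the whole graphs.\<close>

lemma local_dist_0:
  assumes XY: "rooted_connected X" "rooted_connected Y" and "local_dist X Y = 0"
  shows "isomorphic X Y"
proof -
  obtain G a H b where X: "X = (G, a)" "Y = (H, b)" by (metis surj_pair)
  have ga: "simple_graph G" "a \<in> verts G" and hb: "simple_graph H" "b \<in> verts H"
    using XY by (auto simp: X rooted_connected_def)
  let ?B = "gball G a"
  have near: "near r \<delta> X Y" if "\<delta> > 0" for r \<delta>
  proof -
    have "local_dist X Y < min \<delta> (1 / (1 + real r))" using assms(3) that by simp
    then obtain r' \<delta>' where h: "0 < \<delta>'" "near r' \<delta>' X Y" "1 / (1 + real r') + \<delta>' < min \<delta> (1 / (1 + real r))"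
      using local_dist_less_iff[OF XY] by blast
    have p: "0 \<le> 1 / (1 + real r')" by simp
    then have "\<delta>' \<le> \<delta>" using h by linarith
    moreover have "1 / (1 + real r') < 1 / (1 + real r)" using h by linarith
    then have "r \<le> r'" by (simp add: frac_less_eq divide_simps split: if_splits)
    ultimately show ?thesis using near_le[OF h(2) XY] by blast
  qed
  define S where "S r = {\<Psi> \<in> extensional (?B r). marked_iso (=) (=) \<Psi> (root_nbhd r X) (root_nbhd r Y)}" for r
  have fin: "finite {\<Psi> \<in> extensional (?B r). marked_iso R T \<Psi> (root_nbhd r X) (root_nbhd r Y)}"
    (is "finite ?F") for r R T
  proof (rule finite_subset)
    show "?F \<subseteq> ?B r \<rightarrow>\<^sub>E gball H b r"
      by (auto simp: marked_iso_def root_nbhd_def X graph_iso_def bij_betw_def PiE_def)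
    show "finite (?B r \<rightarrow>\<^sub>E gball H b r)"
      using finite_gball[of G a r] finite_gball[of H b r] XY unfolding X by (intro finite_PiE) auto
  qed
  have res: "marked_iso R T (restrict \<Psi> (?B n)) (root_nbhd r X) (root_nbhd r Y) \<longleftrightarrow>
      marked_iso R T \<Psi> (root_nbhd r X) (root_nbhd r Y)" if "r \<le> n" for R T \<Psi> r n
    by (rule marked_iso_restrict)
      (use that gball_mono[OF that, of G a] ga in
        \<open>auto simp: X root_nbhd_def simple_graph_induced root_in_gball\<close>)
  have ne: "S r \<noteq> {}" for r
  proof -
    let ?e = "\<lambda>k. 1 / real (Suc k)"
    let ?A = "\<lambda>k \<Psi>. marked_iso (\<lambda>s t. dist s t < ?e k) (\<lambda>s t. dist s t < ?e k) \<Psi> (root_nbhd r X) (root_nbhd r Y)"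
    have "\<exists>\<Psi>. ?A k \<Psi>" for k
      using near[of "?e k" r] unfolding near_def by simp
    then have "\<exists>\<Psi>\<in>extensional (?B r). ?A k \<Psi>" for k
      using res[of r r] by (metis order_refl restrict_extensional)
    then obtain f where f: "f k \<in> extensional (?B r)" "?A k (f k)" for k by metis
    have "range f \<subseteq> {\<Psi> \<in> extensional (?B r). marked_iso (\<lambda>_ _. True) (\<lambda>_ _. True) \<Psi> (root_nbhd r X) (root_nbhd r Y)}"
      using f by (auto simp: marked_iso_def split: prod.splits)
    then have "finite (range f)" using fin finite_subset by blast
    then obtain \<Psi> where "infinite (f -` {\<Psi>})"
      using pigeonhole_infinite[of UNIV f] by (auto simp: vimage_def)
    then have inf: "\<exists>k\<ge>m. f k = \<Psi>" for m
      unfolding infinite_nat_iff_unbounded_le by blast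
    have z: "s = t" if "\<And>k. f k = \<Psi> \<Longrightarrow> dist s t < ?e k" for s t :: "'x::metric_space"
    proof (rule ccontr)
      assume "s \<noteq> t"
      then obtain m where m: "?e m < dist s t" using reals_Archimedean[of "dist s t"]
        by (auto simp: inverse_eq_divide)
      obtain k where k: "k \<ge> m" "f k = \<Psi>" using inf by blast
      have "?e k \<le> ?e m" using k by (simp add: frac_le)
      then show False using that[OF k(2)] m by linarith
    qed
    have A: "?A k \<Psi>" if "f k = \<Psi>" for k using f(2)[of k] that by simp
    have "\<Psi> \<in> extensional (?B r)" using f(1) inf by metis
    moreover have "marked_iso (=) (=) \<Psi> (root_nbhd r X) (root_nbhd r Y)"
    proof -
      obtain k where "f k = \<Psi>" using inf by blast
      from A[OF this] show ?thesis using A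
        by (auto simp: marked_iso_def root_nbhd_def X intro!: z)
    qed
    ultimately show ?thesis by (auto simp: S_def)
  qed
  have down: "restrict \<Psi> (?B r) \<in> S r" if "\<Psi> \<in> S n" "r \<le> n" for \<Psi> r n
    using that marked_iso_nbhd_le[OF _ XY that(2)] res[of r r] by (auto simp: S_def)
  define good where "good r \<psi> \<longleftrightarrow> (\<forall>n\<ge>r. \<exists>\<phi>\<in>S n. restrict \<phi> (?B r) = \<psi>)" for r \<psi>
  have rr: "restrict (restrict \<phi> (?B n)) (?B r) = restrict \<phi> (?B r)" if "r \<le> n" for \<phi> :: "'a \<Rightarrow> 'd" and r n
    using gball_mono[OF that, of G a] by (simp add: restrict_restrict Int_absorb1)
  have pick: "\<exists>\<psi>. good r \<psi> \<and> P \<psi>" if "\<And>n. n \<ge> r \<Longrightarrow> \<exists>\<phi>\<in>S n. P (restrict \<phi> (?B r))" for r P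
  proof -
    have "\<forall>n\<in>{r..}. \<exists>\<phi>. \<phi> \<in> S n \<and> P (restrict \<phi> (?B r))" using that by auto
    from bchoice[OF this] obtain f where f: "\<And>n. n \<ge> r \<Longrightarrow> f n \<in> S n \<and> P (restrict (f n) (?B r))"
      by auto
    let ?g = "\<lambda>n. restrict (f (n + r)) (?B r)"
    have "?g n \<in> S r" for n using f[of "n + r"] down[of "f (n + r)" "n + r" r] by simp
    then have "range ?g \<subseteq> S r" by blast
    then have "finite (range ?g)" using fin finite_subset unfolding S_def by blast
    then obtain \<psi> where "infinite (?g -` {\<psi>})"
      using pigeonhole_infinite[of UNIV ?g] by (auto simp: vimage_def)
    then have inf: "\<exists>k\<ge>m. ?g k = \<psi>" for m
      unfolding infinite_nat_iff_unbounded_le by blast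
    have "good r \<psi>" unfolding good_def
    proof (intro allI impI)
      fix n assume "r \<le> n"
      obtain k where k: "k \<ge> n" "?g k = \<psi>" using inf by blast
      then have "restrict (f (k + r)) (?B n) \<in> S n" using f[of "k + r"] down[of "f (k + r)" "k + r" n] by simp
      moreover have "restrict (restrict (f (k + r)) (?B n)) (?B r) = \<psi>"
        using k(2) rr[OF \<open>r \<le> n\<close>, of "f (k + r)"] by (simp only:)
      ultimately show "\<exists>\<phi>\<in>S n. restrict \<phi> (?B r) = \<psi>" by blast
    qed
    moreover have "P \<psi>" using inf[of 0] f by force
    ultimately show ?thesis by blast
  qed
  have ext: "\<exists>\<psi>'. good (Suc r) \<psi>' \<and> restrict \<psi>' (?B r) = \<psi>" if "good r \<psi>" for r \<psi>
  proof (rule pick)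
    fix n assume "Suc r \<le> n"
    then obtain \<phi> where "\<phi> \<in> S n" "restrict \<phi> (?B r) = \<psi>" using \<open>good r \<psi>\<close> unfolding good_def
      by (meson Suc_leD)
    then show "\<exists>\<phi>\<in>S n. restrict (restrict \<phi> (?B (Suc r))) (?B r) = \<psi>" using rr[of r "Suc r"] by auto
  qed
  have "\<exists>\<psi>. good 0 \<psi> \<and> True" by (rule pick) (use ne in blast)
  then have "\<exists>\<psi>. good 0 \<psi>" by blast
  then have "\<exists>F. \<forall>n. good n (F n) \<and> restrict (F (Suc n)) (?B n) = F n"
    using ext by (rule dependent_nat_choice)
  then obtain F where F: "\<And>r. good r (F r)" "\<And>r. restrict (F (Suc r)) (?B r) = F r"
    by blast
  have FS: "F r \<in> S r" for r
  proof -
    obtain \<phi> where "\<phi> \<in> S r" "restrict \<phi> (?B r) = F r"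
      using F(1)[of r] unfolding good_def by (meson order_refl)
    then show ?thesis using down[of \<phi> r r] by (simp only: order_refl)
  qed
  have Fle: "F n v = F r v" if "r \<le> n" "v \<in> ?B r" for r n v
    using that
  proof (induction n rule: dec_induct)
    case (step n)
    have "v \<in> ?B n" using step gball_mono[of r n G a] by auto
    then show ?case using step F(2)[of n] by (metis restrict_apply')
  qed (rule refl)
  have "\<exists>n. v \<in> ?B n" if "v \<in> verts G" for v
  proof -
    have "(a, v) \<in> (adj G)\<^sup>*" using XY(1) that ga by (auto simp: X rooted_connected_def)
    then show ?thesis using that by (auto simp: gball_def dest!: rtrancl_imp_relpow)
  qed
  then obtain N where N: "\<And>v. v \<in> verts G \<Longrightarrow> v \<in> ?B (N v)" by metis
  define \<Psi> where "\<Psi> v = F (N v) v" for v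
  have eqF: "\<Psi> v = F r v" if "v \<in> ?B r" for v r
    using that Fle[of r "max r (N v)" v] Fle[of "N v" "max r (N v)" v] N gball_subset[of G a r]
    unfolding \<Psi>_def by (metis max.cobounded1 max.cobounded2 subsetD)
  have FI: "marked_iso (=) (=) (F r) (root_nbhd r X) (root_nbhd r Y)" for r
    using FS[of r] by (simp add: S_def)
  have bij: "bij_betw (F r) (?B r) (gball H b r)" for r
    using FI[of r] by (auto simp: marked_iso_def graph_iso_def root_nbhd_def X)
  have two: "\<exists>r. u \<in> ?B r \<and> v \<in> ?B r" if "u \<in> verts G" "v \<in> verts G" for u v
    using N[OF that(1)] N[OF that(2)] gball_mono[of "N u" "max (N u) (N v)" G a]
      gball_mono[of "N v" "max (N u) (N v)" G a] by (intro exI[of _ "max (N u) (N v)"]) auto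
  have "inj_on \<Psi> (verts G)"
  proof (rule inj_onI)
    fix u v assume uv: "u \<in> verts G" "v \<in> verts G" "\<Psi> u = \<Psi> v"
    obtain r where "u \<in> ?B r" "v \<in> ?B r" using two uv by blast
    then show "u = v" using uv(3) eqF[of u r] eqF[of v r] bij_betw_imp_inj_on[OF bij[of r]]
      by (simp only: inj_on_eq_iff)
  qed
  moreover have "\<Psi> ` verts G = verts H"
  proof
    show "\<Psi> ` verts G \<subseteq> verts H"
    proof (rule image_subsetI)
      fix v assume "v \<in> verts G"
      then have "F (N v) v \<in> gball H b (N v)"
        using N[of v] bij_betw_apply[OF bij[of "N v"]] by blast
      then show "\<Psi> v \<in> verts H" using gball_subset[of H b "N v"] by (auto simp only: \<Psi>_def)
    qed
    show "verts H \<subseteq> \<Psi> ` verts G"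
    proof
      fix w assume w: "w \<in> verts H"
      have "(b, w) \<in> (adj H)\<^sup>*" using XY(2) w hb by (auto simp: X rooted_connected_def)
      then obtain n where "w \<in> gball H b n" using w by (auto simp: gball_def dest!: rtrancl_imp_relpow)
      then obtain v where "v \<in> ?B n" "F n v = w"
        using bij_betw_imp_surj_on[OF bij[of n]] by (metis imageE)
      then show "w \<in> \<Psi> ` verts G" using eqF[of v n] gball_subset[of G a n] by (metis image_eqI subsetD)
    qed
  qed
  ultimately have 1: "bij_betw \<Psi> (verts G) (verts H)" by (simp add: bij_betw_def)
  have 2: "{u, v} \<in> edges G \<longleftrightarrow> {\<Psi> u, \<Psi> v} \<in> edges H" if uv: "u \<in> verts G" "v \<in> verts G" for u v
  proof -
    obtain r where r: "u \<in> ?B r" "v \<in> ?B r" using two uv by blast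
    have "F r u \<in> gball H b r" "F r v \<in> gball H b r"
      using bij_betw_apply[OF bij[of r]] r by blast+
    then show ?thesis using FI[of r] r eqF[OF r(1)] eqF[OF r(2)] by (auto simp: marked_iso_def graph_iso_def root_nbhd_def X)
  qed
  have 3: "\<Psi> a = b" using eqF[of a 0] root_in_gball[OF ga(2), of 0] FI[of 0]
    by (auto simp: marked_iso_def root_nbhd_def X)
  have 4: "vmark G v = vmark H (\<Psi> v)" if v: "v \<in> verts G" for v
    using FI[of "N v"] N[OF v] by (auto simp: marked_iso_def root_nbhd_def X \<Psi>_def)
  have 5: "emark G u v = emark H (\<Psi> u) (\<Psi> v)" if e: "{u, v} \<in> edges G" for u v
  proof -
    obtain r where r: "u \<in> ?B r" "v \<in> ?B r" using two edge_verts[OF ga(1) e] by blast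
    then show ?thesis using FI[of r] e eqF[OF r(1)] eqF[OF r(2)] by (auto simp: marked_iso_def root_nbhd_def X)
  qed
  show ?thesis unfolding isomorphic_def marked_iso_def graph_iso_def
    using XY 1 2 3 4 5 by (auto simp: X)
qed


section \<open>The space of rooted marked graphs up to isomorphism\<close>

text \<open>Connected locally finite graphs are countable, so vertex sets contained in \<open>nat\<close> suffice to
  represent every isomorphism class.\<close>

lemma part_equivp_isomorphic: "part_equivp (isomorphic :: (nat, 'a, 'b) rgraph \<Rightarrow> (nat, 'a, 'b) rgraph \<Rightarrow> bool)"
proof (rule part_equivpI)
  let ?G = "\<lparr>verts = {0::nat}, edges = {}, vmark = \<lambda>_. undefined, emark = \<lambda>_ _. undefined\<rparr>"
  have "rooted_connected (?G, 0)"
    by (simp add: rooted_connected_def simple_graph_def locally_finite_def)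
  then show "\<exists>X::(nat, 'a, 'b) rgraph. isomorphic X X" by (intro exI) (rule isomorphic_refl)
  show "symp (isomorphic :: (nat, 'a, 'b) rgraph \<Rightarrow> (nat, 'a, 'b) rgraph \<Rightarrow> bool)"
    by (rule sympI) (rule isomorphic_sym)
  show "transp (isomorphic :: (nat, 'a, 'b) rgraph \<Rightarrow> (nat, 'a, 'b) rgraph \<Rightarrow> bool)"
    by (rule transpI) (rule isomorphic_trans)
qed
quotient_type ('a, 'b) gstar = "(nat, 'a, 'b) rgraph" / partial: isomorphic
  by (rule part_equivp_isomorphic)

instantiation gstar :: (metric_space, metric_space) metric_space
begin

lift_definition dist_gstar :: "('a, 'b) gstar \<Rightarrow> ('a, 'b) gstar \<Rightarrow> real" is local_dist
  by (rule local_dist_cong)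

definition uniformity_gstar :: "(('a, 'b) gstar \<times> ('a, 'b) gstar) filter" where
  "uniformity_gstar = (INF e\<in>{0<..}. principal {(x, y). dist x y < e})"

definition open_gstar :: "('a, 'b) gstar set \<Rightarrow> bool" where
  "open_gstar U = (\<forall>x\<in>U. \<forall>\<^sub>F (x', y) in uniformity. x' = x \<longrightarrow> y \<in> U)"

instance
proof
  fix x y z :: "('a, 'b) gstar"
  show "dist x y = 0 \<longleftrightarrow> x = y"
  proof (transfer, rule iffI)
    fix X Y :: "(nat, 'a, 'b) rgraph"
    assume "isomorphic X X" "isomorphic Y Y"
    then have rc: "rooted_connected X" "rooted_connected Y" by (auto simp: isomorphic_def)
    show "isomorphic X Y" if "local_dist X Y = 0" using local_dist_0[OF rc that] .
    assume *: "isomorphic X Y"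
    show "local_dist X Y = 0"
      using local_dist_self[OF rc(1)] local_dist_cong[OF isomorphic_refl[OF rc(1)] *] by simp
  qed
  show "dist x y \<le> dist x z + dist y z"
  proof transfer
    fix X Y Z :: "(nat, 'a, 'b) rgraph"
    assume "isomorphic X X" "isomorphic Y Y" "isomorphic Z Z"
    then have rc: "rooted_connected X" "rooted_connected Y" "rooted_connected Z"
      by (auto simp: isomorphic_def)
    show "local_dist X Y \<le> local_dist X Z + local_dist Y Z"
      using local_dist_triangle[OF rc(1) rc(3) rc(2)] local_dist_sym[OF rc(2) rc(3)] by simp
  qed
qed (rule uniformity_gstar_def open_gstar_def)+

end

definition relabel :: "('v::countable, 'a, 'b) mgraph \<Rightarrow> (nat, 'a, 'b) mgraph" where
  "relabel G = \<lparr>verts = to_nat ` verts G, edges = (\<lambda>e. to_nat ` e) ` edges G,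
     vmark = (\<lambda>i. vmark G (from_nat i)), emark = (\<lambda>i j. emark G (from_nat i) (from_nat j))\<rparr>"

text \<open>The isomorphism class of a connected rooted marked graph; it is meaningful only for
  \<^const>\<open>rooted_connected\<close> arguments.\<close>

definition iso_class :: "('v::countable, 'a, 'b) mgraph \<Rightarrow> 'v \<Rightarrow> ('a, 'b) gstar" where
  "iso_class G v = abs_gstar (relabel G, to_nat v)"

lift_definition root_mark :: "('a, 'b) gstar \<Rightarrow> 'a" is "\<lambda>(G, a). vmark G a"
  by (auto simp: isomorphic_def marked_iso_def rooted_connected_def)

lemma isomorphic_card_nbrs:
  assumes "isomorphic (G, a) (H, b)"
  shows "card {v. {a, v} \<in> edges G \<and> P (emark G v a) (emark G a v)} =
    card {v. {b, v} \<in> edges H \<and> P (emark H v b) (emark H b v)}"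
proof -
  obtain \<Psi> where "marked_iso (=) (=) \<Psi> (G, a) (H, b)"
    and rc: "rooted_connected (G, a)" "rooted_connected (H, b)"
    using assms by (auto simp: isomorphic_def)
  then have i: "bij_betw \<Psi> (verts G) (verts H)" "\<Psi> a = b"
      "\<And>u v. u \<in> verts G \<Longrightarrow> v \<in> verts G \<Longrightarrow> {u, v} \<in> edges G \<longleftrightarrow> {\<Psi> u, \<Psi> v} \<in> edges H"
      "\<And>u v. {u, v} \<in> edges G \<Longrightarrow> emark G u v = emark H (\<Psi> u) (\<Psi> v)"
    by (auto simp: marked_iso_def graph_iso_def)
  have s: "simple_graph G" "simple_graph H" "a \<in> verts G"
    using rc by (auto simp: rooted_connected_def)
  have m: "P (emark G v a) (emark G a v) \<longleftrightarrow> P (emark H (\<Psi> v) b) (emark H b (\<Psi> v))"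
    if "{a, v} \<in> edges G" for v
    using i(2) i(4)[of a v] i(4)[of v a] that by (simp add: insert_commute)
  have "bij_betw \<Psi> {v. {a, v} \<in> edges G \<and> P (emark G v a) (emark G a v)}
      {v. {b, v} \<in> edges H \<and> P (emark H v b) (emark H b v)}" (is "bij_betw _ ?L ?R")
  proof (rule bij_betw_imageI)
    show "inj_on \<Psi> ?L" using edge_verts[OF s(1), of a] i(1)
      by (auto simp: bij_betw_def inj_on_def)
    show "\<Psi> ` ?L = ?R"
    proof
      show "\<Psi> ` ?L \<subseteq> ?R" using edge_verts[OF s(1), of a] i(2,3) m s(3) by auto
      show "?R \<subseteq> \<Psi> ` ?L"
      proof
        fix w assume w: "w \<in> ?R"
        then obtain v where v: "v \<in> verts G" "w = \<Psi> v"
          using edge_verts[OF s(2), of b w] i(1) by (auto simp: bij_betw_def)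
        then have "{a, v} \<in> edges G" using w i(2,3) s(3) by auto
        then show "w \<in> \<Psi> ` ?L" using w v m[of v] by auto
      qed
    qed
  qed
  then show ?thesis by (rule bij_betw_same_card)
qed

lift_definition root_degree :: "('a, 'b) gstar \<Rightarrow> nat" is
  "\<lambda>(G, a). card {v. {a, v} \<in> edges G}"
proof (clarsimp)
  fix G H :: "(nat, 'a, 'b) mgraph" and a b :: nat
  assume "isomorphic (G, a) (H, b)"
  then show "card {v. {a, v} \<in> edges G} = card {v. {b, v} \<in> edges H}"
    using isomorphic_card_nbrs[of G a H b "\<lambda>_ _. True"] by simp
qed

text \<open>The number of neighbours \<open>v\<close> of the root \<open>a\<close> with \<open>\<xi>(v, a) = x\<close> and \<open>\<xi>(a, v) = x'\<close>.\<close>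

lift_definition root_degree_marked :: "'b \<Rightarrow> 'b \<Rightarrow> ('a, 'b) gstar \<Rightarrow> nat" is
  "\<lambda>x x' (G, a). card {v. {a, v} \<in> edges G \<and> emark G v a = x \<and> emark G a v = x'}"
proof (clarsimp)
  fix x x' :: 'b and G H :: "(nat, 'a, 'b) mgraph" and a b :: nat
  assume "isomorphic (G, a) (H, b)"
  then show "card {v. {a, v} \<in> edges G \<and> emark G v a = x \<and> emark G a v = x'} =
      card {v. {b, v} \<in> edges H \<and> emark H v b = x \<and> emark H b v = x'}"
    by (rule isomorphic_card_nbrs)
qed

text \<open>The classes in the subspace of graphs with vertex marks in \<open>A\<close> and edge marks in \<open>B\<close>.\<close>

lift_definition marks_in :: "'a set \<Rightarrow> 'b set \<Rightarrow> ('a, 'b) gstar \<Rightarrow> bool" is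
  "\<lambda>A B (G, a). vmark G ` verts G \<subseteq> A \<and> (\<forall>u v. {u, v} \<in> edges G \<longrightarrow> emark G u v \<in> B)"
proof -
  fix A :: "'a set" and B :: "'b set" and X Y :: "(nat, 'a, 'b) rgraph"
  have imp: "(case Y of (H, b) \<Rightarrow> vmark H ` verts H \<subseteq> A \<and> (\<forall>u v. {u, v} \<in> edges H \<longrightarrow> emark H u v \<in> B))"
    if iso: "isomorphic X Y"
      and marks: "case X of (G, a) \<Rightarrow> vmark G ` verts G \<subseteq> A \<and> (\<forall>u v. {u, v} \<in> edges G \<longrightarrow> emark G u v \<in> B)"
    for X Y :: "(nat, 'a, 'b) rgraph"
  proof -
    obtain G a H b where X: "X = (G, a)" "Y = (H, b)" by (metis surj_pair)
    obtain \<Psi> where "marked_iso (=) (=) \<Psi> Y X" and "simple_graph H"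
      using isomorphic_sym[OF iso] by (auto simp: isomorphic_def rooted_connected_def X)
    then have "\<Psi> v \<in> verts G \<and> vmark H v = vmark G (\<Psi> v)" if "v \<in> verts H" for v
      using that by (auto simp: marked_iso_def graph_iso_def bij_betw_def X)
    moreover have "{\<Psi> u, \<Psi> v} \<in> edges G \<and> emark H u v = emark G (\<Psi> u) (\<Psi> v)"
      if "{u, v} \<in> edges H" for u v
      using that \<open>marked_iso (=) (=) \<Psi> Y X\<close> edge_verts[OF \<open>simple_graph H\<close> that]
      by (auto simp: marked_iso_def graph_iso_def X)
    ultimately show ?thesis using marks by (auto simp: X)
  qed
  assume iso: "isomorphic X Y"
  show "(case X of (G, a) \<Rightarrow> vmark G ` verts G \<subseteq> A \<and> (\<forall>u v. {u, v} \<in> edges G \<longrightarrow> emark G u v \<in> B)) =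
      (case Y of (H, b) \<Rightarrow> vmark H ` verts H \<subseteq> A \<and> (\<forall>u v. {u, v} \<in> edges H \<longrightarrow> emark H u v \<in> B))"
    by (rule iffI) (rule imp[OF iso], assumption, rule imp[OF isomorphic_sym[OF iso]], assumption)
qed


section \<open>Probability measures\<close>

abbreviation prob_measures :: "'c::topological_space measure set" where
  "prob_measures \<equiv> space (prob_algebra borel)"

definition levy_prokhorov :: "'c::metric_space measure \<Rightarrow> 'c measure \<Rightarrow> real" where
  "levy_prokhorov M N = Inf {\<epsilon>. 0 < \<epsilon> \<and> (\<forall>A\<in>sets borel.
     measure M A \<le> measure N (\<Union>x\<in>A. ball x \<epsilon>) + \<epsilon> \<and>
     measure N A \<le> measure M (\<Union>x\<in>A. ball x \<epsilon>) + \<epsilon>)}"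

text \<open>\<open>U(G)\<close>, for a finite marked graph with at least one vertex.\<close>

definition empirical ::
  "('v::countable, 'a::metric_space, 'b::metric_space) mgraph \<Rightarrow> ('a, 'b) gstar measure" where
  "empirical G = distr (uniform_count_measure (verts G)) borel (\<lambda>v. iso_class (component G v) v)"


section \<open>The marked unimodular Galton--Watson tree\<close>

text \<open>Individuals are Ulam--Harris words; the \<open>i\<close>-th child of \<open>w\<close> is \<open>w @ [i]\<close>. Every word \<open>w\<close> carries
  an independent sample \<open>(N, t, (x1, x2), c)\<close>: \<open>N\<close> is the number of children of \<open>w\<close>, \<open>t\<close> its mark,
  \<open>(x1, x2)\<close> the pair of marks for the edge from \<open>w\<close> to its parent, and the fair coin \<open>c\<close> decides which
  orientation of that edge gets \<open>x1\<close>. For Poisson offspring the root and all other individuals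
  have the same offspring law.\<close>

type_synonym ('a, 'b) gw_sample = "nat list \<Rightarrow> nat \<times> 'a \<times> ('b \<times> 'b) \<times> bool"

definition gw_space ::
  "'a::topological_space measure \<Rightarrow> ('b::topological_space \<times> 'b) measure \<Rightarrow> real \<Rightarrow>
    ('a, 'b) gw_sample measure" where
  "gw_space \<nu> chi d = (\<Pi>\<^sub>M w\<in>UNIV. measure_pmf (poisson_pmf d) \<Otimes>\<^sub>M \<nu> \<Otimes>\<^sub>M chi \<Otimes>\<^sub>M
     measure_pmf (bernoulli_pmf (1/2)))"

definition gw_tree :: "('a, 'b) gw_sample \<Rightarrow> (nat list, 'a, 'b) mgraph" where
  "gw_tree \<omega> = (let
      children = (\<lambda>w. fst (\<omega> w));
      V = {w. \<forall>i<length w. w ! i < children (take i w)};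
      \<comment> \<open>marks of the edge between \<open>w\<close> and its parent: (away from the root, towards the root)\<close>
      edge_pair = (\<lambda>w. case \<omega> w of (N, t, (x1, x2), c) \<Rightarrow> if c then (x1, x2) else (x2, x1))
    in \<lparr>verts = V,
        edges = {{w, w @ [i]} | w i. w @ [i] \<in> V},
        vmark = (\<lambda>w. fst (snd (\<omega> w))),
        emark = (\<lambda>u v. if length u < length v then fst (edge_pair v) else snd (edge_pair u))\<rparr>)"

definition ugw :: "'a::metric_space measure \<Rightarrow> ('b::metric_space \<times> 'b) measure \<Rightarrow> real \<Rightarrow>
    ('a, 'b) gstar measure" where
  "ugw \<nu> chi d = distr (gw_space \<nu> chi d) borel (\<lambda>\<omega>. iso_class (gw_tree \<omega>) [])"


section \<open>BC entropy\<close>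

text \<open>Finite mark spaces are given by finite sets \<open>A\<close> (vertex marks) and \<open>B\<close> (edge marks) of ambient
  mark types, \<open>B\<close> with a linear order \<open>R\<close>. As the marked graphs over \<open>A\<close> and \<open>B\<close> form a closed subspace of
  \<^typ>\<open>('a, 'b) gstar\<close>, the Levy--Prokhorov distances of measures living there agree.\<close>

definition ordered_pairs :: "'b set \<Rightarrow> ('b \<times> 'b) set \<Rightarrow> ('b \<times> 'b) set" where
  "ordered_pairs B R = {(x, x') \<in> B \<times> B. (x, x') \<in> R}"

definition vertex_count :: "('v, 'a, 'b) mgraph \<Rightarrow> 'a \<Rightarrow> nat" where
  "vertex_count G t = card {v\<in>verts G. vmark G v = t}"

definition edge_count :: "('v, 'a, 'b) mgraph \<Rightarrow> 'b \<Rightarrow> 'b \<Rightarrow> nat" where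
  "edge_count G x x' = card {e\<in>edges G. \<exists>u v. e = {u, v} \<and> emark G u v = x \<and> emark G v u = x'}"

definition total_count :: "'b set \<Rightarrow> ('b \<times> 'b) set \<Rightarrow> ('b \<Rightarrow> 'b \<Rightarrow> nat) \<Rightarrow> nat" where
  "total_count B R m = (\<Sum>(x, x')\<in>ordered_pairs B R. m x x')"

definition adapted :: "'a set \<Rightarrow> 'b set \<Rightarrow> ('b \<times> 'b) set \<Rightarrow> ('b \<Rightarrow> 'b \<Rightarrow> real) \<Rightarrow> ('a \<Rightarrow> real) \<Rightarrow>
    (nat \<Rightarrow> 'b \<Rightarrow> 'b \<Rightarrow> nat) \<Rightarrow> (nat \<Rightarrow> 'a \<Rightarrow> nat) \<Rightarrow> bool" where
  "adapted A B R D Q m u \<longleftrightarrow>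
     (\<forall>n. \<forall>x\<in>B. \<forall>x'\<in>B. m n x x' = m n x' x) \<and>
     (\<forall>n. total_count B R (m n) \<le> n choose 2) \<and>
     (\<forall>n. (\<Sum>t\<in>A. u n t) = n) \<and>
     (\<forall>x\<in>B. (\<lambda>n. real (m n x x) / real n) \<longlonglongrightarrow> D x x / 2) \<and>
     (\<forall>x\<in>B. \<forall>x'\<in>B. x \<noteq> x' \<longrightarrow> (\<lambda>n. real (m n x x') / real n) \<longlonglongrightarrow> D x x') \<and>
     (\<forall>t\<in>A. (\<lambda>n. real (u n t) / real n) \<longlonglongrightarrow> Q t) \<and>
     (\<forall>x\<in>B. \<forall>x'\<in>B. D x x' = 0 \<longrightarrow> (\<forall>n. m n x x' = 0)) \<and>
     (\<forall>t\<in>A. Q t = 0 \<longrightarrow> (\<forall>n. u n t = 0))"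

text \<open>Marked graphs on \<open>{1..n}\<close> with given counts. Mark functions are \<open>undefined\<close> off the vertices
  and edges, so that each marked graph is represented, and hence counted, exactly once.\<close>

definition graphs_with_counts :: "'a set \<Rightarrow> 'b set \<Rightarrow> nat \<Rightarrow> ('b \<Rightarrow> 'b \<Rightarrow> nat) \<Rightarrow> ('a \<Rightarrow> nat) \<Rightarrow>
    (nat, 'a, 'b) mgraph set" where
  "graphs_with_counts A B n m u = {G. simple_graph G \<and> verts G = {1..n} \<and>
     (\<forall>v\<in>{1..n}. vmark G v \<in> A) \<and> (\<forall>v. v \<notin> {1..n} \<longrightarrow> vmark G v = undefined) \<and>
     (\<forall>v w. {v, w} \<in> edges G \<longrightarrow> emark G v w \<in> B) \<and>
     (\<forall>v w. {v, w} \<notin> edges G \<longrightarrow> emark G v w = undefined) \<and>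
     (\<forall>x\<in>B. \<forall>x'\<in>B. edge_count G x x' = m x x') \<and> (\<forall>t\<in>A. vertex_count G t = u t)}"

definition ln_card :: "'c set \<Rightarrow> ereal" where
  "ln_card S = (if S = {} then -\<infinity> else ereal (ln (real (card S))))"

definition bc_entropy_along ::
  "'a::metric_space set \<Rightarrow> 'b::metric_space set \<Rightarrow> ('b \<times> 'b) set \<Rightarrow>
    (nat \<Rightarrow> 'b \<Rightarrow> 'b \<Rightarrow> nat) \<Rightarrow> (nat \<Rightarrow> 'a \<Rightarrow> nat) \<Rightarrow> ('a, 'b) gstar measure \<Rightarrow> ereal" where
  "bc_entropy_along A B R m u \<mu> = Lim (at_right 0) (\<lambda>\<epsilon>. limsup (\<lambda>n. ereal (1 / real n) *
     (ln_card {G \<in> graphs_with_counts A B n (m n) (u n). levy_prokhorov (empirical G) \<mu> < \<epsilon>}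
       - ereal (real (total_count B R (m n)) * ln (real n)))))"

text \<open>The value does not depend on the adapted sequence (Delgosha and Anantharam); some adapted
  sequence is chosen.\<close>

definition bc_entropy ::
  "'a::metric_space set \<Rightarrow> 'b::metric_space set \<Rightarrow> ('b \<times> 'b) set \<Rightarrow>
    ('b \<Rightarrow> 'b \<Rightarrow> real) \<Rightarrow> ('a \<Rightarrow> real) \<Rightarrow> ('a, 'b) gstar measure \<Rightarrow> ereal" where
  "bc_entropy A B R D Q \<mu> =
     (case SOME (m, u). adapted A B R D Q m u of (m, u) \<Rightarrow> bc_entropy_along A B R m u \<mu>)"


section \<open>Rate functions for finite mark spaces\<close>

text \<open>The function \<open>ln\<close> is total, so the products below vanish when their first factor is \<open>0\<close>; this
  gives the conventions \<open>s(0) = 0\<close> and \<open>0 log 0 = 0\<close>.\<close>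

definition s_fun :: "real \<Rightarrow> real" where
  "s_fun a = a / 2 - a / 2 * ln a"

definition entropy_on :: "'c set \<Rightarrow> ('c \<Rightarrow> real) \<Rightarrow> real" where
  "entropy_on S p = - (\<Sum>x\<in>S. p x * ln (p x))"

definition rel_entropy_on :: "'c set \<Rightarrow> ('c \<Rightarrow> real) \<Rightarrow> ('c \<Rightarrow> real) \<Rightarrow> ereal" where
  "rel_entropy_on S p q = (if \<exists>x\<in>S. p x \<noteq> 0 \<and> q x = 0 then \<infinity>
     else ereal (\<Sum>x\<in>S. p x * ln (p x / q x)))"

definition root_law :: "('a::metric_space, 'b::metric_space) gstar measure \<Rightarrow> 'a \<Rightarrow> real" where
  "root_law \<mu> t = measure (distr \<mu> borel root_mark) {t}"

definition mean_degree :: "('a::metric_space, 'b::metric_space) gstar measure \<Rightarrow> ennreal" where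
  "mean_degree \<mu> = (\<integral>\<^sup>+ g. of_nat (root_degree g) \<partial>\<mu>)"

definition mean_degree_marked ::
  "('a::metric_space, 'b::metric_space) gstar measure \<Rightarrow> 'b \<Rightarrow> 'b \<Rightarrow> ennreal" where
  "mean_degree_marked \<mu> x x' = (\<integral>\<^sup>+ g. of_nat (root_degree_marked x x' g) \<partial>\<mu>)"

definition pair_law :: "('b \<Rightarrow> 'b \<Rightarrow> real) \<Rightarrow> real \<Rightarrow> 'b \<times> 'b \<Rightarrow> real" where
  "pair_law D d = (\<lambda>(x, x'). if x = x' then D x x / d else 2 * D x x' / d)"

definition sorted_law :: "'b set \<Rightarrow> ('b \<times> 'b) set \<Rightarrow> ('b \<times> 'b) measure \<Rightarrow> 'b \<times> 'b \<Rightarrow> real" where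
  "sorted_law B R chi q =
     measure chi {(x, x') \<in> B \<times> B. (if (x, x') \<in> R then (x, x') else (x', x)) = q}"

text \<open>The case \<open>d = 0\<close> is the convention \<open>I\<^sub>0(\<mu>) = H(\<Pi>(\<mu>) | \<nu>)\<close> used by the Erdos--Renyi rate function.\<close>

definition rate_u :: "'a::metric_space set \<Rightarrow> 'b::metric_space set \<Rightarrow> ('b \<times> 'b) set \<Rightarrow>
    'a measure \<Rightarrow> ('b \<times> 'b) measure \<Rightarrow> real \<Rightarrow> ('a, 'b) gstar measure \<Rightarrow> ereal" where
  "rate_u A B R \<nu> chi d \<mu> = (let
      D = (\<lambda>x x'. enn2real (mean_degree_marked \<mu> x x'));
      Q = root_law \<mu>;
      H\<nu> = rel_entropy_on A Q (\<lambda>t. measure \<nu> {t})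
    in if mean_degree \<mu> \<noteq> ennreal d \<or>
          (\<exists>x\<in>B. \<exists>x'\<in>B. mean_degree_marked \<mu> x x' \<noteq> mean_degree_marked \<mu> x' x) then \<infinity>
       else if d = 0 then H\<nu>
       else ereal (entropy_on A Q + (\<Sum>(x, x')\<in>B \<times> B. s_fun (D x x')))
         - bc_entropy A B R D Q \<mu>
         + ereal (d / 2) * rel_entropy_on (ordered_pairs B R) (pair_law D d) (sorted_law B R chi)
         + H\<nu>)"

definition rate_ER :: "'a::metric_space set \<Rightarrow> 'b::metric_space set \<Rightarrow> ('b \<times> 'b) set \<Rightarrow>
    'a measure \<Rightarrow> ('b \<times> 'b) measure \<Rightarrow> real \<Rightarrow> ('a, 'b) gstar measure \<Rightarrow> ereal" where
  "rate_ER A B R \<nu> chi d \<mu> = (if mean_degree \<mu> = \<infinity> then \<infinity> else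
     let D = enn2real (mean_degree \<mu>)
     in rate_u A B R \<nu> chi D \<mu> + ereal (1/2 * (D * ln (D / d) - D + d)))"


section \<open>Rate functions for general mark spaces\<close>

text \<open>A tagged partition is a nonempty list of pairs (cell, tag). Only the last cell, the one that is
  not required to be of small diameter, may be empty, in which case its tag is irrelevant.\<close>

type_synonym 'c tpartition = "('c set \<times> 'c) list"

definition tagged_partition :: "'c::topological_space tpartition \<Rightarrow> bool" where
  "tagged_partition P \<longleftrightarrow> P \<noteq> [] \<and> (\<forall>(C, t)\<in>set P. C \<in> sets borel) \<and>
     (\<forall>i<length P. \<forall>j<length P. i \<noteq> j \<longrightarrow> fst (P ! i) \<inter> fst (P ! j) = {}) \<and>
     (\<Union>(C, t)\<in>set P. C) = UNIV \<and>
     (\<forall>(C, t)\<in>set (butlast P). t \<in> C) \<and>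
     (fst (last P) \<noteq> {} \<longrightarrow> snd (last P) \<in> fst (last P))"

definition tags :: "'c tpartition \<Rightarrow> 'c set" where
  "tags P = {t. \<exists>C. (C, t) \<in> set P \<and> t \<in> C}"

definition projection :: "'c tpartition \<Rightarrow> 'c \<Rightarrow> 'c" where
  "projection P x = (THE t. \<exists>C. (C, t) \<in> set P \<and> x \<in> C)"

text \<open>Bounds on diameters are spelled out pointwise, because \<^const>\<open>diameter\<close> is not meaningful for
  unbounded sets; products carry the maximum metric rather than the Euclidean one of the type
  \<^typ>\<open>'b \<times> 'b\<close>.\<close>

definition good_pair :: "'a::metric_space measure \<Rightarrow> ('b::metric_space \<times> 'b) measure \<Rightarrow>
    real \<Rightarrow> real \<Rightarrow> 'a tpartition \<Rightarrow> 'b tpartition \<Rightarrow> bool" where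
  "good_pair \<nu> chi \<epsilon> \<delta> P P' \<longleftrightarrow> tagged_partition P \<and> tagged_partition P' \<and>
     (\<forall>(C, t)\<in>set (butlast P). \<forall>x\<in>C. \<forall>y\<in>C. dist x y \<le> \<epsilon>) \<and>
     (\<forall>(C, t)\<in>set (butlast P'). \<forall>(C', t')\<in>set (butlast P').
        \<forall>x\<in>C. \<forall>y\<in>C. \<forall>x'\<in>C'. \<forall>y'\<in>C'. max (dist x y) (dist x' y') \<le> \<epsilon>) \<and>
     measure \<nu> (fst (last P)) < \<delta> \<and>
     measure chi (fst (last P') \<times> UNIV \<union> UNIV \<times> fst (last P')) < \<delta>"

definition project_law :: "'c::topological_space tpartition \<Rightarrow> 'c measure \<Rightarrow> 'c measure" where
  "project_law P \<nu> = distr \<nu> borel (projection P)"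

definition project_law2 ::
  "'c::topological_space tpartition \<Rightarrow> ('c \<times> 'c) measure \<Rightarrow> ('c \<times> 'c) measure" where
  "project_law2 P chi = distr chi borel (map_prod (projection P) (projection P))"

definition extend_rate :: "'a::metric_space set \<Rightarrow> 'b::metric_space set \<Rightarrow>
    (('a, 'b) gstar measure \<Rightarrow> ereal) \<Rightarrow> ('a, 'b) gstar measure \<Rightarrow> ereal" where
  "extend_rate A B I \<mu> = (if AE g in \<mu>. marks_in A B g then I \<mu> else \<infinity>)"

definition rate_u_k :: "'a::metric_space tpartition \<Rightarrow> 'b::metric_space tpartition \<Rightarrow>
    ('b \<times> 'b) set \<Rightarrow> 'a measure \<Rightarrow> ('b \<times> 'b) measure \<Rightarrow> real \<Rightarrow>
    ('a, 'b) gstar measure \<Rightarrow> ereal" where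
  "rate_u_k P P' R \<nu> chi d = extend_rate (tags P) (tags P')
     (rate_u (tags P) (tags P') R (project_law P \<nu>) (project_law2 P' chi) d)"

definition rate_ER_k :: "'a::metric_space tpartition \<Rightarrow> 'b::metric_space tpartition \<Rightarrow>
    ('b \<times> 'b) set \<Rightarrow> 'a measure \<Rightarrow> ('b \<times> 'b) measure \<Rightarrow> real \<Rightarrow>
    ('a, 'b) gstar measure \<Rightarrow> ereal" where
  "rate_ER_k P P' R \<nu> chi d = extend_rate (tags P) (tags P')
     (rate_ER (tags P) (tags P') R (project_law P \<nu>) (project_law2 P' chi) d)"

definition lower_limit :: "(nat \<Rightarrow> 'c::metric_space measure \<Rightarrow> ereal) \<Rightarrow> 'c measure \<Rightarrow> ereal" where
  "lower_limit I \<mu> = Limsup (at_right 0) (\<lambda>\<delta>. limsup (\<lambda>k.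
     INF \<rho>\<in>{\<rho>\<in>prob_measures. levy_prokhorov \<mu> \<rho> < \<delta>}. I k \<rho>))"

definition rate_u_bar :: "(nat \<Rightarrow> 'a::metric_space tpartition) \<Rightarrow>
    (nat \<Rightarrow> 'b::metric_space tpartition) \<Rightarrow> (nat \<Rightarrow> ('b \<times> 'b) set) \<Rightarrow>
    'a measure \<Rightarrow> ('b \<times> 'b) measure \<Rightarrow> real \<Rightarrow> ('a, 'b) gstar measure \<Rightarrow> ereal" where
  "rate_u_bar P P' R \<nu> chi d = lower_limit (\<lambda>k. rate_u_k (P k) (P' k) (R k) \<nu> chi d)"

definition rate_ER_bar :: "(nat \<Rightarrow> 'a::metric_space tpartition) \<Rightarrow>
    (nat \<Rightarrow> 'b::metric_space tpartition) \<Rightarrow> (nat \<Rightarrow> ('b \<times> 'b) set) \<Rightarrow>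
    'a measure \<Rightarrow> ('b \<times> 'b) measure \<Rightarrow> real \<Rightarrow> ('a, 'b) gstar measure \<Rightarrow> ereal" where
  "rate_ER_bar P P' R \<nu> chi d = lower_limit (\<lambda>k. rate_ER_k (P k) (P' k) (R k) \<nu> chi d)"

end

(*
  For finite mark spaces the rates are nonnegative: relative entropies are, and the BC entropy is at
  most the growth rate of the number of all graphs with the given counts. So it suffices to find, near
  the tree, measures of rate at most 0. Projecting the marks of the tree changes, with high probability,
  no mark of its first generations by more than 1/k, and the law rho of the projected tree has vanishing
  relative entropies; it remains to see that its BC entropy attains the upper bound, that is, that most
  graphs with the given counts look locally like rho.

  Choose the marks of the vertices and, with probability d/n each, the marked edges independently, so
  that the graphs with given counts are essentially equally likely and together have a probability that
  is not exponentially small. The number of vertices whose neighbourhood is a given finite tree is a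
  Lipschitz function of the independent choices. Its expectation is bounded below by counting
  embeddings of the tree, and by an exponential moment bound it is exponentially unlikely to fall short
  of this by a fraction of n. Conditioning on the counts thus keeps these lower bounds for most graphs.
  As finitely many finite trees carry almost all of the mass of rho, lower bounds alone force the
  empirical measure to be close to rho.
*)

theory Submission
  imports Defs
begin

text \<open>The BC entropy is evaluated along whichever adapted sequence the choice operator picks,
  so both entropy bounds are proved for every adapted sequence. They rest on one number: in the
  independent model a configuration with the prescribed counts has weight exactly
  \<open>exp (log_weight n)\<close>, and \<open>(- log_weight n - M n * ln n) / n\<close> tends to
  H(Q) + s(d), the very expression from which the rate function subtracts the entropy. Total mass 1
  bounds the number of configurations from above, mass that is not exponentially small bounds it
  from below. The event of exact counts is only known to have probability at least exp(-theta n) for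
  each theta > 0, so the estimates that survive conditioning must fail with probability
  exponentially small in n, although there are about n^2 independent slots. This is why pattern
  counts are arranged to change by a bounded amount when one slot changes, uniformly in n and
  without any bound on the degrees of the graph. Sorting siblings makes the embedding a function of
  its root, so different patterns have disjoint sets of roots and their frequencies add up.\<close>

section \<open>Estimates for the Levy-Prokhorov distance\<close>

text \<open>For probability measures one of the two inequalities implies the other: apply it to the
  complement of the \<open>e\<close>-neighbourhood of \<open>A\<close>, whose own
  \<open>e\<close>-neighbourhood misses \<open>A\<close>, and pass to complements. This is what
  later lets lower bounds on frequencies control the distance.\<close>

lemma levy_prokhorov_leI:
  fixes M N :: "'c::metric_space measure"
  assumes M: "M \<in> prob_measures" and N: "N \<in> prob_measures" and "0 < e"
    and le: "\<And>A. A \<in> sets borel \<Longrightarrow> measure M A \<le> measure N (\<Union>x\<in>A. ball x e) + e"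
  shows "levy_prokhorov M N \<le> e"
proof -
  interpret M: prob_space M using M by (simp add: space_prob_algebra)
  interpret N: prob_space N using N by (simp add: space_prob_algebra)
  have s: "sets M = sets borel" "sets N = sets borel" "space M = UNIV" "space N = UNIV"
    using M N sets_eq_imp_space_eq[of M borel] sets_eq_imp_space_eq[of N borel]
    by (auto simp: space_prob_algebra)
  have "measure N A \<le> measure M (\<Union>x\<in>A. ball x e) + e" if A: "A \<in> sets borel" for A
  proof -
    let ?B = "- (\<Union>x\<in>A. ball x e)"
    have B: "?B \<in> sets borel" by (intro borel_closed) (auto simp: closed_def)
    have "(\<Union>x\<in>?B. ball x e) \<subseteq> - A"
      by (force simp: dist_commute)
    moreover have "open (\<Union>x\<in>?B. ball x e)" by auto
    ultimately have "measure N (\<Union>x\<in>?B. ball x e) \<le> measure N (- A)"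
      using A s by (intro N.finite_measure_mono) auto
    also have "\<dots> = 1 - measure N A"
      using N.prob_compl[of A] A s by (simp add: Compl_eq_Diff_UNIV)
    finally have "measure M ?B \<le> 1 - measure N A + e" using le[OF B] by simp
    moreover have "measure M ?B = 1 - measure M (\<Union>x\<in>A. ball x e)"
    proof -
      have "(\<Union>x\<in>A. ball x e) \<in> sets M" unfolding s by (intro borel_open) auto
      then show ?thesis using M.prob_compl s by (simp add: Compl_eq_Diff_UNIV)
    qed
    ultimately show ?thesis by simp
  qed
  then show ?thesis unfolding levy_prokhorov_def using le \<open>0 < e\<close>
    by (intro cInf_lower) (auto intro!: bdd_belowI[of _ 0])
qed

text \<open>Countably many measurable sets covering the space on each of which \<open>F\<close> oscillates by less than
  \<open>1 / m\<close> give measurability without any separability of the target.\<close>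

lemma borel_measurable_oscillation:
  fixes F :: "'w \<Rightarrow> 'c::metric_space"
  assumes "\<And>m. countable (C m)" and "\<And>m E. E \<in> C m \<Longrightarrow> E \<in> sets M"
    and "\<And>m w. w \<in> space M \<Longrightarrow> \<exists>E\<in>C m. w \<in> E"
    and osc: "\<And>m E w w'. E \<in> C m \<Longrightarrow> w \<in> E \<Longrightarrow> w' \<in> E \<Longrightarrow> dist (F w) (F w') < 1 / real (Suc m)"
  shows "F \<in> borel_measurable M"
proof (rule borel_measurableI)
  fix U :: "'c set" assume "open U"
  let ?D = "{E \<in> \<Union>(range C). E \<subseteq> F -` U}"
  have "F -` U \<inter> space M = \<Union>?D \<inter> space M"
  proof
    show "F -` U \<inter> space M \<subseteq> \<Union>?D \<inter> space M"
    proof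
      fix w assume w: "w \<in> F -` U \<inter> space M"
      then obtain e where e: "e > 0" "ball (F w) e \<subseteq> U" using \<open>open U\<close> open_contains_ball by blast
      obtain m where m: "1 / real (Suc m) < e"
        using reals_Archimedean[OF e(1)] by (auto simp: inverse_eq_divide)
      obtain E where E: "E \<in> C m" "w \<in> E" using assms(3) w by blast
      have "E \<subseteq> F -` U"
      proof
        fix w' assume "w' \<in> E"
        then have "dist (F w) (F w') < e" using osc[OF E] m by (meson less_trans)
        then show "w' \<in> F -` U" using e(2) by auto
      qed
      then show "w \<in> \<Union>?D \<inter> space M" using E w by blast
    qed
  qed auto
  moreover have "countable ?D" using assms(1) by (intro countable_subset[OF Collect_subset]) auto
  moreover have "\<Union>?D \<in> sets M" using assms(2) \<open>countable ?D\<close> by (intro sets.countable_Union) auto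
  ultimately show "F -` U \<inter> space M \<in> sets M" by auto
qed

text \<open>The coupling is a common sample space; it is applied to the marked tree and its
  projection, both functions of one sample. Outside \<open>B\<close> a point of \<open>A\<close>
  moves only within the \<open>e\<close>-neighbourhood of \<open>A\<close>.\<close>

lemma levy_prokhorov_coupling:
  fixes F F' :: "'w \<Rightarrow> 'c::metric_space"
  assumes "prob_space M" and [measurable]: "F \<in> borel_measurable M" "F' \<in> borel_measurable M"
    and "0 < e" and B: "B \<in> sets M" "measure M B \<le> e"
    and close: "\<And>w. w \<in> space M - B \<Longrightarrow> dist (F w) (F' w) < e"
  shows "levy_prokhorov (distr M borel F) (distr M borel F') \<le> e"
proof (rule levy_prokhorov_leI)
  interpret prob_space M by fact
  show "distr M borel F \<in> prob_measures" "distr M borel F' \<in> prob_measures"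
    by (auto simp: space_prob_algebra intro!: prob_space_distr)
  fix A :: "'c set" assume A: "A \<in> sets borel"
  have [measurable]: "(\<Union>x\<in>A. ball x e) \<in> sets borel" by (intro borel_open) auto
  have "measure (distr M borel F) A = prob (F -` A \<inter> space M)" using A by (simp add: measure_distr)
  also have "\<dots> \<le> prob ((F' -` (\<Union>x\<in>A. ball x e) \<inter> space M) \<union> B)"
  proof (intro finite_measure_mono subsetI)
    fix w assume w: "w \<in> F -` A \<inter> space M"
    show "w \<in> (F' -` (\<Union>x\<in>A. ball x e) \<inter> space M) \<union> B"
    proof (cases "w \<in> B")
      case False
      then have "F' w \<in> ball (F w) e" using close w by simp
      then show ?thesis using w by blast
    qed simp
  qed (use B(1) in auto)
  also have "\<dots> \<le> prob (F' -` (\<Union>x\<in>A. ball x e) \<inter> space M) + prob B"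
    using B(1) by (intro measure_Un_le) auto
  also have "\<dots> \<le> measure (distr M borel F') (\<Union>x\<in>A. ball x e) + e"
    using B(2) by (simp add: measure_distr)
  finally show "measure (distr M borel F) A \<le> measure (distr M borel F') (\<Union>x\<in>A. ball x e) + e" .
qed fact

section \<open>Local isomorphisms, components and relabelling\<close>

text \<open>A criterion of covering type: \<open>\<phi>\<close> has to map the neighbours of each
  vertex within distance \<open>r\<close> exactly onto the neighbours of its image, and induction on
  the radius then shows that balls map onto balls. Injectivity up to distance \<open>Suc r\<close>
  serves to reflect edges: an edge of \<open>G\<close> lifts to an edge towards some neighbour,
  which a priori may lie at distance \<open>Suc r\<close>, and injectivity identifies it with the
  expected endpoint.\<close>

lemma near_gcovering:
  fixes T :: "('v, 'a::metric_space, 'b::metric_space) mgraph" and G :: "('w, 'a, 'b) mgraph"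
  assumes T: "simple_graph T" "a \<in> verts T" and G: "simple_graph G" "b \<in> verts G"
    and inj: "inj_on \<phi> (gball T a (Suc r))" and root: "\<phi> a = b"
    and nbrs: "\<And>w. w \<in> gball T a r \<Longrightarrow> {j. {\<phi> w, j} \<in> edges G} = \<phi> ` {w'. {w, w'} \<in> edges T}"
    and vm: "\<And>w. w \<in> gball T a r \<Longrightarrow> dist (vmark T w) (vmark G (\<phi> w)) < \<delta>"
    and em: "\<And>w w'. w \<in> gball T a r \<Longrightarrow> w' \<in> gball T a r \<Longrightarrow> {w, w'} \<in> edges T \<Longrightarrow>
      dist (emark T w w') (emark G (\<phi> w) (\<phi> w')) < \<delta>"
  shows "near r \<delta> (T, a) (G, b)"
proof -
  have step: "gball K c (Suc s) = gball K c s \<union> (\<Union>u\<in>gball K c s. {v. {u, v} \<in> edges K})"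
    if K: "simple_graph K" "c \<in> verts K" for s and K :: "('x, 'a, 'b) mgraph" and c
  proof
    have "v \<in> gball K c (Suc s)" if uv: "u \<in> gball K c s" "{u, v} \<in> edges K" for u v
    proof -
      obtain n where n: "n \<le> s" "(c, u) \<in> adj K ^^ n" using uv by (auto simp: gball_def)
      then have "(c, v) \<in> adj K ^^ Suc n" using uv by (auto simp: adj_def)
      then show ?thesis using n edge_verts[OF K(1) uv(2)] by (auto simp: gball_def intro!: exI[of _ "Suc n"])
    qed
    then show "gball K c s \<union> (\<Union>u\<in>gball K c s. {v. {u, v} \<in> edges K}) \<subseteq> gball K c (Suc s)"
      using gball_mono[of s "Suc s" K c] by auto
  qed (rule gball_Suc[OF K])
  have ball: "\<phi> ` gball T a s = gball G b s" if "s \<le> Suc r" for s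
    using that
  proof (induction s)
    case 0 show ?case using T G root by (auto simp: gball_def)
  next
    case (Suc s)
    have sub: "gball T a s \<subseteq> gball T a r" using Suc by (intro gball_mono) simp
    have "(\<Union>u\<in>gball G b s. {v. {u, v} \<in> edges G}) = (\<Union>w\<in>gball T a s. {v. {\<phi> w, v} \<in> edges G})"
      using Suc.prems by (simp flip: Suc.IH)
    also have "\<dots> = (\<Union>w\<in>gball T a s. \<phi> ` {w'. {w, w'} \<in> edges T})"
      using nbrs sub by (intro SUP_cong) auto
    finally show ?case using Suc unfolding step[OF T] step[OF G] by (auto simp: image_Un image_UN)
  qed
  have sub: "gball T a r \<subseteq> gball T a (Suc r)" by (rule gball_mono) simp
  have e: "{u, w} \<in> edges T \<longleftrightarrow> {\<phi> u, \<phi> w} \<in> edges G" if uw: "u \<in> gball T a r" "w \<in> gball T a r" for u w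
  proof
    assume "{u, w} \<in> edges T"
    then show "{\<phi> u, \<phi> w} \<in> edges G" using nbrs[OF uw(1)] by blast
  next
    assume "{\<phi> u, \<phi> w} \<in> edges G"
    then obtain w' where w': "{u, w'} \<in> edges T" "\<phi> w = \<phi> w'" using nbrs[OF uw(1)] by blast
    then have "w' \<in> gball T a (Suc r)" using step[OF T] uw by auto
    then have "w = w'" using inj_onD[OF inj w'(2)] uw(2) sub by auto
    then show "{u, w} \<in> edges T" using w' by simp
  qed
  have "graph_iso \<phi> (induced T (gball T a r)) (induced G (gball G b r))"
    using ball[of r] inj_on_subset[OF inj sub] e
    by (auto simp: graph_iso_def bij_betw_def)
  then show ?thesis unfolding near_def marked_iso_def root_nbhd_def
    using root vm em by (intro exI[of _ \<phi>]) auto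
qed

lemma adj_component_relpow:
  "(v, w) \<in> adj (component G v) ^^ n \<longleftrightarrow> (v, w) \<in> adj G ^^ n"
proof (induction n arbitrary: w)
  case (Suc n)
  have "(u, w) \<in> adj (component G v) \<longleftrightarrow> (u, w) \<in> adj G" if "(v, u) \<in> adj G ^^ n" for u
  proof -
    have "(v, u) \<in> (adj G)\<^sup>*" using that by (rule relpow_imp_rtrancl)
    then show ?thesis by (auto simp: component_def adj_def intro: rtrancl_into_rtrancl)
  qed
  then show ?case using Suc by auto
qed simp

lemma verts_component:
  assumes "simple_graph G" "v \<in> verts G"
  shows "verts (component G v) \<subseteq> verts G"
proof
  fix w assume "w \<in> verts (component G v)"
  then have "(v, w) \<in> (adj G)\<^sup>*" by (simp add: component_def)
  then obtain n where "(v, w) \<in> adj G ^^ n" using rtrancl_imp_relpow by blast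
  then show "w \<in> verts G" by (rule relpow_verts[OF assms])
qed

lemma rooted_connected_component:
  assumes G: "simple_graph G" "locally_finite G" "v \<in> verts G"
  shows "rooted_connected (component G v, v)"
proof -
  let ?C = "component G v"
  have to: "(v, u) \<in> (adj ?C)\<^sup>*" if "u \<in> verts ?C" for u
  proof -
    have "(v, u) \<in> (adj G)\<^sup>*" using that by (simp add: component_def)
    then show ?thesis unfolding rtrancl_is_UN_relpow by (simp add: adj_component_relpow)
  qed
  have "sym (adj ?C)" by (auto simp: sym_def adj_def insert_commute)
  then have "sym ((adj ?C)\<^sup>*)" by (rule sym_rtrancl)
  then have "(u, w) \<in> (adj ?C)\<^sup>*" if "u \<in> verts ?C" "w \<in> verts ?C" for u w
    using to[OF that(1)] to[OF that(2)] by (meson rtrancl_trans symD)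
  moreover have "locally_finite ?C" unfolding locally_finite_def
  proof
    fix u assume "u \<in> verts ?C"
    then have "finite {w. {u, w} \<in> edges G}" using G(2) verts_component[OF G(1,3)]
      by (auto simp: locally_finite_def)
    then show "finite {w. {u, w} \<in> edges ?C}"
      by (rule finite_subset[rotated]) (auto simp: component_def)
  qed
  ultimately show ?thesis using G
    by (auto simp: rooted_connected_def component_def simple_graph_induced)
qed

lemma root_nbhd_component:
  assumes "simple_graph G" "v \<in> verts G"
  shows "root_nbhd r (component G v, v) = root_nbhd r (G, v)"
proof -
  have b: "gball (component G v) v r = gball G v r"
  proof -
    have "(v, w) \<in> (adj G)\<^sup>* \<and> w \<in> verts G" if "(v, w) \<in> adj G ^^ n" for w n
      using that relpow_verts[OF assms that] relpow_imp_rtrancl by blast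
    then show ?thesis unfolding gball_def adj_component_relpow by (auto simp: component_def)
  qed
  have "gball G v r \<subseteq> {w. (v, w) \<in> (adj G)\<^sup>*}"
    by (auto simp: gball_def dest: relpow_imp_rtrancl)
  then have "{e \<in> edges G. e \<subseteq> {w. (v, w) \<in> (adj G)\<^sup>*} \<and> e \<subseteq> gball G v r} = {e \<in> edges G. e \<subseteq> gball G v r}"
    by blast
  then show ?thesis unfolding root_nbhd_def prod.case b by (simp add: component_def induced_def)
qed

lemma isomorphic_relabel:
  fixes G :: "('v::countable, 'a, 'b) mgraph"
  assumes rc: "rooted_connected (G, v)"
  shows "isomorphic (G, v) (relabel G, to_nat v)"
proof -
  let ?f = "to_nat :: 'v \<Rightarrow> nat"
  have e: "{?f u, j} \<in> edges (relabel G) \<longleftrightarrow> (\<exists>w. j = ?f w \<and> {u, w} \<in> edges G)" for u j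
  proof
    assume "{?f u, j} \<in> edges (relabel G)"
    then obtain x where x: "x \<in> edges G" "{?f u, j} = ?f ` x" by (auto simp: relabel_def)
    moreover obtain p q where pq: "x = {p, q}"
      using x rc by (auto simp: rooted_connected_def simple_graph_def card_2_iff)
    ultimately show "\<exists>w. j = ?f w \<and> {u, w} \<in> edges G"
      by (auto simp: doubleton_eq_iff insert_commute)
  next
    assume "\<exists>w. j = ?f w \<and> {u, w} \<in> edges G"
    then obtain w where "j = ?f w" "{u, w} \<in> edges G" by blast
    then show "{?f u, j} \<in> edges (relabel G)"
      by (auto simp: relabel_def intro!: image_eqI[of _ _ "{u, w}"])
  qed
  have iso: "graph_iso ?f G (relabel G)"
    unfolding graph_iso_def e by (simp add: relabel_def bij_betw_def)
  have path: "(?f u, ?f w) \<in> (adj (relabel G))\<^sup>*" if "(u, w) \<in> (adj G)\<^sup>*" for u w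
    using that
  proof (induction rule: rtrancl_induct)
    case (step y z)
    then have "(?f y, ?f z) \<in> adj (relabel G)" using e by (auto simp: adj_def)
    then show ?case using step by simp
  qed simp
  have "simple_graph (relabel G)" using rc
    by (auto simp: rooted_connected_def simple_graph_def relabel_def card_image inj_on_def)
  moreover have "locally_finite (relabel G)"
  proof -
    have "{j. {?f u, j} \<in> edges (relabel G)} = ?f ` {w. {u, w} \<in> edges G}" for u
      unfolding e by auto
    moreover have "\<forall>u\<in>verts G. finite {w. {u, w} \<in> edges G}"
      using rc by (simp add: rooted_connected_def locally_finite_def)
    ultimately have "\<forall>u\<in>verts G. finite {j. {?f u, j} \<in> edges (relabel G)}" by simp
    then show ?thesis by (simp add: locally_finite_def relabel_def)
  qed
  moreover have "(i, j) \<in> (adj (relabel G))\<^sup>*" if ij: "i \<in> verts (relabel G)" "j \<in> verts (relabel G)" for i j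
  proof -
    obtain u w where "u \<in> verts G" "w \<in> verts G" "i = ?f u" "j = ?f w"
      using ij unfolding relabel_def by auto
    then show ?thesis using path rc by (simp add: rooted_connected_def)
  qed
  moreover have "?f v \<in> verts (relabel G)" using rc by (auto simp: relabel_def rooted_connected_def)
  ultimately have "rooted_connected (relabel G, ?f v)" by (auto simp: rooted_connected_def)
  moreover have "marked_iso (=) (=) ?f (G, v) (relabel G, ?f v)"
    using iso by (simp add: marked_iso_def relabel_def)
  ultimately show ?thesis using rc unfolding isomorphic_def by blast
qed

lemma rooted_connected_relabel:
  "rooted_connected (G, v) \<Longrightarrow> rooted_connected (relabel G, to_nat v)"
  using isomorphic_relabel[of G v] by (simp add: isomorphic_def)

text \<open>Classes are formed after relabelling by natural numbers, but distances may be computed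
  on the original graphs, even over two different vertex types. Trees on words and graphs on numbers
  are compared through this.\<close>

lemma dist_iso_class:
  fixes G :: "('v::countable, 'a::metric_space, 'b::metric_space) mgraph"
    and H :: "('w::countable, 'a, 'b) mgraph"
  assumes "rooted_connected (G, v)" "rooted_connected (H, w)"
  shows "dist (iso_class G v) (iso_class H w) = local_dist (G, v) (H, w)"
proof -
  have "dist (iso_class G v) (iso_class H w) = local_dist (relabel G, to_nat v) (relabel H, to_nat w)"
    unfolding iso_class_def
    by (intro dist_gstar.abs_eq isomorphic_refl rooted_connected_relabel assms)
  also have "\<dots> = local_dist (G, v) (H, w)"
    using assms by (intro local_dist_cong isomorphic_sym[OF isomorphic_relabel])
  finally show ?thesis .
qed

lemma dist_iso_class_less:
  fixes G :: "('v::countable, 'a::metric_space, 'b::metric_space) mgraph"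
    and H :: "('w::countable, 'a, 'b) mgraph"
  assumes "rooted_connected (G, v)" "rooted_connected (H, w)"
    and "near r \<delta> (G, v) (H, w)" "0 < \<delta>" "1 / (1 + real r) + \<delta> < c"
  shows "dist (iso_class G v) (iso_class H w) < c"
  unfolding dist_iso_class[OF assms(1,2)] local_dist_less_iff[OF assms(1,2)]
  using assms(3-5) by blast

section \<open>Finite product weights\<close>

text \<open>The expectation of \<open>f\<close> under independent coordinates with weights
  \<open>p i\<close>. As a plain finite sum it makes sense for arbitrary real weights, so
  nonnegativity and total mass 1 are hypotheses of single lemmas; the weight
  \<open>1 - d / n\<close> of an absent edge is negative for \<open>n < d\<close>.\<close>

definition prod_expect :: "'i set \<Rightarrow> ('i \<Rightarrow> 'k set) \<Rightarrow> ('i \<Rightarrow> 'k \<Rightarrow> real) \<Rightarrow> (('i \<Rightarrow> 'k) \<Rightarrow> real) \<Rightarrow> real" where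
  "prod_expect I K p f = (\<Sum>\<omega>\<in>PiE I K. (\<Prod>i\<in>I. p i (\<omega> i)) * f \<omega>)"

lemma prod_expect_mono:
  assumes "\<And>i k. i \<in> I \<Longrightarrow> k \<in> K i \<Longrightarrow> 0 \<le> p i k" and "\<And>\<omega>. \<omega> \<in> PiE I K \<Longrightarrow> f \<omega> \<le> g \<omega>"
  shows "prod_expect I K p f \<le> prod_expect I K p g"
  unfolding prod_expect_def using assms
  by (intro sum_mono mult_left_mono prod_nonneg) (auto simp: PiE_mem)

lemma prod_expect_cmult: "prod_expect I K p (\<lambda>\<omega>. c * f \<omega>) = c * prod_expect I K p f"
  by (simp add: prod_expect_def sum_distrib_left mult_ac)

lemma prod_expect_sum:
  "prod_expect I K p (\<lambda>\<omega>. \<Sum>x\<in>X. f x \<omega>) = (\<Sum>x\<in>X. prod_expect I K p (f x))"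
  unfolding prod_expect_def by (subst sum.swap) (simp add: sum_distrib_left)

text \<open>Fubini for one coordinate, in the form that drives the inductions on the index
  set.\<close>

lemma prod_expect_insert:
  assumes "finite I" "x \<notin> I"
  shows "prod_expect (insert x I) K p f =
    prod_expect I K p (\<lambda>\<omega>. \<Sum>k\<in>K x. p x k * f (fun_upd \<omega> x k))"
proof -
  let ?g = "\<lambda>(k, \<omega>). (fun_upd \<omega> x k)"
  have inj: "inj_on ?g (K x \<times> PiE I K)"
    using assms(2) by (rule inj_combinator)
  have p: "(\<Prod>i\<in>insert x I. p i ((fun_upd \<omega> x k) i)) = p x k * (\<Prod>i\<in>I. p i (\<omega> i))" for \<omega> k
  proof -
    have "(\<Prod>i\<in>I. p i (fun_upd \<omega> x k i)) = (\<Prod>i\<in>I. p i (\<omega> i))"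
      using assms(2) by (intro prod.cong) auto
    then show ?thesis by (simp add: assms)
  qed
  have "prod_expect (insert x I) K p f =
      (\<Sum>(k, \<omega>)\<in>K x \<times> PiE I K. p x k * (\<Prod>i\<in>I. p i (\<omega> i)) * f (fun_upd \<omega> x k))"
    unfolding prod_expect_def PiE_insert_eq
  proof (subst sum.reindex[OF inj], rule sum.cong[OF refl])
    fix z :: "'b \<times> ('a \<Rightarrow> 'b)"
    obtain k \<omega> where z: "z = (k, \<omega>)" by (cases z)
    show "((\<lambda>\<omega>. (\<Prod>i\<in>insert x I. p i (\<omega> i)) * f \<omega>) \<circ> ?g) z =
        (case z of (k, \<omega>) \<Rightarrow> p x k * (\<Prod>i\<in>I. p i (\<omega> i)) * f (fun_upd \<omega> x k))"
      by (simp only: z o_def prod.case p)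
  qed
  also have "\<dots> = (\<Sum>\<omega>\<in>PiE I K. \<Sum>k\<in>K x. p x k * (\<Prod>i\<in>I. p i (\<omega> i)) * f (fun_upd \<omega> x k))"
    by (subst sum.cartesian_product[symmetric], rule sum.swap)
  finally show ?thesis
    unfolding prod_expect_def by (simp add: sum_distrib_left mult_ac)
qed

lemma prod_expect_const:
  assumes "finite I" "\<And>i. i \<in> I \<Longrightarrow> (\<Sum>k\<in>K i. p i k) = 1"
  shows "prod_expect I K p (\<lambda>_. c) = c"
  using assms
proof (induction I)
  case empty then show ?case by (simp add: prod_expect_def)
next
  case (insert x I)
  then show ?case by (simp add: prod_expect_insert flip: sum_distrib_right)
qed

lemma prod_expect_cylinder:
  assumes "finite I" "\<And>i. i \<in> I \<Longrightarrow> (\<Sum>k\<in>K i. p i k) = 1" "\<And>i. i \<in> I \<Longrightarrow> finite (K i)"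
    and "J \<subseteq> I" "\<And>i. i \<in> J \<Longrightarrow> a i \<in> K i"
  shows "prod_expect I K p (\<lambda>\<omega>. of_bool (\<forall>i\<in>J. \<omega> i = a i)) = (\<Prod>i\<in>J. p i (a i))"
  using assms
proof (induction I arbitrary: J)
  case empty then show ?case by (simp add: prod_expect_def)
next
  case (insert x I)
  have IH: "prod_expect I K p (\<lambda>\<omega>. of_bool (\<forall>i\<in>J - {x}. \<omega> i = a i)) = (\<Prod>i\<in>J - {x}. p i (a i))"
    by (rule insert.IH) (use insert.prems in auto)
  have fJ: "finite J" by (rule finite_subset[OF insert.prems(3)]) (use insert.hyps in simp)
  show ?case
  proof (cases "x \<in> J")
    case True
    have "(\<Sum>k\<in>K x. p x k * of_bool (\<forall>i\<in>J. (fun_upd \<omega> x k) i = a i)) =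
        p x (a x) * of_bool (\<forall>i\<in>J - {x}. \<omega> i = a i)" for \<omega>
    proof -
      have "(\<Sum>k\<in>K x. p x k * of_bool (\<forall>i\<in>J. (fun_upd \<omega> x k) i = a i)) =
          (\<Sum>k\<in>K x. if k = a x then p x (a x) * of_bool (\<forall>i\<in>J - {x}. \<omega> i = a i) else 0)"
        using True by (intro sum.cong) auto
      then show ?thesis using insert.prems True by (simp add: sum.delta)
    qed
    then have "prod_expect (insert x I) K p (\<lambda>\<omega>. of_bool (\<forall>i\<in>J. \<omega> i = a i)) =
        p x (a x) * prod_expect I K p (\<lambda>\<omega>. of_bool (\<forall>i\<in>J - {x}. \<omega> i = a i))"
      by (simp only: prod_expect_insert[OF insert.hyps] prod_expect_cmult)
    also have "\<dots> = (\<Prod>i\<in>J. p i (a i))"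
      unfolding IH by (rule prod.remove[OF fJ True, symmetric])
    finally show ?thesis .
  next
    case False
    then have J: "J - {x} = J" by simp
    have "(\<forall>i\<in>J. fun_upd \<omega> x k i = a i) \<longleftrightarrow> (\<forall>i\<in>J. \<omega> i = a i)" for \<omega> k
      using False by (intro ball_cong) auto
    then have "prod_expect (insert x I) K p (\<lambda>\<omega>. of_bool (\<forall>i\<in>J. \<omega> i = a i)) =
        prod_expect I K p (\<lambda>\<omega>. (\<Sum>k\<in>K x. p x k) * of_bool (\<forall>i\<in>J. \<omega> i = a i))"
      by (simp only: prod_expect_insert[OF insert.hyps] sum_distrib_right)
    also have "\<dots> = (\<Prod>i\<in>J. p i (a i))" using IH insert.prems(1)[of x] by (simp add: J)
    finally show ?thesis .
  qed
qed

section \<open>Concentration\<close>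


text \<open>For positive \<open>y\<close> this follows from \<open>exp y \<ge> 1 + y\<close>,
  because the right-hand side times \<open>1 + y\<close> is \<open>1 + y ^ 3\<close>.\<close>

lemma exp_neg_le_quadratic:
  fixes y :: real assumes "\<bar>y\<bar> \<le> 1" shows "exp (- y) \<le> 1 - y + y\<^sup>2"
proof (cases "y \<le> 0")
  case True
  then show ?thesis using exp_bound[of "- y"] assms by simp
next
  case False
  have "exp (- y) = 1 / exp y" by (simp add: exp_minus inverse_eq_divide)
  also have "\<dots> \<le> 1 / (1 + y)" using False by (intro divide_left_mono) auto
  also have "\<dots> \<le> 1 - y + y\<^sup>2"
  proof -
    have "(1 - y + y\<^sup>2) * (1 + y) = 1 + y ^ 3" by (simp add: power2_eq_square power3_eq_cube algebra_simps)
    then show ?thesis using False by (simp add: divide_le_eq)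
  qed
  finally show ?thesis .
qed

text \<open>Expand to second order: the linear term vanishes by centering, and the variance is at
  most the second moment about \<open>g k0\<close>, to which \<open>k0\<close> itself contributes
  nothing. This produces the factor \<open>1 - p k0\<close>, which is small for a slot that is
  almost always empty.\<close>

lemma weighted_exp_neg_bound:
  fixes p g :: "'k \<Rightarrow> real"
  assumes K: "finite K" "k0 \<in> K" and p: "\<And>k. k \<in> K \<Longrightarrow> 0 \<le> p k" "(\<Sum>k\<in>K. p k) = 1"
    and g: "\<And>k l. k \<in> K \<Longrightarrow> l \<in> K \<Longrightarrow> \<bar>g k - g l\<bar> \<le> c"
    and lc: "0 \<le> \<theta>" "\<theta> * c \<le> 1"
  defines "m \<equiv> \<Sum>k\<in>K. p k * g k"
  shows "(\<Sum>k\<in>K. p k * exp (- \<theta> * (g k - m))) \<le> exp (\<theta>\<^sup>2 * c\<^sup>2 * (1 - p k0))"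
proof -
  have c0: "0 \<le> c" using g[OF K(2) K(2)] by simp
  have dev: "\<bar>g k - m\<bar> \<le> c" if "k \<in> K" for k
  proof -
    have "g k - m = (\<Sum>l\<in>K. p l * (g k - g l))"
      using p(2) by (simp add: m_def right_diff_distrib sum_subtractf flip: sum_distrib_right)
    also have "\<bar>\<dots>\<bar> \<le> (\<Sum>l\<in>K. \<bar>p l * (g k - g l)\<bar>)" by (rule sum_abs)
    also have "\<dots> \<le> (\<Sum>l\<in>K. p l * c)"
      using p(1) g[OF that] by (intro sum_mono) (auto simp: abs_mult intro!: mult_left_mono)
    also have "\<dots> = c" using p(2) by (simp flip: sum_distrib_right)
    finally show ?thesis .
  qed
  have "(\<Sum>k\<in>K. p k * exp (- \<theta> * (g k - m))) \<le>
      (\<Sum>k\<in>K. p k * (1 - \<theta> * (g k - m) + (\<theta> * (g k - m))\<^sup>2))"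
  proof (intro sum_mono mult_left_mono p(1))
    fix k assume "k \<in> K"
    have "\<bar>\<theta> * (g k - m)\<bar> \<le> \<theta> * c"
      using dev[OF \<open>k \<in> K\<close>] lc(1) by (auto simp: abs_mult intro!: mult_left_mono)
    then show "exp (- \<theta> * (g k - m)) \<le> 1 - \<theta> * (g k - m) + (\<theta> * (g k - m))\<^sup>2"
      using exp_neg_le_quadratic[of "\<theta> * (g k - m)"] lc(2) by simp
  qed
  also have "\<dots> = (\<Sum>k\<in>K. p k) - \<theta> * (m - (\<Sum>k\<in>K. p k) * m) + \<theta>\<^sup>2 * (\<Sum>k\<in>K. p k * (g k - m)\<^sup>2)"
  proof -
    have "p k * (1 - \<theta> * (g k - m) + (\<theta> * (g k - m))\<^sup>2) =
        p k - \<theta> * (p k * g k - p k * m) + \<theta>\<^sup>2 * (p k * (g k - m)\<^sup>2)" for k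
      by (simp only: power_mult_distrib) (simp add: algebra_simps)
    then show ?thesis
      by (simp only: sum.distrib sum_subtractf m_def sum_distrib_left[symmetric] sum_distrib_right[symmetric])
  qed
  also have "\<dots> = 1 + \<theta>\<^sup>2 * (\<Sum>k\<in>K. p k * (g k - m)\<^sup>2)" using p(2) by simp
  also have "(\<Sum>k\<in>K. p k * (g k - m)\<^sup>2) \<le> c\<^sup>2 * (1 - p k0)"
  proof -
    \<comment> \<open>The second moment about \<open>g k0\<close> exceeds the variance by
      \<open>(m - g k0)\<^sup>2\<close>; the mixed term sums to zero.\<close>
    have "p k * (g k - g k0)\<^sup>2 = p k * (g k - m)\<^sup>2 + p k * (m - g k0)\<^sup>2 +
        (p k * g k - p k * m) * (2 * (m - g k0))" for k
      by (simp add: power2_eq_square algebra_simps)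
    then have "(\<Sum>k\<in>K. p k * (g k - g k0)\<^sup>2) = (\<Sum>k\<in>K. p k * (g k - m)\<^sup>2) +
        (\<Sum>k\<in>K. p k) * (m - g k0)\<^sup>2 + (m - (\<Sum>k\<in>K. p k) * m) * (2 * (m - g k0))"
      by (simp only: sum.distrib sum_subtractf m_def sum_distrib_right[symmetric])
    then have "(\<Sum>k\<in>K. p k * (g k - m)\<^sup>2) \<le> (\<Sum>k\<in>K. p k * (g k - g k0)\<^sup>2)"
      using p(2) by simp
    also have "\<dots> = (\<Sum>k\<in>K - {k0}. p k * (g k - g k0)\<^sup>2)"
      using K by (simp add: sum.remove[of K k0])
    also have "\<dots> \<le> (\<Sum>k\<in>K - {k0}. p k * c\<^sup>2)"
    proof (intro sum_mono mult_left_mono)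
      fix k assume "k \<in> K - {k0}"
      then show "(g k - g k0)\<^sup>2 \<le> c\<^sup>2" "0 \<le> p k"
        using g[of k k0] p(1)[of k] K(2) c0 power_mono[of "\<bar>g k - g k0\<bar>" c 2] by auto
    qed
    also have "\<dots> = c\<^sup>2 * (1 - p k0)"
      using K p(2) by (simp add: sum.remove[of K k0] flip: sum_distrib_right)
    finally show ?thesis .
  qed
  finally have "(\<Sum>k\<in>K. p k * exp (- \<theta> * (g k - m))) \<le> 1 + \<theta>\<^sup>2 * c\<^sup>2 * (1 - p k0)"
    by (simp add: mult_left_mono mult.assoc)
  also have "\<dots> \<le> exp (\<theta>\<^sup>2 * c\<^sup>2 * (1 - p k0))" by (rule exp_ge_add_one_self)
  finally show ?thesis .
qed

text \<open>Below, \<open>k0 i\<close> is the absence of an edge. There are about \<open>n\<^sup>2\<close> coordinates, and only the weights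
  \<open>1 - p i (k0 i)\<close>, of order \<open>1 / n\<close>, keep the exponent linear in \<open>n\<close>.\<close>

lemma prod_expect_exp_neg_bound:
  assumes "finite I" and K: "\<And>i. i \<in> I \<Longrightarrow> finite (K i)" "\<And>i. i \<in> I \<Longrightarrow> k0 i \<in> K i"
    and p: "\<And>i k. i \<in> I \<Longrightarrow> k \<in> K i \<Longrightarrow> 0 \<le> p i k" "\<And>i. i \<in> I \<Longrightarrow> (\<Sum>k\<in>K i. p i k) = 1"
    and lc: "0 \<le> \<theta>" "0 \<le> c" "\<theta> * c \<le> 1"
    and f: "\<And>\<omega> i k l. \<omega> \<in> PiE I K \<Longrightarrow> i \<in> I \<Longrightarrow> k \<in> K i \<Longrightarrow> l \<in> K i \<Longrightarrow>
      \<bar>f (fun_upd \<omega> i k) - f (fun_upd \<omega> i l)\<bar> \<le> c"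
  shows "prod_expect I K p (\<lambda>\<omega>. exp (- \<theta> * (f \<omega> - prod_expect I K p f))) \<le>
    exp (\<theta>\<^sup>2 * c\<^sup>2 * (\<Sum>i\<in>I. 1 - p i (k0 i)))"
  using assms
proof (induction I arbitrary: f)
  case empty then show ?case by (simp add: prod_expect_def)
next
  case (insert x I)
  \<comment> \<open>The conditional expectation of \<open>f\<close> given the coordinates in
    \<open>I\<close>. It has the same mean as \<open>f\<close>, and averaging preserves the bound
    \<open>c\<close> on its oscillation in each coordinate, so the induction hypothesis applies to
    it; the fluctuation of \<open>f\<close> around \<open>F\<close> is a one-coordinate
    problem.\<close>
  define F where "F \<omega> = (\<Sum>k\<in>K x. p x k * f (fun_upd \<omega> x k))" for \<omega>
  let ?m = "prod_expect I K p F"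
  have m: "prod_expect (insert x I) K p f = ?m"
    unfolding F_def by (rule prod_expect_insert) (use insert in auto)
  have upd: "fun_upd \<omega> x k \<in> PiE (insert x I) K" if "\<omega> \<in> PiE I K" "k \<in> K x" for \<omega> k
    using that by (simp add: PiE_fun_upd)
  have Flip: "\<bar>F (fun_upd \<omega> i k) - F (fun_upd \<omega> i l)\<bar> \<le> c"
    if "\<omega> \<in> PiE I K" "i \<in> I" "k \<in> K i" "l \<in> K i" for \<omega> i k l
  proof -
    have eq: "F (fun_upd \<omega> i k) - F (fun_upd \<omega> i l) =
        (\<Sum>y\<in>K x. p x y * (f (fun_upd (fun_upd \<omega> x y) i k) - f (fun_upd (fun_upd \<omega> x y) i l)))"
    proof -
      have "fun_upd (fun_upd \<omega> x y) i k = fun_upd (fun_upd \<omega> i k) x y" for y k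
        using that(2) insert.hyps(2) by (intro fun_upd_twist) auto
      then show ?thesis by (simp only: F_def right_diff_distrib sum_subtractf)
    qed
    have "\<bar>F (fun_upd \<omega> i k) - F (fun_upd \<omega> i l)\<bar> \<le>
        (\<Sum>y\<in>K x. \<bar>p x y * (f (fun_upd (fun_upd \<omega> x y) i k) - f (fun_upd (fun_upd \<omega> x y) i l))\<bar>)"
      unfolding eq by (rule sum_abs)
    also have "\<dots> \<le> (\<Sum>y\<in>K x. p x y * c)"
    proof (rule sum_mono)
      fix y assume y: "y \<in> K x"
      have "\<bar>f (fun_upd (fun_upd \<omega> x y) i k) - f (fun_upd (fun_upd \<omega> x y) i l)\<bar> \<le> c"
        using that y by (intro insert.prems(8) upd) auto
      then show "\<bar>p x y * (f (fun_upd (fun_upd \<omega> x y) i k) - f (fun_upd (fun_upd \<omega> x y) i l))\<bar> \<le> p x y * c"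
        using insert.prems(3)[of x y] y by (simp add: abs_mult mult_left_mono)
    qed
    also have "\<dots> = c" using insert.prems(4)[of x] by (simp flip: sum_distrib_right)
    finally show ?thesis .
  qed
  have IH: "prod_expect I K p (\<lambda>\<omega>. exp (- \<theta> * (F \<omega> - ?m))) \<le> exp (\<theta>\<^sup>2 * c\<^sup>2 * (\<Sum>i\<in>I. 1 - p i (k0 i)))"
    by (rule insert.IH) (use insert.prems(1-7) Flip in \<open>simp_all only: insert_iff simp_thms\<close>)
  let ?e = "exp (\<theta>\<^sup>2 * c\<^sup>2 * (1 - p x (k0 x)))"
  have "prod_expect (insert x I) K p (\<lambda>\<omega>. exp (- \<theta> * (f \<omega> - ?m))) =
      prod_expect I K p (\<lambda>\<omega>. exp (- \<theta> * (F \<omega> - ?m)) *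
        (\<Sum>k\<in>K x. p x k * exp (- \<theta> * (f (fun_upd \<omega> x k) - F \<omega>))))"
  proof -
    have "p x k * exp (- \<theta> * (f (fun_upd \<omega> x k) - ?m)) =
        exp (- \<theta> * (F \<omega> - ?m)) * (p x k * exp (- \<theta> * (f (fun_upd \<omega> x k) - F \<omega>)))" for k \<omega>
    proof -
      have "- \<theta> * (f (fun_upd \<omega> x k) - ?m) = - \<theta> * (F \<omega> - ?m) + - \<theta> * (f (fun_upd \<omega> x k) - F \<omega>)"
        by (simp add: algebra_simps)
      then show ?thesis by (simp only: exp_add mult_ac)
    qed
    then show ?thesis by (simp only: prod_expect_insert[OF insert.hyps] sum_distrib_left)
  qed
  also have "\<dots> \<le> prod_expect I K p (\<lambda>\<omega>. exp (- \<theta> * (F \<omega> - ?m)) * ?e)"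
  proof (intro prod_expect_mono mult_left_mono)
    fix \<omega> assume w: "\<omega> \<in> PiE I K"
    have "\<bar>f (fun_upd \<omega> x k) - f (fun_upd \<omega> x l)\<bar> \<le> c" if "k \<in> K x" "l \<in> K x" for k l
    proof -
      have "\<bar>f (fun_upd (fun_upd \<omega> x k) x k) - f (fun_upd (fun_upd \<omega> x k) x l)\<bar> \<le> c"
        by (rule insert.prems(8)[OF upd[OF w that(1)] insertI1 that])
      then show ?thesis by (simp only: fun_upd_upd)
    qed
    then show "(\<Sum>k\<in>K x. p x k * exp (- \<theta> * (f (fun_upd \<omega> x k) - F \<omega>))) \<le> ?e"
      unfolding F_def by (intro weighted_exp_neg_bound insert.prems(1-7)) simp_all
  qed (use insert.prems in auto)
  also have "\<dots> = ?e * prod_expect I K p (\<lambda>\<omega>. exp (- \<theta> * (F \<omega> - ?m)))"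
    by (subst prod_expect_cmult[symmetric]) (simp add: mult.commute)
  also have "\<dots> \<le> ?e * exp (\<theta>\<^sup>2 * c\<^sup>2 * (\<Sum>i\<in>I. 1 - p i (k0 i)))" using IH by simp
  also have "\<dots> = exp (\<theta>\<^sup>2 * c\<^sup>2 * (\<Sum>i\<in>insert x I. 1 - p i (k0 i)))"
    by (simp only: sum.insert[OF insert.hyps] distrib_left exp_add)
  finally show ?case unfolding m .
qed

text \<open>Markov's inequality for the exponential moment. The parameter \<open>\<theta>\<close>
  stays free; the application balances the two terms of the exponent.\<close>

lemma prod_expect_lower_tail:
  assumes "finite I" and K: "\<And>i. i \<in> I \<Longrightarrow> finite (K i)" "\<And>i. i \<in> I \<Longrightarrow> k0 i \<in> K i"
    and p: "\<And>i k. i \<in> I \<Longrightarrow> k \<in> K i \<Longrightarrow> 0 \<le> p i k" "\<And>i. i \<in> I \<Longrightarrow> (\<Sum>k\<in>K i. p i k) = 1"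
    and lc: "0 \<le> \<theta>" "0 \<le> c" "\<theta> * c \<le> 1"
    and f: "\<And>\<omega> i k l. \<omega> \<in> PiE I K \<Longrightarrow> i \<in> I \<Longrightarrow> k \<in> K i \<Longrightarrow> l \<in> K i \<Longrightarrow>
      \<bar>f (fun_upd \<omega> i k) - f (fun_upd \<omega> i l)\<bar> \<le> c"
    and V: "(\<Sum>i\<in>I. 1 - p i (k0 i)) \<le> V"
  shows "prod_expect I K p (\<lambda>\<omega>. of_bool (f \<omega> < prod_expect I K p f - t)) \<le> exp (\<theta>\<^sup>2 * c\<^sup>2 * V - \<theta> * t)"
proof -
  let ?m = "prod_expect I K p f"
  have "prod_expect I K p (\<lambda>\<omega>. of_bool (f \<omega> < ?m - t)) \<le>
      prod_expect I K p (\<lambda>\<omega>. exp (- \<theta> * t) * exp (- \<theta> * (f \<omega> - ?m)))"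
  proof (rule prod_expect_mono)
    fix \<omega>
    have "1 \<le> exp (- \<theta> * t) * exp (- \<theta> * (f \<omega> - ?m))" if "f \<omega> < ?m - t"
    proof -
      have "0 \<le> \<theta> * (?m - t - f \<omega>)" using that lc(1) by simp
      also have "\<dots> = - \<theta> * t + - \<theta> * (f \<omega> - ?m)" by (simp add: algebra_simps)
      finally show ?thesis by (simp only: exp_add[symmetric] one_le_exp_iff)
    qed
    then show "of_bool (f \<omega> < ?m - t) \<le> exp (- \<theta> * t) * exp (- \<theta> * (f \<omega> - ?m))" by simp
  qed (use p in auto)
  also have "\<dots> = exp (- \<theta> * t) * prod_expect I K p (\<lambda>\<omega>. exp (- \<theta> * (f \<omega> - ?m)))"
    by (rule prod_expect_cmult)
  also have "\<dots> \<le> exp (- \<theta> * t) * exp (\<theta>\<^sup>2 * c\<^sup>2 * (\<Sum>i\<in>I. 1 - p i (k0 i)))"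
    by (intro mult_left_mono prod_expect_exp_neg_bound assms(1-9)) simp_all
  also have "\<dots> \<le> exp (- \<theta> * t) * exp (\<theta>\<^sup>2 * c\<^sup>2 * V)"
    using V by (simp add: mult_left_mono)
  also have "\<dots> = exp (\<theta>\<^sup>2 * c\<^sup>2 * V - \<theta> * t)" by (simp flip: exp_add)
  finally show ?thesis .
qed

section \<open>Galton--Watson trees\<close>

text \<open>The first component belongs to the edge from the parent to \<open>w\<close>, the second
  to the reverse orientation. The root carries such a pair too, but no edge uses it.\<close>

definition gw_pair :: "('a, 'b) gw_sample \<Rightarrow> nat list \<Rightarrow> 'b \<times> 'b" where
  "gw_pair \<omega> w = (case \<omega> w of (N, t, (x1, x2), c) \<Rightarrow> if c then (x1, x2) else (x2, x1))"

lemma gw_tree_simps: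
  "verts (gw_tree \<omega>) = {w. \<forall>i<length w. w ! i < fst (\<omega> (take i w))}"
  "edges (gw_tree \<omega>) = {{w, w @ [i]} | w i. w @ [i] \<in> verts (gw_tree \<omega>)}"
  "vmark (gw_tree \<omega>) w = fst (snd (\<omega> w))"
  "emark (gw_tree \<omega>) u v = (if length u < length v then fst (gw_pair \<omega> v) else snd (gw_pair \<omega> u))"
  by (simp_all add: gw_tree_def Let_def gw_pair_def)

lemma Nil_in_gw_tree [simp]: "[] \<in> verts (gw_tree \<omega>)"
  by (simp add: gw_tree_simps)

lemma snoc_in_gw_tree [simp]:
  "w @ [i] \<in> verts (gw_tree \<omega>) \<longleftrightarrow> w \<in> verts (gw_tree \<omega>) \<and> i < fst (\<omega> w)"
  by (auto simp: gw_tree_simps nth_append less_Suc_eq)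

lemma gw_tree_nbrs:
  assumes "w \<in> verts (gw_tree \<omega>)"
  shows "{w'. {w, w'} \<in> edges (gw_tree \<omega>)} =
    (\<lambda>i. w @ [i]) ` {..<fst (\<omega> w)} \<union> (if w = [] then {} else {butlast w})"
proof -
  have "{w, w'} \<in> edges (gw_tree \<omega>) \<longleftrightarrow>
      (\<exists>i. w' = w @ [i] \<and> i < fst (\<omega> w)) \<or> (w \<noteq> [] \<and> w' = butlast w)" for w'
  proof
    assume "{w, w'} \<in> edges (gw_tree \<omega>)"
    then obtain u i where u: "{w, w'} = {u, u @ [i]}" "u @ [i] \<in> verts (gw_tree \<omega>)"
      by (auto simp: gw_tree_simps(2))
    then consider "w = u" "w' = u @ [i]" | "w = u @ [i]" "w' = u" by (auto simp: doubleton_eq_iff)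
    then show "(\<exists>i. w' = w @ [i] \<and> i < fst (\<omega> w)) \<or> (w \<noteq> [] \<and> w' = butlast w)"
      using u(2) by cases auto
  next
    assume "(\<exists>i. w' = w @ [i] \<and> i < fst (\<omega> w)) \<or> (w \<noteq> [] \<and> w' = butlast w)"
    then show "{w, w'} \<in> edges (gw_tree \<omega>)"
    proof
      assume "\<exists>i. w' = w @ [i] \<and> i < fst (\<omega> w)"
      then obtain i where "w' = w @ [i]" "i < fst (\<omega> w)" by blast
      then have "w' = w @ [i] \<and> w @ [i] \<in> verts (gw_tree \<omega>)" using assms by simp
      then show ?thesis unfolding gw_tree_simps(2) by blast
    next
      assume w: "w \<noteq> [] \<and> w' = butlast w"
      then have "w = w' @ [last w]" by simp
      then have "{w, w'} = {w', w' @ [last w]} \<and> w' @ [last w] \<in> verts (gw_tree \<omega>)"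
        using assms by (metis insert_commute)
      then show ?thesis unfolding gw_tree_simps(2) by blast
    qed
  qed
  then show ?thesis by auto
qed

lemma simple_gw_tree: "simple_graph (gw_tree \<omega>)"
proof -
  have "w \<noteq> w @ [i]" for w :: "nat list" and i by simp
  then show ?thesis by (auto simp: simple_graph_def gw_tree_simps(2) card_2_iff) 
qed

lemma gw_tree_path:
  assumes "w \<in> verts (gw_tree \<omega>)"
  shows "([], w) \<in> adj (gw_tree \<omega>) ^^ length w"
  using assms
proof (induction w rule: rev_induct)
  case (snoc i w)
  then have "w @ [i] \<in> {w'. {w, w'} \<in> edges (gw_tree \<omega>)}"
    by (subst gw_tree_nbrs) auto
  then have "(w, w @ [i]) \<in> adj (gw_tree \<omega>)" by (simp add: adj_def)
  then show ?case using snoc by auto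
qed simp

lemma gw_tree_path_length:
  assumes "([], w) \<in> adj (gw_tree \<omega>) ^^ n"
  shows "w \<in> verts (gw_tree \<omega>) \<and> length w \<le> n"
  using assms
proof (induction n arbitrary: w)
  case (Suc n)
  then obtain u where "([], u) \<in> adj (gw_tree \<omega>) ^^ n" and e: "{u, w} \<in> edges (gw_tree \<omega>)"
    by (auto simp: adj_def)
  then have u: "u \<in> verts (gw_tree \<omega>)" "length u \<le> n" using Suc.IH by auto
  moreover have "w \<in> {w. {u, w} \<in> edges (gw_tree \<omega>)}" using e by simp
  ultimately have "length w \<le> Suc n"
    by (subst (asm) gw_tree_nbrs) (auto split: if_splits)
  then show ?case using edge_verts[OF simple_gw_tree e] by simp
qed simp

lemma gball_gw_tree: "gball (gw_tree \<omega>) [] r = {w \<in> verts (gw_tree \<omega>). length w \<le> r}"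
proof
  show "gball (gw_tree \<omega>) [] r \<subseteq> {w \<in> verts (gw_tree \<omega>). length w \<le> r}"
    using gw_tree_path_length by (fastforce simp: gball_def)
  show "{w \<in> verts (gw_tree \<omega>). length w \<le> r} \<subseteq> gball (gw_tree \<omega>) [] r"
    using gw_tree_path by (auto simp: gball_def)
qed

lemma rooted_connected_gw_tree: "rooted_connected (gw_tree \<omega>, [])"
proof -
  have "sym (adj (gw_tree \<omega>))" by (auto simp: sym_def adj_def insert_commute)
  then have s: "sym ((adj (gw_tree \<omega>))\<^sup>*)" by (rule sym_rtrancl)
  have to: "([], w) \<in> (adj (gw_tree \<omega>))\<^sup>*" if "w \<in> verts (gw_tree \<omega>)" for w
    using gw_tree_path[OF that] by (rule relpow_imp_rtrancl)
  have "(u, w) \<in> (adj (gw_tree \<omega>))\<^sup>*" if "u \<in> verts (gw_tree \<omega>)" "w \<in> verts (gw_tree \<omega>)" for u w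
    using to[OF that(1)] to[OF that(2)] s by (meson rtrancl_trans symD)
  moreover have "locally_finite (gw_tree \<omega>)"
    unfolding locally_finite_def by (simp add: gw_tree_nbrs)
  ultimately show ?thesis by (simp add: rooted_connected_def simple_gw_tree)
qed

lemma finite_gw_tree_ball: "finite {w \<in> verts (gw_tree \<omega>). length w \<le> r}"
  using finite_gball[OF rooted_connected_gw_tree] unfolding gball_gw_tree .

lemma gw_tree_verts_mono:
  assumes "w \<in> verts (gw_tree \<omega>)" "length w \<le> Suc r"
    and "\<And>u. u \<in> verts (gw_tree \<omega>) \<Longrightarrow> length u \<le> r \<Longrightarrow> fst (\<omega> u) = fst (\<omega>' u)"
  shows "w \<in> verts (gw_tree \<omega>')"
  using assms(1,2)
proof (induction w rule: rev_induct)
  case (snoc i w) then show ?case using assms(3)[of w] by auto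
qed simp

text \<open>Agreement is assumed along the tree of \<open>\<omega>\<close> although membership is
  known for \<open>\<omega>'\<close>. The induction over prefixes first brings the parent into the
  tree of \<open>\<omega>\<close>, where the assumption applies.\<close>

lemma gw_tree_verts_mono':
  assumes "w \<in> verts (gw_tree \<omega>')" "length w \<le> Suc r"
    and "\<And>u. u \<in> verts (gw_tree \<omega>) \<Longrightarrow> length u \<le> r \<Longrightarrow> fst (\<omega> u) = fst (\<omega>' u)"
  shows "w \<in> verts (gw_tree \<omega>)"
  using assms(1,2)
proof (induction w rule: rev_induct)
  case (snoc i w) then show ?case using assms(3)[of w] by auto
qed simp

text \<open>The identity on words is the isomorphism. Offspring numbers are compared at depth
  \<open>r\<close> as well, because \<open>near_gcovering\<close> looks at all neighbours of the
  vertices up to distance \<open>r\<close>.\<close>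

lemma near_gw_tree:
  fixes \<omega> \<omega>' :: "('a::metric_space, 'b::metric_space) gw_sample"
  assumes N: "\<And>w. w \<in> verts (gw_tree \<omega>) \<Longrightarrow> length w \<le> r \<Longrightarrow> fst (\<omega> w) = fst (\<omega>' w)"
    and t: "\<And>w. w \<in> verts (gw_tree \<omega>) \<Longrightarrow> length w \<le> r \<Longrightarrow>
      dist (fst (snd (\<omega> w))) (fst (snd (\<omega>' w))) < \<delta>"
    and x: "\<And>w. w \<in> verts (gw_tree \<omega>) \<Longrightarrow> length w \<le> r \<Longrightarrow>
      dist (fst (gw_pair \<omega> w)) (fst (gw_pair \<omega>' w)) < \<delta> \<and>
      dist (snd (gw_pair \<omega> w)) (snd (gw_pair \<omega>' w)) < \<delta>"
  shows "near r \<delta> (gw_tree \<omega>, []) (gw_tree \<omega>', [])"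
proof (rule near_gcovering[of _ _ _ _ id])
  fix w assume "w \<in> gball (gw_tree \<omega>) [] r"
  then have w: "w \<in> verts (gw_tree \<omega>)" "length w \<le> r" by (auto simp: gball_gw_tree)
  have "w \<in> verts (gw_tree \<omega>')"
    by (rule gw_tree_verts_mono[OF w(1) _ N]) (use w in auto)
  then show "{j. {id w, j} \<in> edges (gw_tree \<omega>')} = id ` {w'. {w, w'} \<in> edges (gw_tree \<omega>)}"
    using w N by (simp add: gw_tree_nbrs)
  show "dist (vmark (gw_tree \<omega>) w) (vmark (gw_tree \<omega>') (id w)) < \<delta>"
    using t[OF w] by (simp add: gw_tree_simps)
  fix w' assume "w' \<in> gball (gw_tree \<omega>) [] r"
  then show "dist (emark (gw_tree \<omega>) w w') (emark (gw_tree \<omega>') (id w) (id w')) < \<delta>"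
    using x[OF w] x[of w'] by (simp add: gw_tree_simps(4) gball_gw_tree)
qed (auto simp: simple_gw_tree)

section \<open>Measurability of the tree\<close>

abbreviation gw_class :: "('a::metric_space, 'b::metric_space) gw_sample \<Rightarrow> ('a, 'b) gstar" where
  "gw_class \<omega> \<equiv> iso_class (gw_tree \<omega>) []"

text \<open>Carrier of the sigma-algebra only: measurability is proved here once and transferred to
  \<open>gw_space\<close> for all Borel laws \<open>\<nu>\<close> and \<open>chi\<close>.\<close>

definition gw_borel :: "('a::topological_space, 'b::topological_space) gw_sample measure" where
  "gw_borel = (\<Pi>\<^sub>M w\<in>UNIV. count_space UNIV \<Otimes>\<^sub>M borel \<Otimes>\<^sub>M (borel :: ('b \<times> 'b) measure) \<Otimes>\<^sub>M count_space UNIV)"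

lemma space_gw_borel [simp]: "space gw_borel = UNIV"
  by (simp add: gw_borel_def space_PiM space_pair_measure)

lemma measurable_gw_component [measurable]:
  "(\<lambda>\<omega>. \<omega> w) \<in> measurable gw_borel
    (count_space UNIV \<Otimes>\<^sub>M borel \<Otimes>\<^sub>M (borel :: ('b::topological_space \<times> 'b) measure) \<Otimes>\<^sub>M count_space UNIV)"
  unfolding gw_borel_def by (rule measurable_component_singleton) simp

lemma measurable_gw_coordinates [measurable]:
  fixes w :: "nat list"
  shows "(\<lambda>\<omega>. fst (\<omega> w)) \<in> measurable (gw_borel :: ('a::topological_space, 'b::topological_space) gw_sample measure) (count_space UNIV)"
    and "(\<lambda>\<omega>. fst (snd (\<omega> w))) \<in> borel_measurable (gw_borel :: ('a, 'b) gw_sample measure)"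
    and "(\<lambda>\<omega>. fst (fst (snd (snd (\<omega> w))))) \<in> borel_measurable (gw_borel :: ('a, 'b) gw_sample measure)"
    and "(\<lambda>\<omega>. snd (fst (snd (snd (\<omega> w))))) \<in> borel_measurable (gw_borel :: ('a, 'b) gw_sample measure)"
    and "(\<lambda>\<omega>. snd (snd (snd (\<omega> w)))) \<in> measurable (gw_borel :: ('a, 'b) gw_sample measure) (count_space UNIV)"
proof -
  note c = measurable_gw_component[of w, where ?'a = 'a and ?'b = 'b]
  show "(\<lambda>\<omega>. fst (\<omega> w)) \<in> measurable (gw_borel :: ('a, 'b) gw_sample measure) (count_space UNIV)"
    by (rule measurable_compose[OF c measurable_fst])
  note s = measurable_compose[OF c measurable_snd]
  show "(\<lambda>\<omega>. fst (snd (\<omega> w))) \<in> borel_measurable (gw_borel :: ('a, 'b) gw_sample measure)"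
    by (rule measurable_compose[OF s measurable_fst])
  note ss = measurable_compose[OF s measurable_snd]
  show "(\<lambda>\<omega>. snd (snd (snd (\<omega> w)))) \<in> measurable (gw_borel :: ('a, 'b) gw_sample measure) (count_space UNIV)"
    by (rule measurable_compose[OF ss measurable_snd])
  note p = measurable_compose[OF ss measurable_fst]
  show "(\<lambda>\<omega>. fst (fst (snd (snd (\<omega> w))))) \<in> borel_measurable (gw_borel :: ('a, 'b) gw_sample measure)"
    by (rule measurable_compose[OF p borel_measurable_continuous_onI]) (intro continuous_intros)
  show "(\<lambda>\<omega>. snd (fst (snd (snd (\<omega> w))))) \<in> borel_measurable (gw_borel :: ('a, 'b) gw_sample measure)"
    by (rule measurable_compose[OF p borel_measurable_continuous_onI]) (intro continuous_intros)
qed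

text \<open>Separability of the mark spaces supplies countably many cells. A cell is given by a
  finite list of records, each with a word, its offspring number, marks approximated by points of a
  countable dense set, and its coin. Samples in one cell have the same tree and almost the same
  marks up to depth \<open>r m\<close>, so their classes are close.\<close>

lemma measurable_gw_class:
  "gw_class \<in> borel_measurable (gw_borel :: ('a::polish_space, 'b::polish_space) gw_sample measure)"
proof -
  obtain D :: "'a set" where D: "countable D" "\<And>X. open X \<Longrightarrow> X \<noteq> {} \<Longrightarrow> \<exists>d\<in>D. d \<in> X"
    using countable_dense_exists by auto
  obtain D' :: "'b set" where D': "countable D'" "\<And>X. open X \<Longrightarrow> X \<noteq> {} \<Longrightarrow> \<exists>d\<in>D'. d \<in> X"
    using countable_dense_exists by auto
  \<comment> \<open>Chosen such that \<open>1 / (1 + r m) + \<delta> m\<close> is below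
    \<open>1 / Suc m\<close>: the second summand is half of it and the first is strictly less than
    half.\<close>
  define \<delta> :: "nat \<Rightarrow> real" where "\<delta> m = 1 / (2 * real (Suc m))" for m
  define r :: "nat \<Rightarrow> nat" where "r m = 2 * Suc m" for m
  have d0: "0 < \<delta> m" for m by (simp add: \<delta>_def)
  have rd: "1 / (1 + real (r m)) + \<delta> m < 1 / real (Suc m)" for m
  proof -
    have "1 / (1 + real (r m)) < \<delta> m" unfolding \<delta>_def
      by (intro divide_strict_left_mono) (auto simp: r_def)
    moreover have "\<delta> m + \<delta> m = 1 / real (Suc m)" by (simp add: \<delta>_def field_simps)
    ultimately show ?thesis by simp
  qed
  \<comment> \<open>The tolerance is \<open>\<delta> m / 2\<close> so that two samples matching the
    same record have marks within \<open>\<delta> m\<close> of each other.\<close>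
  define Q where "Q m \<omega> = (\<lambda>(w, N, a, b1, b2, c). fst (\<omega> w) = N \<and>
      dist a (fst (snd (\<omega> w))) < \<delta> m / 2 \<and> dist b1 (fst (fst (snd (snd (\<omega> w))))) < \<delta> m / 2 \<and>
      dist b2 (snd (fst (snd (snd (\<omega> w))))) < \<delta> m / 2 \<and> snd (snd (snd (\<omega> w))) = c)"
    for m and \<omega> :: "('a, 'b) gw_sample"
  define E where "E m L = {\<omega>. \<forall>z\<in>set L. Q m \<omega> z}" for m L
  define Ls where "Ls m = {L \<in> lists (UNIV \<times> UNIV \<times> D \<times> D' \<times> D' \<times> UNIV).
      \<forall>\<omega>\<in>E m L. \<forall>w\<in>verts (gw_tree \<omega>). length w \<le> r m \<longrightarrow> w \<in> fst ` set L}" for m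
  show ?thesis
  proof (rule borel_measurable_oscillation[where C = "\<lambda>m. E m ` Ls m"])
    fix m
    show "countable (E m ` Ls m)" using D(1) D'(1)
      by (intro countable_image countable_subset[OF _ countable_lists, of "Ls m" "UNIV \<times> UNIV \<times> D \<times> D' \<times> D' \<times> UNIV"])
        (auto simp: Ls_def)
    show "A \<in> sets gw_borel" if A: "A \<in> E m ` Ls m" for A
    proof -
      obtain L where L: "A = E m L" using A by blast
      have "{\<omega> \<in> space gw_borel. Q m \<omega> z} \<in> sets gw_borel" for z
      proof -
        obtain w N a b1 b2 c where z: "z = (w, N, a, b1, b2, c)" by (metis surj_pair)
        have "{\<omega> \<in> space (gw_borel :: ('a, 'b) gw_sample measure). fst (\<omega> w) = N} \<in> sets gw_borel"
          by measurable
        moreover have "{\<omega> \<in> space (gw_borel :: ('a, 'b) gw_sample measure). snd (snd (snd (\<omega> w))) = c} \<in> sets gw_borel"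
          by measurable
        ultimately show ?thesis unfolding z Q_def prod.case
          by (intro sets.sets_Collect_conj borel_measurable_less borel_measurable_dist
              borel_measurable_const measurable_gw_coordinates)
      qed
      then have "{\<omega> \<in> space gw_borel. \<forall>z\<in>set L. Q m \<omega> z} \<in> sets gw_borel"
        by (intro sets.sets_Collect_finite_All) auto
      then show ?thesis by (simp add: L E_def)
    qed
    show "\<exists>A\<in>E m ` Ls m. \<omega> \<in> A" if "\<omega> \<in> space gw_borel" for \<omega> :: "('a, 'b) gw_sample"
    proof -
      let ?W = "{w \<in> verts (gw_tree \<omega>). length w \<le> r m}"
      have "\<exists>a\<in>D. dist a y < \<delta> m / 2" for y
        using D(2)[of "ball y (\<delta> m / 2)"] d0[of m] by (auto simp: dist_commute)
      then obtain fa where fa: "\<And>y. fa y \<in> D" "\<And>y. dist (fa y) y < \<delta> m / 2" by metis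
      have "\<exists>a\<in>D'. dist a y < \<delta> m / 2" for y
        using D'(2)[of "ball y (\<delta> m / 2)"] d0[of m] by (auto simp: dist_commute)
      then obtain fb where fb: "\<And>y. fb y \<in> D'" "\<And>y. dist (fb y) y < \<delta> m / 2" by metis
      obtain ws where ws: "set ws = ?W" using finite_list[OF finite_gw_tree_ball] by blast
      define L where "L = map (\<lambda>w. (w, fst (\<omega> w), fa (fst (snd (\<omega> w))),
        fb (fst (fst (snd (snd (\<omega> w))))), fb (snd (fst (snd (snd (\<omega> w))))), snd (snd (snd (\<omega> w))))) ws"
      have in_E: "\<omega> \<in> E m L" using fa fb by (auto simp: E_def L_def Q_def)
      have "w \<in> fst ` set L" if w': "\<omega>' \<in> E m L" "w \<in> verts (gw_tree \<omega>')" "length w \<le> r m" for \<omega>' w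
      proof -
        have "fst (\<omega> u) = fst (\<omega>' u)" if "u \<in> verts (gw_tree \<omega>)" "length u \<le> r m" for u
          using w'(1) that ws by (auto simp: E_def L_def Q_def)
        then have "w \<in> verts (gw_tree \<omega>)" using w'(2,3) by (intro gw_tree_verts_mono'[of w \<omega>' "r m" \<omega>]) auto
        then show ?thesis using w'(3) ws by (force simp: L_def)
      qed
      moreover have "L \<in> lists (UNIV \<times> UNIV \<times> D \<times> D' \<times> D' \<times> UNIV)"
        using fa(1) fb(1) by (auto simp: L_def)
      ultimately have "L \<in> Ls m" by (auto simp: Ls_def)
      then show ?thesis using in_E by blast
    qed
    fix A and \<omega> \<omega>' :: "('a, 'b) gw_sample" assume A: "A \<in> E m ` Ls m" "\<omega> \<in> A" "\<omega>' \<in> A"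
    then obtain L where L: "L \<in> Ls m" "\<omega> \<in> E m L" "\<omega>' \<in> E m L" by blast
    have key: "fst (\<omega> w) = fst (\<omega>' w) \<and> dist (fst (snd (\<omega> w))) (fst (snd (\<omega>' w))) < \<delta> m \<and>
        dist (fst (gw_pair \<omega> w)) (fst (gw_pair \<omega>' w)) < \<delta> m \<and>
        dist (snd (gw_pair \<omega> w)) (snd (gw_pair \<omega>' w)) < \<delta> m"
      if "w \<in> verts (gw_tree \<omega>)" "length w \<le> r m" for w
    proof -
      have "w \<in> fst ` set L" using L that unfolding Ls_def by blast
      then obtain N a b1 b2 c where z: "(w, N, a, b1, b2, c) \<in> set L" by force
      have Q: "Q m \<omega> (w, N, a, b1, b2, c)" "Q m \<omega>' (w, N, a, b1, b2, c)"
        using L z by (auto simp: E_def)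
      obtain t x1 x2 where o: "\<omega> w = (N, t, (x1, x2), c)"
        using Q(1) by (cases "\<omega> w") (auto simp: Q_def)
      obtain t' x1' x2' where o': "\<omega>' w = (N, t', (x1', x2'), c)"
        using Q(2) by (cases "\<omega>' w") (auto simp: Q_def)
      have "dist t t' < \<delta> m" "dist x1 x1' < \<delta> m" "dist x2 x2' < \<delta> m"
        using Q dist_triangle_half_r[of a t "\<delta> m" t'] dist_triangle_half_r[of b1 x1 "\<delta> m" x1']
          dist_triangle_half_r[of b2 x2 "\<delta> m" x2'] by (auto simp: Q_def o o')
      then show ?thesis by (simp add: o o' gw_pair_def)
    qed
    have "near (r m) (\<delta> m) (gw_tree \<omega>, []) (gw_tree \<omega>', [])"
      by (rule near_gw_tree) (use key in auto)
    then show "dist (gw_class \<omega>) (gw_class \<omega>') < 1 / real (Suc m)"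
      using d0 rd by (intro dist_iso_class_less rooted_connected_gw_tree)
  qed
qed

section \<open>Counting functions with prescribed fibres\<close>

definition with_fibres :: "'s set \<Rightarrow> 'k set \<Rightarrow> ('k \<Rightarrow> nat) \<Rightarrow> ('s \<Rightarrow> 'k) set" where
  "with_fibres S K c = {f \<in> S \<rightarrow>\<^sub>E K. \<forall>k\<in>K. card {s\<in>S. f s = k} = c k}"

lemma finite_with_fibres:
  assumes "finite S" "finite K" shows "finite (with_fibres S K c)"
  unfolding with_fibres_def using assms by (intro finite_subset[OF Collect_subset] finite_PiE) auto

text \<open>The lower half of the multinomial formula. The fibre \<open>T\<close> of
  \<open>k\<close> is chosen first, then a function on \<open>S - T\<close> with the remaining fibre
  sizes; \<open>?h\<close> glues the two injectively.\<close>

lemma fact_le_card_with_fibres: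
  assumes "finite K" "finite S" "(\<Sum>k\<in>K. c k) = card S"
  shows "fact (card S) \<le> card (with_fibres S K c) * (\<Prod>k\<in>K. fact (c k))"
  using assms
proof (induction K arbitrary: S)
  case empty
  then have "S = {}" by simp
  then have "with_fibres S {} c = {\<lambda>_. undefined}" by (auto simp: with_fibres_def)
  then show ?case using \<open>S = {}\<close> by simp
next
  case (insert k K)
  let ?T = "{T. T \<subseteq> S \<and> card T = c k}"
  let ?h = "\<lambda>(T, g). (\<lambda>s. if s \<in> T then k else g s)"
  have fT: "finite ?T" using insert.prems by simp
  have le: "c k \<le> card S" using insert by simp
  have cT: "card (S - T) = card S - c k" "(\<Sum>k\<in>K. c k) = card (S - T)" if "T \<in> ?T" for T
    using that insert finite_subset[of T S] by (auto simp: card_Diff_subset)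
  have gk: "g s \<in> K" if "g \<in> with_fibres (S - T) K c" "s \<in> S - T" for g T s
    using that by (auto simp: with_fibres_def)
  have inj: "inj_on ?h (SIGMA T:?T. with_fibres (S - T) K c)"
  proof (rule inj_onI, clarify)
    fix T g T' g' assume T: "T \<subseteq> S" "card T = c k" "g \<in> with_fibres (S - T) K c"
      and T': "T' \<subseteq> S" "card T' = c k" "g' \<in> with_fibres (S - T') K c"
      and eq: "(\<lambda>s. if s \<in> T then k else g s) = (\<lambda>s. if s \<in> T' then k else g' s)"
    have *: "s \<in> T \<longleftrightarrow> s \<in> T'" if "s \<in> S" for s
      using fun_cong[OF eq, of s] gk[OF T(3), of s] gk[OF T'(3), of s] insert.hyps(2) that
      by (auto split: if_splits)
    then have "T = T'" using T T' by blast
    moreover have "g s = g' s" for s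
    proof (cases "s \<in> T")
      case True
      then show ?thesis using T(3) T'(3) \<open>T = T'\<close> by (auto simp: with_fibres_def PiE_def extensional_def)
    next
      case False
      then show ?thesis using fun_cong[OF eq, of s] \<open>T = T'\<close> by simp
    qed
    ultimately show "T = T' \<and> g = g'" by blast
  qed
  have sub: "?h ` (SIGMA T:?T. with_fibres (S - T) K c) \<subseteq> with_fibres S (insert k K) c"
  proof clarify
    fix T g assume T: "T \<subseteq> S" "card T = c k" "g \<in> with_fibres (S - T) K c"
    have "{s \<in> S. (if s \<in> T then k else g s) = k} = T"
      using gk[OF T(3)] insert.hyps(2) T(1) by force
    moreover have "{s \<in> S. (if s \<in> T then k else g s) = l} = {s \<in> S - T. g s = l}" if "l \<in> K" for l
      using insert.hyps(2) that by auto
    moreover have "(\<lambda>s. if s \<in> T then k else g s) \<in> S \<rightarrow>\<^sub>E insert k K"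
      using T(1) gk[OF T(3)] T(3) by (auto simp: with_fibres_def PiE_def extensional_def)
    ultimately show "(\<lambda>s. if s \<in> T then k else g s) \<in> with_fibres S (insert k K) c"
      using T by (auto simp: with_fibres_def)
  qed
  have fin: "finite (with_fibres S (insert k K) c)"
    using insert by (intro finite_with_fibres) auto
  have finT: "finite (with_fibres (S - T) K c)" for T
    using insert by (intro finite_with_fibres) auto
  have "fact (card S) = fact (c k) * (card S choose c k) * fact (card S - c k)"
    using binomial_fact_lemma[OF le] by (simp add: mult_ac)
  also have "\<dots> = fact (c k) * (\<Sum>T\<in>?T. fact (card (S - T)))"
  proof -
    have "(\<Sum>T\<in>?T. fact (card (S - T))) = (\<Sum>T\<in>?T. (fact (card S - c k) :: nat))"
      using cT(1) by (intro sum.cong) auto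
    then show ?thesis using n_subsets[OF insert.prems(1)] by simp
  qed
  also have "\<dots> \<le> fact (c k) * (\<Sum>T\<in>?T. card (with_fibres (S - T) K c) * (\<Prod>k\<in>K. fact (c k)))"
    using insert.IH[OF _ cT(2)] insert.prems by (intro mult_le_mono2 sum_mono) auto
  also have "\<dots> = card (SIGMA T:?T. with_fibres (S - T) K c) * (\<Prod>k\<in>insert k K. fact (c k))"
    using insert.hyps fT finT by (simp add: card_SigmaI sum_distrib_right sum_distrib_left mult_ac)
  also have "card (SIGMA T:?T. with_fibres (S - T) K c) \<le> card (with_fibres S (insert k K) c)"
    using card_inj_on_le[OF inj sub fin] .
  finally show ?case by simp
qed

text \<open>Stirling's formula with a logarithmic error, which is negligible on the scale of
  \<open>n\<close>. The induction compares the increment of the logarithm with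
  \<open>1 / Suc c\<close>.\<close>

lemma ln_fact_le:
  assumes "1 \<le> c"
  shows "ln (fact c) \<le> real c * ln (real c) - real c + 1 + ln (real c)"
  using assms
proof (induction c rule: dec_induct)
  case (step c)
  have "ln (real c / real (Suc c)) \<le> real c / real (Suc c) - 1"
    using step by (intro ln_le_minus_one) auto
  then have "1 / real (Suc c) \<le> ln (real (Suc c)) - ln (real c)"
    using step by (simp add: ln_div field_simps)
  then have "real (Suc c) * (1 / real (Suc c)) \<le> real (Suc c) * (ln (real (Suc c)) - ln (real c))"
    by (intro mult_left_mono) auto
  then have 1: "1 \<le> real (Suc c) * (ln (real (Suc c)) - ln (real c))" by simp
  have "ln (fact (Suc c)) = ln (real (Suc c)) + ln (fact c)"
    by (simp add: ln_mult_pos del: of_nat_Suc)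
  then show ?case using step.IH 1 by (simp add: algebra_simps)
qed simp

lemma ln_fact_ge: "real n * ln (real n) - real n \<le> ln (fact n)"
proof (induction n)
  case (Suc n)
  show ?case
  proof (cases "n = 0")
    case False
    have "ln (real (Suc n) / real n) \<le> real (Suc n) / real n - 1"
      using False by (intro ln_le_minus_one) auto
    then have "ln (real (Suc n)) - ln (real n) \<le> 1 / real n"
      using False by (simp add: ln_div field_simps)
    then have "real n * (ln (real (Suc n)) - ln (real n)) \<le> real n * (1 / real n)"
      by (intro mult_left_mono) auto
    then have 1: "real n * (ln (real (Suc n)) - ln (real n)) \<le> 1" using False by simp
    have "ln (fact (Suc n)) = ln (real (Suc n)) + ln (fact n)"
      by (simp add: ln_mult_pos del: of_nat_Suc)
    then show ?thesis using Suc 1 by (simp add: algebra_simps)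
  qed simp
qed simp

lemma fact_add_ge: "fact a * a ^ M \<le> (fact (a + M) :: nat)"
proof (induction M)
  case (Suc M)
  have "fact a * a ^ Suc M = a * (fact a * a ^ M)" by simp
  also have "\<dots> \<le> Suc (a + M) * fact (a + M)" using Suc by (intro mult_le_mono) auto
  finally show ?case by simp
qed simp

text \<open>A bound for the falling factorial. In the application \<open>N\<close> is of order n^2
  and \<open>M\<close> of order n, so \<open>M^2 / N\<close> stays bounded and the bound is lossless
  on the exponential scale.\<close>

lemma ln_fact_diff_ge:
  assumes "M \<le> N" "M < N"
  shows "real M * ln (real (N - M)) \<le> ln (fact N) - ln (fact (N - M))"
proof -
  have "real (fact (N - M) * (N - M) ^ M) \<le> real (fact N)"
    using fact_add_ge[of "N - M" M] assms by (simp only: of_nat_le_iff) simp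
  then have "ln (fact (N - M) * real (N - M) ^ M) \<le> ln (fact N)"
    using assms by (subst ln_le_cancel_iff) auto
  then show ?thesis using assms by (simp add: ln_mult_pos ln_realpow)
qed

section \<open>Asymptotics of the counts\<close>

text \<open>At \<open>q = 0\<close> the logarithm is discontinuous; there the counts vanish
  identically, as adapted sequences guarantee.\<close>

lemma tendsto_ratio_ln:
  fixes c :: "nat \<Rightarrow> nat"
  assumes "(\<lambda>n. real (c n) / real n) \<longlonglongrightarrow> q" "q = 0 \<Longrightarrow> \<forall>n. c n = 0"
  shows "(\<lambda>n. real (c n) / real n * ln (real (c n) / real n)) \<longlonglongrightarrow> q * ln q"
proof (cases "q = 0")
  case True then show ?thesis using assms(2) by simp
next
  case False then show ?thesis using assms(1) by (intro tendsto_intros) auto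
qed

lemma tendsto_ln_count_over_n:
  fixes c :: "nat \<Rightarrow> nat"
  assumes "(\<lambda>n. real (c n) / real n) \<longlonglongrightarrow> q"
  shows "(\<lambda>n. ln (real (c n)) / real n) \<longlonglongrightarrow> 0"
proof -
  obtain C where C: "\<And>n. norm (real (c n) / real n) \<le> C"
    using convergent_imp_Bseq[OF convergentI[OF assms]] unfolding Bseq_def by blast
  have C': "real (c n) \<le> (C + 1) * real n" if "n \<ge> 1" for n
    using C[of n] that by (simp add: field_simps)
  have "0 \<le> C" using C[of 0] by simp
  have "(\<lambda>n. (ln (C + 1) + ln (real n)) / real n) \<longlonglongrightarrow> 0"
    using lim_ln_over_n tendsto_add[OF lim_const_over_n[of "ln (C + 1)"] lim_ln_over_n]
    by (simp add: add_divide_distrib)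
  then show ?thesis
  proof (rule tendsto_sandwich[OF _ _ tendsto_const, rotated 2])
    show "\<forall>\<^sub>F n in sequentially. 0 \<le> ln (real (c n)) / real n"
    proof (rule always_eventually, rule allI)
      fix n show "0 \<le> ln (real (c n)) / real n" by (cases "c n = 0") auto
    qed
    show "\<forall>\<^sub>F n in sequentially. ln (real (c n)) / real n \<le> (ln (C + 1) + ln (real n)) / real n"
      using eventually_ge_at_top[of 1]
    proof eventually_elim
      case (elim n)
      have "ln (real (c n)) \<le> ln (C + 1) + ln (real n)"
      proof (cases "c n = 0")
        case False
        then have "ln (real (c n)) \<le> ln ((C + 1) * real n)" using C'[OF elim] elim \<open>0 \<le> C\<close>
          by (subst ln_le_cancel_iff) auto
        then show ?thesis using elim \<open>0 \<le> C\<close> by (simp add: ln_mult_pos)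
      qed (use elim \<open>0 \<le> C\<close> in auto)
      then show ?case by (simp add: divide_right_mono)
    qed
  qed
qed

text \<open>The right-hand side is the logarithm of a multinomial probability: that \<open>n\<close>
  independent marks with law \<open>Q\<close> have the counts \<open>u n\<close>. Since the counts
  follow \<open>Q\<close> to first order, this probability is not exponentially small.\<close>

lemma vertex_count_asymptotics:
  fixes u :: "nat \<Rightarrow> 'k \<Rightarrow> nat"
  assumes A: "finite A" and lim: "\<And>t. t \<in> A \<Longrightarrow> (\<lambda>n. real (u n t) / real n) \<longlonglongrightarrow> Q t"
    and sum: "\<And>n. (\<Sum>t\<in>A. u n t) = n" and Q0: "\<And>t n. t \<in> A \<Longrightarrow> Q t = 0 \<Longrightarrow> u n t = 0"
    and Q: "\<And>t. t \<in> A \<Longrightarrow> 0 \<le> Q t" and "0 < \<theta>"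
  shows "\<forall>\<^sub>F n in sequentially. - (\<theta> * real n) \<le>
    ln (fact n) - (\<Sum>t\<in>A. ln (fact (u n t))) + (\<Sum>t\<in>A. real (u n t) * ln (Q t))"
proof -
  \<comment> \<open>What Stirling's bounds leave after division by \<open>n\<close>. The terms in
    \<open>ln n\<close> cancel because the counts add up to \<open>n\<close>, and the remaining main
    terms cancel in the limit.\<close>
  let ?g = "\<lambda>n. \<Sum>t\<in>A. real (u n t) / real n * ln (Q t) - real (u n t) / real n * ln (real (u n t) / real n)
      - 1 / real n - ln (real (u n t)) / real n"
  have "?g \<longlonglongrightarrow> (\<Sum>t\<in>A. Q t * ln (Q t) - Q t * ln (Q t) - 0 - 0)"
    using lim Q0 by (intro tendsto_sum tendsto_diff tendsto_mult tendsto_const tendsto_ratio_ln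
        tendsto_ln_count_over_n lim_const_over_n) auto
  then have "?g \<longlonglongrightarrow> 0" by simp
  then have "\<forall>\<^sub>F n in sequentially. - \<theta> < ?g n" using \<open>0 < \<theta>\<close> by (intro order_tendstoD) auto
  then show ?thesis using eventually_ge_at_top[of 1]
  proof eventually_elim
    case (elim n)
    have "ln (fact (u n t)) \<le> real n * (real (u n t) / real n * ln (real (u n t) / real n)
      + 1 / real n + ln (real (u n t)) / real n) + real (u n t) * ln (real n) - real (u n t)" for t
    proof (cases "u n t = 0")
      case False
      then have "ln (fact (u n t)) \<le> real (u n t) * ln (real (u n t)) - real (u n t) + 1 + ln (real (u n t))"
        by (intro ln_fact_le) simp
      moreover have "real (u n t) * ln (real (u n t)) =
          real (u n t) * ln (real (u n t) / real n) + real (u n t) * ln (real n)"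
        using False elim by (simp add: ln_div algebra_simps)
      moreover have "real n * (real (u n t) / real n * ln (real (u n t) / real n) + 1 / real n
          + ln (real (u n t)) / real n) = real (u n t) * ln (real (u n t) / real n) + 1 + ln (real (u n t))"
        using elim by (simp add: distrib_left)
      ultimately show ?thesis by linarith
    qed (use elim in simp)
    then have "(\<Sum>t\<in>A. ln (fact (u n t))) \<le> (\<Sum>t\<in>A. real n * (real (u n t) / real n * ln (real (u n t) / real n)
      + 1 / real n + ln (real (u n t)) / real n) + real (u n t) * ln (real n) - real (u n t))"
      by (rule sum_mono)
    also have "\<dots> = (\<Sum>t\<in>A. real n * (real (u n t) / real n * ln (real (u n t) / real n)
      + 1 / real n + ln (real (u n t)) / real n)) + (\<Sum>t\<in>A. real (u n t)) * ln (real n) - (\<Sum>t\<in>A. real (u n t))"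
      by (simp add: sum.distrib sum_subtractf sum_distrib_right)
    also have "(\<Sum>t\<in>A. real (u n t)) = real n" using sum[of n] by (metis of_nat_sum)
    finally have 1: "(\<Sum>t\<in>A. ln (fact (u n t))) \<le> (\<Sum>t\<in>A. real n * (real (u n t) / real n * ln (real (u n t) / real n)
      + 1 / real n + ln (real (u n t)) / real n)) + real n * ln (real n) - real n" .
    have "real n * (- \<theta>) \<le> real n * ?g n" using elim by (intro mult_left_mono) auto
    also have "\<dots> = (\<Sum>t\<in>A. real (u n t) * ln (Q t)) - (\<Sum>t\<in>A. real n * (real (u n t) / real n * ln (real (u n t) / real n)
      + 1 / real n + ln (real (u n t)) / real n))"
      using elim by (simp add: sum_distrib_left right_diff_distrib distrib_left sum_subtractf sum.distrib)
    finally show ?case using 1 ln_fact_ge[of n] by (simp add: algebra_simps)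
  qed
qed

lemma tendsto_n_ln_one_minus: "(\<lambda>n. real n * ln (1 - d / real n)) \<longlonglongrightarrow> - d"
proof -
  have "(\<lambda>n. ln ((1 + (- d) / real n) ^ n)) \<longlonglongrightarrow> ln (exp (- d))"
    by (intro tendsto_ln tendsto_exp_limit_sequentially) auto
  moreover have "\<forall>\<^sub>F n in sequentially. ln ((1 + (- d) / real n) ^ n) = real n * ln (1 - d / real n)"
    using eventually_gt_at_top[of "nat \<lceil>\<bar>d\<bar>\<rceil>"]
  proof eventually_elim
    case (elim n)
    then have "\<bar>d\<bar> < real n" by linarith
    then have "0 < 1 + (- d) / real n" by (simp add: field_simps)
    then show ?case by (simp add: ln_realpow)
  qed
  ultimately show ?thesis by (simp add: tendsto_cong)
qed

lemma tendsto_remaining_slots: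
  fixes M :: "nat \<Rightarrow> nat"
  assumes M: "\<And>n. M n \<le> n choose 2" and lim: "(\<lambda>n. real (M n) / real n) \<longlonglongrightarrow> e"
  shows "(\<lambda>n. real ((n choose 2) - M n) / (real n)\<^sup>2) \<longlonglongrightarrow> 1 / 2"
proof -
  have "(\<lambda>n. 1 / 2 - (1 / 2) * (1 / real n) - real (M n) / real n * (1 / real n)) \<longlonglongrightarrow> 1 / 2 - (1 / 2) * 0 - e * 0"
    by (intro tendsto_diff tendsto_mult tendsto_const lim lim_const_over_n)
  moreover have "\<forall>\<^sub>F n in sequentially. 1 / 2 - (1 / 2) * (1 / real n) - real (M n) / real n * (1 / real n) =
      real ((n choose 2) - M n) / (real n)\<^sup>2"
    using eventually_ge_at_top[of 1]
  proof eventually_elim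
    case (elim n)
    have "real (n choose 2) = real n * (real n - 1) / 2"
    proof -
      have "2 * (n choose 2) = n * (n - 1)"
        unfolding choose_two by (rule dvd_mult_div_cancel) auto
      then have "2 * real (n choose 2) = real n * real (n - 1)" by (metis of_nat_mult of_nat_numeral)
      then show ?thesis using elim by (simp add: of_nat_diff)
    qed
    then have "real ((n choose 2) - M n) = real n * (real n - 1) / 2 - real (M n)"
      using M[of n] by (simp add: of_nat_diff)
    moreover have "1 / 2 - (1 / 2) * (1 / x) - y / x * (1 / x) = (x * (x - 1) / 2 - y) / x\<^sup>2"
      if "x \<noteq> 0" for x y :: real using that by (simp add: power2_eq_square field_simps)
    ultimately show ?case using elim by simp
  qed
  ultimately show ?thesis by (simp add: tendsto_cong)
qed

text \<open>The counterpart for edges: the logarithm of the multinomial probability that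
  \<open>n choose 2\<close> independent slots, each of type \<open>p\<close> with probability
  \<open>D p / n\<close> and empty otherwise, show the counts \<open>c n\<close>. Types are oriented
  pairs, hence the expected count near \<open>n * D p / 2\<close>.\<close>

lemma edge_count_asymptotics:
  fixes c :: "nat \<Rightarrow> 'k \<Rightarrow> nat"
  defines "N \<equiv> \<lambda>n. n choose 2" and "M \<equiv> \<lambda>n P. \<Sum>p\<in>P. c n p"
  assumes P: "finite P" and lim: "\<And>p. p \<in> P \<Longrightarrow> (\<lambda>n. real (c n p) / real n) \<longlonglongrightarrow> D p / 2"
    and M: "\<And>n. M n P \<le> N n" and D0: "\<And>p n. p \<in> P \<Longrightarrow> D p = 0 \<Longrightarrow> c n p = 0"
    and D: "\<And>p. p \<in> P \<Longrightarrow> 0 \<le> D p" and d: "d = (\<Sum>p\<in>P. D p)" and "0 < \<theta>"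
  shows "\<forall>\<^sub>F n in sequentially. - (\<theta> * real n) \<le>
    ln (fact (N n)) - ln (fact (N n - M n P)) - (\<Sum>p\<in>P. ln (fact (c n p))) +
    (\<Sum>p\<in>P. real (c n p) * ln (D p / real n)) + real (N n - M n P) * ln (1 - d / real n)"
proof -
  define a where "a n = real (N n - M n P) / (real n)\<^sup>2" for n
  have "(\<lambda>n. real (M n P) / real n) \<longlonglongrightarrow> (\<Sum>p\<in>P. D p / 2)"
    unfolding M_def of_nat_sum sum_divide_distrib by (intro tendsto_sum lim)
  then have a: "a \<longlonglongrightarrow> 1 / 2"
    unfolding a_def N_def by (rule tendsto_remaining_slots[OF M[unfolded N_def]])
  \<comment> \<open>The contribution of type \<open>p\<close> divided by \<open>n\<close>. Its
    \<open>ln n\<close> terms cancel: the number of free slots gives \<open>2 * ln n\<close> per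
    edge, the factorial of the count and the probability \<open>D p / n\<close> take away one each.
    The limit is \<open>D p / 2\<close>; these add up to \<open>d / 2\<close>, which the empty slots
    compensate.\<close>
  define h where "h n p = real (c n p) / real n * ln (a n) - real (c n p) / real n * ln (real (c n p) / real n)
      + real (c n p) / real n * ln (D p) + real (c n p) / real n - 1 / real n - ln (real (c n p)) / real n" for n p
  let ?g = "\<lambda>n. (\<Sum>p\<in>P. h n p) + a n * (real n * ln (1 - d / real n))"
  have "?g \<longlonglongrightarrow> (\<Sum>p\<in>P. D p / 2 * ln (1 / 2) - D p / 2 * ln (D p / 2) + D p / 2 * ln (D p) + D p / 2 - 0 - 0)
      + 1 / 2 * - d"
    unfolding h_def using lim D0
    by (intro tendsto_sum tendsto_add tendsto_diff tendsto_mult tendsto_const tendsto_ratio_ln a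
        tendsto_ln_count_over_n lim_const_over_n tendsto_n_ln_one_minus tendsto_ln) auto
  also have "(\<Sum>p\<in>P. D p / 2 * ln (1 / 2) - D p / 2 * ln (D p / 2) + D p / 2 * ln (D p) + D p / 2 - 0 - 0) =
      (\<Sum>p\<in>P. D p / 2)"
  proof (rule sum.cong[OF refl])
    fix p assume "p \<in> P"
    show "D p / 2 * ln (1 / 2) - D p / 2 * ln (D p / 2) + D p / 2 * ln (D p) + D p / 2 - 0 - 0 = D p / 2"
    proof (cases "D p = 0")
      case False
      then have "0 < D p" using D[OF \<open>p \<in> P\<close>] by simp
      then show ?thesis by (simp add: ln_div algebra_simps)
    qed simp
  qed
  finally have "?g \<longlonglongrightarrow> 0" by (simp add: d sum_divide_distrib)
  then have "\<forall>\<^sub>F n in sequentially. - \<theta> < ?g n" using \<open>0 < \<theta>\<close> by (intro order_tendstoD) auto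
  moreover have "\<forall>\<^sub>F n in sequentially. 0 < a n" using a by (intro order_tendstoD) auto
  ultimately show ?thesis using eventually_ge_at_top[of 1]
  proof eventually_elim
    case (elim n)
    have n: "0 < real n" using elim by simp
    have pos: "0 < N n - M n P"
      using elim(2) unfolding a_def by (simp add: zero_less_divide_iff)
    have lnNM: "ln (real (N n - M n P)) = ln (a n) + 2 * ln (real n)"
      using pos n by (simp add: a_def ln_div ln_realpow)
    have 1: "real n * h n p \<le> real (c n p) * ln (real (N n - M n P)) - ln (fact (c n p))
        + real (c n p) * ln (D p / real n)" if p: "p \<in> P" for p
    proof (cases "c n p = 0")
      case False
      then have Dp: "0 < D p" using D[OF p] D0[OF p] by (cases "D p = 0") auto
      have "ln (fact (c n p)) \<le> real (c n p) * ln (real (c n p)) - real (c n p) + 1 + ln (real (c n p))"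
        using False by (intro ln_fact_le) simp
      moreover have "real (c n p) * ln (real (c n p)) =
          real (c n p) * ln (real (c n p) / real n) + real (c n p) * ln (real n)"
        using False n by (simp add: ln_div algebra_simps)
      moreover have "real (c n p) * ln (D p / real n) = real (c n p) * ln (D p) - real (c n p) * ln (real n)"
        using Dp n by (simp add: ln_div algebra_simps)
      moreover have "real n * h n p = real (c n p) * ln (a n) - real (c n p) * ln (real (c n p) / real n)
          + real (c n p) * ln (D p) + real (c n p) - 1 - ln (real (c n p))"
        using n by (simp add: h_def distrib_left right_diff_distrib)
      moreover have "real (c n p) * ln (real (N n - M n P)) = real (c n p) * ln (a n) + 2 * (real (c n p) * ln (real n))"
        by (simp add: lnNM algebra_simps)
      ultimately show ?thesis by linarith
    next
      case True
      then show ?thesis using n by (simp add: h_def)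
    qed
    have "real n * - \<theta> \<le> real n * ?g n" using elim by (intro mult_left_mono) auto
    also have "\<dots> = (\<Sum>p\<in>P. real n * h n p) + real (N n - M n P) * ln (1 - d / real n)"
      using n by (simp add: a_def distrib_left sum_distrib_left power2_eq_square)
    also have "(\<Sum>p\<in>P. real n * h n p) \<le> (\<Sum>p\<in>P. real (c n p) * ln (real (N n - M n P)) - ln (fact (c n p))
        + real (c n p) * ln (D p / real n))"
      using 1 by (rule sum_mono)
    also have "\<dots> = real (M n P) * ln (real (N n - M n P)) - (\<Sum>p\<in>P. ln (fact (c n p)))
        + (\<Sum>p\<in>P. real (c n p) * ln (D p / real n))"
      by (simp add: sum.distrib sum_subtractf M_def sum_distrib_right)
    finally show ?case using ln_fact_diff_ge[of "M n P" "N n"] pos M[of n] by (simp add: algebra_simps)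
  qed
qed

section \<open>Root statistics\<close>

lemma near_root_nbrs:
  assumes near: "near r \<delta> (G, a) (H, b)" and "1 \<le> r"
    and rc: "rooted_connected (G, a)" "rooted_connected (H, b)"
  obtains \<Psi> where "bij_betw \<Psi> {v. {a, v} \<in> edges G} {v. {b, v} \<in> edges H}"
    and "\<And>v. {a, v} \<in> edges G \<Longrightarrow>
      dist (emark G v a) (emark H (\<Psi> v) b) < \<delta> \<and> dist (emark G a v) (emark H b (\<Psi> v)) < \<delta>"
proof -
  obtain \<Psi> where "marked_iso (\<lambda>s t. dist s t < \<delta>) (\<lambda>s t. dist s t < \<delta>) \<Psi>
      (root_nbhd r (G, a)) (root_nbhd r (H, b))"
    using near unfolding near_def by blast
  then have bij: "bij_betw \<Psi> (gball G a r) (gball H b r)" and root: "\<Psi> a = b"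
    and e: "\<And>u v. u \<in> gball G a r \<Longrightarrow> v \<in> gball G a r \<Longrightarrow> {u, v} \<in> edges G \<longleftrightarrow>
      {\<Psi> u, \<Psi> v} \<in> edges H \<and> {\<Psi> u, \<Psi> v} \<subseteq> gball H b r"
    and m: "\<And>u v. {u, v} \<in> edges G \<Longrightarrow> {u, v} \<subseteq> gball G a r \<Longrightarrow> dist (emark G u v) (emark H (\<Psi> u) (\<Psi> v)) < \<delta>"
    unfolding marked_iso_def root_nbhd_def prod.case graph_iso_def induced_simps
    by (simp, simp, (blast | auto dest: bij_betw_apply)[1], simp)
  have nb: "v \<in> gball K c r" if K: "simple_graph K" "{c, v} \<in> edges K" for K :: "('x, 'y, 'z) mgraph" and c v
    using edge_verts[OF K] K(2) \<open>1 \<le> r\<close> by (auto simp: gball_def adj_def intro!: exI[of _ 1])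
  have G: "simple_graph G" "a \<in> gball G a r" and H: "simple_graph H" "b \<in> gball H b r"
    using rc by (auto simp: rooted_connected_def root_in_gball)
  have nG: "\<And>v. {a, v} \<in> edges G \<Longrightarrow> v \<in> gball G a r" and nH: "\<And>v. {b, v} \<in> edges H \<Longrightarrow> v \<in> gball H b r"
    by (rule nb[OF G(1)], assumption, rule nb[OF H(1)], assumption)
  have sub: "{v. {a, v} \<in> edges G} \<subseteq> gball G a r" using nG by auto
  have "bij_betw \<Psi> {v. {a, v} \<in> edges G} {v. {b, v} \<in> edges H}"
  proof (rule bij_betw_imageI)
    show "inj_on \<Psi> {v. {a, v} \<in> edges G}"
      by (rule inj_on_subset[OF bij_betw_imp_inj_on[OF bij] sub])
    show "\<Psi> ` {v. {a, v} \<in> edges G} = {v. {b, v} \<in> edges H}"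
    proof
      show "\<Psi> ` {v. {a, v} \<in> edges G} \<subseteq> {v. {b, v} \<in> edges H}"
      proof (rule image_subsetI)
        fix v assume "v \<in> {v. {a, v} \<in> edges G}"
        then have "{a, v} \<in> edges G" by simp
        then have "{\<Psi> a, \<Psi> v} \<in> edges H" using e[OF G(2) nG] by blast
        then show "\<Psi> v \<in> {v. {b, v} \<in> edges H}" by (simp add: root)
      qed
      show "{v. {b, v} \<in> edges H} \<subseteq> \<Psi> ` {v. {a, v} \<in> edges G}"
      proof
        fix w assume "w \<in> {v. {b, v} \<in> edges H}"
        then have w: "{b, w} \<in> edges H" "w \<in> gball H b r" using nH by simp_all
        then obtain v where v: "v \<in> gball G a r" "w = \<Psi> v"
          using bij_betw_imp_surj_on[OF bij] by blast
        have "{\<Psi> a, \<Psi> v} \<in> edges H \<and> {\<Psi> a, \<Psi> v} \<subseteq> gball H b r"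
          using w v(2) H(2) by (simp add: root)
        then have "{a, v} \<in> edges G" using e[OF G(2) v(1)] by blast
        then show "w \<in> \<Psi> ` {v. {a, v} \<in> edges G}" using v by blast
      qed
    qed
  qed
  moreover have "dist (emark G v a) (emark H (\<Psi> v) b) < \<delta> \<and> dist (emark G a v) (emark H b (\<Psi> v)) < \<delta>"
    if v: "{a, v} \<in> edges G" for v
  proof -
    have "{v, a} \<in> edges G" using v by (simp add: insert_commute)
    then have "dist (emark G v a) (emark H (\<Psi> v) (\<Psi> a)) < \<delta>" "dist (emark G a v) (emark H (\<Psi> a) (\<Psi> v)) < \<delta>"
      using nG[OF v] G(2) v by (auto intro!: m)
    then show ?thesis by (simp add: root)
  qed
  ultimately show thesis by (rule that)
qed

lemma rooted_connected_rep_gstar: "rooted_connected (rep_gstar g)"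
proof -
  have "isomorphic (rep_gstar g) (rep_gstar g)" using Quotient3_gstar by (rule Quotient3_rep_reflp)
  then show ?thesis by (simp add: isomorphic_def)
qed

lemma dist_gstar_lessD:
  assumes "dist g h < c"
  obtains r \<delta> where "0 < \<delta>" "near r \<delta> (rep_gstar g) (rep_gstar h)" "1 / (1 + real r) + \<delta> < c"
  using assms unfolding dist_gstar.rep_eq local_dist_less_iff[OF rooted_connected_rep_gstar rooted_connected_rep_gstar]
  by blast

lemma dist_root_mark_le: "dist (root_mark g) (root_mark h) \<le> dist g h"
proof (rule dense_ge)
  fix c assume "dist g h < c"
  then obtain r \<delta> where n: "0 < \<delta>" "near r \<delta> (rep_gstar g) (rep_gstar h)" "1 / (1 + real r) + \<delta> < c"
    by (rule dist_gstar_lessD)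
  obtain G a H b where X: "rep_gstar g = (G, a)" "rep_gstar h = (H, b)" by (metis surj_pair)
  have "a \<in> gball G a r" using rooted_connected_rep_gstar[of g]
    by (auto simp: X rooted_connected_def root_in_gball)
  then have "dist (vmark G a) (vmark H b) < \<delta>"
    using n(2) by (auto simp: near_def X marked_iso_def root_nbhd_def)
  moreover have "0 \<le> 1 / (1 + real r)" by simp
  ultimately have "dist (vmark G a) (vmark H b) \<le> c" using n(3) by linarith
  then show "dist (root_mark g) (root_mark h) \<le> c" by (simp add: root_mark.rep_eq X)
qed

lemma measurable_root_mark [measurable]: "root_mark \<in> borel_measurable borel"
proof (rule borel_measurable_continuous_onI)
  show "continuous_on UNIV (root_mark :: ('a::metric_space, 'b::metric_space) gstar \<Rightarrow> 'a)"
    unfolding continuous_on_iff using dist_root_mark_le by (metis le_less_trans)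
qed

text \<open>A distance below \<open>1 / 2\<close> excludes radius 0, so the isomorphism sees all
  neighbours of the root.\<close>

lemma root_degree_locally_constant:
  assumes "dist g h < 1 / 2" shows "root_degree g = root_degree h"
proof -
  obtain r \<delta> where n: "0 < \<delta>" "near r \<delta> (rep_gstar g) (rep_gstar h)" "1 / (1 + real r) + \<delta> < 1 / 2"
    using assms by (rule dist_gstar_lessD)
  obtain G a H b where X: "rep_gstar g = (G, a)" "rep_gstar h = (H, b)" by (metis surj_pair)
  have rc: "rooted_connected (G, a)" "rooted_connected (H, b)"
    using rooted_connected_rep_gstar[of g] rooted_connected_rep_gstar[of h] by (auto simp: X)
  have "1 \<le> r" using n(1,3) by (cases r) auto
  obtain \<Psi> where "bij_betw \<Psi> {v. {a, v} \<in> edges G} {v. {b, v} \<in> edges H}"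
    using n(2) unfolding X by (rule near_root_nbrs[OF _ \<open>1 \<le> r\<close> rc])
  then show ?thesis using bij_betw_same_card by (auto simp: root_degree.rep_eq X)
qed

text \<open>A neighbour carrying exactly the marks \<open>x\<close>, \<open>x'\<close> may lose them
  under a small perturbation, so continuity fails. The finitely many neighbours with other marks
  keep a positive distance from that pair, so close by the count cannot increase. This already
  yields measurability.\<close>

lemma root_degree_marked_upper_semicontinuous:
  fixes g :: "('a::metric_space, 'b::metric_space) gstar"
  shows "\<exists>e>0. \<forall>h. dist g h < e \<longrightarrow> root_degree_marked x x' h \<le> root_degree_marked x x' g"
proof -
  obtain G a where X: "rep_gstar g = (G, a)" by (metis surj_pair)
  have rc: "rooted_connected (G, a)" using rooted_connected_rep_gstar[of g] by (simp add: X)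
  let ?N = "{v. {a, v} \<in> edges G}"
  let ?good = "\<lambda>v. emark G v a = x \<and> emark G a v = x'"
  have fin: "finite ?N" using rc by (auto simp: rooted_connected_def locally_finite_def)
  \<comment> \<open>The entry \<open>1/2\<close> makes the minimum exist when all neighbours are
    good, and forces radius at least 1 in the comparison.\<close>
  define D where "D = insert (1/2) ((\<lambda>v. max (dist (emark G v a) x) (dist (emark G a v) x')) ` {v\<in>?N. \<not> ?good v})"
  define e where "e = Min D"
  have D: "finite D" "D \<noteq> {}" using fin by (auto simp: D_def)
  have "0 < y" if "y \<in> D" for y using that by (auto simp: D_def less_max_iff_disj)
  then have "e > 0" using D by (simp add: e_def)
  have e: "e \<le> 1/2" "\<And>v. v \<in> ?N \<Longrightarrow> \<not> ?good v \<Longrightarrow> e \<le> max (dist (emark G v a) x) (dist (emark G a v) x')"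
  proof -
    have "1/2 \<in> D" by (simp add: D_def)
    then show "e \<le> 1/2" unfolding e_def by (rule Min_le[OF D(1)])
    fix v assume "v \<in> ?N" "\<not> ?good v"
    then have "max (dist (emark G v a) x) (dist (emark G a v) x') \<in> D" unfolding D_def by blast
    then show "e \<le> max (dist (emark G v a) x) (dist (emark G a v) x')" unfolding e_def by (rule Min_le[OF D(1)])
  qed
  have "root_degree_marked x x' h \<le> root_degree_marked x x' g" if gh: "dist g h < e" for h
  proof -
    obtain r \<delta> where n: "0 < \<delta>" "near r \<delta> (rep_gstar g) (rep_gstar h)" "1 / (1 + real r) + \<delta> < e"
      using gh by (rule dist_gstar_lessD)
    obtain H b where Y: "rep_gstar h = (H, b)" by (metis surj_pair)
    have rc': "rooted_connected (H, b)" using rooted_connected_rep_gstar[of h] by (simp add: Y)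
    have "1 \<le> r" using n(1,3) e(1) by (cases r) auto
    obtain \<Psi> where \<Psi>: "bij_betw \<Psi> ?N {v. {b, v} \<in> edges H}"
      "\<And>v. {a, v} \<in> edges G \<Longrightarrow>
        dist (emark G v a) (emark H (\<Psi> v) b) < \<delta> \<and> dist (emark G a v) (emark H b (\<Psi> v)) < \<delta>"
      using near_root_nbrs[OF n(2)[unfolded X Y] \<open>1 \<le> r\<close> rc rc'] by metis
    have "0 \<le> 1 / (1 + real r)" by simp
    then have de: "\<delta> < e" using n(3) by linarith
    have "{v. {b, v} \<in> edges H \<and> emark H v b = x \<and> emark H b v = x'} \<subseteq> \<Psi> ` {v \<in> ?N. ?good v}"
    proof
      fix w assume w: "w \<in> {v. {b, v} \<in> edges H \<and> emark H v b = x \<and> emark H b v = x'}"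
      then obtain v where v: "v \<in> ?N" "w = \<Psi> v" using bij_betw_imp_surj_on[OF \<Psi>(1)] by blast
      have "max (dist (emark G v a) x) (dist (emark G a v) x') < e"
        using \<Psi>(2)[of v] v w de by auto
      then have "?good v" using e(2)[OF v(1)] by force
      then show "w \<in> \<Psi> ` {v \<in> ?N. ?good v}" using v by blast
    qed
    then have "card {v. {b, v} \<in> edges H \<and> emark H v b = x \<and> emark H b v = x'} \<le> card {v \<in> ?N. ?good v}"
      using fin by (intro surj_card_le) auto
    then show ?thesis by (simp add: root_degree_marked.rep_eq X Y)
  qed
  then show ?thesis using \<open>e > 0\<close> by blast
qed

lemma measurable_root_degree [measurable]:
  "(root_degree :: ('a::metric_space, 'b::metric_space) gstar \<Rightarrow> nat) \<in> measurable borel (count_space UNIV)"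
proof (rule measurable_count_space_eq2_countable[THEN iffD2])
  have "open (root_degree -` {n} :: ('a, 'b) gstar set)" for n
    unfolding open_dist
  proof
    fix g :: "('a, 'b) gstar" assume "g \<in> root_degree -` {n}"
    then show "\<exists>e>0. \<forall>h. dist h g < e \<longrightarrow> h \<in> root_degree -` {n}"
    proof (intro exI[of _ "1/2"] conjI allI impI)
      fix h assume "dist h g < 1 / 2"
      then have "root_degree h = root_degree g" by (rule root_degree_locally_constant)
      then show "h \<in> root_degree -` {n}" using \<open>g \<in> root_degree -` {n}\<close> by simp
    qed simp
  qed
  then show "root_degree \<in> space borel \<rightarrow> UNIV \<and> (\<forall>n\<in>UNIV. root_degree -` {n} \<inter> space borel \<in> sets (borel :: ('a, 'b) gstar measure))"
    by auto
qed

lemma measurable_root_degree_marked [measurable]: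
  "(root_degree_marked x x' :: ('a::metric_space, 'b::metric_space) gstar \<Rightarrow> nat) \<in> measurable borel (count_space UNIV)"
proof (rule measurable_count_space_eq2_countable[THEN iffD2])
  let ?f = "root_degree_marked x x' :: ('a, 'b) gstar \<Rightarrow> nat"
  have "open {g. ?f g < n}" for n
    unfolding open_dist
  proof
    fix g assume "g \<in> {g. ?f g < n}"
    then show "\<exists>e>0. \<forall>h. dist h g < e \<longrightarrow> h \<in> {g. ?f g < n}"
      using root_degree_marked_upper_semicontinuous[of g x x'] unfolding mem_Collect_eq
      by (metis dist_commute le_less_trans)
  qed
  then have "{g. ?f g < Suc n} - {g. ?f g < n} \<in> sets borel" for n by auto
  moreover have "?f -` {n} = {g. ?f g < Suc n} - {g. ?f g < n}" for n by auto
  ultimately show "?f \<in> space borel \<rightarrow> UNIV \<and> (\<forall>n\<in>UNIV. ?f -` {n} \<inter> space borel \<in> sets borel)"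
    by auto
qed

lemma root_statistics_iso_class:
  fixes G :: "('v::countable, 'a::metric_space, 'b::metric_space) mgraph"
  assumes rc: "rooted_connected (G, v)"
  shows "root_mark (iso_class G v) = vmark G v"
    and "root_degree (iso_class G v) = card {u. {v, u} \<in> edges G}"
    and "root_degree_marked x x' (iso_class G v) = card {u. {v, u} \<in> edges G \<and> emark G u v = x \<and> emark G v u = x'}"
proof -
  note i = isomorphic_refl[OF rooted_connected_relabel[OF rc]]
  note iso = isomorphic_relabel[OF rc]
  show "root_mark (iso_class G v) = vmark G v"
    unfolding iso_class_def root_mark.abs_eq[OF i] by (simp add: relabel_def)
  show "root_degree (iso_class G v) = card {u. {v, u} \<in> edges G}"
    unfolding iso_class_def root_degree.abs_eq[OF i]
    using isomorphic_card_nbrs[OF iso, of "\<lambda>_ _. True"] by simp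
  show "root_degree_marked x x' (iso_class G v) = card {u. {v, u} \<in> edges G \<and> emark G u v = x \<and> emark G v u = x'}"
    unfolding iso_class_def root_degree_marked.abs_eq[OF i]
    using isomorphic_card_nbrs[OF iso, of "\<lambda>y y'. y = x \<and> y' = x'"] by simp
qed

lemma marks_in_iso_class:
  fixes G :: "('v::countable, 'a::metric_space, 'b::metric_space) mgraph"
  assumes rc: "rooted_connected (G, v)"
    and "\<And>u. u \<in> verts G \<Longrightarrow> vmark G u \<in> A" "\<And>u w. {u, w} \<in> edges G \<Longrightarrow> emark G u w \<in> B"
  shows "marks_in A B (iso_class G v)"
proof -
  note i = isomorphic_refl[OF rooted_connected_relabel[OF rc]]
  obtain \<Psi> where \<Psi>: "marked_iso (=) (=) \<Psi> (relabel G, to_nat v) (G, v)"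
    using isomorphic_sym[OF isomorphic_relabel[OF rc]] by (auto simp: isomorphic_def)
  have s: "simple_graph (relabel G)" using rooted_connected_relabel[OF rc] by (simp add: rooted_connected_def)
  have "vmark (relabel G) u \<in> A" if "u \<in> verts (relabel G)" for u
    using \<Psi> that assms(2) by (auto simp: marked_iso_def graph_iso_def bij_betw_def)
  moreover have "emark (relabel G) u w \<in> B" if "{u, w} \<in> edges (relabel G)" for u w
    using \<Psi> that assms(3) edge_verts[OF s that] by (auto simp: marked_iso_def graph_iso_def)
  ultimately show ?thesis unfolding iso_class_def marks_in.abs_eq[OF i] by auto
qed

lemma marks_in_root_degree_marked_sum:
  assumes "marks_in A B g" "finite B"
  shows "root_mark g \<in> A" and "root_degree g = (\<Sum>(x, x')\<in>B \<times> B. root_degree_marked x x' g)"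
proof -
  obtain G a where X: "rep_gstar g = (G, a)" by (metis surj_pair)
  have rc: "rooted_connected (G, a)" using rooted_connected_rep_gstar[of g] by (simp add: X)
  have m: "vmark G ` verts G \<subseteq> A" "\<And>u v. {u, v} \<in> edges G \<Longrightarrow> emark G u v \<in> B"
    using assms(1) by (auto simp: marks_in.rep_eq X)
  show "root_mark g \<in> A" using m rc by (auto simp: root_mark.rep_eq X rooted_connected_def)
  let ?N = "{v. {a, v} \<in> edges G}"
  have fin: "finite ?N" using rc by (auto simp: rooted_connected_def locally_finite_def)
  have "?N = (\<Union>p\<in>B \<times> B. {v \<in> ?N. (emark G v a, emark G a v) = p})"
    using m(2) by (auto simp: insert_commute)
  then have "card ?N = card (\<Union>p\<in>B \<times> B. {v \<in> ?N. (emark G v a, emark G a v) = p})"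
    by (rule arg_cong)
  also have "\<dots> = (\<Sum>p\<in>B \<times> B. card {v \<in> ?N. (emark G v a, emark G a v) = p})"
    using fin assms(2) by (intro card_UN_disjoint) auto
  also have "\<dots> = (\<Sum>(x, x')\<in>B \<times> B. root_degree_marked x x' g)"
    by (intro sum.cong) (auto simp: root_degree_marked.rep_eq X intro!: arg_cong[of _ _ card])
  finally show "root_degree g = (\<Sum>(x, x')\<in>B \<times> B. root_degree_marked x x' g)"
    by (simp add: root_degree.rep_eq X)
qed

section \<open>The law of the Galton--Watson tree with projected marks\<close>

definition gw_proj :: "('a \<Rightarrow> 'a) \<Rightarrow> ('b \<Rightarrow> 'b) \<Rightarrow> ('a, 'b) gw_sample \<Rightarrow> ('a, 'b) gw_sample" where
  "gw_proj f g \<omega> w = (case \<omega> w of (N, t, (x1, x2), c) \<Rightarrow> (N, f t, (g x1, g x2), c))"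

lemma gw_proj_simps [simp]:
  "fst (gw_proj f g \<omega> w) = fst (\<omega> w)"
  "fst (snd (gw_proj f g \<omega> w)) = f (fst (snd (\<omega> w)))"
  "gw_pair (gw_proj f g \<omega>) w = map_prod g g (gw_pair \<omega> w)"
  "verts (gw_tree (gw_proj f g \<omega>)) = verts (gw_tree \<omega>)"
proof -
  obtain N t x1 x2 c where "\<omega> w = (N, t, (x1, x2), c)" by (metis surj_pair)
  then show "fst (gw_proj f g \<omega> w) = fst (\<omega> w)"
    "fst (snd (gw_proj f g \<omega> w)) = f (fst (snd (\<omega> w)))"
    "gw_pair (gw_proj f g \<omega>) w = map_prod g g (gw_pair \<omega> w)"
    by (auto simp: gw_proj_def gw_pair_def)
  have "fst (gw_proj f g \<omega> u) = fst (\<omega> u)" for u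
    by (cases "\<omega> u") (auto simp: gw_proj_def)
  then show "verts (gw_tree (gw_proj f g \<omega>)) = verts (gw_tree \<omega>)" by (simp add: gw_tree_simps)
qed

lemma measurable_gw_proj [measurable]:
  fixes f :: "'a::topological_space \<Rightarrow> 'a" and g :: "'b::second_countable_topology \<Rightarrow> 'b"
  assumes f: "f \<in> borel_measurable borel" and g: "g \<in> borel_measurable borel"
  shows "gw_proj f g \<in> measurable gw_borel gw_borel"
proof -
  have m: "(\<lambda>(N, t, x, c). (N, f t, map_prod g g x, c)) \<in>
    measurable (count_space UNIV \<Otimes>\<^sub>M borel \<Otimes>\<^sub>M (borel :: ('b \<times> 'b) measure) \<Otimes>\<^sub>M count_space UNIV)
      (count_space UNIV \<Otimes>\<^sub>M borel \<Otimes>\<^sub>M (borel :: ('b \<times> 'b) measure) \<Otimes>\<^sub>M count_space UNIV)"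
    (is "?h \<in> measurable ?X ?X")
  proof -
    have [measurable]: "map_prod g g \<in> borel_measurable borel"
      unfolding map_prod_def borel_prod[symmetric] using g by measurable
    note f [measurable]
    show ?thesis by measurable
  qed
  have e: "gw_proj f g \<omega> = (\<lambda>w. ?h (\<omega> w))" for \<omega>
    by (rule ext) (auto simp: gw_proj_def split: prod.splits)
  have "(\<lambda>\<omega> w. ?h (\<omega> w)) \<in> measurable gw_borel (\<Pi>\<^sub>M w\<in>UNIV. ?X)"
    by (rule measurable_PiM_single') (auto intro!: measurable_compose[OF measurable_gw_component m] simp: space_pair_measure)
  then show ?thesis unfolding e[abs_def] gw_borel_def .
qed

lemma marks_in_gw_proj:
  assumes "range f \<subseteq> A" "range g \<subseteq> B"
  shows "marks_in A B (gw_class (gw_proj f g \<omega>))"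
proof (rule marks_in_iso_class[OF rooted_connected_gw_tree])
  show "vmark (gw_tree (gw_proj f g \<omega>)) u \<in> A" for u
    using assms by (auto simp: gw_tree_simps(3))
  show "emark (gw_tree (gw_proj f g \<omega>)) u w \<in> B" for u w
    using assms by (auto simp: gw_tree_simps(4))
qed

text \<open>The coordinates that determine the tree up to depth \<open>h\<close>: offspring numbers and vertex marks
  at depth less than \<open>h\<close>, edge marks at depth at most \<open>h\<close>. The coin of a normal form is \<open>True\<close>, so that
  its edge marks are stored with the orientation away from the root.\<close>

definition gw_ball :: "nat \<Rightarrow> ('a, 'b) gw_sample \<Rightarrow> nat list set" where
  "gw_ball h \<omega> = {w \<in> verts (gw_tree \<omega>). length w \<le> h}"

text \<open>Whatever the neighbourhood of depth \<open>h\<close> does not determine is overwritten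
  by a default, so that equality of normal forms is equality of neighbourhoods. A normal form is
  again a sample, and offspring number 0 at depth \<open>h\<close> makes its tree end there.\<close>

definition gw_norm :: "nat \<Rightarrow> ('a, 'b) gw_sample \<Rightarrow> ('a, 'b) gw_sample" where
  "gw_norm h \<omega> = (\<lambda>w. if w \<in> gw_ball h \<omega> then
     (if length w < h then fst (\<omega> w) else 0, if length w < h then fst (snd (\<omega> w)) else undefined,
      if w \<noteq> [] then gw_pair \<omega> w else undefined, True) else undefined)"

definition gw_agree :: "nat \<Rightarrow> ('a, 'b) gw_sample \<Rightarrow> ('a, 'b) gw_sample \<Rightarrow> nat list \<Rightarrow> bool" where
  "gw_agree h s \<omega> w \<longleftrightarrow> (length w < h \<longrightarrow> fst (\<omega> w) = fst (s w) \<and> fst (snd (\<omega> w)) = fst (snd (s w))) \<and>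
     (w \<noteq> [] \<longrightarrow> gw_pair \<omega> w = gw_pair s w)"

lemma finite_gw_ball: "finite (gw_ball h \<omega>)"
  unfolding gw_ball_def by (rule finite_gw_tree_ball)

lemma gw_ball_eqI:
  assumes "\<And>w. w \<in> gw_ball h s \<Longrightarrow> length w < h \<Longrightarrow> fst (s w) = fst (\<omega> w)"
  shows "gw_ball h s = gw_ball h \<omega>"
proof -
  have "w \<in> verts (gw_tree s) \<longleftrightarrow> w \<in> verts (gw_tree \<omega>)" if "length w \<le> h" for w
    using that
  proof (induction w rule: rev_induct)
    case (snoc i w)
    then have IH: "w \<in> verts (gw_tree s) \<longleftrightarrow> w \<in> verts (gw_tree \<omega>)" and l: "length w < h" by auto
    have "fst (s w) = fst (\<omega> w)" if "w \<in> verts (gw_tree s)"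
      using that l by (intro assms) (auto simp: gw_ball_def)
    then show ?case using IH by auto
  qed simp
  then show ?thesis by (auto simp: gw_ball_def)
qed

lemma gw_norm_simps:
  assumes "w \<in> gw_ball h \<omega>"
  shows "length w < h \<Longrightarrow> fst (gw_norm h \<omega> w) = fst (\<omega> w)"
    and "length w < h \<Longrightarrow> fst (snd (gw_norm h \<omega> w)) = fst (snd (\<omega> w))"
    and "w \<noteq> [] \<Longrightarrow> gw_pair (gw_norm h \<omega>) w = gw_pair \<omega> w"
proof -
  show "length w < h \<Longrightarrow> fst (gw_norm h \<omega> w) = fst (\<omega> w)"
    and "length w < h \<Longrightarrow> fst (snd (gw_norm h \<omega> w)) = fst (snd (\<omega> w))"
    using assms by (auto simp: gw_norm_def)
  assume "w \<noteq> []"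
  then obtain N t where "gw_norm h \<omega> w = (N, t, gw_pair \<omega> w, True)"
    using assms by (auto simp: gw_norm_def)
  then show "gw_pair (gw_norm h \<omega>) w = gw_pair \<omega> w"
    by (cases "gw_pair \<omega> w") (simp add: gw_pair_def[of "gw_norm h \<omega>"])
qed

lemma gw_ball_norm: "gw_ball h (gw_norm h \<omega>) = gw_ball h \<omega>"
  by (rule gw_ball_eqI[symmetric]) (simp add: gw_norm_simps)

lemma gw_norm_eqI:
  assumes "\<And>w. w \<in> gw_ball h s \<Longrightarrow> gw_agree h s \<omega> w"
  shows "gw_norm h \<omega> = gw_norm h s"
proof -
  have b: "gw_ball h s = gw_ball h \<omega>"
    by (rule gw_ball_eqI) (use assms in \<open>auto simp: gw_agree_def\<close>)
  show ?thesis
  proof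
    fix w show "gw_norm h \<omega> w = gw_norm h s w"
      using assms[of w] unfolding gw_norm_def b[symmetric] gw_agree_def by auto
  qed
qed

text \<open>Turns the occurrence of a pattern into finitely many conditions on single coordinates,
  so that its probability is a product.\<close>

lemma gw_norm_eq_iff:
  assumes "gw_norm h s = s"
  shows "gw_norm h \<omega> = s \<longleftrightarrow> (\<forall>w\<in>gw_ball h s. gw_agree h s \<omega> w)"
proof
  assume n: "gw_norm h \<omega> = s"
  then have "gw_ball h s = gw_ball h \<omega>" using gw_ball_norm by metis
  then show "\<forall>w\<in>gw_ball h s. gw_agree h s \<omega> w"
    using gw_norm_simps[of _ h \<omega>] n by (auto simp: gw_agree_def)
next
  assume "\<forall>w\<in>gw_ball h s. gw_agree h s \<omega> w"
  then show "gw_norm h \<omega> = s" using gw_norm_eqI[of h s \<omega>] assms by simp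
qed

lemma gw_norm_norm: "gw_norm h (gw_norm h \<omega>) = gw_norm h \<omega>"
  by (rule gw_norm_eqI) (simp add: gw_agree_def gw_norm_simps)

section \<open>Probabilities of finite neighbourhoods\<close>

text \<open>Tagged partitions enter only through measurable maps \<open>f\<close> and
  \<open>g\<close> with values in finite sets.\<close>

locale projected_gw =
  fixes \<nu> :: "'a::polish_space measure" and chi :: "('b::polish_space \<times> 'b) measure" and d :: real
    and f :: "'a \<Rightarrow> 'a" and g :: "'b \<Rightarrow> 'b" and A :: "'a set" and B :: "'b set"
  assumes nu: "\<nu> \<in> prob_measures" and chi: "chi \<in> prob_measures" and d_pos: "0 < d"
    and f_meas [measurable]: "f \<in> borel_measurable borel" and g_meas [measurable]: "g \<in> borel_measurable borel"
    and fin_A: "finite A" and fin_B: "finite B" and range_f: "range f \<subseteq> A" and range_g: "range g \<subseteq> B"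
begin

definition vmark_prob :: "'a \<Rightarrow> real" where
  "vmark_prob t = measure \<nu> (f -` {t})"

definition emark_prob :: "'b \<times> 'b \<Rightarrow> real" where
  "emark_prob y = measure chi (map_prod g g -` {y})"

text \<open>The law of the oriented pair after the fair coin. Its symmetry makes the marked mean
  degrees of the tree symmetric.\<close>

definition sym_emark_prob :: "'b \<times> 'b \<Rightarrow> real" where
  "sym_emark_prob y = (emark_prob y + emark_prob (prod.swap y)) / 2"

abbreviation coord_measure :: "(nat \<times> 'a \<times> ('b \<times> 'b) \<times> bool) measure" where
  "coord_measure \<equiv> measure_pmf (poisson_pmf d) \<Otimes>\<^sub>M \<nu> \<Otimes>\<^sub>M chi \<Otimes>\<^sub>M measure_pmf (bernoulli_pmf (1/2))"

abbreviation gw_measure :: "('a, 'b) gw_sample measure" where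
  "gw_measure \<equiv> gw_space \<nu> chi d"

abbreviation proj :: "('a, 'b) gw_sample \<Rightarrow> ('a, 'b) gw_sample" where
  "proj \<equiv> gw_proj f g"

lemma prob_nu: "prob_space \<nu>" and sets_nu: "sets \<nu> = sets borel" and space_nu: "space \<nu> = UNIV"
  using nu sets_eq_imp_space_eq[of \<nu> borel] by (auto simp: space_prob_algebra)

lemma prob_chi: "prob_space chi" and sets_chi: "sets chi = sets borel" and space_chi: "space chi = UNIV"
  using chi sets_eq_imp_space_eq[of chi borel] by (auto simp: space_prob_algebra)

lemma prob_coord: "prob_space coord_measure"
  by (intro prob_space_pair measure_pmf.prob_space_axioms prob_nu prob_chi)

lemma gw_product_prob: "product_prob_space (\<lambda>_ :: nat list. coord_measure)"
  using prob_coord by (simp add: product_prob_space_def product_prob_space_axioms_def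
      product_sigma_finite_def prob_space_imp_sigma_finite)

lemma prob_gw_measure: "prob_space gw_measure"
proof -
  interpret product_prob_space "\<lambda>_ :: nat list. coord_measure" UNIV by (rule gw_product_prob)
  show ?thesis unfolding gw_space_def by (rule prob_space_axioms)
qed

lemma sets_gw_measure: "sets gw_measure = sets gw_borel"
  unfolding gw_space_def gw_borel_def
  by (intro sets_PiM_cong refl sets_pair_measure_cong sets_nu sets_chi) simp_all

lemma space_gw_measure [simp]: "space gw_measure = UNIV"
  using sets_eq_imp_space_eq[OF sets_gw_measure] by simp

lemma measurable_gw_measure_eq: "measurable gw_measure M = measurable gw_borel M"
  by (rule measurable_cong_sets[OF sets_gw_measure refl])

lemma map_prod_g_meas [measurable]: "map_prod g g \<in> borel_measurable borel"
  unfolding map_prod_def borel_prod[symmetric] by measurable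

lemma vmark_prob_nonneg: "0 \<le> vmark_prob t" by (simp add: vmark_prob_def)
lemma emark_prob_nonneg: "0 \<le> emark_prob y" by (simp add: emark_prob_def)
lemma sym_emark_prob_nonneg: "0 \<le> sym_emark_prob y"
  by (simp add: sym_emark_prob_def emark_prob_nonneg)
lemma sym_emark_prob_swap: "sym_emark_prob (prod.swap y) = sym_emark_prob y"
  by (simp add: sym_emark_prob_def)

lemma sum_vmark_prob: "(\<Sum>t\<in>A. vmark_prob t) = 1"
proof -
  interpret prob_space \<nu> by (rule prob_nu)
  have "(\<Sum>t\<in>A. vmark_prob t) = measure \<nu> (\<Union>t\<in>A. f -` {t})"
    unfolding vmark_prob_def
    by (rule finite_measure_finite_Union[symmetric])
      (auto simp: fin_A disjoint_family_on_def sets_nu intro!: measurable_sets_borel[OF f_meas])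
  also have "(\<Union>t\<in>A. f -` {t}) = space \<nu>" using range_f by (auto simp: space_nu)
  finally show ?thesis by (simp add: prob_space)
qed

lemma sum_emark_prob: "(\<Sum>y\<in>B \<times> B. emark_prob y) = 1"
proof -
  interpret prob_space chi by (rule prob_chi)
  have "(\<Sum>y\<in>B \<times> B. emark_prob y) = measure chi (\<Union>y\<in>B \<times> B. map_prod g g -` {y})"
    unfolding emark_prob_def
    by (rule finite_measure_finite_Union[symmetric])
      (auto simp: fin_B disjoint_family_on_def sets_chi intro!: measurable_sets_borel[OF map_prod_g_meas])
  also have "(\<Union>y\<in>B \<times> B. map_prod g g -` {y}) = space chi" using range_g by (auto simp: space_chi image_subset_iff)
  finally show ?thesis by (simp add: prob_space)
qed

lemma sum_sym_emark_prob: "(\<Sum>y\<in>B \<times> B. sym_emark_prob y) = 1"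
proof -
  have "(\<Sum>y\<in>B \<times> B. emark_prob (prod.swap y)) = (\<Sum>y\<in>B \<times> B. emark_prob y)"
    by (rule sum.reindex_bij_witness[of _ prod.swap prod.swap]) auto
  then show ?thesis
    by (simp add: sym_emark_prob_def sum.distrib sum_emark_prob flip: sum_divide_distrib)
qed

definition orient :: "nat \<times> 'a \<times> ('b \<times> 'b) \<times> bool \<Rightarrow> 'b \<times> 'b" where
  "orient z = (if snd (snd (snd z)) then fst (snd (snd z)) else prod.swap (fst (snd (snd z))))"

lemma gw_pair_orient: "gw_pair \<omega> w = orient (\<omega> w)"
  by (auto simp: gw_pair_def orient_def split: prod.splits)

text \<open>The flags switch the constraints on: \<open>a\<close> for words of depth less than
  \<open>h\<close>, where offspring number and vertex mark belong to the pattern, and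
  \<open>b\<close> for words other than the root, which have an edge to a parent.\<close>

definition coord_event :: "bool \<Rightarrow> bool \<Rightarrow> nat \<Rightarrow> 'a \<Rightarrow> 'b \<times> 'b \<Rightarrow> (nat \<times> 'a \<times> ('b \<times> 'b) \<times> bool) set" where
  "coord_event a b k t y = {z. (a \<longrightarrow> fst z = k \<and> f (fst (snd z)) = t) \<and> (b \<longrightarrow> map_prod g g (orient z) = y)}"

lemma coord_event:
  "coord_event a b k t y \<in> sets coord_measure"
  "emeasure coord_measure (coord_event a b k t y) =
    ennreal ((if a then pmf (poisson_pmf d) k * vmark_prob t else 1) * (if b then sym_emark_prob y else 1))"
proof -
  interpret nu: prob_space \<nu> by (rule prob_nu)
  interpret chi: prob_space chi by (rule prob_chi)
  let ?b = "measure_pmf (bernoulli_pmf (1/2))"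
  have p1: "prob_space (chi \<Otimes>\<^sub>M ?b)"
    by (intro prob_space_pair measure_pmf.prob_space_axioms prob_chi)
  have p2: "prob_space (\<nu> \<Otimes>\<^sub>M chi \<Otimes>\<^sub>M ?b)"
    by (intro prob_space_pair measure_pmf.prob_space_axioms prob_nu prob_chi)
  note times = sigma_finite_measure.emeasure_pair_measure_Times[OF prob_space_imp_sigma_finite]
  let ?SN = "if a then {k} else UNIV" and ?ST = "if a then f -` {t} else UNIV"
  let ?Z1 = "if b then map_prod g g -` {y} else UNIV" and ?Z2 = "if b then map_prod g g -` {prod.swap y} else UNIV"
  let ?Z = "?Z1 \<times> {True} \<union> ?Z2 \<times> {False}"
  \<comment> \<open>The coin splits the event into two rectangles; for \<open>False\<close> the
    unoriented pair must project to the swapped value.\<close>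
  have eq: "coord_event a b k t y = ?SN \<times> ?ST \<times> ?Z"
  proof (intro set_eqI)
    fix z :: "nat \<times> 'a \<times> ('b \<times> 'b) \<times> bool"
    obtain N u x1 x2 c where z: "z = (N, u, (x1, x2), c)" by (metis surj_pair)
    obtain y1 y2 where y: "y = (y1, y2)" by (cases y)
    show "z \<in> coord_event a b k t y \<longleftrightarrow> z \<in> ?SN \<times> ?ST \<times> ?Z"
      by (cases c; cases a; cases b) (auto simp: z y coord_event_def orient_def)
  qed
  have ST: "?ST \<in> sets \<nu>" by (auto simp: sets_nu intro!: measurable_sets_borel[OF f_meas])
  have Z1: "?Z1 \<in> sets chi" and Z2: "?Z2 \<in> sets chi"
    by (auto simp: sets_chi intro!: measurable_sets_borel[OF map_prod_g_meas])
  have Z: "?Z \<in> sets (chi \<Otimes>\<^sub>M ?b)" using Z1 Z2 by (intro sets.Un pair_measureI) auto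
  show "coord_event a b k t y \<in> sets coord_measure"
    unfolding eq using ST Z by (intro pair_measureI) auto
  have e1: "emeasure chi (if b then map_prod g g -` {y'} else UNIV) = ennreal (if b then emark_prob y' else 1)" for y'
    using chi.emeasure_space_1 by (simp add: chi.emeasure_eq_measure emark_prob_def space_chi)
  have half: "emeasure ?b {c} = ennreal (1/2)" for c by (cases c) (auto simp: emeasure_pmf_single)
  have "emeasure (chi \<Otimes>\<^sub>M ?b) ?Z = emeasure (chi \<Otimes>\<^sub>M ?b) (?Z1 \<times> {True}) + emeasure (chi \<Otimes>\<^sub>M ?b) (?Z2 \<times> {False})"
    using Z1 Z2 by (intro plus_emeasure[symmetric] pair_measureI) auto
  also have "\<dots> = emeasure chi ?Z1 * emeasure ?b {True} + emeasure chi ?Z2 * emeasure ?b {False}"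
    using Z1 Z2 by (intro arg_cong2[of _ _ _ _ "(+)"] times measure_pmf.prob_space_axioms) auto
  also have "\<dots> = ennreal (if b then sym_emark_prob y else 1)"
  proof -
    have "ennreal x * ennreal (1/2) + ennreal z * ennreal (1/2) = ennreal ((x + z) / 2)" if "0 \<le> x" "0 \<le> z" for x z
    proof -
      have "ennreal (x * (1/2) + z * (1/2)) = ennreal (x * (1/2)) + ennreal (z * (1/2))"
        using that by (intro ennreal_plus) auto
      also have "\<dots> = ennreal x * ennreal (1/2) + ennreal z * ennreal (1/2)"
        by (simp only: ennreal_mult'[OF that(1)] ennreal_mult'[OF that(2)])
      finally show ?thesis by (simp add: field_simps)
    qed
    then have "emeasure chi ?Z1 * emeasure ?b {True} + emeasure chi ?Z2 * emeasure ?b {False} =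
        ennreal (((if b then emark_prob y else 1) + (if b then emark_prob (prod.swap y) else 1)) / 2)"
      unfolding e1 half by (auto simp: emark_prob_nonneg )
    then show ?thesis by (simp add: sym_emark_prob_def)
  qed
  finally have eZ: "emeasure (chi \<Otimes>\<^sub>M ?b) ?Z = ennreal (if b then sym_emark_prob y else 1)" .
  have "emeasure coord_measure (coord_event a b k t y) =
      emeasure (measure_pmf (poisson_pmf d)) ?SN * (emeasure \<nu> ?ST * emeasure (chi \<Otimes>\<^sub>M ?b) ?Z)"
    unfolding eq using ST Z
    by (subst times[OF p2]) (auto simp: times[OF p1] intro!: pair_measureI)
  also have "emeasure (measure_pmf (poisson_pmf d)) ?SN = ennreal (if a then pmf (poisson_pmf d) k else 1)"
    using measure_pmf.emeasure_space_1[of "poisson_pmf d"] by (auto simp: emeasure_pmf_single)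
  also have "emeasure \<nu> ?ST = ennreal (if a then vmark_prob t else 1)"
    using nu.emeasure_space_1 by (simp add: nu.emeasure_eq_measure vmark_prob_def space_nu)
  finally show "emeasure coord_measure (coord_event a b k t y) =
    ennreal ((if a then pmf (poisson_pmf d) k * vmark_prob t else 1) * (if b then sym_emark_prob y else 1))"
    unfolding eZ by (auto simp: vmark_prob_nonneg sym_emark_prob_nonneg mult_ac simp flip: ennreal_mult)
qed

lemma emeasure_cylinder:
  assumes "finite J" "\<And>w. w \<in> J \<Longrightarrow> X w \<in> sets coord_measure"
  shows "emeasure gw_measure {\<omega>. \<forall>w\<in>J. \<omega> w \<in> X w} = (\<Prod>w\<in>J. emeasure coord_measure (X w))"
proof -
  interpret product_prob_space "\<lambda>_ :: nat list. coord_measure" UNIV by (rule gw_product_prob)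
  have "{\<omega>. \<forall>w\<in>J. \<omega> w \<in> X w} = {\<omega> \<in> space gw_measure. \<forall>w\<in>J. \<omega> w \<in> X w}" by simp
  then show ?thesis unfolding gw_space_def
    using emeasure_PiM_Collect[of J X] assms by simp
qed

definition pattern_weight :: "nat \<Rightarrow> ('a, 'b) gw_sample \<Rightarrow> nat list \<Rightarrow> real" where
  "pattern_weight h s w =
    (if length w < h then pmf (poisson_pmf d) (fst (s w)) * vmark_prob (fst (snd (s w))) else 1) *
    (if w \<noteq> [] then sym_emark_prob (gw_pair s w) else 1)"

definition pattern_prob :: "nat \<Rightarrow> ('a, 'b) gw_sample \<Rightarrow> real" where
  "pattern_prob h s = (\<Prod>w\<in>gw_ball h s. pattern_weight h s w)"

definition pattern_event :: "nat \<Rightarrow> ('a, 'b) gw_sample \<Rightarrow> ('a, 'b) gw_sample set" where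
  "pattern_event h s = {\<omega>. gw_norm h (proj \<omega>) = s}"

lemma pattern_event:
  assumes s: "gw_norm h s = s"
  shows "pattern_event h s \<in> sets gw_measure" and "measure gw_measure (pattern_event h s) = pattern_prob h s"
proof -
  interpret prob_space gw_measure by (rule prob_gw_measure)
  let ?X = "\<lambda>w. coord_event (length w < h) (w \<noteq> []) (fst (s w)) (fst (snd (s w))) (gw_pair s w)"
  have eq: "pattern_event h s = {\<omega>. \<forall>w\<in>gw_ball h s. \<omega> w \<in> ?X w}"
    unfolding pattern_event_def gw_norm_eq_iff[OF s] gw_agree_def coord_event_def
    by (simp add: gw_pair_orient[symmetric])
  have "emeasure gw_measure (pattern_event h s) = (\<Prod>w\<in>gw_ball h s. emeasure coord_measure (?X w))"
    unfolding eq by (intro emeasure_cylinder finite_gw_ball coord_event(1))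
  also have "\<dots> = (\<Prod>w\<in>gw_ball h s. ennreal (pattern_weight h s w))"
    by (simp only: coord_event(2) pattern_weight_def)
  also have "\<dots> = ennreal (pattern_prob h s)"
    unfolding pattern_prob_def
    by (intro prod_ennreal) (auto simp: pattern_weight_def vmark_prob_nonneg sym_emark_prob_nonneg)
  finally have "emeasure gw_measure (pattern_event h s) = ennreal (pattern_prob h s)" .
  moreover have "0 \<le> pattern_prob h s"
    by (auto simp: pattern_prob_def pattern_weight_def vmark_prob_nonneg sym_emark_prob_nonneg intro!: prod_nonneg)
  ultimately show "measure gw_measure (pattern_event h s) = pattern_prob h s"
    by (simp add: emeasure_eq_measure)
  have "(\<lambda>\<omega>. \<omega> w) \<in> measurable gw_measure coord_measure" for w
    unfolding gw_space_def by (rule measurable_component_singleton) simp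
  then have "(\<lambda>\<omega>. \<omega> w) -` ?X w \<inter> space gw_measure \<in> sets gw_measure" for w
    using coord_event(1) by (rule measurable_sets)
  then have "{\<omega> \<in> space gw_measure. \<omega> w \<in> ?X w} \<in> sets gw_measure" for w
    by (simp add: vimage_def)
  then have "{\<omega> \<in> space gw_measure. \<forall>w\<in>gw_ball h s. \<omega> w \<in> ?X w} \<in> sets gw_measure"
    by (intro sets.sets_Collect_finite_All finite_gw_ball) auto
  then show "pattern_event h s \<in> sets gw_measure" by (simp add: eq)
qed

end

section \<open>Stability of mark constraints\<close>

text \<open>A forbidden mark sits at finite distance from the root, and as the allowed marks are
  closed it stays forbidden under small perturbations. The openness makes the exceptional set Borel
  in \<open>AE_rho_marks_in\<close>.\<close>

lemma open_not_marks_in: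
  fixes A :: "'a::metric_space set" and B :: "'b::metric_space set"
  assumes "closed A" "closed B"
  shows "open {g :: ('a, 'b) gstar. \<not> marks_in A B g}"
  unfolding open_dist
proof
  fix g :: "('a, 'b) gstar" assume g: "g \<in> {g. \<not> marks_in A B g}"
  obtain G a where X: "rep_gstar g = (G, a)" by (metis surj_pair)
  have rc: "rooted_connected (G, a)" using rooted_connected_rep_gstar[of g] by (simp add: X)
  have ball: "\<exists>r. v \<in> gball G a r" if "v \<in> verts G" for v
  proof -
    have "(a, v) \<in> (adj G)\<^sup>*" using rc that by (auto simp: rooted_connected_def)
    then show ?thesis using that by (auto simp: gball_def dest!: rtrancl_imp_relpow)
  qed
  \<comment> \<open>Treats a bad vertex mark and a bad edge mark at once: the first case is used
    with \<open>u = v\<close>, where the clause about the edge is vacuous in a simple graph.\<close>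
  have key: "\<exists>e>0. \<forall>h. dist h g < e \<longrightarrow> \<not> marks_in A B h"
    if u: "u \<in> verts G" and v: "v \<in> verts G" and "0 < e"
      and bad: "\<And>(H :: (nat, 'a, 'b) mgraph) (\<Psi> :: nat \<Rightarrow> nat). \<lbrakk>\<Psi> u \<in> verts H; dist (vmark G u) (vmark H (\<Psi> u)) < e;
        {u, v} \<in> edges G \<Longrightarrow> {\<Psi> u, \<Psi> v} \<in> edges H \<and> dist (emark G u v) (emark H (\<Psi> u) (\<Psi> v)) < e\<rbrakk> \<Longrightarrow>
        \<exists>w\<in>verts H. vmark H w \<notin> A \<or> (\<exists>w'. {w, w'} \<in> edges H \<and> emark H w w' \<notin> B)" for u v :: nat and e :: real
  proof -
    obtain r where r: "u \<in> gball G a r" "v \<in> gball G a r"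
    proof -
      obtain r1 r2 where "u \<in> gball G a r1" "v \<in> gball G a r2" using ball u v by blast
      then show thesis using gball_mono[of r1 "max r1 r2" G a] gball_mono[of r2 "max r1 r2" G a]
        by (intro that[of "max r1 r2"]) auto
    qed
    have "\<not> marks_in A B h" if hg: "dist h g < min e (1 / (1 + real r))" for h
    proof -
      obtain s \<delta> where n: "0 < \<delta>" "near s \<delta> (rep_gstar g) (rep_gstar h)"
          "1 / (1 + real s) + \<delta> < min e (1 / (1 + real r))"
        by (rule dist_gstar_lessD[OF hg[unfolded dist_commute[of h]]])
      obtain H b where Y: "rep_gstar h = (H, b)" by (metis surj_pair)
      have "0 \<le> 1 / (1 + real s)" by simp
      then have de: "\<delta> < e" and "1 / (1 + real s) < 1 / (1 + real r)" using n by linarith+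
      then have "r \<le> s" by (simp add: divide_simps split: if_splits)
      then have us: "u \<in> gball G a s" "v \<in> gball G a s" using r gball_mono[of r s G a] by auto
      obtain \<Psi> where \<Psi>: "marked_iso (\<lambda>x y. dist x y < \<delta>) (\<lambda>x y. dist x y < \<delta>) \<Psi>
          (root_nbhd s (G, a)) (root_nbhd s (H, b))"
        using n(2) unfolding near_def X Y by blast
      have "\<Psi> u \<in> gball H b s"
        using \<Psi> us by (auto simp: marked_iso_def root_nbhd_def graph_iso_def bij_betw_def)
      then have "\<Psi> u \<in> verts H" using gball_subset[of H b s] by auto
      moreover have "dist (vmark G u) (vmark H (\<Psi> u)) < \<delta>"
        using \<Psi> us by (auto simp: marked_iso_def root_nbhd_def)
      moreover have "{\<Psi> u, \<Psi> v} \<in> edges H \<and> dist (emark G u v) (emark H (\<Psi> u) (\<Psi> v)) < \<delta>" if "{u, v} \<in> edges G"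
        using \<Psi> us that by (auto simp: marked_iso_def root_nbhd_def graph_iso_def)
      ultimately have "\<exists>w\<in>verts H. vmark H w \<notin> A \<or> (\<exists>w'. {w, w'} \<in> edges H \<and> emark H w w' \<notin> B)"
        using de by (intro bad[of \<Psi> H]) (auto intro: less_trans)
      then show ?thesis by (auto simp: marks_in.rep_eq Y)
    qed
    then show ?thesis using \<open>0 < e\<close> by (intro exI[of _ "min e (1 / (1 + real r))"]) auto
  qed
  consider v where "v \<in> verts G" "vmark G v \<notin> A" | u v where "{u, v} \<in> edges G" "emark G u v \<notin> B"
    using g by (auto simp: marks_in.rep_eq X)
  then show "\<exists>e>0. \<forall>h. dist h g < e \<longrightarrow> h \<in> {g. \<not> marks_in A B g}"
  proof cases
    case 1
    obtain e where e: "0 < e" "\<And>y. dist y (vmark G v) < e \<Longrightarrow> y \<notin> A"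
      using \<open>closed A\<close> 1(2) unfolding closed_def open_dist by auto
    have "y \<notin> A" if "dist (vmark G v) y < e" for y using e(2)[of y] that by (simp add: dist_commute)
    then show ?thesis unfolding mem_Collect_eq by (intro key[OF 1(1) 1(1) e(1)]) blast
  next
    case 2
    obtain e where e: "0 < e" "\<And>y. dist y (emark G u v) < e \<Longrightarrow> y \<notin> B"
      using \<open>closed B\<close> 2(2) unfolding closed_def open_dist by auto
    have "u \<in> verts G" "v \<in> verts G" using edge_verts[of G u v] rc 2(1) by (auto simp: rooted_connected_def)
    moreover have "\<exists>w\<in>verts H. vmark H w \<notin> A \<or> (\<exists>w'. {w, w'} \<in> edges H \<and> emark H w w' \<notin> B)"
      if "\<Psi> u \<in> verts H" "{u, v} \<in> edges G \<Longrightarrow> {\<Psi> u, \<Psi> v} \<in> edges H \<and> dist (emark G u v) (emark H (\<Psi> u) (\<Psi> v)) < e"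
      for H :: "(nat, 'a, 'b) mgraph" and \<Psi> :: "nat \<Rightarrow> nat"
      using that(1) that(2)[OF 2(1)] e(2)[of "emark H (\<Psi> u) (\<Psi> v)"] by (auto simp: dist_commute)
    ultimately show ?thesis unfolding mem_Collect_eq by (intro key[of u v e] e(1)) blast+
  qed
qed

context projected_gw begin

section \<open>Root statistics of the projected tree\<close>

definition rho :: "('a, 'b) gstar measure" where
  "rho = distr gw_measure borel (\<lambda>\<omega>. gw_class (proj \<omega>))"

lemma gw_class_meas [measurable]: "gw_class \<in> borel_measurable gw_measure"
  unfolding measurable_gw_measure_eq by (rule measurable_gw_class)

lemma gw_class_proj_meas [measurable]: "(\<lambda>\<omega>. gw_class (proj \<omega>)) \<in> borel_measurable gw_measure"
  unfolding measurable_gw_measure_eq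
  by (rule measurable_compose[OF measurable_gw_proj[OF f_meas g_meas] measurable_gw_class])

lemma rho_prob: "rho \<in> prob_measures"
  unfolding rho_def using prob_space.prob_space_distr[OF prob_gw_measure gw_class_proj_meas]
  by (simp add: space_prob_algebra)

lemma ugw_prob: "ugw \<nu> chi d \<in> prob_measures"
  unfolding ugw_def using prob_space.prob_space_distr[OF prob_gw_measure gw_class_meas]
  by (simp add: space_prob_algebra)

lemma AE_rho_marks_in: "AE x in rho. marks_in A B x"
proof (rule AE_I')
  have s: "{x :: ('a, 'b) gstar. \<not> marks_in A B x} \<in> sets borel"
    using fin_A fin_B by (intro borel_open open_not_marks_in finite_imp_closed)
  have "(\<lambda>\<omega>. gw_class (proj \<omega>)) -` {x. \<not> marks_in A B x} = {}"
    using marks_in_gw_proj[OF range_f range_g] by auto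
  then have "emeasure rho {x. \<not> marks_in A B x} = 0"
    unfolding rho_def using s by (simp add: emeasure_distr)
  then show "{x. \<not> marks_in A B x} \<in> null_sets rho" using s by (simp add: null_sets_def rho_def)
  show "{x \<in> space rho. \<not> marks_in A B x} \<subseteq> {x. \<not> marks_in A B x}" by auto
qed

lemma root_mark_gw_class: "root_mark (gw_class \<omega>) = fst (snd (\<omega> []))"
  by (simp add: root_statistics_iso_class(1)[OF rooted_connected_gw_tree] gw_tree_simps)

lemma root_degree_gw_class: "root_degree (gw_class \<omega>) = fst (\<omega> [])"
  by (simp add: root_statistics_iso_class(2)[OF rooted_connected_gw_tree] gw_tree_nbrs card_image inj_on_def)

text \<open>The pair appears reversed because \<open>gw_pair\<close> lists the mark pointing away
  from the root first, whereas the marked degree starts with the mark pointing to the root.\<close>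

lemma root_degree_marked_gw_class:
  "root_degree_marked x x' (gw_class \<omega>) = card {i. i < fst (\<omega> []) \<and> gw_pair \<omega> [i] = (x', x)}"
proof -
  have "{u. {[], u} \<in> edges (gw_tree \<omega>) \<and> emark (gw_tree \<omega>) u [] = x \<and> emark (gw_tree \<omega>) [] u = x'} =
      {u \<in> {u. {[], u} \<in> edges (gw_tree \<omega>)}. emark (gw_tree \<omega>) u [] = x \<and> emark (gw_tree \<omega>) [] u = x'}"
    by simp
  also have "\<dots> = (\<lambda>i. [i]) ` {i. i < fst (\<omega> []) \<and> gw_pair \<omega> [i] = (x', x)}"
    by (subst gw_tree_nbrs) (auto simp: gw_tree_simps(4) prod_eq_iff)
  finally show ?thesis
    by (simp add: root_statistics_iso_class(3)[OF rooted_connected_gw_tree] card_image inj_on_def)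
qed

lemma root_law_rho: "root_law rho t = vmark_prob t"
proof -
  interpret prob_space gw_measure by (rule prob_gw_measure)
  have [measurable]: "(\<lambda>\<omega>. f (fst (snd (\<omega> [])))) \<in> borel_measurable gw_measure"
    unfolding measurable_gw_measure_eq by (rule measurable_compose[OF measurable_gw_coordinates(2) f_meas])
  have "root_law rho t = measure gw_measure {\<omega>. f (fst (snd (\<omega> []))) = t}"
    unfolding root_law_def rho_def
    by (simp add: distr_distr measure_distr comp_def vimage_def root_mark_gw_class)
  also have "{\<omega>. f (fst (snd (\<omega> []))) = t} = {\<omega> :: ('a, 'b) gw_sample. \<forall>w\<in>{[]}. \<omega> w \<in> {z. f (fst (snd z)) = t}}"
    by simp
  also have "measure gw_measure \<dots> = vmark_prob t"
  proof -
    \<comment> \<open>\<open>coord_event\<close> fixes offspring number and vertex mark together, so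
      a condition on the mark alone is a disjoint union over offspring numbers.\<close>
    have m: "{z. f (fst (snd z)) = t} \<in> sets coord_measure"
    proof -
      have "{z. f (fst (snd z)) = t} = (\<Union>k. coord_event True False k t undefined)"
        by (auto simp: coord_event_def)
      then show ?thesis using coord_event(1) by auto
    qed
    have "emeasure coord_measure {z. f (fst (snd z)) = t} = ennreal (vmark_prob t)"
    proof -
      have e: "{z. f (fst (snd z)) = t} = (\<Union>k. coord_event True False k t undefined)"
        by (auto simp: coord_event_def)
      have "emeasure coord_measure (\<Union>k. coord_event True False k t undefined) =
          (\<Sum>k. emeasure coord_measure (coord_event True False k t undefined))"
      proof (rule suminf_emeasure[symmetric])
        show "range (\<lambda>k. coord_event True False k t undefined) \<subseteq> sets coord_measure"
          using coord_event(1) by blast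
        show "disjoint_family (\<lambda>k. coord_event True False k t undefined)"
          by (auto simp: disjoint_family_on_def coord_event_def)
      qed
      also have "\<dots> = (\<Sum>k. ennreal (pmf (poisson_pmf d) k * vmark_prob t))"
        by (simp add: coord_event(2))
      also have "\<dots> = ennreal (vmark_prob t)"
      proof (rule suminf_ennreal_eq)
        have "(\<lambda>k. d ^ k /\<^sub>R fact k * (exp (- d) * vmark_prob t)) sums (exp d * (exp (- d) * vmark_prob t))"
          by (intro sums_mult2 exp_converges)
        also have "exp d * (exp (- d) * vmark_prob t) = vmark_prob t" by (simp add: exp_minus)
        also have "(\<lambda>k. d ^ k /\<^sub>R fact k * (exp (- d) * vmark_prob t)) = (\<lambda>k. pmf (poisson_pmf d) k * vmark_prob t)"
          using d_pos by (intro ext) (simp add: divide_inverse mult_ac)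
        finally show "(\<lambda>k. pmf (poisson_pmf d) k * vmark_prob t) sums vmark_prob t" .
      qed (simp add: vmark_prob_nonneg)
      finally show ?thesis by (simp add: e)
    qed
    then show ?thesis using emeasure_cylinder[of "{[]}" "\<lambda>_. {z. f (fst (snd z)) = t}"] m
      by (simp add: emeasure_eq_measure vmark_prob_nonneg)
  qed
  finally show ?thesis .
qed

text \<open>Tail sums give the mean degree child by child: child \<open>i\<close> exists when the
  root has more than \<open>i\<close> children, and this event is independent of the edge pair
  stored at \<open>[i]\<close>. The marked mean degree therefore factorizes term by term.\<close>

definition tail_prob :: "nat \<Rightarrow> ennreal" where
  "tail_prob i = emeasure coord_measure {z. i < fst z}"

lemma tail_event: "{z. i < fst z} \<in> sets coord_measure"
proof -
  have "{z \<in> space coord_measure. i < fst z} \<in> sets coord_measure"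
    by (intro measurable_sets_Collect[OF measurable_fst]) auto
  moreover have "space coord_measure = UNIV" by (simp add: space_pair_measure space_nu space_chi)
  ultimately show ?thesis by simp
qed

lemma sum_tail_prob: "(\<Sum>i. tail_prob i) = ennreal d"
proof -
  let ?M = "\<nu> \<Otimes>\<^sub>M chi \<Otimes>\<^sub>M measure_pmf (bernoulli_pmf (1/2))"
  have p: "prob_space ?M" by (intro prob_space_pair measure_pmf.prob_space_axioms prob_nu prob_chi)
  have fst_m: "fst \<in> measurable coord_measure (count_space UNIV)"
    using measurable_fst[of "measure_pmf (poisson_pmf d)" ?M] by simp
  have "(\<Sum>i. tail_prob i) = (\<integral>\<^sup>+ z. of_nat (fst z) \<partial>coord_measure)"
    unfolding tail_prob_def using nn_integral_nat_function[OF fst_m]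
    by (simp add: space_pair_measure space_nu space_chi)
  also have "\<dots> = (\<integral>\<^sup>+ k. \<integral>\<^sup>+ y. of_nat (fst (k, y)) \<partial>?M \<partial>measure_pmf (poisson_pmf d))"
    by (rule sigma_finite_measure.nn_integral_fst[symmetric, OF prob_space_imp_sigma_finite[OF p]])
      (rule measurable_compose[OF fst_m], simp)
  also have "\<dots> = (\<integral>\<^sup>+ k. of_nat k \<partial>measure_pmf (poisson_pmf d))"
    using prob_space.emeasure_space_1[OF p] by simp
  also have "\<dots> = (\<Sum>k. ennreal (pmf (poisson_pmf d) k) * of_nat k)"
    by (simp add: nn_integral_measure_pmf nn_integral_count_space_nat)
  also have "\<dots> = (\<Sum>k. ennreal (pmf (poisson_pmf d) k * real k))"
    by (simp add: ennreal_mult'' ennreal_of_nat_eq_real_of_nat)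
  also have "\<dots> = ennreal d"
  proof (rule suminf_ennreal_eq)
    have "(\<lambda>k. d ^ k /\<^sub>R fact k * (exp (- d) * d)) sums (exp d * (exp (- d) * d))"
      by (intro sums_mult2 exp_converges)
    also have "exp d * (exp (- d) * d) = d" by (simp add: exp_minus)
    also have "(\<lambda>k. d ^ k /\<^sub>R fact k * (exp (- d) * d)) = (\<lambda>k. pmf (poisson_pmf d) (Suc k) * real (Suc k))"
    proof
      fix k :: nat
      have "(fact (Suc k) :: real) = real (Suc k) * fact k" by (simp del: of_nat_Suc)
      then show "d ^ k /\<^sub>R fact k * (exp (- d) * d) = pmf (poisson_pmf d) (Suc k) * real (Suc k)"
        using d_pos by (simp add: field_simps del: of_nat_Suc fact_Suc)
    qed
    finally show "(\<lambda>k. pmf (poisson_pmf d) k * real k) sums d"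
      by (subst (asm) sums_Suc_iff) simp
  qed simp
  finally show ?thesis .
qed

lemma mean_degree_rho: "mean_degree rho = ennreal d"
proof -
  have m: "(\<lambda>\<omega>. fst (\<omega> [])) \<in> measurable gw_measure (count_space UNIV)"
    unfolding measurable_gw_measure_eq by (rule measurable_gw_coordinates)
  have "mean_degree rho = (\<integral>\<^sup>+ \<omega>. of_nat (fst (\<omega> [])) \<partial>gw_measure)"
    unfolding mean_degree_def rho_def by (simp add: nn_integral_distr root_degree_gw_class)
  also have "\<dots> = (\<Sum>i. emeasure gw_measure {\<omega>. i < fst (\<omega> [])})"
    using nn_integral_nat_function[OF m] by simp
  also have "\<dots> = (\<Sum>i. tail_prob i)"
    using emeasure_cylinder[of "{[]}" "\<lambda>_. {z. i < fst z}" for i] tail_event by (simp add: tail_prob_def)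
  finally show ?thesis by (simp add: sum_tail_prob)
qed

lemma mean_degree_marked_rho: "mean_degree_marked rho x x' = ennreal (d * sym_emark_prob (x, x'))"
proof -
  let ?E = "\<lambda>i. {\<omega> :: ('a, 'b) gw_sample. i < fst (\<omega> []) \<and> map_prod g g (gw_pair \<omega> [i]) = (x', x)}"
  let ?X = "\<lambda>i w. if w = [] then {z. i < fst z} else coord_event False True 0 undefined (x', x)"
  have X: "?X i w \<in> sets coord_measure" for i w using tail_event coord_event(1) by auto
  have eq: "?E i = {\<omega>. \<forall>w\<in>{[], [i]}. \<omega> w \<in> ?X i w}" for i
    by (auto simp: coord_event_def gw_pair_orient)
  have e: "emeasure gw_measure (?E i) = tail_prob i * ennreal (sym_emark_prob (x, x'))" for i
    unfolding eq using emeasure_cylinder[of "{[], [i]}" "?X i", OF _ X] sym_emark_prob_swap[of "(x, x')"]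
    by (simp add: tail_prob_def coord_event(2))
  have sE: "?E i \<in> sets gw_measure" for i
  proof -
    have c: "(\<lambda>\<omega>. \<omega> w) \<in> measurable gw_measure coord_measure" for w
      unfolding gw_space_def by (rule measurable_component_singleton) simp
    have eq2: "?E i = ((\<lambda>\<omega>. \<omega> []) -` {z. i < fst z} \<inter> space gw_measure) \<inter>
        ((\<lambda>\<omega>. \<omega> [i]) -` coord_event False True 0 undefined (x', x) \<inter> space gw_measure)"
      by (auto simp: coord_event_def gw_pair_orient)
    show ?thesis unfolding eq2 by (intro sets.Int measurable_sets[OF c tail_event] measurable_sets[OF c coord_event(1)])
  qed
  have "mean_degree_marked rho x x' = (\<integral>\<^sup>+ \<omega>. of_nat (root_degree_marked x x' (gw_class (proj \<omega>))) \<partial>gw_measure)"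
    unfolding mean_degree_marked_def rho_def by (simp add: nn_integral_distr)
  also have "\<dots> = (\<integral>\<^sup>+ \<omega>. (\<Sum>i. indicator (?E i) \<omega>) \<partial>gw_measure)"
  proof (rule nn_integral_cong)
    fix \<omega> :: "('a, 'b) gw_sample"
    let ?P = "\<lambda>i. map_prod g g (gw_pair \<omega> [i]) = (x', x)"
    have "(\<Sum>i. indicator (?E i) \<omega> :: ennreal) = (\<Sum>i<fst (\<omega> []). indicator (?E i) \<omega>)"
      by (rule suminf_finite) auto
    also have "\<dots> = of_nat (card {i. i < fst (\<omega> []) \<and> ?P i})"
      by (simp add: indicator_def sum.If_cases Int_def)
    finally show "of_nat (root_degree_marked x x' (gw_class (proj \<omega>))) = (\<Sum>i. indicator (?E i) \<omega> :: ennreal)"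
      by (simp add: root_degree_marked_gw_class)
  qed
  also have "\<dots> = (\<Sum>i. emeasure gw_measure (?E i))"
    using sE by (subst nn_integral_suminf) auto
  also have "\<dots> = ennreal d * ennreal (sym_emark_prob (x, x'))"
    unfolding e by (simp add: ennreal_suminf_multc sum_tail_prob)
  finally show ?thesis using d_pos sym_emark_prob_nonneg by (simp add: ennreal_mult)
qed

end

section \<open>Bounded offspring and finite families of patterns\<close>

lemma sets_gw_verts:
  "{\<omega> :: ('a::topological_space, 'b::topological_space) gw_sample. w \<in> verts (gw_tree \<omega>)} \<in> sets gw_borel"
proof -
  have "{\<omega> \<in> space (gw_borel :: ('a, 'b) gw_sample measure). \<forall>i\<in>{..<length w}. w ! i < fst (\<omega> (take i w))} \<in> sets gw_borel"
  proof (intro sets.sets_Collect_finite_All)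
    fix i
    have "{\<omega> \<in> space (gw_borel :: ('a, 'b) gw_sample measure). fst (\<omega> (take i w)) \<in> {n. w ! i < n}} \<in> sets gw_borel"
      by (rule measurable_sets_Collect[OF measurable_gw_coordinates(1)]) simp
    then show "{\<omega> \<in> space (gw_borel :: ('a, 'b) gw_sample measure). w ! i < fst (\<omega> (take i w))} \<in> sets gw_borel" by simp
  qed simp
  moreover have "{\<omega> :: ('a, 'b) gw_sample. w \<in> verts (gw_tree \<omega>)} = {\<omega> \<in> space (gw_borel :: ('a, 'b) gw_sample measure). \<forall>i\<in>{..<length w}. w ! i < fst (\<omega> (take i w))}"
    by (auto simp: gw_tree_simps)
  ultimately show ?thesis by simp
qed

text \<open>The truncation that leaves only finitely many words and patterns; its probability tends
  to 1 as \<open>L\<close> grows, because each sample has finitely many vertices up to depth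
  \<open>h\<close>.\<close>

definition small_offspring :: "nat \<Rightarrow> nat \<Rightarrow> ('a, 'b) gw_sample set" where
  "small_offspring h L = {\<omega>. \<forall>w. w \<in> gw_ball h \<omega> \<and> length w < h \<longrightarrow> fst (\<omega> w) \<le> L}"

lemma sets_small_offspring:
  "(small_offspring h L :: ('a::topological_space, 'b::topological_space) gw_sample set) \<in> sets gw_borel"
proof -
  have "{\<omega> \<in> space (gw_borel :: ('a, 'b) gw_sample measure). \<forall>w. w \<in> gw_ball h \<omega> \<and> length w < h \<longrightarrow> fst (\<omega> w) \<le> L} \<in> sets gw_borel"
  proof (intro sets.sets_Collect_countable_All sets.sets_Collect_imp sets.sets_Collect_conj)
    fix w
    have "{\<omega> \<in> space (gw_borel :: ('a, 'b) gw_sample measure). w \<in> gw_ball h \<omega>} = (if length w \<le> h then {\<omega>. w \<in> verts (gw_tree \<omega>)} else {})"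
      by (auto simp: gw_ball_def)
    then show "{\<omega> \<in> space (gw_borel :: ('a, 'b) gw_sample measure). w \<in> gw_ball h \<omega>} \<in> sets gw_borel"
      using sets_gw_verts by auto
    have "{\<omega> \<in> space (gw_borel :: ('a, 'b) gw_sample measure). fst (\<omega> w) \<in> {n. n \<le> L}} \<in> sets gw_borel"
      by (rule measurable_sets_Collect[OF measurable_gw_coordinates(1)]) simp
    then show "{\<omega> \<in> space (gw_borel :: ('a, 'b) gw_sample measure). fst (\<omega> w) \<le> L} \<in> sets gw_borel" by simp
  qed (use sets.top[of "gw_borel :: ('a, 'b) gw_sample measure"] in simp)
  then show ?thesis by (simp add: small_offspring_def)
qed

lemma incseq_small_offspring: "incseq (small_offspring h)"
  by (auto simp: incseq_def small_offspring_def intro: order_trans)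

lemma UN_small_offspring: "(\<Union>L. small_offspring h L) = UNIV"
proof (intro equalityI subset_UNIV subsetI)
  fix \<omega> :: "('a, 'b) gw_sample"
  have "\<omega> \<in> small_offspring h (Max (insert 0 ((\<lambda>w. fst (\<omega> w)) ` gw_ball h \<omega>)))"
    unfolding small_offspring_def using finite_gw_ball[of h \<omega>] by (auto intro!: Max_ge)
  then show "\<omega> \<in> (\<Union>L. small_offspring h L)" by blast
qed

lemma gw_ball_small_offspring:
  assumes "\<omega> \<in> small_offspring h L" "w \<in> gw_ball h \<omega>"
  shows "set w \<subseteq> {..<L} \<and> length w \<le> h"
proof -
  have "w ! i < L" if "i < length w" for i
  proof -
    have "take i w \<in> gw_ball h \<omega>" "length (take i w) < h" "w ! i < fst (\<omega> (take i w))"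
      using assms(2) that by (auto simp: gw_ball_def gw_tree_simps min_def)
    then show ?thesis using assms(1) by (auto simp: small_offspring_def intro: less_le_trans)
  qed
  then show ?thesis using assms(2) by (auto simp: gw_ball_def in_set_conv_nth)
qed

context projected_gw begin

text \<open>Taken as an image of samples, so that normality and admissible marks are inherited and
  the pattern events cover \<open>small_offspring h L\<close>.\<close>

definition patterns :: "nat \<Rightarrow> nat \<Rightarrow> ('a, 'b) gw_sample set" where
  "patterns h L = (\<lambda>\<omega>. gw_norm h (proj \<omega>)) ` small_offspring h L"

lemma gw_ball_proj [simp]: "gw_ball h (proj \<omega>) = gw_ball h \<omega>"
  by (simp add: gw_ball_def)

lemma finite_patterns: "finite (patterns h L)"
proof (rule finite_subset)
  let ?W = "{w. set w \<subseteq> {..<L} \<and> length w \<le> h}"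
  let ?F = "{..L} \<times> insert undefined A \<times> insert undefined (B \<times> B) \<times> {True} \<union> {undefined}"
  show "finite {s. \<forall>w. (w \<in> ?W \<longrightarrow> s w \<in> ?F) \<and> (w \<notin> ?W \<longrightarrow> s w = undefined)}"
    using fin_A fin_B by (intro finite_set_of_finite_funs finite_lists_length_le) auto
  show "patterns h L \<subseteq> {s. \<forall>w. (w \<in> ?W \<longrightarrow> s w \<in> ?F) \<and> (w \<notin> ?W \<longrightarrow> s w = undefined)}"
  proof
    fix s assume "s \<in> patterns h L"
    then obtain \<omega> where w: "\<omega> \<in> small_offspring h L" "s = gw_norm h (proj \<omega>)" by (auto simp: patterns_def)
    have "(w \<in> ?W \<longrightarrow> s w \<in> ?F) \<and> (w \<notin> ?W \<longrightarrow> s w = undefined)" for w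
    proof (cases "w \<in> gw_ball h \<omega>")
      case True
      have "length w < h \<longrightarrow> fst (\<omega> w) \<le> L" using w(1) True by (auto simp: small_offspring_def)
      moreover have "f t \<in> A" "map_prod g g y \<in> B \<times> B" for t y
        using range_f range_g by (auto simp: image_subset_iff mem_Times_iff)
      ultimately show ?thesis using gw_ball_small_offspring[OF w(1) True] True w(2)
        by (simp add: gw_norm_def del: map_prod_imageI)
    next
      case False
      then show ?thesis using w(2) by (simp add: gw_norm_def)
    qed
    then show "s \<in> {s. \<forall>w. (w \<in> ?W \<longrightarrow> s w \<in> ?F) \<and> (w \<notin> ?W \<longrightarrow> s w = undefined)}" by blast
  qed
qed

lemma patterns_normal: "s \<in> patterns h L \<Longrightarrow> gw_norm h s = s"
  by (auto simp: patterns_def gw_norm_norm)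

lemma patterns_marks:
  assumes "s \<in> patterns h L" "w \<in> gw_ball h s"
  shows "length w < h \<Longrightarrow> fst (snd (s w)) \<in> A" and "w \<noteq> [] \<Longrightarrow> gw_pair s w \<in> B \<times> B"
proof -
  obtain \<omega> where s: "s = gw_norm h (proj \<omega>)" using assms(1) by (auto simp: patterns_def)
  have w: "w \<in> gw_ball h (proj \<omega>)" using assms(2) by (simp add: s gw_ball_norm)
  have "f t \<in> A" "map_prod g g y \<in> B \<times> B" for t y
    using range_f range_g by (auto simp: image_subset_iff mem_Times_iff)
  then show "length w < h \<Longrightarrow> fst (snd (s w)) \<in> A" and "w \<noteq> [] \<Longrightarrow> gw_pair s w \<in> B \<times> B"
    unfolding s by (simp_all add: gw_norm_simps[OF w])
qed

text \<open>The truncation events increase to the whole space, and the patterns for a given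
  \<open>L\<close> have disjoint events covering the truncation. This is the finite family on which
  lower bounds are imposed.\<close>

lemma patterns_mass:
  assumes "0 < \<eta>"
  shows "\<exists>L. 1 - \<eta> < (\<Sum>s\<in>patterns h L. pattern_prob h s)"
proof -
  interpret prob_space gw_measure by (rule prob_gw_measure)
  have "(\<lambda>L. measure gw_measure (small_offspring h L)) \<longlonglongrightarrow> measure gw_measure (\<Union>L. small_offspring h L)"
    using sets_small_offspring incseq_small_offspring
    by (intro finite_Lim_measure_incseq) (auto simp: sets_gw_measure)
  also have "measure gw_measure (\<Union>L. small_offspring h L) = 1"
    unfolding UN_small_offspring using prob_space by simp
  finally have "\<forall>\<^sub>F L in sequentially. 1 - \<eta> < measure gw_measure (small_offspring h L)"
    using assms by (intro order_tendstoD) auto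
  then obtain L where "1 - \<eta> < measure gw_measure (small_offspring h L)"
    by (auto simp: eventually_sequentially)
  also have "\<dots> \<le> measure gw_measure (\<Union>s\<in>patterns h L. pattern_event h s)"
  proof (rule finite_measure_mono)
    show "small_offspring h L \<subseteq> (\<Union>s\<in>patterns h L. pattern_event h s)"
      by (auto simp: patterns_def pattern_event_def)
    show "(\<Union>s\<in>patterns h L. pattern_event h s) \<in> events"
      using finite_patterns patterns_normal pattern_event(1) by (intro sets.finite_UN) auto
  qed
  also have "\<dots> = (\<Sum>s\<in>patterns h L. measure gw_measure (pattern_event h s))"
    using finite_patterns patterns_normal pattern_event(1)
    by (intro finite_measure_finite_Union) (auto simp: disjoint_family_on_def pattern_event_def)
  also have "\<dots> = (\<Sum>s\<in>patterns h L. pattern_prob h s)"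
    using patterns_normal pattern_event(2) by (intro sum.cong) auto
  finally show ?thesis by blast
qed

end

section \<open>Configurations\<close>

text \<open>A marked graph on \<open>{1..n}\<close> is a choice of values at the slots \<open>(i, j)\<close> with \<open>i \<le> j\<close>: a vertex mark at
  \<open>(i, i)\<close>, and at \<open>(i, j)\<close> with \<open>i < j\<close> either no edge or the marks of \<open>(i, j)\<close> and \<open>(j, i)\<close>.\<close>

type_synonym ('a, 'b) config = "nat \<times> nat \<Rightarrow> 'a + ('b \<times> 'b) option"

definition slots :: "nat \<Rightarrow> (nat \<times> nat) set" where
  "slots n = {(i, j). 1 \<le> i \<and> i \<le> j \<and> j \<le> n}"

definition slot_vals :: "'a set \<Rightarrow> 'b set \<Rightarrow> nat \<times> nat \<Rightarrow> ('a + ('b \<times> 'b) option) set" where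
  "slot_vals A B p = (if fst p = snd p then Inl ` A else Inr ` (insert None (Some ` (B \<times> B))))"

fun edge_val :: "'a + 'c option \<Rightarrow> 'c option" where
  "edge_val (Inr z) = z" | "edge_val (Inl _) = None"

text \<open>Reads the slot of \<open>i\<close> and \<open>j\<close> from either end: the first
  component is always the mark of the oriented edge from \<open>i\<close> to \<open>j\<close>. The
  diagonal counts as empty, since it holds vertex marks.\<close>

definition slot :: "('a, 'b) config \<Rightarrow> nat \<Rightarrow> nat \<Rightarrow> ('b \<times> 'b) option" where
  "slot c i j = (if i < j then edge_val (c (i, j))
     else if j < i then map_option prod.swap (edge_val (c (j, i))) else None)"

lemma slot_sym: "slot c j i = map_option prod.swap (slot c i j)"
  by (auto simp: slot_def option.map_comp comp_def option.map_ident)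

lemma slot_self [simp]: "slot c i i = None" by (simp add: slot_def)

lemma slot_None_sym: "slot c j i = None \<longleftrightarrow> slot c i j = None"
  by (simp add: slot_sym[of c j i])

lemma finite_slots: "finite (slots n)"
  by (rule finite_subset[of _ "{..n} \<times> {..n}"]) (auto simp: slots_def)

lemma finite_slot_vals: "finite A \<Longrightarrow> finite B \<Longrightarrow> finite (slot_vals A B p)"
  by (simp add: slot_vals_def)

definition inner_words :: "nat \<Rightarrow> ('a, 'b) gw_sample \<Rightarrow> nat list set" where
  "inner_words h s = {w \<in> gw_ball h s. length w < h}"

text \<open>Nothing is required of the vertices at depth \<open>h\<close>, among which there may be edges, so an embedded
  tree is the neighbourhood of its root only up to distance \<open>h - 1\<close>. Placements list children in
  increasing order, so that a root determines its embedding.\<close>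

definition embeds :: "nat \<Rightarrow> nat \<Rightarrow> ('a, 'b) gw_sample \<Rightarrow> (nat list \<Rightarrow> nat) \<Rightarrow> ('a, 'b) config \<Rightarrow> bool" where
  "embeds n h s \<phi> c \<longleftrightarrow> (\<forall>w\<in>inner_words h s. c (\<phi> w, \<phi> w) = Inl (fst (snd (s w))) \<and>
     (\<forall>i<fst (s w). slot c (\<phi> w) (\<phi> (w @ [i])) = Some (gw_pair s (w @ [i]))) \<and>
     (\<forall>j\<in>{1..n}. j \<notin> (\<lambda>i. \<phi> (w @ [i])) ` {..<fst (s w)} \<longrightarrow> (w \<noteq> [] \<longrightarrow> j \<noteq> \<phi> (butlast w)) \<longrightarrow>
        slot c (\<phi> w) j = None))"

definition placements :: "nat \<Rightarrow> nat \<Rightarrow> ('a, 'b) gw_sample \<Rightarrow> (nat list \<Rightarrow> nat) set" where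
  "placements n h s = {\<phi> \<in> gw_ball h s \<rightarrow>\<^sub>E {1..n}. inj_on \<phi> (gw_ball h s) \<and>
     (\<forall>w\<in>inner_words h s. \<forall>i j. i < j \<longrightarrow> j < fst (s w) \<longrightarrow> \<phi> (w @ [i]) < \<phi> (w @ [j]))}"

definition pattern_roots :: "nat \<Rightarrow> nat \<Rightarrow> ('a, 'b) gw_sample \<Rightarrow> ('a, 'b) config \<Rightarrow> nat set" where
  "pattern_roots n h s c = (\<lambda>\<phi>. \<phi> []) ` {\<phi> \<in> placements n h s. embeds n h s \<phi> c}"

lemma Nil_in_gw_ball [simp]: "[] \<in> gw_ball h s"
  by (simp add: gw_ball_def)

lemma inner_child: "w \<in> inner_words h s \<Longrightarrow> i < fst (s w) \<Longrightarrow> w @ [i] \<in> gw_ball h s"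
  by (auto simp: inner_words_def gw_ball_def)

lemma gw_ball_snoc: "w @ [i] \<in> gw_ball h s \<longleftrightarrow> w \<in> inner_words h s \<and> i < fst (s w)"
  by (auto simp: inner_words_def gw_ball_def)

lemma gw_ball_butlast: "w \<in> gw_ball h s \<Longrightarrow> w \<noteq> [] \<Longrightarrow> butlast w \<in> inner_words h s \<and> last w < fst (s (butlast w))"
  using gw_ball_snoc[of "butlast w" "last w" h s] by simp

lemma inner_subset: "inner_words h s \<subseteq> gw_ball h s" by (auto simp: inner_words_def)

lemma embeds_parent:
  assumes "embeds n h s \<phi> c" "w \<in> gw_ball h s" "w \<noteq> []"
  shows "slot c (\<phi> (butlast w)) (\<phi> w) = Some (gw_pair s w)"
proof -
  have "butlast w \<in> inner_words h s" "last w < fst (s (butlast w))" "w = butlast w @ [last w]"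
    using gw_ball_butlast[OF assms(2,3)] assms(3) by auto
  then show ?thesis using assms(1) unfolding embeds_def by metis
qed

lemma finite_placements: "finite (placements n h s)"
  unfolding placements_def by (intro finite_subset[OF Collect_subset] finite_PiE finite_gw_ball) auto

lemma embeds_nbrs:
  assumes e: "embeds n h s \<phi> c" and p: "\<phi> \<in> placements n h s" and w: "w \<in> inner_words h s"
  shows "{j\<in>{1..n}. slot c (\<phi> w) j \<noteq> None} =
    (\<lambda>i. \<phi> (w @ [i])) ` {..<fst (s w)} \<union> (if w = [] then {} else {\<phi> (butlast w)})"
proof
  show "{j\<in>{1..n}. slot c (\<phi> w) j \<noteq> None} \<subseteq>
      (\<lambda>i. \<phi> (w @ [i])) ` {..<fst (s w)} \<union> (if w = [] then {} else {\<phi> (butlast w)})"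
    using e w unfolding embeds_def by fastforce
  have r: "\<phi> u \<in> {1..n}" if "u \<in> gw_ball h s" for u
    using p that by (auto simp: placements_def)
  have "w \<noteq> [] \<Longrightarrow> slot c (\<phi> w) (\<phi> (butlast w)) \<noteq> None \<and> \<phi> (butlast w) \<in> {1..n}"
    using embeds_parent[OF e, of w] w inner_subset[of h s] gw_ball_butlast[of w h s] r
    by (subst slot_None_sym) auto
  then show "(\<lambda>i. \<phi> (w @ [i])) ` {..<fst (s w)} \<union> (if w = [] then {} else {\<phi> (butlast w)}) \<subseteq>
      {j\<in>{1..n}. slot c (\<phi> w) j \<noteq> None}"
    using e w r inner_child[OF w] unfolding embeds_def by auto
qed

text \<open>The children of a placed word are its neighbours other than the parent, in increasing
  order. Hence they are determined by the configuration and the positions of the word and its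
  parent.\<close>

lemma embeds_children:
  assumes e: "embeds n h s \<phi> c" and p: "\<phi> \<in> placements n h s" and w: "w \<in> inner_words h s"
  shows "map (\<lambda>i. \<phi> (w @ [i])) [0..<fst (s w)] =
    sorted_list_of_set ({j\<in>{1..n}. slot c (\<phi> w) j \<noteq> None} - (if w = [] then {} else {\<phi> (butlast w)}))"
    (is "?l = sorted_list_of_set ?S")
proof (rule strict_sorted_equal)
  show "sorted_wrt (<) ?l"
    using p w by (auto simp: sorted_wrt_iff_nth_less placements_def)
  show "sorted_wrt (<) (sorted_list_of_set ?S)" by (rule strict_sorted_list_of_set)
  have inj: "inj_on \<phi> (gw_ball h s)" using p by (simp add: placements_def)
  have "\<phi> (butlast w) \<notin> (\<lambda>i. \<phi> (w @ [i])) ` {..<fst (s w)}" if "w \<noteq> []"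
  proof
    assume "\<phi> (butlast w) \<in> (\<lambda>i. \<phi> (w @ [i])) ` {..<fst (s w)}"
    then obtain i where i: "i < fst (s w)" "\<phi> (butlast w) = \<phi> (w @ [i])" by auto
    have "butlast w \<in> gw_ball h s" using gw_ball_butlast[of w h s] w that inner_subset[of h s] by auto
    then have "butlast w = w @ [i]" using inj_onD[OF inj i(2)] inner_child[OF w i(1)] by simp
    then have "length (butlast w) = Suc (length w)" by simp
    then show False by simp
  qed
  then have "?S = (\<lambda>i. \<phi> (w @ [i])) ` {..<fst (s w)}"
    unfolding embeds_nbrs[OF assms] by auto
  then show "set ?l = set (sorted_list_of_set ?S)" by (auto simp: lessThan_atLeast0)
qed

text \<open>Explore the tree from the root: once a word and its parent are placed,
  \<open>embeds_children\<close> fixes the number and the positions of its children, and the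
  configuration dictates the marks. So the root vertex determines both pattern and placement.
  Consequently different patterns have disjoint sets of roots, and counting roots is counting
  embeddings.\<close>

lemma embeds_unique:
  fixes s s' :: "('a, 'b) gw_sample"
  assumes e: "embeds n h s \<phi> c" and p: "\<phi> \<in> placements n h s" and n: "gw_norm h s = s"
    and e': "embeds n h s' \<phi>' c" and p': "\<phi>' \<in> placements n h s'" and n': "gw_norm h s' = s'"
    and root: "\<phi> [] = \<phi>' []"
  shows "s = s' \<and> \<phi> = \<phi>'"
proof -
  let ?St = "\<lambda>w. (w \<in> gw_ball h s \<longleftrightarrow> w \<in> gw_ball h s') \<and> (w \<in> gw_ball h s \<longrightarrow> \<phi> w = \<phi>' w)"
  have ch: "fst (s w) = fst (s' w) \<and> (\<forall>i<fst (s w). \<phi> (w @ [i]) = \<phi>' (w @ [i]))"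
    if w: "w \<in> inner_words h s" "w \<in> inner_words h s'" "\<phi> w = \<phi>' w" "w \<noteq> [] \<longrightarrow> \<phi> (butlast w) = \<phi>' (butlast w)" for w
  proof -
    have eq: "map (\<lambda>i. \<phi> (w @ [i])) [0..<fst (s w)] = map (\<lambda>i. \<phi>' (w @ [i])) [0..<fst (s' w)]"
      unfolding embeds_children[OF e p w(1)] embeds_children[OF e' p' w(2)] using w(3,4) by simp
    then have N: "fst (s w) = fst (s' w)" using map_eq_imp_length_eq by fastforce
    then show ?thesis using eq by auto
  qed
  \<comment> \<open>The parent is carried along, since the children of \<open>w\<close> are found by
    removing the parent from its neighbours.\<close>
  have St: "?St w \<and> ?St (butlast w)" for w
  proof (induction w rule: rev_induct)
    case Nil then show ?case using root by simp
  next
    case (snoc i w)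
    have int: "w \<in> inner_words h s \<longleftrightarrow> w \<in> inner_words h s'" using snoc by (auto simp: inner_words_def)
    have "fst (s w) = fst (s' w) \<and> (\<forall>i<fst (s w). \<phi> (w @ [i]) = \<phi>' (w @ [i]))" if "w \<in> inner_words h s"
    proof (rule ch)
      have "w \<in> gw_ball h s" using that inner_subset by blast
      then show "\<phi> w = \<phi>' w" "w \<noteq> [] \<longrightarrow> \<phi> (butlast w) = \<phi>' (butlast w)"
        using snoc gw_ball_butlast[of w h s] inner_subset[of h s] by blast+
    qed (use that int in auto)
    then show ?case using snoc int by (auto simp: gw_ball_snoc)
  qed
  then have ball: "gw_ball h s = gw_ball h s'" by blast
  have \<phi>: "\<phi> = \<phi>'"
  proof
    fix w show "\<phi> w = \<phi>' w"
    proof (cases "w \<in> gw_ball h s")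
      case True then show ?thesis using St by blast
    next
      case False
      then show ?thesis using p p' ball by (auto simp: placements_def PiE_def extensional_def)
    qed
  qed
  have "gw_norm h s' = gw_norm h s"
  proof (rule gw_norm_eqI)
    fix w assume w: "w \<in> gw_ball h s"
    then have w': "w \<in> gw_ball h s'" using ball by simp
    have "fst (s' w) = fst (s w) \<and> fst (snd (s' w)) = fst (snd (s w))" if "length w < h"
    proof -
      have i: "w \<in> inner_words h s" "w \<in> inner_words h s'" using w w' that by (auto simp: inner_words_def)
      have "Inl (fst (snd (s' w))) = (Inl (fst (snd (s w))) :: 'a + ('b \<times> 'b) option)"
        using e e' i unfolding embeds_def \<phi> by metis
      then show ?thesis using ch[OF i] \<phi> by simp
    qed
    moreover have "gw_pair s' w = gw_pair s w" if "w \<noteq> []"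
      using embeds_parent[OF e w that] embeds_parent[OF e' w' that] \<phi> by simp
    ultimately show "gw_agree h s s' w" by (simp add: gw_agree_def)
  qed
  then show ?thesis using n n' \<phi> by simp
qed

section \<open>Graphs of configurations\<close>

text \<open>The default \<open>undefined\<close> follows the convention of
  \<open>graphs_with_counts\<close>; with it \<open>graph_of\<close> and \<open>config_of\<close>
  invert each other on the configurations and graphs with given counts.\<close>

definition graph_of :: "nat \<Rightarrow> ('a, 'b) config \<Rightarrow> (nat, 'a, 'b) mgraph" where
  "graph_of n c = \<lparr>verts = {1..n}, edges = {{i, j} | i j. i \<in> {1..n} \<and> j \<in> {1..n} \<and> slot c i j \<noteq> None},
     vmark = (\<lambda>i. if i \<in> {1..n} then (case c (i, i) of Inl t \<Rightarrow> t | Inr _ \<Rightarrow> undefined) else undefined),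
     emark = (\<lambda>i j. if i \<in> {1..n} \<and> j \<in> {1..n} \<and> slot c i j \<noteq> None then fst (the (slot c i j)) else undefined)\<rparr>"

lemma graph_of_edge: "{i, j} \<in> edges (graph_of n c) \<longleftrightarrow> i \<in> {1..n} \<and> j \<in> {1..n} \<and> slot c i j \<noteq> None"
proof
  assume "{i, j} \<in> edges (graph_of n c)"
  then obtain a b where ab: "{i, j} = {a, b}" "a \<in> {1..n}" "b \<in> {1..n}" "slot c a b \<noteq> None"
    by (auto simp: graph_of_def)
  then consider "i = a" "j = b" | "i = b" "j = a" by (auto simp: doubleton_eq_iff)
  then show "i \<in> {1..n} \<and> j \<in> {1..n} \<and> slot c i j \<noteq> None"
    using ab by cases (auto simp: slot_None_sym[of c b a])
qed (auto simp: graph_of_def)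

lemma simple_graph_of: "simple_graph (graph_of n c)"
proof -
  have "card {i, j} = 2" if "slot c i j \<noteq> None" for i j
    using that by (cases "i = j") auto
  then show ?thesis by (auto simp: simple_graph_def graph_of_def)
qed

lemma locally_finite_graph_of: "locally_finite (graph_of n c)"
  unfolding locally_finite_def graph_of_edge by auto

text \<open>One level is lost: the neighbours in the graph are known exactly only for words of depth
  at most \<open>r\<close>, which is what \<open>near_gcovering\<close> asks for. On that ball the
  marks agree exactly, so any positive \<open>\<delta>\<close> will do.\<close>

lemma near_graph_of:
  fixes \<omega> :: "('a::metric_space, 'b::metric_space) gw_sample"
  assumes s: "gw_norm (Suc r) \<omega> = s" and e: "embeds n (Suc r) s \<phi> c" and p: "\<phi> \<in> placements n (Suc r) s"
    and "0 < \<delta>"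
  shows "near r \<delta> (gw_tree \<omega>, []) (component (graph_of n c) (\<phi> []), \<phi> [])"
proof -
  have ball: "gw_ball (Suc r) s = gw_ball (Suc r) \<omega>" using gw_ball_norm[of "Suc r" \<omega>] s by simp
  have r: "\<phi> u \<in> {1..n}" if "u \<in> gw_ball (Suc r) \<omega>" for u
    using p that by (auto simp: placements_def ball)
  have root: "\<phi> [] \<in> verts (graph_of n c)" using r[of "[]"] by (simp add: graph_of_def)
  have "near r \<delta> (gw_tree \<omega>, []) (graph_of n c, \<phi> [])"
  proof (rule near_gcovering[of _ _ _ _ \<phi>])
    show "inj_on \<phi> (gball (gw_tree \<omega>) [] (Suc r))"
      using p by (simp add: placements_def ball gball_gw_tree flip: gw_ball_def)
    fix w assume "w \<in> gball (gw_tree \<omega>) [] r"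
    then have w: "w \<in> verts (gw_tree \<omega>)" "length w \<le> r" by (auto simp: gball_gw_tree)
    then have wb: "w \<in> gw_ball (Suc r) \<omega>" and wi: "w \<in> inner_words (Suc r) s"
      using ball by (auto simp: gw_ball_def inner_words_def)
    have sw: "fst (s w) = fst (\<omega> w)" "fst (snd (s w)) = fst (snd (\<omega> w))"
      using gw_norm_simps[OF wb] w(2) s by auto
    have "{j. {\<phi> w, j} \<in> edges (graph_of n c)} = {j\<in>{1..n}. slot c (\<phi> w) j \<noteq> None}"
      using r[OF wb] by (auto simp: graph_of_edge)
    also have "\<dots> = \<phi> ` {w'. {w, w'} \<in> edges (gw_tree \<omega>)}"
      unfolding embeds_nbrs[OF e p wi] gw_tree_nbrs[OF w(1)] by (auto simp: sw)
    finally show "{j. {\<phi> w, j} \<in> edges (graph_of n c)} = \<phi> ` {w'. {w, w'} \<in> edges (gw_tree \<omega>)}" .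
    have "c (\<phi> w, \<phi> w) = Inl (fst (snd (s w)))" using e wi unfolding embeds_def by blast
    then have "vmark (graph_of n c) (\<phi> w) = vmark (gw_tree \<omega>) w"
      using r[OF wb] by (simp add: graph_of_def gw_tree_simps sw)
    then show "dist (vmark (gw_tree \<omega>) w) (vmark (graph_of n c) (\<phi> w)) < \<delta>" using \<open>0 < \<delta>\<close> by simp
    fix w' assume "w' \<in> gball (gw_tree \<omega>) [] r" and edge: "{w, w'} \<in> edges (gw_tree \<omega>)"
    then have w': "w' \<in> verts (gw_tree \<omega>)" "length w' \<le> r" by (auto simp: gball_gw_tree)
    then have wb': "w' \<in> gw_ball (Suc r) \<omega>" by (auto simp: gw_ball_def)
    have "w' \<in> {w'. {w, w'} \<in> edges (gw_tree \<omega>)}" using edge by simp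
    then consider i where "w' = w @ [i]" | "w = w' @ [last w]" 
      unfolding gw_tree_nbrs[OF w(1)] by (auto split: if_splits)
    then have "emark (graph_of n c) (\<phi> w) (\<phi> w') = emark (gw_tree \<omega>) w w'"
    proof cases
      case 1
      have "slot c (\<phi> w) (\<phi> w') = Some (gw_pair \<omega> w')"
        using embeds_parent[OF e, of w'] gw_norm_simps(3)[OF wb'] wb' s 1 by (simp add: ball)
      then show ?thesis using 1 r[OF wb] r[OF wb'] by (simp add: graph_of_def gw_tree_simps(4))
    next
      case 2
      have ne: "w \<noteq> []" using 2 by auto
      have b: "butlast w = w'" using 2 by (metis butlast_snoc)
      have "slot c (\<phi> w') (\<phi> w) = Some (gw_pair \<omega> w)"
        using embeds_parent[OF e, of w] gw_norm_simps(3)[OF wb] wb s ne b by (simp add: ball)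
      then have sl: "slot c (\<phi> w) (\<phi> w') = Some (prod.swap (gw_pair \<omega> w))"
        by (subst slot_sym) simp
      have "\<not> length w < length w'" using ne b[symmetric] by simp
      then show ?thesis using sl r[OF wb] r[OF wb'] by (simp add: graph_of_def gw_tree_simps(4))
    qed
    then show "dist (emark (gw_tree \<omega>) w w') (emark (graph_of n c) (\<phi> w) (\<phi> w')) < \<delta>" using \<open>0 < \<delta>\<close> by simp
  qed (auto simp: simple_gw_tree simple_graph_of root)
  then show ?thesis
    unfolding near_def root_nbhd_component[OF simple_graph_of root] .
qed

text \<open>The conditions attached to an inner word read only slots having its own vertex as an
  end. A change of one slot thus matters only to embeddings that place an inner word at one of its
  two ends.\<close>

lemma embeds_fun_upd:
  assumes e: "embeds n h s \<phi> (fun_upd c (a, b) k)" and p: "\<phi> \<in> placements n h s"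
    and "\<And>w. w \<in> inner_words h s \<Longrightarrow> \<phi> w \<noteq> a \<and> \<phi> w \<noteq> b"
  shows "embeds n h s \<phi> (fun_upd c (a, b) l)"
proof -
  have "slot (fun_upd c (a, b) k) (\<phi> w) j = slot (fun_upd c (a, b) l) (\<phi> w) j"
    "fun_upd c (a, b) k (\<phi> w, \<phi> w) = fun_upd c (a, b) l (\<phi> w, \<phi> w)" if "w \<in> inner_words h s" for w j
    using assms(3)[OF that] by (auto simp: slot_def)
  then show ?thesis using e unfolding embeds_def by (simp del: fun_upd_apply)
qed

text \<open>\<open>Suc\<close> accounts for the parent.\<close>

definition max_degree_bound :: "nat \<Rightarrow> ('a, 'b) gw_sample \<Rightarrow> nat" where
  "max_degree_bound h s = Suc (Max (insert 0 ((\<lambda>w. fst (s w)) ` gw_ball h s)))"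

text \<open>Walk back from \<open>a\<close> to the root: each vertex on the way is the image of an
  inner word, so all its neighbours are prescribed by the pattern and there are boundedly many
  candidates for the parent. The bound holds although degrees in \<open>c\<close> may be arbitrarily
  large elsewhere.\<close>

lemma card_roots_through:
  assumes "w \<in> inner_words h s"
  shows "card ((\<lambda>\<phi>. \<phi> []) ` {\<phi> \<in> placements n h s. embeds n h s \<phi> c \<and> \<phi> w = a}) \<le> max_degree_bound h s ^ length w"
  using assms
proof (induction w arbitrary: a rule: rev_induct)
  case Nil
  have "(\<lambda>\<phi>. \<phi> []) ` {\<phi> \<in> placements n h s. embeds n h s \<phi> c \<and> \<phi> [] = a} \<subseteq> {a}" by auto
  then show ?case using card_mono[of "{a}"] by force
next
  case (snoc i w)
  let ?R = "\<lambda>w a. (\<lambda>\<phi>. \<phi> []) ` {\<phi> \<in> placements n h s. embeds n h s \<phi> c \<and> \<phi> w = a}"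
  let ?N = "{j\<in>{1..n}. slot c a j \<noteq> None}"
  let ?K = "max_degree_bound h s"
  have wi: "w @ [i] \<in> inner_words h s" by fact
  have w: "w \<in> inner_words h s" using wi gw_ball_snoc[of w i h s] inner_subset by blast
  have fin: "finite (?R u b)" for u b
    using finite_placements[of n h s] by (intro finite_imageI) (auto intro: finite_subset[rotated])
  show ?case
  \<comment> \<open>A single embedding through \<open>a\<close> bounds the degree of
    \<open>a\<close> in \<open>c\<close>, and that bound then serves for all of them; without any
    there is nothing to count.\<close>
  proof (cases "?R (w @ [i]) a = {}")
    case False
    then obtain \<phi> where \<phi>: "\<phi> \<in> placements n h s" "embeds n h s \<phi> c" "\<phi> (w @ [i]) = a" by auto
    have "card ?N \<le> card ((\<lambda>j. \<phi> ((w @ [i]) @ [j])) ` {..<fst (s (w @ [i]))}) + card {\<phi> w}"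
    proof -
      have "?N = (\<lambda>j. \<phi> ((w @ [i]) @ [j])) ` {..<fst (s (w @ [i]))} \<union> {\<phi> w}"
        using embeds_nbrs[OF \<phi>(2,1) wi] unfolding \<phi>(3) by simp
      then show ?thesis by (simp only: card_Un_le)
    qed
    also have "\<dots> \<le> Suc (fst (s (w @ [i])))"
      using card_image_le[of "{..<fst (s (w @ [i]))}" "\<lambda>j. \<phi> ((w @ [i]) @ [j])"] by simp
    also have "\<dots> \<le> ?K" unfolding max_degree_bound_def
      using wi inner_subset[of h s] finite_gw_ball[of h s] by (intro Suc_le_mono[THEN iffD2] Max_ge) auto
    finally have N: "card ?N \<le> ?K" .
    have "?R (w @ [i]) a \<subseteq> (\<Union>j\<in>?N. ?R w j)"
    proof clarify
      fix \<psi> assume \<psi>: "\<psi> \<in> placements n h s" "embeds n h s \<psi> c" "a = \<psi> (w @ [i])"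
      have "\<psi> w \<in> {j\<in>{1..n}. slot c (\<psi> (w @ [i])) j \<noteq> None}"
        unfolding embeds_nbrs[OF \<psi>(2,1) wi] by simp
      then show "\<psi> [] \<in> (\<Union>j\<in>{j\<in>{1..n}. slot c (\<psi> (w @ [i])) j \<noteq> None}. ?R w j)"
        using \<psi>(1,2) by blast
    qed
    then have "card (?R (w @ [i]) a) \<le> card (\<Union>j\<in>?N. ?R w j)"
      using fin by (intro card_mono) auto
    also have "\<dots> \<le> (\<Sum>j\<in>?N. card (?R w j))" by (rule card_UN_le) simp
    also have "\<dots> \<le> (\<Sum>j\<in>?N. ?K ^ length w)" using snoc.IH[OF w] by (rule sum_mono)
    also have "\<dots> \<le> ?K * ?K ^ length w" using N by simp
    finally show ?thesis by simp
  next
    case True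
    show ?thesis unfolding True by simp
  qed
qed

text \<open>The factor 2 stands for the two ends of the changed slot; the bound is independent of
  \<open>n\<close>.\<close>

definition lipschitz_const :: "nat \<Rightarrow> ('a, 'b) gw_sample \<Rightarrow> nat" where
  "lipschitz_const h s = 2 * (\<Sum>w\<in>inner_words h s. max_degree_bound h s ^ length w)"

lemma finite_inner: "finite (inner_words h s)"
  using finite_gw_ball finite_subset[OF inner_subset] by blast

lemma finite_pattern_roots: "finite (pattern_roots n h s c)"
  unfolding pattern_roots_def using finite_placements[of n h s] by simp

lemma card_pattern_roots_diff:
  "card (pattern_roots n h s (fun_upd c (a, b) k) - pattern_roots n h s (fun_upd c (a, b) l)) \<le> lipschitz_const h s"
proof -
  let ?c = "fun_upd c (a, b) k"
  let ?R = "\<lambda>w a. (\<lambda>\<phi>. \<phi> []) ` {\<phi> \<in> placements n h s. embeds n h s \<phi> ?c \<and> \<phi> w = a}"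
  have fin: "finite (?R u b)" for u b
    using finite_placements[of n h s] by (intro finite_imageI) (auto intro: finite_subset[rotated])
  have "pattern_roots n h s ?c - pattern_roots n h s (fun_upd c (a, b) l) \<subseteq> (\<Union>w\<in>inner_words h s. ?R w a \<union> ?R w b)"
  proof
    fix v assume v: "v \<in> pattern_roots n h s ?c - pattern_roots n h s (fun_upd c (a, b) l)"
    then obtain \<phi> where \<phi>: "\<phi> \<in> placements n h s" "embeds n h s \<phi> ?c" "v = \<phi> []"
      by (auto simp: pattern_roots_def)
    have "\<not> embeds n h s \<phi> (fun_upd c (a, b) l)" using v \<phi> by (auto simp: pattern_roots_def)
    then obtain w where "w \<in> inner_words h s" "\<phi> w = a \<or> \<phi> w = b"
      using embeds_fun_upd[OF \<phi>(2,1)] by blast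
    then show "v \<in> (\<Union>w\<in>inner_words h s. ?R w a \<union> ?R w b)" using \<phi> by blast
  qed
  then have "card (pattern_roots n h s ?c - pattern_roots n h s (fun_upd c (a, b) l)) \<le>
      card (\<Union>w\<in>inner_words h s. ?R w a \<union> ?R w b)"
    by (intro card_mono finite_UN_I finite_UnI fin finite_inner)
  also have "\<dots> \<le> (\<Sum>w\<in>inner_words h s. card (?R w a \<union> ?R w b))"
    by (rule card_UN_le[OF finite_inner])
  also have "\<dots> \<le> (\<Sum>w\<in>inner_words h s. 2 * max_degree_bound h s ^ length w)"
  proof (rule sum_mono)
    fix w assume w: "w \<in> inner_words h s"
    show "card (?R w a \<union> ?R w b) \<le> 2 * max_degree_bound h s ^ length w"
      using card_roots_through[OF w, of n ?c a] card_roots_through[OF w, of n ?c b]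
        card_Un_le[of "?R w a" "?R w b"] by linarith
  qed
  finally show ?thesis by (simp add: lipschitz_const_def sum_distrib_left)
qed

lemma pattern_roots_lipschitz:
  "\<bar>real (card (pattern_roots n h s (fun_upd c p k))) - real (card (pattern_roots n h s (fun_upd c p l)))\<bar>
    \<le> real (lipschitz_const h s)"
proof -
  obtain a b where p: "p = (a, b)" by (cases p)
  let ?V = "\<lambda>k. pattern_roots n h s (fun_upd c p k)"
  have le: "real (card (?V k)) \<le> real (card (?V l)) + real (lipschitz_const h s)" for k l
  proof -
    have "card (?V k) \<le> card (?V l \<union> (?V k - ?V l))"
      by (intro card_mono) (auto simp: finite_pattern_roots)
    also have "\<dots> \<le> card (?V l) + card (?V k - ?V l)" by (rule card_Un_le)
    also have "\<dots> \<le> card (?V l) + lipschitz_const h s"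
      unfolding p by (rule add_left_mono[OF card_pattern_roots_diff])
    finally have "card (?V k) \<le> card (?V l) + lipschitz_const h s" .
    then show ?thesis by (simp only: of_nat_add[symmetric] of_nat_le_iff)
  qed
  show ?thesis using le[of k l] le[of l k] by linarith
qed

section \<open>Graphs with given counts as configurations\<close>

definition config_of :: "nat \<Rightarrow> (nat, 'a, 'b) mgraph \<Rightarrow> ('a, 'b) config" where
  "config_of n G = (\<lambda>(i, j)\<in>slots n. if i = j then Inl (vmark G i)
     else Inr (if {i, j} \<in> edges G then Some (emark G i j, emark G j i) else None))"

definition config_counts :: "'a set \<Rightarrow> 'b set \<Rightarrow> nat \<Rightarrow> ('b \<Rightarrow> 'b \<Rightarrow> nat) \<Rightarrow> ('a \<Rightarrow> nat) \<Rightarrow> ('a, 'b) config set" where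
  "config_counts A B n m u = {c \<in> PiE (slots n) (slot_vals A B).
     (\<forall>t\<in>A. card {i\<in>{1..n}. c (i, i) = Inl t} = u t) \<and>
     (\<forall>x\<in>B. \<forall>x'\<in>B. card {p\<in>slots n. c p \<in> {Inr (Some (x, x')), Inr (Some (x', x))}} = m x x')}"

lemma finite_config_counts: "finite A \<Longrightarrow> finite B \<Longrightarrow> finite (config_counts A B n m u)"
  unfolding config_counts_def
  by (intro finite_subset[OF Collect_subset] finite_PiE finite_slots finite_slot_vals)

lemma edge_count_slots:
  assumes G: "simple_graph G" "verts G = {1..n}"
  shows "edge_count G x x' = card {(i, j)\<in>slots n. i < j \<and> {i, j} \<in> edges G \<and>
    (emark G i j, emark G j i) \<in> {(x, x'), (x', x)}}" (is "_ = card ?P")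
proof -
  let ?h = "\<lambda>(i, j). {i, j :: nat}"
  have inj: "inj_on ?h ?P"
    by (auto simp: inj_on_def doubleton_eq_iff)
  have "?h ` ?P = {e \<in> edges G. \<exists>u v. e = {u, v} \<and> emark G u v = x \<and> emark G v u = x'}"
  proof
    show "?h ` ?P \<subseteq> {e \<in> edges G. \<exists>u v. e = {u, v} \<and> emark G u v = x \<and> emark G v u = x'}"
    proof (rule image_subsetI)
      fix p assume "p \<in> ?P"
      then obtain i j where ij: "p = (i, j)" "{i, j} \<in> edges G"
        "(emark G i j, emark G j i) = (x, x') \<or> (emark G j i, emark G i j) = (x, x')" by auto
      then have "\<exists>u v. {i, j} = {u, v} \<and> emark G u v = x \<and> emark G v u = x'"
        by (metis insert_commute prod.inject)
      then show "?h p \<in> {e \<in> edges G. \<exists>u v. e = {u, v} \<and> emark G u v = x \<and> emark G v u = x'}"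
        using ij by auto
    qed
    show "{e \<in> edges G. \<exists>u v. e = {u, v} \<and> emark G u v = x \<and> emark G v u = x'} \<subseteq> ?h ` ?P"
    proof clarify
      fix u v assume e: "{u, v} \<in> edges G" "x = emark G u v" "x' = emark G v u"
      have v: "u \<in> {1..n}" "v \<in> {1..n}" using edge_verts[OF G(1) e(1)] G(2) by auto
      have "u \<noteq> v" using G(1) e(1) by (auto simp: simple_graph_def)
      then consider "u < v" | "v < u" by linarith
      then show "{u, v} \<in> ?h ` {(i, j)\<in>slots n. i < j \<and> {i, j} \<in> edges G \<and>
          (emark G i j, emark G j i) \<in> {(emark G u v, emark G v u), (emark G v u, emark G u v)}}"
      proof cases
        case 1
        then show ?thesis using e v by (intro image_eqI[of _ _ "(u, v)"]) (auto simp: slots_def)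
      next
        case 2
        then show ?thesis using e v by (intro image_eqI[of _ _ "(v, u)"]) (auto simp: slots_def insert_commute)
      qed
    qed
  qed
  then show ?thesis unfolding edge_count_def using card_image[OF inj] by simp
qed

lemma config_of_counts:
  assumes G: "G \<in> graphs_with_counts A B n m u"
  shows "config_of n G \<in> config_counts A B n m u"
proof -
  have s: "simple_graph G" "verts G = {1..n}" and v: "\<And>i. i \<in> {1..n} \<Longrightarrow> vmark G i \<in> A"
    and e: "\<And>i j. {i, j} \<in> edges G \<Longrightarrow> emark G i j \<in> B"
    and m: "\<And>x x'. x \<in> B \<Longrightarrow> x' \<in> B \<Longrightarrow> edge_count G x x' = m x x'"
    and u: "\<And>t. t \<in> A \<Longrightarrow> vertex_count G t = u t"
    using G by (auto simp: graphs_with_counts_def)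
  have "config_of n G \<in> PiE (slots n) (slot_vals A B)"
  proof (rule PiE_I)
    fix p assume p: "p \<in> slots n"
    obtain i j where ij: "p = (i, j)" by (cases p)
    have "i \<in> {1..n}" using p by (auto simp: ij slots_def)
    then show "config_of n G p \<in> slot_vals A B p"
      using p v[of i] e[of i j] e[of j i] by (auto simp: ij config_of_def slot_vals_def insert_commute)
  qed (simp add: config_of_def)
  moreover have "{i\<in>{1..n}. config_of n G (i, i) = Inl t} = {v \<in> verts G. vmark G v = t}" for t
    using s(2) by (auto simp: config_of_def slots_def)
  moreover have "{p\<in>slots n. config_of n G p \<in> {Inr (Some (x, x')), Inr (Some (x', x))}} =
      {(i, j)\<in>slots n. i < j \<and> {i, j} \<in> edges G \<and> (emark G i j, emark G j i) \<in> {(x, x'), (x', x)}}" for x x'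
    by (auto simp: config_of_def slots_def split: if_splits)
  ultimately show ?thesis
    using u m by (simp add: config_counts_def vertex_count_def edge_count_slots[OF s])
qed

lemma slot_config_of:
  assumes "simple_graph G" "verts G = {1..n}" "i \<in> {1..n}" "j \<in> {1..n}"
  shows "slot (config_of n G) i j = (if {i, j} \<in> edges G then Some (emark G i j, emark G j i) else None)"
proof -
  have "{i, i} \<notin> edges G" using assms(1) by (auto simp: simple_graph_def)
  then show ?thesis using assms(3,4)
    by (cases i j rule: linorder_cases) (auto simp: slot_def config_of_def slots_def insert_commute split: if_splits)
qed

lemma graph_of_emark:
  "emark (graph_of n c) i j = (if i \<in> {1..n} \<and> j \<in> {1..n} \<and> slot c i j \<noteq> None then fst (the (slot c i j)) else undefined)"
  by (simp add: graph_of_def)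

lemma graph_of_config_of:
  assumes G: "G \<in> graphs_with_counts A B n m u"
  shows "graph_of n (config_of n G) = G"
proof -
  have s: "simple_graph G" "verts G = {1..n}" and v: "\<And>i. i \<notin> {1..n} \<Longrightarrow> vmark G i = undefined"
    and e: "\<And>i j. {i, j} \<notin> edges G \<Longrightarrow> emark G i j = undefined"
    using G by (auto simp: graphs_with_counts_def)
  have "edges (graph_of n (config_of n G)) = edges G"
  proof -
    have "{i, j} \<in> edges (graph_of n (config_of n G)) \<longleftrightarrow> {i, j} \<in> edges G" for i j
      using slot_config_of[OF s, of i j] edge_verts[OF s(1), of i j] s(2) by (auto simp: graph_of_edge split: if_splits)
    moreover have "\<exists>i j. x = {i, j}" if "x \<in> edges G \<or> x \<in> edges (graph_of n (config_of n G))" for x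
    proof -
      have "card x = 2" using that s(1) simple_graph_of[of n "config_of n G"] by (auto simp: simple_graph_def)
      then show ?thesis by (metis card_2_iff)
    qed
    ultimately show ?thesis by blast
  qed
  moreover have "vmark (graph_of n (config_of n G)) = vmark G"
    using v by (auto simp: graph_of_def config_of_def slots_def fun_eq_iff)
  moreover have "emark (graph_of n (config_of n G)) i j = emark G i j" for i j
    using slot_config_of[OF s, of i j] e[of i j] edge_verts[OF s(1), of i j] s(2)
    by (auto simp: graph_of_def)
  moreover have "verts (graph_of n (config_of n G)) = verts G" using s(2) by (simp add: graph_of_def)
  ultimately show ?thesis by (intro mgraph.equality ext) simp_all
qed

lemma config_of_graph_of:
  assumes c: "c \<in> PiE (slots n) (slot_vals A B)"
  shows "config_of n (graph_of n c) = c"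
proof
  fix p
  show "config_of n (graph_of n c) p = c p"
  proof (cases "p \<in> slots n")
    case False
    then show ?thesis using c by (cases p) (auto simp: config_of_def PiE_def extensional_def)
  next
    case True
    obtain i j where ij: "p = (i, j)" by (cases p)
    have b: "i \<in> {1..n}" "j \<in> {1..n}" "i \<le> j" using True by (auto simp: ij slots_def)
    have v: "c (i, j) \<in> slot_vals A B (i, j)" using c True ij by auto
    show ?thesis
    proof (cases "i = j")
      case True
      then show ?thesis using v b \<open>p \<in> slots n\<close> by (auto simp: ij config_of_def graph_of_def slot_vals_def)
    next
      case False
      then obtain z where z: "c (i, j) = Inr z" using v by (auto simp: slot_vals_def)
      have sl: "slot c i j = z" "slot c j i = map_option prod.swap z"
        using False b(3) z by (auto simp: slot_def)
      have "config_of n (graph_of n c) p = Inr (if slot c i j \<noteq> None then Some (fst (the (slot c i j)), fst (the (slot c j i))) else None)"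
        using \<open>p \<in> slots n\<close> False b sl
        by (cases z) (simp_all add: ij config_of_def graph_of_edge graph_of_emark)
      also have "\<dots> = Inr z" unfolding sl by (cases z) auto
      finally show ?thesis by (simp add: ij z)
    qed
  qed
qed

lemma graph_of_counts:
  assumes c: "c \<in> config_counts A B n m u"
  shows "graph_of n c \<in> graphs_with_counts A B n m u"
proof -
  have cp: "c \<in> PiE (slots n) (slot_vals A B)" using c by (simp add: config_counts_def)
  let ?G = "graph_of n c"
  have s: "simple_graph ?G" "verts ?G = {1..n}" by (rule simple_graph_of, simp add: graph_of_def)
  have vm: "\<exists>t\<in>A. c (i, i) = Inl t" if "i \<in> {1..n}" for i
    using PiE_mem[OF cp, of "(i, i)"] that by (auto simp: slots_def slot_vals_def)
  have sl: "slot c i j \<in> insert None (Some ` (B \<times> B))" if "i \<in> {1..n}" "j \<in> {1..n}" for i j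
    using PiE_mem[OF cp, of "(i, j)"] PiE_mem[OF cp, of "(j, i)"] that
    by (cases i j rule: linorder_cases) (auto simp: slot_def slots_def slot_vals_def)
  have cfg: "config_of n ?G = c" by (rule config_of_graph_of[OF cp])
  have "vmark ?G i \<in> A" if "i \<in> {1..n}" for i
    using vm[OF that] that by (auto simp: graph_of_def)
  moreover have "vmark ?G i = undefined" if "i \<notin> {1..n}" for i
    using that by (simp add: graph_of_def del: atLeastAtMost_iff)
  moreover have "emark ?G i j \<in> B" if "{i, j} \<in> edges ?G" for i j
    using that sl[of i j] unfolding graph_of_edge by (auto simp: graph_of_def)
  moreover have "emark ?G i j = undefined" if "{i, j} \<notin> edges ?G" for i j
    using that unfolding graph_of_edge by (auto simp: graph_of_def)
  moreover have "vertex_count ?G t = u t" if "t \<in> A" for t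
  proof -
    have "{v \<in> verts ?G. vmark ?G v = t} = {i\<in>{1..n}. c (i, i) = Inl t}"
      using vm by (force simp: graph_of_def)
    then show ?thesis using c that by (simp add: vertex_count_def config_counts_def)
  qed
  moreover have "edge_count ?G x x' = m x x'" if "x \<in> B" "x' \<in> B" for x x'
  proof -
    have "{(i, j)\<in>slots n. i < j \<and> {i, j} \<in> edges ?G \<and> (emark ?G i j, emark ?G j i) \<in> {(x, x'), (x', x)}} =
        {p\<in>slots n. config_of n ?G p \<in> {Inr (Some (x, x')), Inr (Some (x', x))}}"
      by (auto simp: config_of_def slots_def split: if_splits)
    then show ?thesis using c that unfolding cfg by (simp add: edge_count_slots[OF s] config_counts_def)
  qed
  ultimately show ?thesis using s unfolding graphs_with_counts_def by blast
qed

section \<open>Counting placements\<close>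

text \<open>Each word other than the root is a child exactly once. Through this the powers of
  \<open>d\<close> in the Poisson weights are moved onto the edges.\<close>

lemma sum_offspring_inner: "(\<Sum>w\<in>inner_words h s. fst (s w)) = card (gw_ball h s) - 1"
proof -
  have eq: "gw_ball h s - {[]} = (\<Union>w\<in>inner_words h s. (\<lambda>i. w @ [i]) ` {..<fst (s w)})"
  proof (intro equalityI subsetI)
    fix w assume "w \<in> gw_ball h s - {[]}"
    then have "w = butlast w @ [last w]" "butlast w \<in> inner_words h s" "last w < fst (s (butlast w))"
      using gw_ball_butlast[of w h s] by auto
    then show "w \<in> (\<Union>w\<in>inner_words h s. (\<lambda>i. w @ [i]) ` {..<fst (s w)})" by blast
  qed (auto intro: inner_child)
  have "finite (inner_words h s)" using finite_gw_ball finite_subset[OF inner_subset] by blast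
  then have "card (gw_ball h s - {[]}) = (\<Sum>w\<in>inner_words h s. card ((\<lambda>i. w @ [i]) ` {..<fst (s w)}))"
    unfolding eq by (intro card_UN_disjoint) auto
  also have "\<dots> = (\<Sum>w\<in>inner_words h s. fst (s w))"
    by (intro sum.cong) (auto simp: card_image inj_on_def)
  finally show ?thesis by (simp add: finite_gw_ball)
qed

lemma card_injections_lessThan: "card {f \<in> {..<k} \<rightarrow>\<^sub>E {..<k}. inj_on f {..<k}} = fact k"
  using card_inj_on_subset_funcset[of "{..<k}" "{..<k}" "{..<k}"] by (simp add: fact_prod_rev)

text \<open>Sorting the images of the children of every individual makes an injection into a placement;
  it can be recovered from the placement and the permutations that were used.\<close>

lemma card_placements_ge:
  assumes n: "card (gw_ball h s) \<le> n"
  shows "(n - card (gw_ball h s)) ^ card (gw_ball h s) \<le> card (placements n h s) * (\<Prod>w\<in>inner_words h s. fact (fst (s w)))"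
proof -
  let ?W = "gw_ball h s" and ?t = "card (gw_ball h s)"
  let ?I = "{\<phi> \<in> ?W \<rightarrow>\<^sub>E {1..n}. inj_on \<phi> ?W}"
  let ?P = "\<lambda>w. {f \<in> {..<fst (s w)} \<rightarrow>\<^sub>E {..<fst (s w)}. inj_on f {..<fst (s w)}}"
  have fi: "finite (inner_words h s)" using finite_gw_ball finite_subset[OF inner_subset] by blast
  \<comment> \<open>\<open>Ch\<close> lists the images of the children in increasing order,
    \<open>srt\<close> assigns them in this order, and \<open>prm\<close> records the permutation of
    siblings that undoes the sorting. Each family is sorted on its own: the images of deeper words
    are not moved along with their ancestors.\<close>
  define Ch where "Ch \<phi> w = sorted_list_of_set ((\<lambda>i. \<phi> (w @ [i])) ` {..<fst (s w)})" for \<phi> :: "nat list \<Rightarrow> nat" and w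
  define srt where "srt \<phi> = (\<lambda>w\<in>?W. if w = [] then \<phi> [] else Ch \<phi> (butlast w) ! last w)" for \<phi>
  define prm where "prm \<phi> = (\<lambda>w\<in>inner_words h s. \<lambda>i\<in>{..<fst (s w)}. inv_into {..<fst (s w)} ((!) (Ch \<phi> w)) (\<phi> (w @ [i])))" for \<phi>
  have "(n - ?t) ^ ?t \<le> card ?I"
  proof -
    have "card ?I = (\<Prod>i\<in>{0..<?t}. n - i)"
      using card_inj_on_subset_funcset[of ?W "{1..n}" ?W] finite_gw_ball[of h s] by simp
    moreover have "(\<Prod>i\<in>{0..<?t}. n - ?t) \<le> (\<Prod>i\<in>{0..<?t}. n - i)"
      by (intro prod_mono) auto
    ultimately show ?thesis by simp
  qed
  also have "card ?I \<le> card (placements n h s \<times> PiE (inner_words h s) ?P)"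
  proof (rule card_inj_on_le)
    have len: "length (Ch \<phi> w) = fst (s w)" "distinct (Ch \<phi> w)" "sorted_wrt (<) (Ch \<phi> w)"
        "set (Ch \<phi> w) = (\<lambda>i. \<phi> (w @ [i])) ` {..<fst (s w)}"
      if "\<phi> \<in> ?I" "w \<in> inner_words h s" for \<phi> w
    proof -
      have "inj_on (\<lambda>i. \<phi> (w @ [i])) {..<fst (s w)}"
        using that inner_child[OF that(2)] by (auto simp: inj_on_def)
      then show "length (Ch \<phi> w) = fst (s w)" by (simp add: Ch_def card_image)
      show "distinct (Ch \<phi> w)" "sorted_wrt (<) (Ch \<phi> w)" by (simp_all add: Ch_def)
      show "set (Ch \<phi> w) = (\<lambda>i. \<phi> (w @ [i])) ` {..<fst (s w)}" by (simp add: Ch_def)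
    qed
    have bij: "bij_betw ((!) (Ch \<phi> w)) {..<fst (s w)} ((\<lambda>i. \<phi> (w @ [i])) ` {..<fst (s w)})"
      if "\<phi> \<in> ?I" "w \<in> inner_words h s" for \<phi> w
      using len[OF that] by (metis bij_betw_nth)
    have rec: "\<phi> (w @ [i]) = Ch \<phi> w ! (prm \<phi> w i) \<and> prm \<phi> w i < fst (s w)"
      if "\<phi> \<in> ?I" "w \<in> inner_words h s" "i < fst (s w)" for \<phi> w i
    proof -
      have "\<phi> (w @ [i]) \<in> (!) (Ch \<phi> w) ` {..<fst (s w)}"
        using bij_betw_imp_surj_on[OF bij[OF that(1,2)]] that(3) by auto
      then show ?thesis using that f_inv_into_f[of "\<phi> (w @ [i])" "(!) (Ch \<phi> w)" "{..<fst (s w)}"]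
          inv_into_into[of "\<phi> (w @ [i])" "(!) (Ch \<phi> w)" "{..<fst (s w)}"]
        by (simp add: prm_def)
    qed
    have srt_child: "srt \<phi> (w @ [i]) = Ch \<phi> w ! i" if "w \<in> inner_words h s" "i < fst (s w)" for \<phi> w i
      using inner_child[OF that] by (simp add: srt_def)
    have srt_mem: "srt \<phi> (w @ [i]) \<in> (\<lambda>i. \<phi> (w @ [i])) ` {..<fst (s w)}"
      if "\<phi> \<in> ?I" "w \<in> inner_words h s" "i < fst (s w)" for \<phi> w i
      using len(1,4)[OF that(1,2)] that by (metis srt_child nth_mem)
    show "inj_on (\<lambda>\<phi>. (srt \<phi>, prm \<phi>)) ?I"
    proof (rule inj_onI)
      fix \<phi> \<psi> assume p: "\<phi> \<in> ?I" "\<psi> \<in> ?I" and eq: "(srt \<phi>, prm \<phi>) = (srt \<psi>, prm \<psi>)"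
      show "\<phi> = \<psi>"
      proof
        fix w show "\<phi> w = \<psi> w"
        proof (cases "w \<in> ?W")
          case True
          show ?thesis
          proof (cases "w = []")
            case True
            have "srt \<phi> [] = srt \<psi> []" using eq by simp
            then show ?thesis using True by (simp add: srt_def)
          next
            case False
            define u i where "u = butlast w" and "i = last w"
            have w: "w = u @ [i]" using False by (simp add: u_def i_def)
            have u: "u \<in> inner_words h s" "i < fst (s u)" using gw_ball_butlast[OF True False] by (auto simp: u_def i_def)
            have "\<phi> w = srt \<phi> (u @ [prm \<phi> u i])" using rec[OF p(1) u] u(1) w by (simp add: srt_child)
            also have "\<dots> = srt \<psi> (u @ [prm \<psi> u i])" using eq by simp
            also have "\<dots> = \<psi> w" using rec[OF p(2) u] u(1) w by (simp add: srt_child)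
            finally show ?thesis .
          qed
        next
          case False
          then show ?thesis using p by (auto simp: PiE_def extensional_def)
        qed
      qed
    qed
    show "(\<lambda>\<phi>. (srt \<phi>, prm \<phi>)) ` ?I \<subseteq> placements n h s \<times> PiE (inner_words h s) ?P"
    proof (rule image_subsetI, rule SigmaI)
      fix \<phi> assume p: "\<phi> \<in> ?I"
      have inj: "inj_on \<phi> ?W" and range: "\<And>w. w \<in> ?W \<Longrightarrow> \<phi> w \<in> {1..n}" using p by auto
      \<comment> \<open>Sorting permutes images within one family, so the new image of a word is the
        old image of a word with the same parent. Range and injectivity are inherited from
        \<open>\<phi>\<close> through this.\<close>
      have src: "\<exists>w'\<in>?W. srt \<phi> w = \<phi> w' \<and> (w = [] \<longrightarrow> w' = []) \<and> (w \<noteq> [] \<longrightarrow> w' \<noteq> [] \<and> butlast w' = butlast w)"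
        if "w \<in> ?W" for w
      proof (cases "w = []")
        case True then show ?thesis by (auto simp: srt_def)
      next
        case False
        have u: "butlast w \<in> inner_words h s" "last w < fst (s (butlast w))" using gw_ball_butlast[OF that False] by auto
        obtain j where "j < fst (s (butlast w))" "srt \<phi> (butlast w @ [last w]) = \<phi> (butlast w @ [j])"
          using srt_mem[OF p u] by auto
        then show ?thesis using False inner_child[OF u(1)] by (intro bexI[of _ "butlast w @ [j]"]) auto
      qed
      have "inj_on (srt \<phi>) ?W"
      proof (rule inj_onI)
        fix w v assume wv: "w \<in> ?W" "v \<in> ?W" "srt \<phi> w = srt \<phi> v"
        obtain w' where w': "w' \<in> ?W" "srt \<phi> w = \<phi> w'" "w = [] \<longrightarrow> w' = []" "w \<noteq> [] \<longrightarrow> w' \<noteq> [] \<and> butlast w' = butlast w"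
          using src[OF wv(1)] by blast
        obtain v' where v': "v' \<in> ?W" "srt \<phi> v = \<phi> v'" "v = [] \<longrightarrow> v' = []" "v \<noteq> [] \<longrightarrow> v' \<noteq> [] \<and> butlast v' = butlast v"
          using src[OF wv(2)] by blast
        have e: "w' = v'" using inj_onD[OF inj _ w'(1) v'(1)] wv(3) w'(2) v'(2) by simp
        show "w = v"
        proof (cases "w = []")
          case True then show ?thesis using e w'(3) v'(4) by auto
        next
          case False
          then have v: "v \<noteq> []" "butlast w = butlast v" using e w'(4) v'(3,4) by auto
          have u: "butlast w \<in> inner_words h s" "last w < fst (s (butlast w))" using gw_ball_butlast[OF wv(1) False] by auto
          have u2: "last v < fst (s (butlast w))" using gw_ball_butlast[OF wv(2) v(1)] v(2) by auto
          have "srt \<phi> w = Ch \<phi> (butlast w) ! last w"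
            using srt_child[OF u, of \<phi>] append_butlast_last_id[OF False] by simp
          moreover have "srt \<phi> v = Ch \<phi> (butlast w) ! last v"
            using srt_child[OF u(1) u2, of \<phi>] append_butlast_last_id[OF v(1)] v(2) by simp
          ultimately have "Ch \<phi> (butlast w) ! last w = Ch \<phi> (butlast w) ! last v" using wv(3) by simp
          then have "last w = last v" using len(1,2)[OF p u(1)] u(2) u2 by (simp add: nth_eq_iff_index_eq)
          then show ?thesis using False v by (metis append_butlast_last_id)
        qed
      qed
      moreover have "srt \<phi> \<in> ?W \<rightarrow>\<^sub>E {1..n}"
      proof (rule PiE_I)
        fix w assume "w \<in> ?W"
        then show "srt \<phi> w \<in> {1..n}" using src[of w] range by metis
      qed (simp add: srt_def)
      moreover have "srt \<phi> (w @ [i]) < srt \<phi> (w @ [j])" if "w \<in> inner_words h s" "i < j" "j < fst (s w)" for w i j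
        using len(1,3)[OF p that(1)] that by (simp add: srt_child sorted_wrt_nth_less)
      ultimately show "srt \<phi> \<in> placements n h s" by (simp add: placements_def)
      show "prm \<phi> \<in> PiE (inner_words h s) ?P"
      proof (rule PiE_I)
        fix w assume w: "w \<in> inner_words h s"
        have "inj_on (prm \<phi> w) {..<fst (s w)}"
        proof (rule inj_onI)
          fix i j assume ij: "i \<in> {..<fst (s w)}" "j \<in> {..<fst (s w)}" "prm \<phi> w i = prm \<phi> w j"
          then have "\<phi> (w @ [i]) = \<phi> (w @ [j])" using rec[OF p w, of i] rec[OF p w, of j] by simp
          then have "w @ [i] = w @ [j]"
            by (rule inj_onD[OF inj]) (use inner_child[OF w] ij in auto)
          then show "i = j" by simp
        qed
        moreover have "prm \<phi> w \<in> {..<fst (s w)} \<rightarrow>\<^sub>E {..<fst (s w)}"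
        proof (rule PiE_I)
          fix i assume "i \<in> {..<fst (s w)}"
          then show "prm \<phi> w i \<in> {..<fst (s w)}" using rec[OF p w, of i] by simp
        qed (simp add: prm_def w)
        ultimately show "prm \<phi> w \<in> ?P w" by simp
      qed (simp add: prm_def)
    qed
    show "finite (placements n h s \<times> PiE (inner_words h s) ?P)"
      using fi finite_placements by (intro finite_cartesian_product finite_PiE) (auto intro: finite_subset[OF Collect_subset] finite_PiE)
  qed
  also have "\<dots> = card (placements n h s) * (\<Prod>w\<in>inner_words h s. fact (fst (s w)))"
    using fi by (simp add: card_cartesian_product card_PiE card_injections_lessThan)
  finally show ?thesis .
qed

section \<open>The independent random graph\<close>

text \<open>\<open>D\<close> plays the role of the marked mean degrees: in the slot of two vertices
  the oriented pair \<open>y\<close> has probability \<open>D y / n\<close>, and by the symmetry of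
  \<open>D\<close> it does not matter from which end it is read.\<close>

locale er_model =
  fixes A :: "'a set" and B :: "'b set" and Q :: "'a \<Rightarrow> real" and D :: "'b \<times> 'b \<Rightarrow> real" and d :: real
  assumes fin_A: "finite A" and fin_B: "finite B"
    and Q_nonneg: "\<And>t. t \<in> A \<Longrightarrow> 0 \<le> Q t" and Q_sum: "(\<Sum>t\<in>A. Q t) = 1"
    and D_nonneg: "\<And>y. y \<in> B \<times> B \<Longrightarrow> 0 \<le> D y" and D_sum: "(\<Sum>y\<in>B \<times> B. D y) = d"
    and D_swap: "\<And>y. y \<in> B \<times> B \<Longrightarrow> D (prod.swap y) = D y" and d_pos: "0 < d"
begin

definition slot_weight :: "nat \<Rightarrow> nat \<times> nat \<Rightarrow> 'a + ('b \<times> 'b) option \<Rightarrow> real" where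
  "slot_weight n p v = (case v of Inl t \<Rightarrow> Q t | Inr z \<Rightarrow> (case z of None \<Rightarrow> 1 - d / real n | Some y \<Rightarrow> D y / real n))"

abbreviation er_expect :: "nat \<Rightarrow> (('a, 'b) config \<Rightarrow> real) \<Rightarrow> real" where
  "er_expect n \<equiv> prod_expect (slots n) (slot_vals A B) (slot_weight n)"

lemma slot_weight_nonneg:
  assumes "d \<le> real n" "1 \<le> n" "v \<in> slot_vals A B p"
  shows "0 \<le> slot_weight n p v"
  using assms Q_nonneg D_nonneg
  by (auto simp: slot_weight_def slot_vals_def divide_le_eq split: if_splits)

lemma slot_weight_sum:
  assumes "1 \<le> n" shows "(\<Sum>v\<in>slot_vals A B p. slot_weight n p v) = 1"
proof (cases "fst p = snd p")
  case True
  have "(\<Sum>v\<in>Inl ` A. slot_weight n p v) = (\<Sum>t\<in>A. slot_weight n p (Inl t))"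
    by (subst sum.reindex) (auto simp: inj_on_def)
  then show ?thesis using True by (simp add: slot_vals_def slot_weight_def Q_sum)
next
  case False
  have "(\<Sum>v\<in>Inr ` (insert None (Some ` (B \<times> B))). slot_weight n p v) =
      (\<Sum>z\<in>insert None (Some ` (B \<times> B)). slot_weight n p (Inr z))"
    by (subst sum.reindex) (auto simp: inj_on_def)
  also have "\<dots> = slot_weight n p (Inr None) + (\<Sum>z\<in>Some ` (B \<times> B). slot_weight n p (Inr z))"
    using fin_B by (subst sum.insert) auto
  also have "(\<Sum>z\<in>Some ` (B \<times> B). slot_weight n p (Inr z)) = (\<Sum>y\<in>B \<times> B. slot_weight n p (Inr (Some y)))"
    by (subst sum.reindex) (auto simp: inj_on_def)
  also have "\<dots> = d / real n"
    by (simp add: slot_weight_def D_sum flip: sum_divide_distrib)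
  finally show ?thesis using False by (simp add: slot_vals_def slot_weight_def)
qed

definition marks_ok :: "nat \<Rightarrow> ('a, 'b) gw_sample \<Rightarrow> bool" where
  "marks_ok h s \<longleftrightarrow> gw_norm h s = s \<and> (\<forall>w\<in>inner_words h s. fst (snd (s w)) \<in> A) \<and>
     (\<forall>w\<in>gw_ball h s. w \<noteq> [] \<longrightarrow> gw_pair s w \<in> B \<times> B)"

text \<open>For a fixed placement the embedding is implied by a cylinder event: vertex marks on
  \<open>J1\<close>, tree edges on \<open>J2\<close>, empty slots on \<open>J3\<close>. The last set
  is estimated by \<open>n\<close> slots per inner word, which leaves the limit unchanged since the
  true number differs by a bounded amount.\<close>

lemma placement_prob:
  assumes p: "\<phi> \<in> placements n h s" and ok: "marks_ok h s" and n: "d \<le> real n" "1 \<le> n"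
  shows "(\<Prod>w\<in>inner_words h s. Q (fst (snd (s w)))) * (\<Prod>w\<in>gw_ball h s - {[]}. D (gw_pair s w) / real n) *
    (1 - d / real n) ^ (card (inner_words h s) * n) \<le> er_expect n (\<lambda>c. of_bool (embeds n h s \<phi> c))"
proof -
  let ?W = "gw_ball h s" and ?I = "inner_words h s"
  let ?Wp = "gw_ball h s - {[]}"
  have inj: "inj_on \<phi> ?W" and rng: "\<And>w. w \<in> ?W \<Longrightarrow> \<phi> w \<in> {1..n}"
    using p by (auto simp: placements_def)
  have IW: "w \<in> ?W" if "w \<in> ?I" for w using that inner_subset by blast
  have bl: "butlast w \<in> ?W" "butlast w \<in> ?I" "last w < fst (s (butlast w))" if "w \<in> ?Wp" for w
    using gw_ball_butlast[of w h s] that IW by auto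
  have bl_ne: "\<phi> (butlast w) \<noteq> \<phi> w" if "w \<in> ?Wp" for w
  proof
    assume "\<phi> (butlast w) = \<phi> w"
    then have "butlast w = w" using inj_onD[OF inj] bl(1)[OF that] that by blast
    then have "length w - 1 = length w" by (metis length_butlast)
    then show False using that by (cases w) auto
  qed
  define sl where "sl i j = (min i j, max i j)" for i j :: nat
  have sl_slots: "sl i j \<in> slots n" if "i \<in> {1..n}" "j \<in> {1..n}" for i j
    using that by (auto simp: sl_def slots_def)
  have sl_eq: "sl i j = sl i' j' \<longleftrightarrow> (i = i' \<and> j = j') \<or> (i = j' \<and> j = i')" for i j i' j'
    by (auto simp: sl_def min_def max_def)
  have sl_diag: "fst (sl i j) = snd (sl i j) \<longleftrightarrow> i = j" for i j by (auto simp: sl_def min_def max_def)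
  define g where "g w = sl (\<phi> (butlast w)) (\<phi> w)" for w
  have inj_g: "inj_on g ?Wp"
  proof (rule inj_onI)
    fix w v assume wv: "w \<in> ?Wp" "v \<in> ?Wp" "g w = g v"
    then consider "\<phi> w = \<phi> v" | "\<phi> (butlast w) = \<phi> v" "\<phi> w = \<phi> (butlast v)" by (auto simp: g_def sl_eq)
    then show "w = v"
    proof cases
      case 1 then show ?thesis using inj_onD[OF inj] wv by blast
    next
      case 2
      then have "butlast w = v" "w = butlast v" using inj_onD[OF inj] wv bl(1) by blast+
      then have "length w - 1 = length v" "length w = length v - 1" by (metis length_butlast)+
      then show ?thesis using wv by (cases w; cases v) auto
    qed
  qed
  define J1 where "J1 = (\<lambda>w. (\<phi> w, \<phi> w)) ` ?I"
  define J2 where "J2 = g ` ?Wp"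
  define J3 where "J3 = (\<Union>w\<in>?I. sl (\<phi> w) ` ({1..n} - {\<phi> w})) - J2"
  \<comment> \<open>The value required in each slot. An edge is stored from its smaller to its
    larger end, hence the swap when the parent has the larger number.\<close>
  define tgt where "tgt x = (if fst x = snd x then Inl (fst (snd (s (inv_into ?W \<phi> (fst x)))))
    else if x \<in> J2 then (let w = inv_into ?Wp g x in
      Inr (Some (if \<phi> (butlast w) < \<phi> w then gw_pair s w else prod.swap (gw_pair s w))))
    else Inr None)" for x
  have tgt1: "tgt (\<phi> w, \<phi> w) = Inl (fst (snd (s w)))" if "w \<in> ?I" for w
    using inv_into_f_f[OF inj IW[OF that]] by (simp add: tgt_def)
  have tgt2: "tgt (g w) = Inr (Some (if \<phi> (butlast w) < \<phi> w then gw_pair s w else prod.swap (gw_pair s w)))"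
    if "w \<in> ?Wp" for w
  proof -
    have "fst (g w) \<noteq> snd (g w)" using bl_ne[OF that] by (simp add: g_def sl_diag)
    moreover have "g w \<in> J2" using that by (auto simp: J2_def)
    ultimately show ?thesis by (simp add: tgt_def Let_def inv_into_f_f[OF inj_g that])
  qed
  have tgt3: "tgt x = Inr None" if "x \<in> J3" for x
    using that by (auto simp: J3_def tgt_def sl_diag)
  have disj: "J1 \<inter> J2 = {}" "J1 \<inter> J3 = {}" "J2 \<inter> J3 = {}"
  proof -
    have "fst x = snd x" if "x \<in> J1" for x using that by (auto simp: J1_def)
    moreover have "fst x \<noteq> snd x" if "x \<in> J2" for x using that bl_ne by (auto simp: J2_def g_def sl_diag)
    moreover have "fst x \<noteq> snd x" if "x \<in> J3" for x using that by (auto simp: J3_def sl_diag)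
    ultimately show "J1 \<inter> J2 = {}" "J1 \<inter> J3 = {}" by blast+
    show "J2 \<inter> J3 = {}" by (auto simp: J3_def)
  qed
  have fin: "finite ?I" "finite ?Wp" using finite_inner finite_gw_ball by auto
  have finJ: "finite J1" "finite J2" "finite J3" using fin by (auto simp: J1_def J2_def J3_def)
  have sub: "J1 \<union> J2 \<union> J3 \<subseteq> slots n"
  proof -
    have "J1 \<subseteq> slots n" using rng IW by (fastforce simp: J1_def slots_def)
    moreover have "g w \<in> slots n" if "w \<in> ?Wp" for w
      unfolding g_def using that by (intro sl_slots rng bl(1)) auto
    then have "J2 \<subseteq> slots n" unfolding J2_def by blast
    moreover have "sl (\<phi> w) j \<in> slots n" if "w \<in> ?I" "j \<in> {1..n}" for w j
      using that by (intro sl_slots rng IW)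
    then have "J3 \<subseteq> slots n" unfolding J3_def by blast
    ultimately show ?thesis by blast
  qed
  have mem: "tgt x \<in> slot_vals A B x" if x: "x \<in> J1 \<union> J2 \<union> J3" for x
  proof -
    consider w where "w \<in> ?I" "x = (\<phi> w, \<phi> w)" | w where "w \<in> ?Wp" "x = g w" | "x \<in> J3"
      using x by (auto simp: J1_def J2_def)
    then show ?thesis
    proof cases
      case 1 then show ?thesis using ok tgt1 by (auto simp: slot_vals_def marks_ok_def)
    next
      case 2
      have "gw_pair s w \<in> B \<times> B" using ok 2 by (auto simp: marks_ok_def)
      moreover have "fst x \<noteq> snd x" using 2 bl_ne by (simp add: g_def sl_diag)
      ultimately show ?thesis using tgt2[OF 2(1)] 2(2) by (auto simp: slot_vals_def)
    next
      case 3
      then have "fst x \<noteq> snd x" by (auto simp: J3_def sl_diag)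
      then show ?thesis using tgt3[OF 3] by (simp add: slot_vals_def)
    qed
  qed
  have slot_sl: "slot c i j = (if i < j then edge_val (c (sl i j)) else map_option prod.swap (edge_val (c (sl i j))))"
    if "i \<noteq> j" for c :: "('a, 'b) config" and i j
    using that by (auto simp: slot_def sl_def min_def max_def)
  have emb: "embeds n h s \<phi> c" if c: "\<forall>x\<in>J1 \<union> J2 \<union> J3. c x = tgt x" for c
    unfolding embeds_def
  proof (intro ballI conjI allI impI)
    fix w assume w: "w \<in> ?I"
    have "(\<phi> w, \<phi> w) \<in> J1" using w by (auto simp: J1_def)
    then show "c (\<phi> w, \<phi> w) = Inl (fst (snd (s w)))" using c tgt1[OF w] by auto
    show "slot c (\<phi> w) (\<phi> (w @ [i])) = Some (gw_pair s (w @ [i]))" if i: "i < fst (s w)" for i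
    proof -
      have u: "w @ [i] \<in> ?Wp" using inner_child[OF w i] by simp
      have "c (g (w @ [i])) = tgt (g (w @ [i]))" using c u by (auto simp: J2_def)
      then have "c (sl (\<phi> w) (\<phi> (w @ [i]))) =
          Inr (Some (if \<phi> w < \<phi> (w @ [i]) then gw_pair s (w @ [i]) else prod.swap (gw_pair s (w @ [i]))))"
        using tgt2[OF u] by (simp add: g_def)
      then show ?thesis using bl_ne[OF u] by (simp add: slot_sl)
    qed
    fix j assume j: "j \<in> {1..n}" "j \<notin> (\<lambda>i. \<phi> (w @ [i])) ` {..<fst (s w)}" "w \<noteq> [] \<longrightarrow> j \<noteq> \<phi> (butlast w)"
    show "slot c (\<phi> w) j = None"
    proof (cases "j = \<phi> w")
      case False
      have "sl (\<phi> w) j \<notin> J2"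
      proof
        assume "sl (\<phi> w) j \<in> J2"
        then obtain u where u: "u \<in> ?Wp" "sl (\<phi> w) j = sl (\<phi> (butlast u)) (\<phi> u)" by (auto simp: J2_def g_def)
        then consider "\<phi> w = \<phi> (butlast u)" "j = \<phi> u" | "\<phi> w = \<phi> u" "j = \<phi> (butlast u)" by (auto simp: sl_eq)
        then show False
        proof cases
          case 1
          then have "w = butlast u" using inj_onD[OF inj] IW[OF w] bl(1)[OF u(1)] by blast
          then have "j = \<phi> (w @ [last u])" "last u < fst (s w)" using 1 u(1) bl(3)[OF u(1)] by auto
          then show False using j(2) by blast
        next
          case 2
          then have "w = u" using inj_onD[OF inj] IW[OF w] u(1) by blast
          then show False using 2 j(3) u(1) by auto
        qed
      qed
      then have "sl (\<phi> w) j \<in> J3" using w j(1) False unfolding J3_def by blast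
      then have "c (sl (\<phi> w) j) = Inr None" using c tgt3 by auto
      then show ?thesis using False by (simp add: slot_sl)
    qed simp
  qed
  have p0: "0 \<le> 1 - d / real n" "1 - d / real n \<le> 1" using n d_pos by (auto simp: divide_le_eq)
  have "(\<Prod>x\<in>J1 \<union> J2 \<union> J3. slot_weight n x (tgt x)) =
      (\<Prod>x\<in>J1. slot_weight n x (tgt x)) * (\<Prod>x\<in>J2. slot_weight n x (tgt x)) * (\<Prod>x\<in>J3. slot_weight n x (tgt x))"
  proof -
    have d: "(J1 \<union> J2) \<inter> J3 = {}" using disj by blast
    show ?thesis
      by (simp only: prod.union_disjoint[OF finite_UnI[OF finJ(1,2)] finJ(3) d]
          prod.union_disjoint[OF finJ(1,2) disj(1)])
  qed
  also have "(\<Prod>x\<in>J1. slot_weight n x (tgt x)) = (\<Prod>w\<in>?I. Q (fst (snd (s w))))"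
  proof -
    have "inj_on (\<lambda>w. (\<phi> w, \<phi> w)) ?I" using inj IW by (auto simp: inj_on_def)
    then show ?thesis unfolding J1_def by (simp add: prod.reindex tgt1 slot_weight_def)
  qed
  also have "(\<Prod>x\<in>J2. slot_weight n x (tgt x)) = (\<Prod>w\<in>?Wp. D (gw_pair s w) / real n)"
    unfolding J2_def prod.reindex[OF inj_g] comp_def
  proof (rule prod.cong[OF refl])
    fix w assume w: "w \<in> ?Wp"
    then have "gw_pair s w \<in> B \<times> B" using ok by (auto simp: marks_ok_def)
    then show "slot_weight n (g w) (tgt (g w)) = D (gw_pair s w) / real n"
      unfolding tgt2[OF w] by (simp add: slot_weight_def D_swap)
  qed
  also have "(\<Prod>x\<in>J3. slot_weight n x (tgt x)) = (1 - d / real n) ^ card J3"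
    by (simp add: tgt3 slot_weight_def)
  finally have eq: "(\<Prod>x\<in>J1 \<union> J2 \<union> J3. slot_weight n x (tgt x)) = (\<Prod>w\<in>?I. Q (fst (snd (s w)))) *
      (\<Prod>w\<in>?Wp. D (gw_pair s w) / real n) * (1 - d / real n) ^ card J3" .
  have cJ3: "card J3 \<le> card ?I * n"
  proof -
    have "card J3 \<le> card (\<Union>w\<in>?I. sl (\<phi> w) ` ({1..n} - {\<phi> w}))"
      using fin by (intro card_mono) (auto simp: J3_def)
    also have "\<dots> \<le> (\<Sum>w\<in>?I. card (sl (\<phi> w) ` ({1..n} - {\<phi> w})))" by (rule card_UN_le[OF fin(1)])
    also have "\<dots> \<le> (\<Sum>w\<in>?I. n)"
    proof (rule sum_mono)
      fix w
      have "card (sl (\<phi> w) ` ({1..n} - {\<phi> w})) \<le> card ({1..n} - {\<phi> w})" by (rule card_image_le) simp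
      also have "\<dots> \<le> card {1..n}" by (rule card_mono) auto
      finally show "card (sl (\<phi> w) ` ({1..n} - {\<phi> w})) \<le> n" by simp
    qed
    finally show ?thesis by simp
  qed
  have "(\<Prod>w\<in>?I. Q (fst (snd (s w)))) * (\<Prod>w\<in>?Wp. D (gw_pair s w) / real n) * (1 - d / real n) ^ (card ?I * n)
      \<le> (\<Prod>x\<in>J1 \<union> J2 \<union> J3. slot_weight n x (tgt x))"
    unfolding eq
  proof (intro mult_left_mono power_decreasing cJ3 p0 mult_nonneg_nonneg prod_nonneg)
    show "0 \<le> Q (fst (snd (s w)))" if "w \<in> ?I" for w using ok that Q_nonneg by (auto simp: marks_ok_def)
    show "0 \<le> D (gw_pair s w) / real n" if "w \<in> ?Wp" for w using ok that D_nonneg by (auto simp: marks_ok_def)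
  qed
  also have "\<dots> = er_expect n (\<lambda>c. of_bool (\<forall>x\<in>J1 \<union> J2 \<union> J3. c x = tgt x))"
    by (rule prod_expect_cylinder[symmetric])
      (use finite_slots slot_weight_sum[OF n(2)] finite_slot_vals[OF fin_A fin_B] sub mem in auto)
  also have "\<dots> \<le> er_expect n (\<lambda>c. of_bool (embeds n h s \<phi> c))"
  proof (rule prod_expect_mono)
    show "of_bool (\<forall>x\<in>J1 \<union> J2 \<union> J3. c x = tgt x) \<le> (of_bool (embeds n h s \<phi> c) :: real)" for c
      using emb[of c] by auto
  qed (rule slot_weight_nonneg[OF n])
  finally show ?thesis .
qed

text \<open>By \<open>embeds_unique\<close> roots and embeddings correspond one to one, so the count
  is a sum of indicators over placements.\<close>

lemma expect_pattern_roots: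
  assumes ok: "marks_ok h s"
  shows "er_expect n (\<lambda>c. real (card (pattern_roots n h s c))) =
    (\<Sum>\<phi>\<in>placements n h s. er_expect n (\<lambda>c. of_bool (embeds n h s \<phi> c)))"
proof -
  have "real (card (pattern_roots n h s c)) = (\<Sum>\<phi>\<in>placements n h s. of_bool (embeds n h s \<phi> c))" for c
  proof -
    have "inj_on (\<lambda>\<phi>. \<phi> []) {\<phi> \<in> placements n h s. embeds n h s \<phi> c}"
      using embeds_unique[of n h s _ c s] ok by (auto simp: inj_on_def marks_ok_def)
    then have "card (pattern_roots n h s c) = card {\<phi> \<in> placements n h s. embeds n h s \<phi> c}"
      by (simp add: pattern_roots_def card_image)
    then show ?thesis using finite_placements[of n h s] by (simp add: of_bool_def sum.If_cases Int_def)
  qed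
  then show ?thesis by (simp add: prod_expect_sum)
qed

text \<open>The limiting frequency as the count produces it: the factorials come from the number of
  sorted placements, the exponentials from the empty slots, and the powers of \<open>d\<close> are
  contained in \<open>D\<close>. It is identified with the probability of the pattern in
  \<open>pattern_limit_eq\<close>.\<close>

definition pattern_limit :: "nat \<Rightarrow> ('a, 'b) gw_sample \<Rightarrow> real" where
  "pattern_limit h s = (\<Prod>w\<in>inner_words h s. exp (- d) * Q (fst (snd (s w))) / fact (fst (s w))) *
     (\<Prod>w\<in>gw_ball h s - {[]}. D (gw_pair s w))"

text \<open>With \<open>t\<close> words in the pattern there are at least \<open>(n - t) ^ t\<close>
  over the product of factorials placements, and the \<open>t - 1\<close> edges contribute
  \<open>n\<close> to the power \<open>- (t - 1)\<close>; one factor \<open>n\<close> remains,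
  multiplied by \<open>?L n\<close>.\<close>

lemma expect_pattern_roots_ge:
  assumes ok: "marks_ok h s" and "0 < \<eta>"
  shows "\<forall>\<^sub>F n in sequentially. real n * (pattern_limit h s - \<eta>) \<le> er_expect n (\<lambda>c. real (card (pattern_roots n h s c)))"
proof -
  let ?W = "gw_ball h s" and ?I = "inner_words h s"
  let ?Wp = "gw_ball h s - {[]}"
  let ?t = "card ?W" and ?F = "\<Prod>w\<in>inner_words h s. fact (fst (s w)) :: real"
  let ?Q = "\<Prod>w\<in>?I. Q (fst (snd (s w)))" and ?D = "\<Prod>w\<in>?Wp. D (gw_pair s w)"
  have t: "1 \<le> ?t" "card ?Wp = ?t - 1" using finite_gw_ball[of h s] card_gt_0_iff[of ?W] Nil_in_gw_ball[of h s]
    by (auto simp: Suc_le_eq simp del: Nil_in_gw_ball)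
  have Q0: "0 \<le> ?Q" using ok Q_nonneg by (intro prod_nonneg) (auto simp: marks_ok_def)
  have D0: "0 \<le> ?D" using ok D_nonneg by (intro prod_nonneg) (auto simp: marks_ok_def)
  have F0: "0 < ?F" by (intro prod_pos) simp
  let ?L = "\<lambda>n. (1 - real ?t / real n) ^ ?t / ?F * (?Q * ?D * ((1 + (- d) / real n) ^ n) ^ card ?I)"
  have "?L \<longlonglongrightarrow> (1 - 0) ^ ?t / ?F * (?Q * ?D * (exp (- d)) ^ card ?I)"
    using F0 by (intro tendsto_intros tendsto_exp_limit_sequentially lim_const_over_n) auto
  also have "(1 - 0) ^ ?t / ?F * (?Q * ?D * (exp (- d)) ^ card ?I) = pattern_limit h s"
    by (simp add: pattern_limit_def prod_dividef prod.distrib mult_ac)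
  finally have "\<forall>\<^sub>F n in sequentially. pattern_limit h s - \<eta> < ?L n"
    using \<open>0 < \<eta>\<close> by (intro order_tendstoD) auto
  then show ?thesis using eventually_ge_at_top[of "max ?t (nat \<lceil>d\<rceil>)"]
  proof eventually_elim
    case (elim n)
    then have n: "?t \<le> n" "d \<le> real n" "1 \<le> n" using t by linarith+
    let ?b = "?Q * (\<Prod>w\<in>?Wp. D (gw_pair s w) / real n) * (1 - d / real n) ^ (card ?I * n)"
    have b0: "0 \<le> ?b"
    proof -
      have "0 \<le> (\<Prod>w\<in>?Wp. D (gw_pair s w) / real n)"
        using ok D_nonneg by (intro prod_nonneg) (auto simp: marks_ok_def)
      then show ?thesis using Q0 n by (intro mult_nonneg_nonneg zero_le_power) (auto simp: divide_le_eq)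
    qed
    have "real n * (pattern_limit h s - \<eta>) \<le> real n * ?L n"
      using elim by (intro mult_left_mono) auto
    also have "\<dots> = real (n - ?t) ^ ?t / ?F * ?b"
    proof -
      have "(1 - real ?t / real n) ^ ?t = real (n - ?t) ^ ?t / real n ^ ?t"
        using n by (simp add: of_nat_diff diff_divide_distrib flip: power_divide)
      moreover have "(\<Prod>w\<in>?Wp. D (gw_pair s w) / real n) = ?D / real n ^ (?t - 1)"
        using t(2) by (simp add: prod_dividef)
      moreover have "real n ^ ?t = real n * real n ^ (?t - 1)" using t(1) by (cases ?t) auto
      moreover have "((1 + (- d) / real n) ^ n) ^ card ?I = (1 - d / real n) ^ (card ?I * n)"
        by (simp add: power_mult[symmetric] mult.commute)
      ultimately show ?thesis using n F0 by (simp add: field_simps)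
    qed
    also have "\<dots> \<le> real (card (placements n h s)) * ?b"
    proof (rule mult_right_mono[OF _ b0])
      have "real ((n - ?t) ^ ?t) \<le> real (card (placements n h s) * (\<Prod>w\<in>inner_words h s. fact (fst (s w))))"
        using card_placements_ge[OF n(1)] by (simp only: of_nat_le_iff)
      then show "real (n - ?t) ^ ?t / ?F \<le> real (card (placements n h s))"
        using F0 by (simp add: divide_le_eq)
    qed
    also have "\<dots> = (\<Sum>\<phi>\<in>placements n h s. ?b)" by simp
    also have "\<dots> \<le> (\<Sum>\<phi>\<in>placements n h s. er_expect n (\<lambda>c. of_bool (embeds n h s \<phi> c)))"
      using placement_prob[OF _ ok n(2,3)] by (rule sum_mono)
    also have "\<dots> = er_expect n (\<lambda>c. real (card (pattern_roots n h s c)))"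
      by (rule expect_pattern_roots[OF ok, symmetric])
    finally show ?case .
  qed
qed

end

section \<open>Concentration of pattern counts\<close>

context er_model begin

text \<open>The \<open>n\<close> diagonal slots contribute at most 1 each. The off-diagonal ones, at
  most n^2 in number, contribute \<open>d / n\<close> each because the reference value is the
  absence of an edge.\<close>

lemma slot_variance_sum:
  assumes n: "d \<le> real n" "1 \<le> n" and t0: "t0 \<in> A"
  shows "(\<Sum>p\<in>slots n. 1 - slot_weight n p (if fst p = snd p then Inl t0 else Inr None)) \<le> real n * (1 + d)"
proof -
  let ?S = "{p\<in>slots n. fst p = snd p}" and ?T = "{p\<in>slots n. fst p \<noteq> snd p}"
  have S: "?S = (\<lambda>i. (i, i)) ` {1..n}" by (auto simp: slots_def)
  have cS: "card ?S = n" unfolding S by (subst card_image) (auto simp: inj_on_def)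
  have cT: "real (card ?T) \<le> real n * real n"
  proof -
    have "card ?T \<le> card ({1..n} \<times> {1..n})" by (intro card_mono) (auto simp: slots_def)
    then show ?thesis by (simp add: card_cartesian_product flip: of_nat_mult)
  qed
  have "(\<Sum>p\<in>slots n. 1 - slot_weight n p (if fst p = snd p then Inl t0 else Inr None)) =
      (\<Sum>p\<in>?S. 1 - slot_weight n p (if fst p = snd p then Inl t0 else Inr None)) +
      (\<Sum>p\<in>?T. 1 - slot_weight n p (if fst p = snd p then Inl t0 else Inr None))"
    by (subst sum.union_disjoint[symmetric]) (auto simp: finite_slots intro!: sum.cong)
  also have "\<dots> \<le> (\<Sum>p\<in>?S. 1) + (\<Sum>p\<in>?T. d / real n)"
    using Q_nonneg[OF t0] by (intro add_mono sum_mono) (auto simp: slot_weight_def)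
  also have "\<dots> = real n + real (card ?T) * (d / real n)" by (simp add: cS)
  also have "\<dots> \<le> real n + real n * real n * (d / real n)"
    using cT d_pos by (intro add_left_mono mult_right_mono) auto
  also have "\<dots> = real n * (1 + d)" using n by (simp add: distrib_left)
  finally show ?thesis .
qed

text \<open>Half of \<open>\<eta>\<close> pays for the gap between expectation and limit, the other
  half for the deviation from the expectation.\<close>

lemma pattern_roots_lower_tail:
  assumes ok: "marks_ok h s" and "0 < \<eta>"
  shows "\<exists>\<kappa>>0. \<forall>\<^sub>F n in sequentially.
    er_expect n (\<lambda>c. of_bool (real (card (pattern_roots n h s c)) < real n * (pattern_limit h s - \<eta>))) \<le> exp (- \<kappa> * real n)"
proof -
  \<comment> \<open>Adding 1 makes the Lipschitz constant positive. In \<open>\<theta>\<close>, the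
    first bound ensures \<open>\<theta> * c \<le> 1\<close>, the second that the quadratic term of
    the exponent is at most half of the linear one; the other half is
    \<open>\<kappa>\<close>.\<close>
  define c where "c = real (lipschitz_const h s) + 1"
  define \<theta> where "\<theta> = min (1 / c) ((\<eta> / 2) / (2 * c\<^sup>2 * (1 + d)))"
  have c: "1 \<le> c" by (simp add: c_def)
  have th: "0 < \<theta>" using c \<open>0 < \<eta>\<close> d_pos by (simp add: \<theta>_def)
  have thc: "\<theta> * c \<le> 1"
  proof -
    have "\<theta> * c \<le> 1 / c * c" using c by (intro mult_right_mono) (auto simp: \<theta>_def)
    then show ?thesis using c by simp
  qed
  have th2: "\<theta>\<^sup>2 * c\<^sup>2 * (1 + d) \<le> \<theta> * (\<eta> / 2) / 2"
  proof -
    have p: "0 < 2 * c\<^sup>2 * (1 + d)" using c d_pos by (intro mult_pos_pos) auto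
    have "\<theta> \<le> \<eta> / 2 / (2 * c\<^sup>2 * (1 + d))" by (simp only: \<theta>_def min.cobounded2)
    then have "\<theta> * (2 * c\<^sup>2 * (1 + d)) \<le> \<eta> / 2" by (simp only: pos_le_divide_eq[OF p])
    then have "\<theta> * (\<theta> * (2 * c\<^sup>2 * (1 + d))) \<le> \<theta> * (\<eta> / 2)" using th by (intro mult_left_mono) auto
    then show ?thesis by (simp add: power2_eq_square field_simps)
  qed
  obtain t0 where t0: "t0 \<in> A" using Q_sum by fastforce
  define \<kappa> where "\<kappa> = \<theta> * (\<eta> / 2) / 2"
  have "0 < \<kappa>" using th \<open>0 < \<eta>\<close> by (simp add: \<kappa>_def)
  moreover have "\<forall>\<^sub>F n in sequentially.
    er_expect n (\<lambda>c. of_bool (real (card (pattern_roots n h s c)) < real n * (pattern_limit h s - \<eta>))) \<le> exp (- \<kappa> * real n)"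
    using expect_pattern_roots_ge[OF ok half_gt_zero[OF \<open>0 < \<eta>\<close>]] eventually_ge_at_top[of "max 1 (nat \<lceil>d\<rceil>)"]
  proof eventually_elim
    case (elim n)
    then have n: "d \<le> real n" "1 \<le> n" by linarith+
    let ?X = "\<lambda>c. real (card (pattern_roots n h s c))"
    let ?k0 = "\<lambda>p. if fst p = snd p then Inl t0 else Inr None"
    have "er_expect n (\<lambda>c. of_bool (?X c < real n * (pattern_limit h s - \<eta>))) \<le>
        er_expect n (\<lambda>c. of_bool (?X c < er_expect n ?X - real n * (\<eta> / 2)))"
    proof (rule prod_expect_mono)
      fix c
      have "real n * (pattern_limit h s - \<eta>) = real n * (pattern_limit h s - \<eta> / 2) - real n * (\<eta> / 2)"
        by (simp add: algebra_simps)
      then show "of_bool (?X c < real n * (pattern_limit h s - \<eta>)) \<le>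
          (of_bool (?X c < er_expect n ?X - real n * (\<eta> / 2)) :: real)"
        using elim(1) by auto
    qed (rule slot_weight_nonneg[OF n])
    also have "\<dots> \<le> exp (\<theta>\<^sup>2 * c\<^sup>2 * (real n * (1 + d)) - \<theta> * (real n * (\<eta> / 2)))"
    proof (rule prod_expect_lower_tail[where ?k0.0 = ?k0])
      fix \<omega> i k l
      have "\<bar>?X (fun_upd \<omega> i k) - ?X (fun_upd \<omega> i l)\<bar> \<le> real (lipschitz_const h s)"
        by (rule pattern_roots_lipschitz)
      then show "\<bar>?X (fun_upd \<omega> i k) - ?X (fun_upd \<omega> i l)\<bar> \<le> c" by (simp add: c_def)
    next
      show "(\<Sum>i\<in>slots n. 1 - slot_weight n i (?k0 i)) \<le> real n * (1 + d)"
        by (rule slot_variance_sum[OF n t0])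
      show "?k0 i \<in> slot_vals A B i" for i using t0 by (auto simp: slot_vals_def)
    qed (use finite_slots finite_slot_vals[OF fin_A fin_B] slot_weight_nonneg[OF n] slot_weight_sum[OF n(2)] th c thc in auto)
    also have "\<dots> \<le> exp (- \<kappa> * real n)"
    proof -
      have "real n * (\<theta>\<^sup>2 * c\<^sup>2 * (1 + d)) \<le> real n * (\<theta> * (\<eta> / 2) / 2)" using th2 by (intro mult_left_mono) auto
      then show ?thesis by (simp add: \<kappa>_def algebra_simps)
    qed
    finally show ?case .
  qed
  ultimately show ?thesis by blast
qed

end

section \<open>Weights of graphs with given counts\<close>

lemma prod_over_fibres:
  fixes g :: "'v \<Rightarrow> real"
  assumes "finite S" "finite V" "k ` S \<subseteq> V"
  shows "(\<Prod>p\<in>S. g (k p)) = (\<Prod>v\<in>V. g v ^ card {p\<in>S. k p = v})"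
proof -
  have "(\<Prod>p\<in>S. g (k p)) = (\<Prod>v\<in>V. \<Prod>p\<in>{p\<in>S. k p = v}. g (k p))"
    by (rule prod.group[symmetric, OF assms])
  also have "\<dots> = (\<Prod>v\<in>V. \<Prod>p\<in>{p\<in>S. k p = v}. g v)"
    by (intro prod.cong) auto
  finally show ?thesis by simp
qed

lemma card_over_fibres:
  assumes "finite S" "finite V" "k ` S \<subseteq> V"
  shows "card S = (\<Sum>v\<in>V. card {p\<in>S. k p = v})"
  using sum.group[OF assms, of "\<lambda>_. 1 :: nat"] by simp

lemma card_offdiag_slots: "card {p\<in>slots n. fst p \<noteq> snd p} = n choose 2"
proof -
  let ?f = "\<lambda>(i, j). {i, j :: nat}"
  have inj: "inj_on ?f {p\<in>slots n. fst p \<noteq> snd p}"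
  proof (rule inj_onI)
    fix p q assume "p \<in> {p\<in>slots n. fst p \<noteq> snd p}" "q \<in> {p\<in>slots n. fst p \<noteq> snd p}" "?f p = ?f q"
    moreover obtain i j where p: "p = (i, j)" by (cases p)
    moreover obtain i' j' where q: "q = (i', j')" by (cases q)
    ultimately have "i < j" "i' < j'" "{i, j} = {i', j'}" by (simp_all add: slots_def)
    then have "i = i' \<and> j = j'" unfolding doubleton_eq_iff by linarith
    then show "p = q" by (simp add: p q)
  qed
  have img: "?f ` {p\<in>slots n. fst p \<noteq> snd p} = {e. e \<subseteq> {1..n} \<and> card e = 2}"
  proof
    show "?f ` {p\<in>slots n. fst p \<noteq> snd p} \<subseteq> {e. e \<subseteq> {1..n} \<and> card e = 2}"
      by (rule image_subsetI) (simp add: slots_def split: prod.splits)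
    show "{e. e \<subseteq> {1..n} \<and> card e = 2} \<subseteq> ?f ` {p\<in>slots n. fst p \<noteq> snd p}"
    proof
      fix e assume "e \<in> {e. e \<subseteq> {1..n} \<and> card e = 2}"
      then have "card e = 2" and sub: "e \<subseteq> {1..n}" by simp_all
      then obtain i j where ij: "e = {i, j}" "i \<noteq> j" unfolding card_2_iff by blast
      have m: "i \<in> {1..n}" "j \<in> {1..n}" using sub ij by simp_all
      show "e \<in> ?f ` {p\<in>slots n. fst p \<noteq> snd p}"
      proof (cases "i < j")
        case True
        then show ?thesis using m ij by (intro image_eqI[of _ _ "(i, j)"]) (simp_all add: slots_def)
      next
        case False
        then show ?thesis using m ij by (intro image_eqI[of _ _ "(j, i)"]) (simp_all add: slots_def insert_commute)
      qed
    qed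
  qed
  have "card {p\<in>slots n. fst p \<noteq> snd p} = card {e. e \<subseteq> {1..n} \<and> card e = 2}"
    using card_image[OF inj] unfolding img by simp
  then show ?thesis using n_subsets[of "{1..n}" 2] by simp
qed

lemma linear_order_onD:
  assumes "linear_order_on B R"
  shows "x \<in> B \<Longrightarrow> x' \<in> B \<Longrightarrow> (x, x') \<in> R \<or> (x', x) \<in> R"
    and "(x, x') \<in> R \<Longrightarrow> (x', x) \<in> R \<Longrightarrow> x = x'"
  using assms unfolding linear_order_on_def partial_order_on_def preorder_on_def total_on_def refl_on_def antisym_def
  by (cases "x = x'"; blast)+

text \<open>Off the diagonal each pair is grouped with its reversal; totality and antisymmetry of
  \<open>R\<close> put exactly one of the two into \<open>ordered_pairs B R\<close>.\<close>

lemma sum_ordered_pairs: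
  fixes F :: "'b \<times> 'b \<Rightarrow> 'r::comm_monoid_add"
  assumes "finite B" and R: "linear_order_on B R"
  shows "(\<Sum>y\<in>B \<times> B. F y) = (\<Sum>(x, x')\<in>ordered_pairs B R. if x = x' then F (x, x) else F (x, x') + F (x', x))"
proof -
  let ?O = "ordered_pairs B R"
  have fin: "finite ?O" using assms(1) by (auto simp: ordered_pairs_def intro: finite_subset[of _ "B \<times> B"])
  have tot: "(x, x') \<in> R \<or> (x', x) \<in> R" if "x \<in> B" "x' \<in> B" for x x'
    using linear_order_onD(1)[OF R that] .
  have anti: "x = x'" if "(x, x') \<in> R" "(x', x) \<in> R" for x x'
    using linear_order_onD(2)[OF R that] .
  let ?S = "{y \<in> ?O. fst y \<noteq> snd y}"
  have BB: "B \<times> B = ?O \<union> prod.swap ` ?S"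
  proof (intro equalityI subsetI)
    fix y assume y: "y \<in> B \<times> B"
    obtain x x' where xx: "y = (x, x')" by (cases y)
    show "y \<in> ?O \<union> prod.swap ` ?S"
    proof (cases "(x, x') \<in> R")
      case True then show ?thesis using y by (simp add: xx ordered_pairs_def)
    next
      case False
      then have "(x', x) \<in> ?S" using y tot[of x x'] by (auto simp: xx ordered_pairs_def)
      then show ?thesis by (intro UnI2 image_eqI[of _ _ "(x', x)"]) (simp_all add: xx)
    qed
  next
    fix y assume "y \<in> ?O \<union> prod.swap ` ?S"
    then show "y \<in> B \<times> B" by (auto simp: ordered_pairs_def)
  qed
  have disj: "?O \<inter> prod.swap ` ?S = {}"
  proof -
    have False if "y \<in> ?O" "z \<in> ?S" "y = prod.swap z" for y z
      using that anti[of "fst z" "snd z"] by (auto simp: ordered_pairs_def)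
    then show ?thesis by blast
  qed
  have "(\<Sum>y\<in>B \<times> B. F y) = (\<Sum>y\<in>?O. F y) + (\<Sum>y\<in>prod.swap ` ?S. F y)"
    unfolding BB using fin disj by (intro sum.union_disjoint) auto
  also have "(\<Sum>y\<in>prod.swap ` ?S. F y) = (\<Sum>y\<in>?S. F (prod.swap y))"
    by (subst sum.reindex) (auto simp: comp_def)
  also have "\<dots> = (\<Sum>y\<in>?O. if fst y \<noteq> snd y then F (prod.swap y) else 0)"
    using fin by (rule sum.inter_filter)
  finally show ?thesis
    by (subst (asm) sum.distrib[symmetric]) (auto simp: case_prod_unfold intro!: sum.cong)
qed

lemma ln_power_zero:
  fixes a :: real assumes "0 \<le> a" "a = 0 \<Longrightarrow> k = 0"
  shows "0 < a ^ k" "ln (a ^ k) = real k * ln a"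
  using assms by (cases "a = 0"; simp add: ln_realpow)+

locale er_counts = er_model A B Q D d
  for A :: "'a set" and B :: "'b set" and Q D d +
  fixes R :: "('b \<times> 'b) set" and m :: "nat \<Rightarrow> 'b \<Rightarrow> 'b \<Rightarrow> nat" and u :: "nat \<Rightarrow> 'a \<Rightarrow> nat"
  assumes R: "linear_order_on B R" and adapted: "adapted A B R (\<lambda>x x'. D (x, x')) Q m u"
begin

abbreviation OP where "OP \<equiv> ordered_pairs B R"
abbreviation M where "M n \<equiv> total_count B R (m n)"

text \<open>The common log-probability, in the independent model, of all configurations with the
  prescribed counts.\<close>

definition log_weight :: "nat \<Rightarrow> real" where
  "log_weight n = (\<Sum>t\<in>A. real (u n t) * ln (Q t)) + (\<Sum>(x, x')\<in>OP. real (m n x x') * ln (D (x, x') / real n))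
     + real ((n choose 2) - M n) * ln (1 - d / real n)"

text \<open>The exponential growth rate of the number of all graphs with the prescribed counts,
  after removal of the factor n^M. It is also the part of the rate function from which the BC
  entropy is subtracted.\<close>

definition free_entropy :: real where
  "free_entropy = entropy_on A Q + (\<Sum>(x, x')\<in>B \<times> B. s_fun (D (x, x')))"

lemma adaptedD:
  "\<And>n x x'. x \<in> B \<Longrightarrow> x' \<in> B \<Longrightarrow> m n x x' = m n x' x"
  "\<And>n. M n \<le> n choose 2" "\<And>n. (\<Sum>t\<in>A. u n t) = n"
  "\<And>x. x \<in> B \<Longrightarrow> (\<lambda>n. real (m n x x) / real n) \<longlonglongrightarrow> D (x, x) / 2"
  "\<And>x x'. x \<in> B \<Longrightarrow> x' \<in> B \<Longrightarrow> x \<noteq> x' \<Longrightarrow> (\<lambda>n. real (m n x x') / real n) \<longlonglongrightarrow> D (x, x')"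
  "\<And>t. t \<in> A \<Longrightarrow> (\<lambda>n. real (u n t) / real n) \<longlonglongrightarrow> Q t"
  "\<And>x x' n. x \<in> B \<Longrightarrow> x' \<in> B \<Longrightarrow> D (x, x') = 0 \<Longrightarrow> m n x x' = 0"
  "\<And>t n. t \<in> A \<Longrightarrow> Q t = 0 \<Longrightarrow> u n t = 0"
proof -
  note a1 = adapted[unfolded adapted_def]
  note a2 = conjunct2[OF a1] note a3 = conjunct2[OF a2] note a4 = conjunct2[OF a3]
  note a5 = conjunct2[OF a4] note a6 = conjunct2[OF a5] note a7 = conjunct2[OF a6]
  show "\<And>n x x'. x \<in> B \<Longrightarrow> x' \<in> B \<Longrightarrow> m n x x' = m n x' x"
    using conjunct1[OF a1] by blast
  show "\<And>n. M n \<le> n choose 2" by (rule conjunct1[OF a2, rule_format])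
  show "\<And>n. (\<Sum>t\<in>A. u n t) = n" by (rule conjunct1[OF a3, rule_format])
  show "\<And>x. x \<in> B \<Longrightarrow> (\<lambda>n. real (m n x x) / real n) \<longlonglongrightarrow> D (x, x) / 2"
    by (rule conjunct1[OF a4, rule_format])
  show "\<And>x x'. x \<in> B \<Longrightarrow> x' \<in> B \<Longrightarrow> x \<noteq> x' \<Longrightarrow> (\<lambda>n. real (m n x x') / real n) \<longlonglongrightarrow> D (x, x')"
    by (rule conjunct1[OF a5, rule_format])
  show "\<And>t. t \<in> A \<Longrightarrow> (\<lambda>n. real (u n t) / real n) \<longlonglongrightarrow> Q t"
    by (rule conjunct1[OF a6, rule_format])
  show "\<And>x x' n. x \<in> B \<Longrightarrow> x' \<in> B \<Longrightarrow> D (x, x') = 0 \<Longrightarrow> m n x x' = 0"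
    by (rule conjunct1[OF a7, rule_format])
  show "\<And>t n. t \<in> A \<Longrightarrow> Q t = 0 \<Longrightarrow> u n t = 0"
    by (rule conjunct2[OF a7, rule_format])
qed

lemma OP_subset: "OP \<subseteq> B \<times> B" by (auto simp: ordered_pairs_def)

lemma finite_OP: "finite OP"
  by (rule finite_subset[OF OP_subset]) (simp add: fin_B)

text \<open>The weight depends on the counts alone, as \<open>D\<close> does not see the orientation
  in which an edge is stored. The condition \<open>d < n\<close> makes \<open>1 - d / n\<close>
  positive, so that its power is an exponential; types of weight zero have count zero.\<close>

lemma config_weight:
  assumes c: "c \<in> config_counts A B n (m n) (u n)" and n: "d < real n"
  shows "(\<Prod>p\<in>slots n. slot_weight n p (c p)) = exp (log_weight n)"
proof -
  have cp: "c \<in> PiE (slots n) (slot_vals A B)"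
    and cu: "\<And>t. t \<in> A \<Longrightarrow> card {i\<in>{1..n}. c (i, i) = Inl t} = u n t"
    and cm: "\<And>x x'. x \<in> B \<Longrightarrow> x' \<in> B \<Longrightarrow> card {p\<in>slots n. c p \<in> {Inr (Some (x, x')), Inr (Some (x', x))}} = m n x x'"
    using c by (auto simp: config_counts_def)
  have n0: "0 < real n" using n d_pos by linarith
  let ?S = "{p\<in>slots n. fst p = snd p}" and ?T = "{p\<in>slots n. fst p \<noteq> snd p}"
  have fin: "finite ?S" "finite ?T" using finite_slots by auto
  have split: "(\<Prod>p\<in>slots n. slot_weight n p (c p)) = (\<Prod>p\<in>?S. slot_weight n p (c p)) * (\<Prod>p\<in>?T. slot_weight n p (c p))"
    using fin by (subst prod.union_disjoint[symmetric]) (auto intro!: prod.cong)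
  have val: "c p \<in> slot_vals A B p" if "p \<in> slots n" for p using cp that by auto
  have "(\<Prod>p\<in>?S. slot_weight n p (c p)) = (\<Prod>p\<in>?S. Q (projl (c p)))"
  proof (rule prod.cong[OF refl])
    fix p assume "p \<in> ?S"
    then obtain t where "c p = Inl t" using val[of p] by (auto simp: slot_vals_def)
    then show "slot_weight n p (c p) = Q (projl (c p))" by (simp add: slot_weight_def)
  qed
  also have "\<dots> = (\<Prod>t\<in>A. Q t ^ card {p\<in>?S. projl (c p) = t})"
    by (rule prod_over_fibres[OF fin(1) fin_A]) (use val in \<open>fastforce simp: slot_vals_def\<close>)
  also have "\<dots> = (\<Prod>t\<in>A. Q t ^ u n t)"
  proof (rule prod.cong[OF refl])
    fix t assume t: "t \<in> A"
    have "{p\<in>?S. projl (c p) = t} = (\<lambda>i. (i, i)) ` {i\<in>{1..n}. c (i, i) = Inl t}"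
    proof -
      have "c (i, i) = Inl t \<longleftrightarrow> projl (c (i, i)) = t" if "(i, i) \<in> slots n" for i
        using val[OF that] by (auto simp: slot_vals_def)
      then show ?thesis by (auto simp: slots_def)
    qed
    then show "Q t ^ card {p\<in>?S. projl (c p) = t} = Q t ^ u n t"
      using cu[OF t] by (simp add: card_image inj_on_def)
  qed
  finally have diag: "(\<Prod>p\<in>?S. slot_weight n p (c p)) = (\<Prod>t\<in>A. Q t ^ u n t)" .
  \<comment> \<open>\<open>k\<close> forgets the orientation of an edge, so that its fibres are
    exactly the edge types counted by \<open>m\<close>.\<close>
  define srt where "srt y = (if y \<in> R then y else prod.swap y)" for y :: "'b \<times> 'b"
  define k where "k p = map_option srt (edge_val (c p))" for p
  define g where "g z = (case z of None \<Rightarrow> 1 - d / real n | Some y \<Rightarrow> D y / real n)" for z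
  let ?V = "insert None (Some ` OP)"
  have tot: "(x, x') \<in> R \<or> (x', x) \<in> R" if "x \<in> B" "x' \<in> B" for x x'
    using linear_order_onD(1)[OF R that] .
  have anti: "x = x'" if "(x, x') \<in> R" "(x', x) \<in> R" for x x'
    using linear_order_onD(2)[OF R that] .
  have Tval: "\<exists>z\<in>insert None (Some ` (B \<times> B)). c p = Inr z" if "p \<in> ?T" for p
    using val[of p] that by (auto simp: slot_vals_def)
  have kV: "k ` ?T \<subseteq> ?V"
  proof (rule image_subsetI)
    fix p assume "p \<in> ?T"
    then obtain z where "z \<in> insert None (Some ` (B \<times> B))" "c p = Inr z" using Tval by blast
    moreover have "srt y \<in> OP" if "y \<in> B \<times> B" for y
      using that tot by (cases y) (auto simp: srt_def ordered_pairs_def)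
    ultimately show "k p \<in> ?V" by (auto simp: k_def)
  qed
  have gk: "slot_weight n p (c p) = g (k p)" if pT: "p \<in> ?T" for p
  proof -
    obtain z where "z \<in> insert None (Some ` (B \<times> B))" "c p = Inr z" using Tval[OF pT] by blast
    then show ?thesis using D_swap by (auto simp: k_def g_def srt_def slot_weight_def)
  qed
  have cOP: "card {p\<in>?T. k p = Some (x, x')} = m n x x'" if "(x, x') \<in> OP" for x x'
  proof -
    have B: "x \<in> B" "x' \<in> B" "(x, x') \<in> R" using that by (auto simp: ordered_pairs_def)
    have "{p\<in>?T. k p = Some (x, x')} = {p\<in>slots n. c p \<in> {Inr (Some (x, x')), Inr (Some (x', x))}}"
    proof (rule set_eqI)
      fix p
      have 1: "fst p \<noteq> snd p" if "p \<in> slots n" "c p = Inr z" for z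
        using val[OF that(1)] that(2) by (auto simp: slot_vals_def)
      show "p \<in> {p\<in>?T. k p = Some (x, x')} \<longleftrightarrow> p \<in> {p\<in>slots n. c p \<in> {Inr (Some (x, x')), Inr (Some (x', x))}}"
      proof (cases "p \<in> ?T")
        case True
        then obtain z where z: "z \<in> insert None (Some ` (B \<times> B))" "c p = Inr z" using Tval by blast
        have "map_option srt z = Some (x, x') \<longleftrightarrow> z = Some (x, x') \<or> z = Some (x', x)"
          using B z(1) tot anti by (cases z) (auto simp: srt_def split: if_splits)
        then show ?thesis using True z(2) by (simp add: k_def)
      next
        case False
        then show ?thesis using 1 by auto
      qed
    qed
    then show ?thesis using cm B by simp
  qed
  have cNone: "card {p\<in>?T. k p = None} = (n choose 2) - M n"
  proof -
    have "n choose 2 = (\<Sum>v\<in>?V. card {p\<in>?T. k p = v})"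
      using card_over_fibres[OF fin(2) _ kV] finite_OP card_offdiag_slots[of n] by simp
    also have "\<dots> = card {p\<in>?T. k p = None} + (\<Sum>v\<in>Some ` OP. card {p\<in>?T. k p = v})"
      using finite_OP by (subst sum.insert) auto
    also have "(\<Sum>v\<in>Some ` OP. card {p\<in>?T. k p = v}) = (\<Sum>y\<in>OP. card {p\<in>?T. k p = Some y})"
      by (subst sum.reindex) (auto simp: inj_on_def)
    also have "\<dots> = M n" unfolding total_count_def using cOP by (intro sum.cong) auto
    finally show ?thesis by simp
  qed
  have "(\<Prod>p\<in>?T. slot_weight n p (c p)) = (\<Prod>p\<in>?T. g (k p))" using gk by (intro prod.cong) auto
  also have "\<dots> = (\<Prod>v\<in>?V. g v ^ card {p\<in>?T. k p = v})"
    using finite_OP by (intro prod_over_fibres[OF fin(2) _ kV]) auto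
  also have "\<dots> = g None ^ ((n choose 2) - M n) * (\<Prod>v\<in>Some ` OP. g v ^ card {p\<in>?T. k p = v})"
    using finite_OP by (subst prod.insert) (auto simp only: cNone finite_imageI)
  also have "(\<Prod>v\<in>Some ` OP. g v ^ card {p\<in>?T. k p = v}) = (\<Prod>y\<in>OP. g (Some y) ^ card {p\<in>?T. k p = Some y})"
    by (subst prod.reindex) (auto simp: inj_on_def)
  also have "\<dots> = (\<Prod>(x, x')\<in>OP. (D (x, x') / real n) ^ m n x x')"
    using cOP by (intro prod.cong) (auto simp: g_def)
  finally have off: "(\<Prod>p\<in>?T. slot_weight n p (c p)) =
      (1 - d / real n) ^ ((n choose 2) - M n) * (\<Prod>(x, x')\<in>OP. (D (x, x') / real n) ^ m n x x')"
    by (simp add: g_def)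
  have e1: "(\<Prod>t\<in>A. Q t ^ u n t) = exp (\<Sum>t\<in>A. real (u n t) * ln (Q t))"
    unfolding exp_sum[OF fin_A]
  proof (rule prod.cong[OF refl])
    fix t assume t: "t \<in> A"
    show "Q t ^ u n t = exp (real (u n t) * ln (Q t))"
      using ln_power_zero[of "Q t" "u n t"] Q_nonneg[OF t] adaptedD(8)[OF t] by (metis exp_ln)
  qed
  have e2: "(\<Prod>(x, x')\<in>OP. (D (x, x') / real n) ^ m n x x') = exp (\<Sum>(x, x')\<in>OP. real (m n x x') * ln (D (x, x') / real n))"
    unfolding exp_sum[OF finite_OP]
  proof (rule prod.cong[OF refl], clarify)
    fix x x' assume xx: "(x, x') \<in> OP"
    then have B: "x \<in> B" "x' \<in> B" by (auto simp: ordered_pairs_def)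
    have "0 \<le> D (x, x') / real n" using D_nonneg B by auto
    moreover have "D (x, x') / real n = 0 \<Longrightarrow> m n x x' = 0" using adaptedD(7)[OF B] n0 by simp
    ultimately show "(D (x, x') / real n) ^ m n x x' = exp (real (m n x x') * ln (D (x, x') / real n))"
      using ln_power_zero[of "D (x, x') / real n" "m n x x'"] by (metis exp_ln)
  qed
  have e3: "(1 - d / real n) ^ ((n choose 2) - M n) = exp (real ((n choose 2) - M n) * ln (1 - d / real n))"
  proof -
    have "0 < 1 - d / real n" using n n0 by (simp add: divide_less_eq)
    then show ?thesis by (simp add: exp_of_nat_mult)
  qed
  show ?thesis unfolding split diag off e1 e2 e3 log_weight_def by (simp add: exp_add mult_ac)
qed

text \<open>The vertex part gives \<open>H(Q)\<close>. Each edge contributes \<open>ln n\<close>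
  through \<open>D / n\<close>, which cancels the subtracted \<open>M ln n\<close>. The empty slots
  give \<open>d / 2\<close>, and since \<open>D\<close> has total mass \<open>d\<close> this
  combines with the remaining edge part to the sum of \<open>s_fun\<close>.\<close>

lemma log_weight_limit:
  "(\<lambda>n. (- log_weight n - real (M n) * ln (real n)) / real n) \<longlonglongrightarrow> free_entropy"
proof -
  define q where "q y = (case y of (x, x') \<Rightarrow> if x = x' then D (x, x) / 2 else D (x, x'))" for y
  have ql: "(\<lambda>n. real (m n x x') / real n) \<longlonglongrightarrow> q (x, x')" if "(x, x') \<in> OP" for x x'
    using adaptedD(4)[of x] adaptedD(5)[of x x'] that by (auto simp: q_def ordered_pairs_def)
  have "(\<lambda>n. real (M n) / real n) \<longlonglongrightarrow> (\<Sum>y\<in>OP. q y)"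
  proof -
    have "(\<lambda>n. \<Sum>(x, x')\<in>OP. real (m n x x') / real n) \<longlonglongrightarrow> (\<Sum>y\<in>OP. q y)"
      using ql by (intro tendsto_sum) auto
    then show ?thesis by (simp add: total_count_def sum_divide_distrib case_prod_unfold)
  qed
  then have rem: "(\<lambda>n. real ((n choose 2) - M n) / (real n)\<^sup>2) \<longlonglongrightarrow> 1 / 2"
    by (rule tendsto_remaining_slots[OF adaptedD(2)])
  let ?g = "\<lambda>n. - (\<Sum>t\<in>A. real (u n t) / real n * ln (Q t)) - (\<Sum>(x, x')\<in>OP. real (m n x x') / real n * ln (D (x, x')))
      - real ((n choose 2) - M n) / (real n)\<^sup>2 * (real n * ln (1 - d / real n))"
  have "(\<lambda>n. \<Sum>y\<in>OP. real (m n (fst y) (snd y)) / real n * ln (D y)) \<longlonglongrightarrow> (\<Sum>y\<in>OP. q y * ln (D y))"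
  proof (intro tendsto_sum tendsto_mult tendsto_const)
    fix y assume "y \<in> OP"
    then show "(\<lambda>n. real (m n (fst y) (snd y)) / real n) \<longlonglongrightarrow> q y" using ql[of "fst y" "snd y"] by simp
  qed
  then have "?g \<longlonglongrightarrow> - (\<Sum>t\<in>A. Q t * ln (Q t)) - (\<Sum>y\<in>OP. q y * ln (D y)) - 1 / 2 * - d"
    unfolding case_prod_unfold prod.collapse
    by (intro tendsto_diff tendsto_minus tendsto_mult rem tendsto_n_ln_one_minus)
      (intro tendsto_sum tendsto_mult tendsto_const adaptedD(6); assumption)
  also have "- (\<Sum>t\<in>A. Q t * ln (Q t)) - (\<Sum>y\<in>OP. q y * ln (D y)) - 1 / 2 * - d = free_entropy"
  proof -
    have "(\<Sum>y\<in>B \<times> B. D y / 2 * ln (D y)) = (\<Sum>y\<in>OP. q y * ln (D y))"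
      unfolding sum_ordered_pairs[OF fin_B R]
    proof (rule sum.cong[OF refl], clarify)
      fix x x' assume "(x, x') \<in> OP"
      then have "D (x', x) = D (x, x')" using D_swap[of "(x, x')"] by (auto simp: ordered_pairs_def)
      then show "(if x = x' then D (x, x) / 2 * ln (D (x, x)) else D (x, x') / 2 * ln (D (x, x')) + D (x', x) / 2 * ln (D (x', x)))
          = q (x, x') * ln (D (x, x'))" by (simp add: q_def)
    qed
    then have "(\<Sum>(x, x')\<in>B \<times> B. s_fun (D (x, x'))) = d / 2 - (\<Sum>y\<in>OP. q y * ln (D y))"
      by (simp add: s_fun_def case_prod_unfold sum_subtractf D_sum flip: sum_divide_distrib)
    then show ?thesis by (simp add: free_entropy_def entropy_on_def)
  qed
  finally have lim: "?g \<longlonglongrightarrow> free_entropy" .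
  have "\<forall>\<^sub>F n in sequentially. ?g n = (- log_weight n - real (M n) * ln (real n)) / real n"
    using eventually_ge_at_top[of 1]
  proof eventually_elim
    case (elim n)
    have n0: "0 < real n" using elim by simp
    have "(\<Sum>(x, x')\<in>OP. real (m n x x') * ln (D (x, x') / real n)) =
        (\<Sum>(x, x')\<in>OP. real (m n x x') * ln (D (x, x')) - real (m n x x') * ln (real n))"
    proof (rule sum.cong[OF refl], clarify)
      fix x x' assume "(x, x') \<in> OP"
      then have B: "x \<in> B" "x' \<in> B" by (auto simp: ordered_pairs_def)
      show "real (m n x x') * ln (D (x, x') / real n) = real (m n x x') * ln (D (x, x')) - real (m n x x') * ln (real n)"
      proof (cases "D (x, x') = 0")
        case True then show ?thesis using adaptedD(7)[OF B] by simp
      next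
        case False
        then have "0 < D (x, x')" using D_nonneg[of "(x, x')"] B by auto
        then show ?thesis using n0 by (simp add: ln_div algebra_simps)
      qed
    qed
    also have "\<dots> = (\<Sum>(x, x')\<in>OP. real (m n x x') * ln (D (x, x'))) - real (M n) * ln (real n)"
      by (simp add: case_prod_unfold sum_subtractf total_count_def sum_distrib_right)
    finally have e: "(\<Sum>(x, x')\<in>OP. real (m n x x') * ln (D (x, x') / real n)) =
        (\<Sum>(x, x')\<in>OP. real (m n x x') * ln (D (x, x'))) - real (M n) * ln (real n)" .
    have "real n * ?g n = - log_weight n - real (M n) * ln (real n)"
    proof -
      have "real n * (\<Sum>t\<in>A. real (u n t) / real n * ln (Q t)) = (\<Sum>t\<in>A. real (u n t) * ln (Q t))"
        unfolding sum_distrib_left using n0 by (intro sum.cong) auto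
      moreover have "real n * (\<Sum>(x, x')\<in>OP. real (m n x x') / real n * ln (D (x, x'))) =
          (\<Sum>(x, x')\<in>OP. real (m n x x') * ln (D (x, x')))"
        unfolding sum_distrib_left using n0 by (intro sum.cong) auto
      moreover have "real n * (real ((n choose 2) - M n) / (real n)\<^sup>2 * (real n * ln (1 - d / real n))) =
          real ((n choose 2) - M n) * ln (1 - d / real n)"
        using n0 by (simp add: power2_eq_square)
      ultimately show ?thesis
        unfolding log_weight_def e by (simp only: right_diff_distrib mult_minus_right)
    qed
    then show ?case using n0 by (simp add: field_simps)
  qed
  then show ?thesis using lim by (rule Lim_transform_eventually[rotated])
qed

text \<open>Equally weighted configurations of total mass at most 1.\<close>

lemma card_config_counts_le:
  assumes n: "d < real n" and "config_counts A B n (m n) (u n) \<noteq> {}"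
  shows "ln (real (card (config_counts A B n (m n) (u n)))) \<le> - log_weight n"
proof -
  let ?C = "config_counts A B n (m n) (u n)"
  have n1: "d \<le> real n" "1 \<le> n" using n d_pos by (simp, cases n, auto)
  have fin: "finite (PiE (slots n) (slot_vals A B))"
    by (intro finite_PiE finite_slots finite_slot_vals fin_A fin_B)
  have sub: "?C \<subseteq> PiE (slots n) (slot_vals A B)" by (auto simp: config_counts_def)
  have "real (card ?C) * exp (log_weight n) = (\<Sum>c\<in>?C. \<Prod>p\<in>slots n. slot_weight n p (c p))"
    using config_weight[OF _ n] by simp
  also have "\<dots> \<le> (\<Sum>c\<in>PiE (slots n) (slot_vals A B). \<Prod>p\<in>slots n. slot_weight n p (c p))"
    using fin sub slot_weight_nonneg[OF n1] by (intro sum_mono2 prod_nonneg) (auto simp: PiE_mem)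
  also have "\<dots> = er_expect n (\<lambda>_. 1)" by (simp add: prod_expect_def)
  also have "\<dots> = 1" by (intro prod_expect_const finite_slots slot_weight_sum n1)
  finally have le: "real (card ?C) * exp (log_weight n) \<le> 1" .
  have "0 < real (card ?C)" using assms(2) finite_subset[OF sub fin] by (simp add: card_gt_0_iff)
  then have "ln (real (card ?C) * exp (log_weight n)) \<le> ln 1" using le by (subst ln_le_cancel_iff) auto
  then show ?thesis using \<open>0 < real (card ?C)\<close> by (simp add: ln_mult_pos)
qed

end

context er_counts begin

section \<open>Many graphs have the given counts\<close>

text \<open>The number of edges of an off-diagonal type is split evenly between its two orientations; this
  loses only a polynomial factor.\<close>

definition split_count :: "nat \<Rightarrow> 'b \<times> 'b \<Rightarrow> nat" where
  "split_count n y = (case y of (x, x') \<Rightarrow> if x = x' then m n x x else if (x, x') \<in> R then m n x x' div 2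
     else m n x x' - m n x x' div 2)"

definition slot_count :: "nat \<Rightarrow> ('b \<times> 'b) option \<Rightarrow> nat" where
  "slot_count n z = (case z of None \<Rightarrow> (n choose 2) - M n | Some y \<Rightarrow> split_count n y)"

lemma split_count_sum:
  fixes F :: "'b \<times> 'b \<Rightarrow> real"
  assumes "\<And>y. y \<in> B \<times> B \<Longrightarrow> F (prod.swap y) = F y"
  shows "(\<Sum>y\<in>B \<times> B. real (split_count n y) * F y) = (\<Sum>(x, x')\<in>OP. real (m n x x') * F (x, x'))"
  unfolding sum_ordered_pairs[OF fin_B R]
proof (rule sum.cong[OF refl], clarify)
  fix x x' assume xx: "(x, x') \<in> OP"
  then have B: "x \<in> B" "x' \<in> B" "(x, x') \<in> R" by (auto simp: ordered_pairs_def)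
  have F: "F (x', x) = F (x, x')" using assms[of "(x, x')"] B by simp
  show "(if x = x' then real (split_count n (x, x)) * F (x, x) else
      real (split_count n (x, x')) * F (x, x') + real (split_count n (x', x)) * F (x', x)) = real (m n x x') * F (x, x')"
  proof (cases "x = x'")
    case False
    then have "(x', x) \<notin> R" using linear_order_onD(2)[OF R B(3)] by blast
    then have "split_count n (x, x') + split_count n (x', x) = m n x x'"
      using False B adaptedD(1)[of x x' n] by (simp add: split_count_def)
    then have "real (split_count n (x, x')) + real (split_count n (x', x)) = real (m n x x')"
      by (metis of_nat_add)
    then have "real (split_count n (x, x')) * F (x, x') + real (split_count n (x', x)) * F (x, x') = real (m n x x') * F (x, x')"
      by (simp only: distrib_right[symmetric])
    then show ?thesis using False F by simp
  qed (simp add: split_count_def)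
qed

lemma sum_split_count: "(\<Sum>y\<in>B \<times> B. split_count n y) = M n"
proof -
  have "real (\<Sum>y\<in>B \<times> B. split_count n y) = real (M n)"
    using split_count_sum[of "\<lambda>_. 1" n] by (simp add: total_count_def case_prod_unfold)
  then show ?thesis by (simp only: of_nat_eq_iff)
qed

lemma split_count_limit:
  assumes "y \<in> B \<times> B"
  shows "(\<lambda>n. real (split_count n y) / real n) \<longlonglongrightarrow> D y / 2"
proof -
  obtain x x' where y: "y = (x, x')" by (cases y)
  have B: "x \<in> B" "x' \<in> B" using assms y by auto
  show ?thesis
  proof (cases "x = x'")
    case True then show ?thesis using adaptedD(4)[OF B(1)] by (simp add: y split_count_def)
  next
    case False
    note lim = adaptedD(5)[OF B False]
    have l1: "(\<lambda>n. real (m n x x') / real n * (1 / 2) - 1 / real n) \<longlonglongrightarrow> D (x, x') * (1 / 2) - 0"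
      by (intro tendsto_diff tendsto_mult tendsto_const lim lim_const_over_n)
    have l2: "(\<lambda>n. real (m n x x') / real n * (1 / 2) + 1 / real n) \<longlonglongrightarrow> D (x, x') * (1 / 2) + 0"
      by (intro tendsto_add tendsto_mult tendsto_const lim lim_const_over_n)
    have b: "real (m n x x') / real n * (1 / 2) - 1 / real n \<le> real (split_count n y) / real n"
      "real (split_count n y) / real n \<le> real (m n x x') / real n * (1 / 2) + 1 / real n" for n
    proof -
      have "2 * split_count n y \<le> m n x x' + 1" "m n x x' \<le> 2 * split_count n y + 1"
        using False by (auto simp: y split_count_def)
      then have h: "real (m n x x') / 2 - 1 \<le> real (split_count n y)" "real (split_count n y) \<le> real (m n x x') / 2 + 1"
        by linarith+
      note divide_right_mono[OF h(1) of_nat_0_le_iff[of n]] divide_right_mono[OF h(2) of_nat_0_le_iff[of n]]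
      moreover have "(real (m n x x') / 2 - 1) / real n = real (m n x x') / real n * (1 / 2) - 1 / real n"
        "(real (m n x x') / 2 + 1) / real n = real (m n x x') / real n * (1 / 2) + 1 / real n"
        by (simp_all only: diff_divide_distrib add_divide_distrib) simp_all
      ultimately show "real (m n x x') / real n * (1 / 2) - 1 / real n \<le> real (split_count n y) / real n"
        "real (split_count n y) / real n \<le> real (m n x x') / real n * (1 / 2) + 1 / real n" by simp_all
    qed
    have "(\<lambda>n. real (split_count n y) / real n) \<longlonglongrightarrow> D (x, x') * (1 / 2)"
      by (rule tendsto_sandwich[OF always_eventually[OF allI[OF b(1)]] always_eventually[OF allI[OF b(2)]]
            l1[unfolded diff_zero] l2[unfolded add_0_right]])
    then show ?thesis by (simp add: y)
  qed
qed

text \<open>Vertex marks and oriented edge slots can be chosen independently of each other; choosing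
  the orientations according to \<open>slot_count\<close> yields the required unoriented
  counts.\<close>

lemma card_config_counts_ge:
  "card (with_fibres {1..n} A (u n)) *
    card (with_fibres {p\<in>slots n. fst p \<noteq> snd p} (insert None (Some ` (B \<times> B))) (slot_count n))
    \<le> card (config_counts A B n (m n) (u n))"
proof -
  let ?T = "{p\<in>slots n. fst p \<noteq> snd p}" and ?V = "insert None (Some ` (B \<times> B))"
  let ?X = "with_fibres {1..n} A (u n)" and ?Y = "with_fibres ?T ?V (slot_count n)"
  define h where "h = (\<lambda>(f, g). \<lambda>p\<in>slots n. if fst p = snd p then (Inl (f (fst p)) :: 'a + ('b \<times> 'b) option) else Inr (g p))"
  have "card (?X \<times> ?Y) \<le> card (config_counts A B n (m n) (u n))"
  proof (rule card_inj_on_le[of h])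
    show "inj_on h (?X \<times> ?Y)"
    proof (rule inj_onI, clarify)
      fix f g f' g' assume fg: "f \<in> ?X" "g \<in> ?Y" "f' \<in> ?X" "g' \<in> ?Y" and eq: "h (f, g) = h (f', g')"
      have E: "f \<in> {1..n} \<rightarrow>\<^sub>E A" "f' \<in> {1..n} \<rightarrow>\<^sub>E A" "g \<in> ?T \<rightarrow>\<^sub>E ?V" "g' \<in> ?T \<rightarrow>\<^sub>E ?V"
        using fg unfolding with_fibres_def by blast+
      have "f i = f' i" for i
      proof (cases "i \<in> {1..n}")
        case True
        then have "(i, i) \<in> slots n" by (auto simp: slots_def)
        then show ?thesis using fun_cong[OF eq, of "(i, i)"] by (simp add: h_def)
      next
        case False
        show ?thesis by (simp only: PiE_arb[OF E(1) False] PiE_arb[OF E(2) False])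
      qed
      moreover have "g p = g' p" for p
      proof (cases "p \<in> ?T")
        case True
        then show ?thesis using fun_cong[OF eq, of p] by (simp add: h_def)
      next
        case False
        show ?thesis by (simp only: PiE_arb[OF E(3) False] PiE_arb[OF E(4) False])
      qed
      ultimately show "f = f' \<and> g = g'" by (intro conjI ext)
    qed
    show "h ` (?X \<times> ?Y) \<subseteq> config_counts A B n (m n) (u n)"
    proof (rule image_subsetI)
      fix z assume "z \<in> ?X \<times> ?Y"
      then obtain f g where z: "z = (f, g)" and f: "f \<in> ?X" and g: "g \<in> ?Y" by (rule SigmaE)
      have fm: "f i \<in> A" if "i \<in> {1..n}" for i
        using f that unfolding with_fibres_def by blast
      have gm: "g p \<in> ?V" if "p \<in> ?T" for p
        using g that unfolding with_fibres_def by blast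
      have gc: "card {p\<in>?T. g p = Some y} = split_count n y" if "y \<in> B \<times> B" for y
        using g that by (auto simp: with_fibres_def slot_count_def)
      have "h z \<in> PiE (slots n) (slot_vals A B)"
      proof (rule PiE_I)
        fix p assume p: "p \<in> slots n"
        then have "fst p \<in> {1..n}" by (auto simp: slots_def)
        then show "h z p \<in> slot_vals A B p" using p fm gm[of p] by (auto simp: h_def z slot_vals_def)
      qed (auto simp: h_def z)
      moreover have "card {i\<in>{1..n}. h z (i, i) = Inl t} = u n t" if "t \<in> A" for t
      proof -
        have "{i\<in>{1..n}. h z (i, i) = Inl t} = {i\<in>{1..n}. f i = t}" by (auto simp: h_def z slots_def)
        then show ?thesis using f that by (simp add: with_fibres_def)
      qed
      moreover have "card {p\<in>slots n. h z p \<in> {Inr (Some (x, x')), Inr (Some (x', x))}} = m n x x'"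
        if "x \<in> B" "x' \<in> B" for x x'
      proof -
        have eq: "{p\<in>slots n. h z p \<in> {Inr (Some (x, x')), Inr (Some (x', x))}} =
            {p\<in>?T. g p = Some (x, x')} \<union> {p\<in>?T. g p = Some (x', x)}"
          by (auto simp: h_def z)
        show ?thesis
        proof (cases "x = x'")
          case True
          then show ?thesis unfolding eq using gc[of "(x, x)"] that by (simp add: split_count_def)
        next
          case False
          have "card ({p\<in>?T. g p = Some (x, x')} \<union> {p\<in>?T. g p = Some (x', x)}) = split_count n (x, x') + split_count n (x', x)"
            using gc[of "(x, x')"] gc[of "(x', x)"] that False finite_slots
            by (subst card_Un_disjoint) auto
          also have "\<dots> = m n x x'"
            using False linear_order_onD[OF R] that adaptedD(1)[OF that, of n] by (auto simp: split_count_def)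
          finally show ?thesis unfolding eq .
        qed
      qed
      ultimately show "h z \<in> config_counts A B n (m n) (u n)" by (simp add: config_counts_def)
    qed
    show "finite (config_counts A B n (m n) (u n))" by (rule finite_config_counts[OF fin_A fin_B])
  qed
  then show ?thesis by (simp add: card_cartesian_product)
qed

text \<open>Multiplies the two multinomial lower bounds, for vertices and for slots: in the
  independent model the exact counts occur with a probability that is not exponentially
  small.\<close>

lemma card_config_counts_asymptotics:
  assumes "0 < \<theta>"
  shows "\<forall>\<^sub>F n in sequentially. exp (- \<theta> * real n) \<le> real (card (config_counts A B n (m n) (u n))) * exp (log_weight n)"
proof -
  have v: "\<forall>\<^sub>F n in sequentially. - (\<theta> / 2 * real n) \<le>
      ln (fact n) - (\<Sum>t\<in>A. ln (fact (u n t))) + (\<Sum>t\<in>A. real (u n t) * ln (Q t))"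
    using vertex_count_asymptotics[OF fin_A adaptedD(6) adaptedD(3) adaptedD(8) Q_nonneg half_gt_zero[OF assms]] .
  have e: "\<forall>\<^sub>F n in sequentially. - (\<theta> / 2 * real n) \<le>
      ln (fact (n choose 2)) - ln (fact ((n choose 2) - (\<Sum>y\<in>B \<times> B. split_count n y))) -
      (\<Sum>y\<in>B \<times> B. ln (fact (split_count n y))) + (\<Sum>y\<in>B \<times> B. real (split_count n y) * ln (D y / real n)) +
      real ((n choose 2) - (\<Sum>y\<in>B \<times> B. split_count n y)) * ln (1 - d / real n)"
  proof (rule edge_count_asymptotics)
    show "split_count n y = 0" if "y \<in> B \<times> B" "D y = 0" for y n
      using that adaptedD(7)[of "fst y" "snd y" n] by (auto simp: split_count_def)
  qed (use fin_B split_count_limit sum_split_count adaptedD(2) D_nonneg D_sum assms in auto)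
  show ?thesis using v e
  proof eventually_elim
    case (elim n)
    let ?T = "{p\<in>slots n. fst p \<noteq> snd p}" and ?V = "insert None (Some ` (B \<times> B))"
    let ?X = "with_fibres {1..n} A (u n)" and ?Y = "with_fibres ?T ?V (slot_count n)"
    have "fact (card {1..n}) \<le> card ?X * (\<Prod>t\<in>A. fact (u n t))"
      by (rule fact_le_card_with_fibres) (simp_all add: fin_A adaptedD(3))
    then have "real (fact (card {1..n})) \<le> real (card ?X * (\<Prod>t\<in>A. fact (u n t)))"
      by (simp only: of_nat_le_iff)
    then have 1: "fact n \<le> real (card ?X) * (\<Prod>t\<in>A. fact (u n t))"
      by (simp only: card_atLeastAtMost diff_Suc_1 of_nat_mult of_nat_prod of_nat_fact)
    have sV: "(\<Sum>z\<in>?V. slot_count n z) = n choose 2"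
    proof -
      have "(\<Sum>z\<in>?V. slot_count n z) = slot_count n None + (\<Sum>z\<in>Some ` (B \<times> B). slot_count n z)"
        using fin_B by (subst sum.insert) auto
      also have "(\<Sum>z\<in>Some ` (B \<times> B). slot_count n z) = (\<Sum>y\<in>B \<times> B. split_count n y)"
        by (subst sum.reindex) (auto simp: slot_count_def)
      finally show ?thesis using adaptedD(2)[of n] by (simp add: sum_split_count slot_count_def)
    qed
    have pV: "(\<Prod>z\<in>?V. fact (slot_count n z)) = (fact ((n choose 2) - M n) * (\<Prod>y\<in>B \<times> B. fact (split_count n y)) :: nat)"
    proof -
      have "(\<Prod>z\<in>?V. fact (slot_count n z)) = (fact (slot_count n None) * (\<Prod>z\<in>Some ` (B \<times> B). fact (slot_count n z)) :: nat)"
        using fin_B by (subst prod.insert) auto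
      also have "(\<Prod>z\<in>Some ` (B \<times> B). fact (slot_count n z)) = (\<Prod>y\<in>B \<times> B. fact (split_count n y) :: nat)"
        by (subst prod.reindex) (auto simp: slot_count_def)
      finally show ?thesis by (simp add: slot_count_def)
    qed
    have "fact (card ?T) \<le> card ?Y * (\<Prod>z\<in>?V. fact (slot_count n z))"
      by (rule fact_le_card_with_fibres) (use fin_B finite_slots sV card_offdiag_slots in auto)
    then have "fact (n choose 2) \<le> card ?Y * (fact ((n choose 2) - M n) * (\<Prod>y\<in>B \<times> B. fact (split_count n y)))"
      by (simp only: card_offdiag_slots pV)
    then have "real (fact (n choose 2)) \<le> real (card ?Y * (fact ((n choose 2) - M n) * (\<Prod>y\<in>B \<times> B. fact (split_count n y))))"
      by (simp only: of_nat_le_iff)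
    then have 2: "fact (n choose 2) \<le> real (card ?Y) * (fact ((n choose 2) - M n) * (\<Prod>y\<in>B \<times> B. fact (split_count n y)))"
      by (simp only: of_nat_mult of_nat_prod of_nat_fact)
    have X0: "0 < real (card ?X)"
    proof (rule ccontr)
      assume "\<not> 0 < real (card ?X)"
      then have "card ?X = 0" by simp
      then show False using 1 fact_gt_zero[of n, where ?'a = real] by (simp only: of_nat_0 mult_zero_left)
    qed
    have Y0: "0 < real (card ?Y)"
    proof (rule ccontr)
      assume "\<not> 0 < real (card ?Y)"
      then have "card ?Y = 0" by simp
      then show False using 2 fact_gt_zero[of "n choose 2", where ?'a = real] by (simp only: of_nat_0 mult_zero_left)
    qed
    have fp: "0 < (\<Prod>t\<in>A. fact (u n t) :: real)" "0 < (\<Prod>y\<in>B \<times> B. fact (split_count n y) :: real)"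
      by (simp_all add: prod_pos)
    have "ln (fact n) \<le> ln (real (card ?X) * (\<Prod>t\<in>A. fact (u n t)))"
      using 1 X0 fp by (subst ln_le_cancel_iff) auto
    also have "\<dots> = ln (real (card ?X)) + (\<Sum>t\<in>A. ln (fact (u n t)))"
      using X0 fp fin_A by (simp add: ln_mult_pos ln_prod)
    finally have l1: "ln (fact n) \<le> ln (real (card ?X)) + (\<Sum>t\<in>A. ln (fact (u n t)))" .
    have "ln (fact (n choose 2)) \<le> ln (real (card ?Y) * (fact ((n choose 2) - M n) * (\<Prod>y\<in>B \<times> B. fact (split_count n y))))"
      using 2 Y0 fp by (subst ln_le_cancel_iff) auto
    also have "\<dots> = ln (real (card ?Y)) + (ln (fact ((n choose 2) - M n)) + (\<Sum>y\<in>B \<times> B. ln (fact (split_count n y))))"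
      using Y0 fp fin_B by (simp add: ln_mult_pos ln_prod)
    finally have l2: "ln (fact (n choose 2)) \<le> ln (real (card ?Y)) + (ln (fact ((n choose 2) - M n)) + (\<Sum>y\<in>B \<times> B. ln (fact (split_count n y))))" .
    have sw: "(\<Sum>y\<in>B \<times> B. real (split_count n y) * ln (D y / real n)) = (\<Sum>(x, x')\<in>OP. real (m n x x') * ln (D (x, x') / real n))"
      by (rule split_count_sum) (simp add: D_swap)
    have "- \<theta> * real n \<le> ln (real (card ?X)) + ln (real (card ?Y)) + log_weight n"
      using elim l1 l2 unfolding log_weight_def sum_split_count sw by linarith
    then have "exp (- \<theta> * real n) \<le> exp (ln (real (card ?X)) + ln (real (card ?Y)) + log_weight n)" by simp
    also have "\<dots> = real (card ?X * card ?Y) * exp (log_weight n)" using X0 Y0 by (simp add: exp_add)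
    also have "\<dots> \<le> real (card (config_counts A B n (m n) (u n))) * exp (log_weight n)"
      using card_config_counts_ge by (intro mult_right_mono) (simp_all only: of_nat_le_iff exp_ge_zero)
    finally show ?case .
  qed
qed

end

section \<open>Typical graphs with given counts\<close>

context er_counts begin

definition good_configs :: "nat \<Rightarrow> nat \<Rightarrow> ('a, 'b) gw_sample set \<Rightarrow> real \<Rightarrow> ('a, 'b) config set" where
  "good_configs n h S \<eta> = {c \<in> config_counts A B n (m n) (u n).
     \<forall>s\<in>S. real n * (pattern_limit h s - \<eta>) \<le> real (card (pattern_roots n h s c))}"

text \<open>The configurations violating some frequency bound have exponentially small mass, whereas
  the prescribed counts have a mass decaying more slowly than any exponential. So at least half of
  the mass with these counts is good, and equal weights turn mass into cardinality.\<close>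

lemma card_good_configs:
  assumes S: "finite S" "\<And>s. s \<in> S \<Longrightarrow> marks_ok h s" and "0 < \<eta>" "0 < \<theta>"
  shows "\<forall>\<^sub>F n in sequentially. exp (- \<theta> * real n) \<le> 2 * (real (card (good_configs n h S \<eta>)) * exp (log_weight n))"
proof -
  let ?bad = "\<lambda>n s c. real (card (pattern_roots n h s c)) < real n * (pattern_limit h s - \<eta>)"
  have "\<exists>\<kappa>. 0 < \<kappa> \<and> (\<forall>\<^sub>F n in sequentially. er_expect n (\<lambda>c. of_bool (?bad n s c)) \<le> exp (- \<kappa> * real n))" if "s \<in> S" for s
    using pattern_roots_lower_tail[OF S(2)[OF that] \<open>0 < \<eta>\<close>] by blast
  then have "\<forall>s\<in>S. \<exists>\<kappa>. 0 < \<kappa> \<and> (\<forall>\<^sub>F n in sequentially. er_expect n (\<lambda>c. of_bool (?bad n s c)) \<le> exp (- \<kappa> * real n))"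
    by blast
  then obtain \<kappa> where "\<forall>s\<in>S. 0 < \<kappa> s \<and>
      (\<forall>\<^sub>F n in sequentially. er_expect n (\<lambda>c. of_bool (?bad n s c)) \<le> exp (- \<kappa> s * real n))"
    by (rule bchoice[THEN exE])
  then have \<kappa>: "\<And>s. s \<in> S \<Longrightarrow> 0 < \<kappa> s"
    "\<And>s. s \<in> S \<Longrightarrow> \<forall>\<^sub>F n in sequentially. er_expect n (\<lambda>c. of_bool (?bad n s c)) \<le> exp (- \<kappa> s * real n)"
    by blast+
  \<comment> \<open>The smallest of the finitely many rates; the entry 1 covers an empty
    \<open>S\<close>.\<close>
  define k where "k = Min (insert 1 (\<kappa> ` S))"
  have k: "0 < k" "\<And>s. s \<in> S \<Longrightarrow> k \<le> \<kappa> s" using S(1) \<kappa>(1) by (auto simp: k_def)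
  \<comment> \<open>With a rate of at most \<open>k / 2\<close> for the counts, half of the decay of
    the bad mass is left over to absorb \<open>card S\<close> and the factor one half.\<close>
  define \<theta>' where "\<theta>' = min \<theta> (k / 2)"
  have t: "0 < \<theta>'" "\<theta>' \<le> \<theta>" "\<theta>' \<le> k / 2" using \<open>0 < \<theta>\<close> k(1) by (auto simp: \<theta>'_def)
  have ev: "\<forall>\<^sub>F n in sequentially. \<forall>s\<in>S. er_expect n (\<lambda>c. of_bool (?bad n s c)) \<le> exp (- \<kappa> s * real n)"
    using S(1) \<kappa>(2) by (simp add: eventually_ball_finite_distrib)
  have "(\<lambda>n. real (card S) * exp (- (k / 2) * real n)) \<longlonglongrightarrow> real (card S) * 0"
  proof (intro tendsto_mult tendsto_const)
    have "filterlim (\<lambda>n. (k / 2) * real n) at_top sequentially"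
      using k(1) by (intro filterlim_tendsto_pos_mult_at_top[OF tendsto_const]) (auto simp: filterlim_real_sequentially)
    then have "filterlim (\<lambda>n. - ((k / 2) * real n)) at_bot sequentially"
      by (simp add: filterlim_uminus_at_top)
    then show "(\<lambda>n. exp (- (k / 2) * real n)) \<longlonglongrightarrow> 0"
      using filterlim_compose[OF exp_at_bot] by simp
  qed
  then have sm: "\<forall>\<^sub>F n in sequentially. real (card S) * exp (- (k / 2) * real n) < 1 / 2"
    by (intro order_tendstoD) auto
  show ?thesis
    using card_config_counts_asymptotics[OF t(1)] ev sm eventually_gt_at_top[of "nat \<lceil>d\<rceil>"]
  proof eventually_elim
    case (elim n)
    let ?C = "config_counts A B n (m n) (u n)" and ?P = "PiE (slots n) (slot_vals A B)"
    let ?w = "\<lambda>c. \<Prod>p\<in>slots n. slot_weight n p (c p)"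
    have nd: "d < real n" using elim(4) by linarith
    have n: "d \<le> real n" "1 \<le> n" using nd d_pos by (simp, cases n, auto)
    have fC: "finite ?C" by (rule finite_config_counts[OF fin_A fin_B])
    have fP: "finite ?P" by (intro finite_PiE finite_slots finite_slot_vals fin_A fin_B)
    have CP: "?C \<subseteq> ?P" unfolding config_counts_def by (rule Collect_subset)
    have w0: "0 \<le> ?w c" if "c \<in> ?P" for c
      using that by (intro prod_nonneg slot_weight_nonneg[OF n]) (auto simp: PiE_mem)
    let ?Bd = "{c \<in> ?C. \<exists>s\<in>S. ?bad n s c}"
    have split: "?C = good_configs n h S \<eta> \<union> ?Bd" by (auto simp: good_configs_def not_less)
    have "real (card ?Bd) * exp (log_weight n) = (\<Sum>c\<in>?Bd. ?w c)"
      using config_weight[OF _ nd] by simp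
    also have "\<dots> \<le> (\<Sum>c\<in>?P. ?w c * (\<Sum>s\<in>S. of_bool (?bad n s c)))"
    proof -
      have "(\<Sum>c\<in>?Bd. ?w c) \<le> (\<Sum>c\<in>?Bd. ?w c * (\<Sum>s\<in>S. of_bool (?bad n s c)))"
      proof (rule sum_mono)
        fix c assume c: "c \<in> ?Bd"
        then obtain s where s: "s \<in> S" "?bad n s c" by blast
        have "(1::real) = of_bool (?bad n s c)" using s by simp
        also have "\<dots> \<le> (\<Sum>s\<in>S. of_bool (?bad n s c))" using s(1) S(1) by (intro member_le_sum) auto
        finally have "?w c * 1 \<le> ?w c * (\<Sum>s\<in>S. of_bool (?bad n s c))"
          using c CP w0 by (intro mult_left_mono) auto
        then show "?w c \<le> ?w c * (\<Sum>s\<in>S. of_bool (?bad n s c))" by simp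
      qed
      also have "\<dots> \<le> (\<Sum>c\<in>?P. ?w c * (\<Sum>s\<in>S. of_bool (?bad n s c)))"
        using fP CP w0 by (intro sum_mono2 mult_nonneg_nonneg sum_nonneg) auto
      finally show ?thesis .
    qed
    also have "\<dots> = (\<Sum>s\<in>S. er_expect n (\<lambda>c. of_bool (?bad n s c)))"
      unfolding prod_expect_sum[symmetric] by (simp only: prod_expect_def)
    also have "\<dots> \<le> (\<Sum>s\<in>S. exp (- k * real n))"
    proof (rule sum_mono)
      fix s assume s: "s \<in> S"
      have "k * real n \<le> \<kappa> s * real n" using k(2)[OF s] by (intro mult_right_mono) auto
      then have "exp (- \<kappa> s * real n) \<le> exp (- k * real n)" by simp
      then show "er_expect n (\<lambda>c. of_bool (?bad n s c)) \<le> exp (- k * real n)"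
        by (rule order_trans[OF bspec[OF elim(2) s]])
    qed
    also have "\<dots> = real (card S) * exp (- (k / 2) * real n) * exp (- (k / 2) * real n)"
      by (simp add: exp_add[symmetric])
    also have "\<dots> \<le> 1 / 2 * exp (- \<theta>' * real n)"
    proof (rule mult_mono)
      have "\<theta>' * real n \<le> k / 2 * real n" using t(3) by (intro mult_right_mono) auto
      then show "exp (- (k / 2) * real n) \<le> exp (- \<theta>' * real n)" by simp
    qed (use elim(3) in auto)
    finally have bd: "real (card ?Bd) * exp (log_weight n) \<le> 1 / 2 * exp (- \<theta>' * real n)" .
    have "exp (- \<theta>' * real n) \<le> real (card ?C) * exp (log_weight n)" by (rule elim(1))
    also have "card ?C \<le> card (good_configs n h S \<eta>) + card ?Bd"
      using card_Un_le[of "good_configs n h S \<eta>" ?Bd] split by simp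
    then have "real (card ?C) * exp (log_weight n) \<le> (real (card (good_configs n h S \<eta>)) + real (card ?Bd)) * exp (log_weight n)"
      by (intro mult_right_mono) (simp_all flip: of_nat_add)
    finally have "exp (- \<theta>' * real n) \<le> 2 * (real (card (good_configs n h S \<eta>)) * exp (log_weight n))"
      using bd by (simp add: distrib_right)
    moreover have "exp (- \<theta> * real n) \<le> exp (- \<theta>' * real n)"
      using t(2) mult_right_mono[of \<theta>' \<theta> "real n"] by simp
    ultimately show ?case by linarith
  qed
qed

end

section \<open>The BC entropy\<close>

lemma finite_graphs_with_counts:
  assumes "finite A" "finite B"
  shows "finite (graphs_with_counts A B n m u)" and "card (graphs_with_counts A B n m u) \<le> card (config_counts A B n m u)"
proof -
  have inj: "inj_on (config_of n) (graphs_with_counts A B n m u)"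
    by (rule inj_on_inverseI[of _ "graph_of n"]) (rule graph_of_config_of)
  have sub: "config_of n ` graphs_with_counts A B n m u \<subseteq> config_counts A B n m u"
    using config_of_counts by blast
  show "finite (graphs_with_counts A B n m u)"
    using inj_on_finite[OF inj sub finite_config_counts[OF assms]] .
  show "card (graphs_with_counts A B n m u) \<le> card (config_counts A B n m u)"
    by (rule card_inj_on_le[OF inj sub finite_config_counts[OF assms]])
qed

lemma ln_card_mono: "S \<subseteq> T \<Longrightarrow> finite T \<Longrightarrow> ln_card S \<le> ln_card T"
proof -
  assume S: "S \<subseteq> T" "finite T"
  show "ln_card S \<le> ln_card T"
  proof (cases "S = {}")
    case False
    then have "T \<noteq> {}" "0 < card S" "card S \<le> card T"
      using S finite_subset[OF S] by (auto simp: card_gt_0_iff intro: card_mono)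
    then show ?thesis using False by (auto simp: ln_card_def)
  qed (simp add: ln_card_def)
qed

lemma tendsto_at_right_0_INF:
  fixes f :: "real \<Rightarrow> ereal"
  assumes "\<And>a b. 0 < a \<Longrightarrow> a \<le> b \<Longrightarrow> f a \<le> f b"
  shows "(f \<longlongrightarrow> (INF e\<in>{0<..}. f e)) (at_right 0)"
proof (rule order_tendstoI)
  fix a assume a: "a < (INF e\<in>{0<..}. f e)"
  have "\<forall>\<^sub>F e in at_right (0::real). 0 < e" by (rule eventually_at_right_less)
  then show "\<forall>\<^sub>F e in at_right 0. a < f e"
  proof eventually_elim
    case (elim e)
    then show ?case using a by (auto intro: less_le_trans INF_lower)
  qed
next
  fix a assume "(INF e\<in>{0<..}. f e) < a"
  then obtain e0 where e0: "0 < e0" "f e0 < a" by (auto simp: INF_less_iff)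
  have "\<forall>\<^sub>F e in at_right (0::real). e \<in> {0<..<e0}" using e0(1) by (rule eventually_at_right_real)
  then show "\<forall>\<^sub>F e in at_right 0. f e < a"
  proof eventually_elim
    case (elim e)
    then show ?case using assms[of e e0] e0(2) by auto
  qed
qed

text \<open>\<open>Lim\<close> is a description operator and carries information only once
  convergence is known. Monotonicity in the radius provides it and identifies the limit as an
  infimum, so that both bounds can be proved at a fixed radius.\<close>

lemma bc_entropy_along_INF:
  fixes A :: "'a::metric_space set" and B :: "'b::metric_space set"
  assumes "finite A" "finite B"
  shows "bc_entropy_along A B R m u \<mu> = (INF \<epsilon>\<in>{0<..}. limsup (\<lambda>n. ereal (1 / real n) *
     (ln_card {G \<in> graphs_with_counts A B n (m n) (u n). levy_prokhorov (empirical G) \<mu> < \<epsilon>}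
       - ereal (real (total_count B R (m n)) * ln (real n)))))"
  unfolding bc_entropy_along_def
proof (rule tendsto_Lim[OF _ tendsto_at_right_0_INF])
  fix a b :: real assume "0 < a" "a \<le> b"
  show "limsup (\<lambda>n. ereal (1 / real n) *
     (ln_card {G \<in> graphs_with_counts A B n (m n) (u n). levy_prokhorov (empirical G) \<mu> < a}
       - ereal (real (total_count B R (m n)) * ln (real n)))) \<le> limsup (\<lambda>n. ereal (1 / real n) *
     (ln_card {G \<in> graphs_with_counts A B n (m n) (u n). levy_prokhorov (empirical G) \<mu> < b}
       - ereal (real (total_count B R (m n)) * ln (real n))))"
  proof (rule Limsup_mono, rule always_eventually, rule allI)
    fix n
    have "ln_card {G \<in> graphs_with_counts A B n (m n) (u n). levy_prokhorov (empirical G) \<mu> < a} \<le>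
        ln_card {G \<in> graphs_with_counts A B n (m n) (u n). levy_prokhorov (empirical G) \<mu> < b}"
      using \<open>a \<le> b\<close> finite_graphs_with_counts(1)[OF assms] by (intro ln_card_mono) auto
    then show "ereal (1 / real n) *
     (ln_card {G \<in> graphs_with_counts A B n (m n) (u n). levy_prokhorov (empirical G) \<mu> < a}
       - ereal (real (total_count B R (m n)) * ln (real n))) \<le> ereal (1 / real n) *
     (ln_card {G \<in> graphs_with_counts A B n (m n) (u n). levy_prokhorov (empirical G) \<mu> < b}
       - ereal (real (total_count B R (m n)) * ln (real n)))"
      by (intro ereal_mult_left_mono ereal_minus_mono) auto
  qed
qed simp

text \<open>Already the number of all graphs with the prescribed counts grows no faster, so
  restricting to a ball around \<open>\<mu>\<close> can only decrease it; the radius 1 is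
  arbitrary.\<close>

lemma bc_entropy_along_le:
  fixes A :: "'a::metric_space set" and B :: "'b::metric_space set"
  assumes "er_counts A B Q D d R m u"
  shows "bc_entropy_along A B R m u \<mu> \<le> ereal (er_counts.free_entropy A B Q D)"
proof -
  interpret er_counts A B Q D d R m u by fact
  let ?S = "\<lambda>n. {G \<in> graphs_with_counts A B n (m n) (u n). levy_prokhorov (empirical G) \<mu> < 1}"
  let ?L = "\<lambda>n. ereal (1 / real n) * (ln_card (?S n) - ereal (real (M n) * ln (real n)))"
  have "limsup ?L \<le> limsup (\<lambda>n. ereal ((- log_weight n - real (M n) * ln (real n)) / real n))"
  proof (rule Limsup_mono)
    show "\<forall>\<^sub>F n in sequentially. ?L n \<le> ereal ((- log_weight n - real (M n) * ln (real n)) / real n)"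
      using eventually_gt_at_top[of "nat \<lceil>d\<rceil>"]
    proof eventually_elim
      case (elim n)
      then have nd: "d < real n" by linarith
      have n0: "0 < real n" using nd d_pos by linarith
      let ?C = "config_counts A B n (m n) (u n)" and ?G = "graphs_with_counts A B n (m n) (u n)"
      show ?case
      proof (cases "?S n = {}")
        case True
        then show ?thesis using n0 unfolding True by (simp add: ln_card_def)
      next
        case False
        have fG: "finite ?G" by (rule finite_graphs_with_counts(1)[OF fin_A fin_B])
        have "card (?S n) \<le> card ?G" using fG by (intro card_mono) auto
        also have "\<dots> \<le> card ?C" by (rule finite_graphs_with_counts(2)[OF fin_A fin_B])
        finally have le: "card (?S n) \<le> card ?C" .
        have pos: "0 < card (?S n)" using False fG by (auto simp: card_gt_0_iff)
        then have "?C \<noteq> {}" using le by auto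
        have "ln (real (card (?S n))) \<le> ln (real (card ?C))" using le pos by simp
        also have "\<dots> \<le> - log_weight n" by (rule card_config_counts_le[OF nd \<open>?C \<noteq> {}\<close>])
        finally have "(ln (real (card (?S n))) - real (M n) * ln (real n)) / real n \<le>
            (- log_weight n - real (M n) * ln (real n)) / real n"
          using n0 by (intro divide_right_mono) auto
        then show ?thesis using False unfolding ln_card_def by simp
      qed
    qed
  qed
  also have "\<dots> = ereal free_entropy"
    by (rule lim_imp_Limsup) (use log_weight_limit in auto)
  finally have "limsup ?L \<le> ereal free_entropy" .
  then show ?thesis unfolding bc_entropy_along_INF[OF fin_A fin_B]
    by (intro INF_lower2[of 1]) auto
qed

text \<open>The hypothesis isolates what the tree has to provide: for each radius, finitely many
  patterns whose frequencies, if not too small, force the empirical measure into the ball. The good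
  configurations then give the growth rate up to an arbitrary \<open>\<theta>\<close>.\<close>

lemma bc_entropy_along_ge:
  fixes A :: "'a::metric_space set" and B :: "'b::metric_space set"
  assumes "er_counts A B Q D d R m u"
    and typical: "\<And>\<epsilon>. 0 < \<epsilon> \<Longrightarrow> \<exists>h S \<eta>. finite S \<and> 0 < \<eta> \<and> (\<forall>s\<in>S. er_model.marks_ok A B h s) \<and>
      (\<forall>n\<ge>1. \<forall>c\<in>er_counts.good_configs A B Q D d m u n h S \<eta>. levy_prokhorov (empirical (graph_of n c)) \<mu> < \<epsilon>)"
  shows "ereal (er_counts.free_entropy A B Q D) \<le> bc_entropy_along A B R m u \<mu>"
proof -
  interpret er_counts A B Q D d R m u by fact
  show ?thesis unfolding bc_entropy_along_INF[OF fin_A fin_B]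
  proof (rule INF_greatest)
    fix \<epsilon> :: real assume "\<epsilon> \<in> {0<..}"
    then have "0 < \<epsilon>" by simp
    obtain h S \<eta> where S: "finite S" "0 < \<eta>" "\<And>s. s \<in> S \<Longrightarrow> marks_ok h s"
      and good: "\<And>n c. 1 \<le> n \<Longrightarrow> c \<in> good_configs n h S \<eta> \<Longrightarrow> levy_prokhorov (empirical (graph_of n c)) \<mu> < \<epsilon>"
      using typical[OF \<open>0 < \<epsilon>\<close>] by blast
    let ?S = "\<lambda>n. {G \<in> graphs_with_counts A B n (m n) (u n). levy_prokhorov (empirical G) \<mu> < \<epsilon>}"
    let ?L = "\<lambda>n. ereal (1 / real n) * (ln_card (?S n) - ereal (real (M n) * ln (real n)))"
    have "ereal (free_entropy - \<theta>) \<le> limsup ?L" if "0 < \<theta>" for \<theta>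
    proof -
      have cg: "\<forall>\<^sub>F n in sequentially. exp (- \<theta> * real n) \<le> 2 * (real (card (good_configs n h S \<eta>)) * exp (log_weight n))"
        by (rule card_good_configs) (fact S(1), rule S(3), assumption, fact S(2), fact that)
      \<comment> \<open>The term \<open>ln 2 / n\<close> is the cost of the factor 2 in
        \<open>card_good_configs\<close>.\<close>
      let ?g = "\<lambda>n. (- log_weight n - real (M n) * ln (real n)) / real n - \<theta> - ln 2 / real n"
      have "?g \<longlonglongrightarrow> free_entropy - \<theta> - 0"
        by (intro tendsto_diff log_weight_limit tendsto_const lim_const_over_n)
      then have "ereal (free_entropy - \<theta>) = limsup (\<lambda>n. ereal (?g n))"
        by (intro lim_imp_Limsup[symmetric]) auto
      also have "\<dots> \<le> limsup ?L"
      proof (rule Limsup_mono)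
        show "\<forall>\<^sub>F n in sequentially. ereal (?g n) \<le> ?L n"
          using cg eventually_ge_at_top[of 1]
        proof eventually_elim
          case (elim n)
          have n0: "0 < real n" using elim by simp
          let ?K = "good_configs n h S \<eta>"
          have KC: "?K \<subseteq> config_counts A B n (m n) (u n)" unfolding good_configs_def by (rule Collect_subset)
          have inj: "inj_on (graph_of n) ?K"
            by (rule inj_on_inverseI[of _ "config_of n"], rule config_of_graph_of[of _ _ A B])
              (use KC in \<open>auto simp: config_counts_def\<close>)
          have sub: "graph_of n ` ?K \<subseteq> ?S n"
            using graph_of_counts KC good[OF elim(2)] by blast
          have fin: "finite (?S n)" using finite_graphs_with_counts(1)[OF fin_A fin_B] by simp
          have le: "card ?K \<le> card (?S n)" by (rule card_inj_on_le[OF inj sub fin])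
          have K0: "0 < real (card ?K)"
          proof (rule ccontr)
            assume "\<not> 0 < real (card ?K)"
            then have "card ?K = 0" by simp
            then have "exp (- \<theta> * real n) \<le> 0" using elim(1) by simp
            then show False using exp_gt_zero[of "- \<theta> * real n"] by linarith
          qed
          have ne: "?S n \<noteq> {}"
          proof
            assume "?S n = {}"
            then have "card (?S n) = 0" by (simp only: card.empty)
            then show False using K0 le by simp
          qed
          have "- \<theta> * real n = ln (exp (- \<theta> * real n))" by simp
          also have "\<dots> \<le> ln (2 * (real (card ?K) * exp (log_weight n)))"
            using elim(1) K0 by (subst ln_le_cancel_iff) auto
          also have "\<dots> = ln 2 + ln (real (card ?K)) + log_weight n" using K0 by (simp add: ln_mult_pos)
          also have "ln (real (card ?K)) \<le> ln (real (card (?S n)))" using le K0 by simp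
          finally have "- log_weight n - real (M n) * ln (real n) - \<theta> * real n - ln 2 \<le>
              ln (real (card (?S n))) - real (M n) * ln (real n)" by simp
          then have "(- log_weight n - real (M n) * ln (real n) - \<theta> * real n - ln 2) / real n \<le>
              (ln (real (card (?S n))) - real (M n) * ln (real n)) / real n"
            using n0 by (intro divide_right_mono) auto
          moreover have "?g n = (- log_weight n - real (M n) * ln (real n) - \<theta> * real n - ln 2) / real n"
            using n0 by (simp add: diff_divide_distrib)
          ultimately show ?case using ne unfolding ln_card_def by simp
        qed
      qed
      finally show ?thesis .
    qed
    then have lower: "\<And>\<theta>. 0 < \<theta> \<Longrightarrow> ereal (free_entropy - \<theta>) \<le> limsup ?L" .
    show "ereal free_entropy \<le> limsup ?L"
    proof (rule dense_le)
      fix y assume y: "y < ereal free_entropy"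
      show "y \<le> limsup ?L"
      proof (cases y)
        case (real z)
        then show ?thesis using lower[of "free_entropy - z"] y by simp
      qed (use y in auto)
    qed
  qed
qed

lemma levy_prokhorov_commute: "levy_prokhorov M N = levy_prokhorov N M"
  unfolding levy_prokhorov_def by (simp only: conj_commute)

lemma empirical_prob:
  fixes G :: "(nat, 'a::metric_space, 'b::metric_space) mgraph"
  assumes "finite (verts G)" "verts G \<noteq> {}"
  shows "empirical G \<in> prob_measures"
    and "X \<in> sets borel \<Longrightarrow> measure (empirical G) X =
      real (card {v \<in> verts G. iso_class (component G v) v \<in> X}) / real (card (verts G))"
proof -
  let ?U = "uniform_count_measure (verts G)"
  interpret U: prob_space ?U by (rule prob_space_uniform_count_measure[OF assms])
  have m: "(\<lambda>v. iso_class (component G v) v) \<in> borel_measurable ?U"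
    by (rule measurableI) (auto simp: sets_uniform_count_measure space_uniform_count_measure)
  show "empirical G \<in> prob_measures"
    unfolding empirical_def using U.prob_space_distr[OF m] by (simp add: space_prob_algebra)
  assume X: "X \<in> sets borel"
  have "measure (empirical G) X = measure ?U {v \<in> verts G. iso_class (component G v) v \<in> X}"
    unfolding empirical_def measure_distr[OF m X]
    by (rule arg_cong[of _ _ "measure ?U"]) (auto simp: space_uniform_count_measure)
  also have "\<dots> = real (card {v \<in> verts G. iso_class (component G v) v \<in> X}) / real (card (verts G))"
    by (rule measure_uniform_count_measure[OF assms(1)]) auto
  finally show "measure (empirical G) X = real (card {v \<in> verts G. iso_class (component G v) v \<in> X}) / real (card (verts G))" .
qed

context projected_gw begin

section \<open>Graphs with typical neighbourhoods are close to the projected tree\<close>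

abbreviation D where "D y \<equiv> d * sym_emark_prob y"

lemma er_model: "er_model A B vmark_prob D d"
proof
  show "(\<Sum>y\<in>B \<times> B. D y) = d" by (simp add: sum_sym_emark_prob flip: sum_distrib_left)
qed (use fin_A fin_B d_pos in \<open>auto simp: vmark_prob_nonneg sum_vmark_prob sym_emark_prob_nonneg sym_emark_prob_swap\<close>)

lemma patterns_marks_ok:
  assumes "s \<in> patterns h L" shows "er_model.marks_ok A B h s"
  unfolding er_model.marks_ok_def[OF er_model]
  using patterns_normal[OF assms] patterns_marks[OF assms] by (auto simp: inner_words_def)

text \<open>In a Poisson weight \<open>exp (- d) * d ^ k / k!\<close> the power can be distributed
  over the \<open>k\<close> children. Over the whole pattern each edge receives one factor
  \<open>d\<close>, which turns \<open>sym_emark_prob\<close> into \<open>D\<close>.\<close>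

lemma pattern_limit_eq: "er_model.pattern_limit vmark_prob D d h s = pattern_prob h s"
proof -
  let ?W = "gw_ball h s" and ?I = "inner_words h s"
  have t: "card (?W - {[]}) = (\<Sum>w\<in>?I. fst (s w))"
    unfolding sum_offspring_inner using finite_gw_ball[of h s] by simp
  have "pattern_prob h s =
      (\<Prod>w\<in>?W. if length w < h then pmf (poisson_pmf d) (fst (s w)) * vmark_prob (fst (snd (s w))) else 1) *
      (\<Prod>w\<in>?W. if w \<noteq> [] then sym_emark_prob (gw_pair s w) else 1)"
    by (simp only: pattern_prob_def pattern_weight_def prod.distrib)
  also have "(\<Prod>w\<in>?W. if length w < h then pmf (poisson_pmf d) (fst (s w)) * vmark_prob (fst (snd (s w))) else 1) =
      (\<Prod>w\<in>?I. pmf (poisson_pmf d) (fst (s w)) * vmark_prob (fst (snd (s w))))"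
    unfolding inner_words_def by (rule prod.inter_filter[symmetric, OF finite_gw_ball])
  also have "(\<Prod>w\<in>?W. if w \<noteq> [] then sym_emark_prob (gw_pair s w) else 1) = (\<Prod>w\<in>{w\<in>?W. w \<noteq> []}. sym_emark_prob (gw_pair s w))"
    by (rule prod.inter_filter[symmetric, OF finite_gw_ball])
  also have "{w\<in>?W. w \<noteq> []} = ?W - {[]}" by auto
  also have "(\<Prod>w\<in>?I. pmf (poisson_pmf d) (fst (s w)) * vmark_prob (fst (snd (s w)))) =
      (\<Prod>w\<in>?I. d ^ fst (s w)) * (\<Prod>w\<in>?I. exp (- d) * vmark_prob (fst (snd (s w))) / fact (fst (s w)))"
    using d_pos by (simp add: mult_ac flip: prod.distrib)
  also have "(\<Prod>w\<in>?I. d ^ fst (s w)) = d ^ card (?W - {[]})"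
    unfolding t by (rule power_sum[symmetric])
  finally show ?thesis
    unfolding er_model.pattern_limit_def[OF er_model] by (simp add: prod.distrib mult_ac)
qed

text \<open>A Borel set \<open>X\<close> has \<open>rho\<close>-mass at most that of the patterns
  meeting it plus the mass \<open>\<eta>\<close> outside the chosen patterns. Roots of these
  patterns lie in the neighbourhood of \<open>X\<close>, are disjoint for different patterns, and
  are frequent enough; the errors \<open>\<eta> / (1 + card ?S)\<close> add up to at most
  \<open>\<eta>\<close>. One direction suffices by \<open>levy_prokhorov_leI\<close>.\<close>

lemma levy_prokhorov_typical:
  assumes n: "1 \<le> n" and r: "0 < \<delta>" "1 / (1 + real r) + \<delta> < \<epsilon>"
    and mass: "1 - \<eta> < (\<Sum>s\<in>patterns (Suc r) L. pattern_prob (Suc r) s)" and eta: "2 * \<eta> \<le> \<epsilon>" "0 < \<epsilon>" "0 < \<eta>"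
    and good: "\<And>s. s \<in> patterns (Suc r) L \<Longrightarrow>
      real n * (pattern_prob (Suc r) s - \<eta> / (1 + real (card (patterns (Suc r) L)))) \<le> real (card (pattern_roots n (Suc r) s c))"
  shows "levy_prokhorov (empirical (graph_of n c)) rho \<le> \<epsilon>"
proof -
  interpret prob_space gw_measure by (rule prob_gw_measure)
  let ?S = "patterns (Suc r) L" and ?G = "graph_of n c" and ?h = "Suc r"
  let ?E = "pattern_event ?h" and ?V = "\<lambda>s. pattern_roots n ?h s c"
  have vG: "verts ?G = {1..n}" by (simp add: graph_of_def)
  then have fG: "finite (verts ?G)" "verts ?G \<noteq> {}" using n by auto
  have fS: "finite ?S" by (rule finite_patterns)
  have E: "?E s \<in> events" "prob (?E s) = pattern_prob ?h s" if "s \<in> ?S" for s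
    using pattern_event[OF patterns_normal[OF that]] by auto
  have Edisj: "disjoint_family_on ?E T" for T by (auto simp: disjoint_family_on_def pattern_event_def)
  have near: "dist (gw_class (proj \<omega>)) (iso_class (component ?G v) v) < \<epsilon>" "v \<in> {1..n}"
    if s: "s \<in> ?S" "\<omega> \<in> ?E s" "v \<in> ?V s" for s \<omega> v
  proof -
    obtain \<phi> where \<phi>: "\<phi> \<in> placements n ?h s" "embeds n ?h s \<phi> c" "v = \<phi> []"
      using s(3) by (auto simp: pattern_roots_def)
    show v: "v \<in> {1..n}" using \<phi>(1) Nil_in_gw_ball[of ?h s] unfolding \<phi>(3) placements_def by blast
    have "gw_norm ?h (proj \<omega>) = s" using s(2) by (simp add: pattern_event_def)
    then have "near r \<delta> (gw_tree (proj \<omega>), []) (component ?G v, v)"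
      unfolding \<phi>(3) using \<phi>(1,2) r(1) by (intro near_graph_of)
    then show "dist (gw_class (proj \<omega>)) (iso_class (component ?G v) v) < \<epsilon>"
      using v vG r by (intro dist_iso_class_less[OF rooted_connected_gw_tree
            rooted_connected_component[OF simple_graph_of locally_finite_graph_of]]) auto
  qed
  have Vdisj: "?V s \<inter> ?V s' = {}" if "s \<in> ?S" "s' \<in> ?S" "s \<noteq> s'" for s s'
    using that embeds_unique[of n ?h s _ c s'] patterns_normal by (fastforce simp: pattern_roots_def)
  have bad: "prob (- (\<Union>s\<in>?S. ?E s)) \<le> \<eta>"
  proof -
    have "prob (\<Union>s\<in>?S. ?E s) = (\<Sum>s\<in>?S. pattern_prob ?h s)"
      using fS E Edisj by (subst finite_measure_finite_Union) auto
    moreover have "(\<Union>s\<in>?S. ?E s) \<in> events" using fS E(1) by auto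
    ultimately show ?thesis using mass prob_compl[of "\<Union>s\<in>?S. ?E s"] by (simp add: Compl_eq_Diff_UNIV)
  qed
  have "levy_prokhorov rho (empirical ?G) \<le> \<epsilon>"
  proof (rule levy_prokhorov_leI[OF rho_prob empirical_prob(1)[OF fG] eta(2)])
    fix X :: "('a, 'b) gstar set" assume X: "X \<in> sets borel"
    let ?F = "\<lambda>\<omega>. gw_class (proj \<omega>)"
    \<comment> \<open>The patterns some of whose samples land in \<open>X\<close>: all samples and
      all roots with a common pattern are within \<open>\<epsilon>\<close> of each other, so one
      sample in \<open>X\<close> puts every root of the pattern near \<open>X\<close>.\<close>
    define T where "T = {s\<in>?S. \<exists>\<omega>\<in>?E s. ?F \<omega> \<in> X}"
    have fT: "finite T" "T \<subseteq> ?S" using fS by (auto simp: T_def)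
    have TE: "(\<Union>s\<in>T. ?E s) \<in> events" using fT E(1) by (intro sets.finite_UN) auto
    have "space gw_measure - (\<Union>s\<in>?S. ?E s) \<in> events"
      using fS E(1) by (intro sets.compl_sets sets.finite_UN) auto
    then have SE: "- (\<Union>s\<in>?S. ?E s) \<in> events" unfolding space_gw_measure Compl_eq_Diff_UNIV .
    have ballX: "(\<Union>x\<in>X. ball x \<epsilon>) \<in> sets borel" by (intro borel_open) auto
    have "measure rho X = prob (?F -` X)" unfolding rho_def using X by (simp add: measure_distr)
    also have "\<dots> \<le> prob ((\<Union>s\<in>T. ?E s) \<union> - (\<Union>s\<in>?S. ?E s))"
    proof (rule finite_measure_mono)
      show "?F -` X \<subseteq> (\<Union>s\<in>T. ?E s) \<union> - (\<Union>s\<in>?S. ?E s)" by (auto simp: T_def)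
      show "(\<Union>s\<in>T. ?E s) \<union> - (\<Union>s\<in>?S. ?E s) \<in> events"
        by (intro sets.Un TE SE)
    qed
    also have "\<dots> \<le> prob (\<Union>s\<in>T. ?E s) + prob (- (\<Union>s\<in>?S. ?E s))"
    proof (rule measure_Un_le)
      show "(\<Union>s\<in>T. ?E s) \<in> events" by (rule TE)
      show "- (\<Union>s\<in>?S. ?E s) \<in> events" by (rule SE)
    qed
    also have "prob (\<Union>s\<in>T. ?E s) = (\<Sum>s\<in>T. pattern_prob ?h s)"
    proof -
      have "prob (\<Union>s\<in>T. ?E s) = (\<Sum>s\<in>T. prob (?E s))"
        using fT E(1) Edisj by (intro finite_measure_finite_Union) auto
      also have "\<dots> = (\<Sum>s\<in>T. pattern_prob ?h s)" using fT E(2) by (intro sum.cong) auto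
      finally show ?thesis .
    qed
    also have "\<dots> \<le> (\<Sum>s\<in>T. real (card (?V s)) / real n + \<eta> / (1 + real (card ?S)))"
    proof (rule sum_mono)
      fix s assume "s \<in> T"
      then have "real n * (pattern_prob ?h s - \<eta> / (1 + real (card ?S))) \<le> real (card (?V s))"
        using good fT by auto
      then have "pattern_prob ?h s - \<eta> / (1 + real (card ?S)) \<le> real (card (?V s)) / real n"
        using n by (subst pos_le_divide_eq) (simp_all only: mult.commute of_nat_0_less_iff)
      then show "pattern_prob ?h s \<le> real (card (?V s)) / real n + \<eta> / (1 + real (card ?S))"
        by linarith
    qed
    also have "\<dots> = real (\<Sum>s\<in>T. card (?V s)) / real n + real (card T) * (\<eta> / (1 + real (card ?S)))"
      by (simp add: sum.distrib sum_divide_distrib)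
    also have "(\<Sum>s\<in>T. card (?V s)) = card (\<Union>s\<in>T. ?V s)"
    proof (rule card_UN_disjoint[symmetric])
      show "\<forall>s\<in>T. finite (?V s)" by (simp add: finite_pattern_roots)
      show "\<forall>s\<in>T. \<forall>s'\<in>T. s \<noteq> s' \<longrightarrow> ?V s \<inter> ?V s' = {}"
        using fT(2) Vdisj by (meson subsetD)
    qed (rule fT(1))
    also have "real (card (\<Union>s\<in>T. ?V s)) / real n \<le> measure (empirical ?G) (\<Union>x\<in>X. ball x \<epsilon>)"
      unfolding empirical_prob(2)[OF fG ballX] vG
    proof -
      have "(\<Union>s\<in>T. ?V s) \<subseteq> {v \<in> {1..n}. iso_class (component ?G v) v \<in> (\<Union>x\<in>X. ball x \<epsilon>)}"
      proof
        fix v assume "v \<in> (\<Union>s\<in>T. ?V s)"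
        then obtain s \<omega> where "s \<in> ?S" "v \<in> ?V s" "\<omega> \<in> ?E s" "?F \<omega> \<in> X" by (auto simp: T_def)
        then show "v \<in> {v \<in> {1..n}. iso_class (component ?G v) v \<in> (\<Union>x\<in>X. ball x \<epsilon>)}"
          using near[of s \<omega> v] by auto
      qed
      then have "card (\<Union>s\<in>T. ?V s) \<le> card {v \<in> {1..n}. iso_class (component ?G v) v \<in> (\<Union>x\<in>X. ball x \<epsilon>)}"
        by (intro card_mono) auto
      then show "real (card (\<Union>s\<in>T. ?V s)) / real n \<le>
          real (card {v \<in> {1..n}. iso_class (component ?G v) v \<in> (\<Union>x\<in>X. ball x \<epsilon>)}) / real (card {1..n})"
        by (simp add: divide_right_mono)
    qed
    also have "real (card T) * (\<eta> / (1 + real (card ?S))) \<le> \<eta>"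
    proof -
      have "real (card T) \<le> 1 + real (card ?S)" using card_mono[OF fS fT(2)] by simp
      then show ?thesis using eta(3) by (simp add: divide_simps mult_right_mono)
    qed
    finally show "measure rho X \<le> measure (empirical ?G) (\<Union>x\<in>X. ball x \<epsilon>) + \<epsilon>"
      using bad eta(1) by linarith
  qed
  then show ?thesis by (simp only: levy_prokhorov_commute)
qed

lemma bc_entropy_rho:
  assumes R: "linear_order_on B R" and adapted: "adapted A B R (\<lambda>x x'. D (x, x')) vmark_prob m u"
  shows "ereal (entropy_on A vmark_prob + (\<Sum>(x, x')\<in>B \<times> B. s_fun (D (x, x')))) \<le> bc_entropy_along A B R m u rho"
proof -
  have er: "er_counts A B vmark_prob D d R m u"
    using er_model R adapted by (simp add: er_counts_def er_counts_axioms_def)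
  have "\<exists>h S \<eta>. finite S \<and> 0 < \<eta> \<and> (\<forall>s\<in>S. er_model.marks_ok A B h s) \<and>
      (\<forall>n\<ge>1. \<forall>c\<in>er_counts.good_configs A B vmark_prob D d m u n h S \<eta>. levy_prokhorov (empirical (graph_of n c)) rho < \<epsilon>)"
    if "0 < \<epsilon>" for \<epsilon>
  proof -
    \<comment> \<open>The constants make the typical distance at most \<open>\<epsilon> / 2\<close>:
      radius and tolerance contribute less than \<open>\<epsilon> / 4 + \<epsilon> / 8\<close>, and
      the mass error \<open>\<epsilon> / 4\<close> enters twice.\<close>
    obtain r where "1 / real (Suc r) < \<epsilon> / 4"
      using reals_Archimedean[of "\<epsilon> / 4"] \<open>0 < \<epsilon>\<close> by (auto simp: inverse_eq_divide)
    then have r: "0 < \<epsilon> / 8" "1 / (1 + real r) + \<epsilon> / 8 < \<epsilon> / 2" using \<open>0 < \<epsilon>\<close> by (auto simp: add.commute)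
    obtain L where L: "1 - \<epsilon> / 4 < (\<Sum>s\<in>patterns (Suc r) L. pattern_prob (Suc r) s)"
      using patterns_mass[of "\<epsilon> / 4" "Suc r"] \<open>0 < \<epsilon>\<close> by auto
    let ?S = "patterns (Suc r) L"
    let ?\<eta> = "\<epsilon> / 4 / (1 + real (card ?S))"
    have "levy_prokhorov (empirical (graph_of n c)) rho < \<epsilon>"
      if n: "1 \<le> n" and c: "c \<in> er_counts.good_configs A B vmark_prob D d m u n (Suc r) ?S ?\<eta>" for n c
    proof -
      have "levy_prokhorov (empirical (graph_of n c)) rho \<le> \<epsilon> / 2"
      proof (rule levy_prokhorov_typical[OF n r L])
        fix s assume "s \<in> ?S"
        then show "real n * (pattern_prob (Suc r) s - ?\<eta>) \<le> real (card (pattern_roots n (Suc r) s c))"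
          using c unfolding er_counts.good_configs_def[OF er] pattern_limit_eq by blast
      qed (use \<open>0 < \<epsilon>\<close> in auto)
      then show ?thesis using \<open>0 < \<epsilon>\<close> by linarith
    qed
    then show ?thesis using finite_patterns patterns_marks_ok \<open>0 < \<epsilon>\<close>
      by (intro exI[of _ "Suc r"] exI[of _ ?S] exI[of _ ?\<eta>]) (auto intro!: divide_pos_pos add_pos_nonneg)
  qed
  then show ?thesis
    using bc_entropy_along_ge[OF er, of rho] unfolding er_counts.free_entropy_def[OF er] by blast
qed

end

section \<open>Nonnegativity of the rate functions\<close>

text \<open>Without existence nothing would be known about the sequence that the choice operator in
  \<open>bc_entropy\<close> selects. Rounding \<open>n\<close> times the limits down is corrected in
  two places, marked below.\<close>

lemma (in er_model) adapted_exists: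
  assumes R: "linear_order_on B R"
  shows "\<exists>m u. adapted A B R (\<lambda>x x'. D (x, x')) Q m u"
proof -
  let ?OP = "ordered_pairs B R"
  define q where "q y = (case y of (x, x') \<Rightarrow> if x = x' then D (x, x) / 2 else D (x, x'))" for y
  have q0: "0 \<le> q y" if "y \<in> B \<times> B" for y
    using D_nonneg that by (auto simp: q_def split: prod.splits)
  have fOP: "finite ?OP" "?OP \<subseteq> B \<times> B"
    using fin_B by (auto simp: ordered_pairs_def intro: finite_subset[of _ "B \<times> B"])
  define K where "K = (\<Sum>y\<in>?OP. q y)"
  \<comment> \<open>From here on \<open>2 * K \<le> n - 1\<close>, so that \<open>n * K\<close> fits
    into \<open>n choose 2\<close>; smaller \<open>n\<close> get no edges at all.\<close>
  define n0 where "n0 = nat \<lceil>2 * K\<rceil> + 1"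
  define m where "m n x x' = (if n < n0 then 0 else nat \<lfloor>real n * q (x, x')\<rfloor>)" for n x x'
  have fl: "(\<lambda>n. real (nat \<lfloor>real n * a\<rfloor>) / real n) \<longlonglongrightarrow> a" if "0 \<le> a" for a :: real
  proof (rule tendsto_sandwich[of "\<lambda>n. a - 1 / real n" _ sequentially "\<lambda>n. a"])
    show "\<forall>\<^sub>F n in sequentially. a - 1 / real n \<le> real (nat \<lfloor>real n * a\<rfloor>) / real n"
      using eventually_ge_at_top[of 1]
    proof eventually_elim
      case (elim n)
      have "real n * a - 1 \<le> real (nat \<lfloor>real n * a\<rfloor>)" using that by linarith
      then have "(real n * a - 1) / real n \<le> real (nat \<lfloor>real n * a\<rfloor>) / real n" by (rule divide_right_mono) simp
      then show ?case using elim by (simp add: diff_divide_distrib)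
    qed
    show "\<forall>\<^sub>F n in sequentially. real (nat \<lfloor>real n * a\<rfloor>) / real n \<le> a"
      using eventually_ge_at_top[of 1]
    proof eventually_elim
      case (elim n)
      have "0 \<le> real n * a" using that by simp
      then have "real (nat \<lfloor>real n * a\<rfloor>) \<le> real n * a" by linarith
      then have "real (nat \<lfloor>real n * a\<rfloor>) / real n \<le> real n * a / real n" by (rule divide_right_mono) simp
      then show ?case using elim by simp
    qed
    have "(\<lambda>n. a - 1 / real n) \<longlonglongrightarrow> a - 0" by (intro tendsto_diff tendsto_const lim_const_over_n)
    then show "(\<lambda>n. a - 1 / real n) \<longlonglongrightarrow> a" by simp
  qed simp
  have ml: "(\<lambda>n. real (m n x x') / real n) \<longlonglongrightarrow> q (x, x')" if "x \<in> B" "x' \<in> B" for x x'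
  proof (rule Lim_transform_eventually[OF fl])
    show "0 \<le> q (x, x')" using q0 that by simp
    show "\<forall>\<^sub>F n in sequentially. real (nat \<lfloor>real n * q (x, x')\<rfloor>) / real n = real (m n x x') / real n"
      using eventually_ge_at_top[of n0] by eventually_elim (simp add: m_def)
  qed
  have tot: "total_count B R (m n) \<le> n choose 2" for n
  proof (cases "n < n0")
    case True
    then show ?thesis by (simp add: total_count_def m_def)
  next
    case False
    have "real (total_count B R (m n)) = (\<Sum>(x, x')\<in>?OP. real (nat \<lfloor>real n * q (x, x')\<rfloor>))"
      using False by (simp add: total_count_def m_def)
    also have "\<dots> \<le> (\<Sum>y\<in>?OP. real n * q y)"
    proof (rule sum_mono, clarify)
      fix x x' assume "(x, x') \<in> ?OP"
      then have "0 \<le> real n * q (x, x')" using q0 fOP(2) by auto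
      then show "real (nat \<lfloor>real n * q (x, x')\<rfloor>) \<le> real n * q (x, x')" by linarith
    qed
    also have "\<dots> = real n * K" by (simp add: K_def sum_distrib_left)
    also have "\<dots> \<le> real n * (real (n - 1) / 2)"
    proof (rule mult_left_mono)
      have "2 * K \<le> real (n - 1)" using False unfolding n0_def by linarith
      then show "K \<le> real (n - 1) / 2" by simp
    qed simp
    also have "\<dots> = real (n choose 2)"
    proof -
      have "2 * (n choose 2) = n * (n - 1)"
        unfolding choose_two by (rule dvd_mult_div_cancel) auto
      then have "2 * real (n choose 2) = real n * real (n - 1)" by (metis of_nat_mult of_nat_numeral)
      then show ?thesis by simp
    qed
    finally show ?thesis by simp
  qed
  have "\<exists>t\<in>A. 0 < Q t"
  proof (rule ccontr)
    assume "\<not> (\<exists>t\<in>A. 0 < Q t)"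
    then have "(\<Sum>t\<in>A. Q t) \<le> 0" by (intro sum_nonpos) (auto simp: not_less)
    then show False using Q_sum by simp
  qed
  then obtain t0 where t0: "t0 \<in> A" "0 < Q t0" by blast
  define rest where "rest n = (\<Sum>t\<in>A - {t0}. nat \<lfloor>real n * Q t\<rfloor>)" for n
  \<comment> \<open>The vertices lost by rounding receive the mark \<open>t0\<close>. Its
    probability is positive, so marks of probability zero keep count zero.\<close>
  define u where "u n t = (if t = t0 then n - rest n else nat \<lfloor>real n * Q t\<rfloor>)" for n t
  have Qr: "(\<Sum>t\<in>A - {t0}. Q t) = 1 - Q t0" using Q_sum fin_A t0 by (simp add: sum_diff1)
  have rest: "rest n \<le> n" for n
  proof -
    have "real (rest n) \<le> (\<Sum>t\<in>A - {t0}. real n * Q t)"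
      unfolding rest_def of_nat_sum
    proof (rule sum_mono)
      fix t assume "t \<in> A - {t0}"
      then have "0 \<le> real n * Q t" using Q_nonneg by auto
      then show "real (nat \<lfloor>real n * Q t\<rfloor>) \<le> real n * Q t" by linarith
    qed
    also have "\<dots> = real n * (1 - Q t0)" by (simp add: Qr flip: sum_distrib_left)
    also have "\<dots> \<le> real n * 1" using t0 by (intro mult_left_mono) auto
    finally show ?thesis by simp
  qed
  have usum: "(\<Sum>t\<in>A. u n t) = n" for n
  proof -
    have "(\<Sum>t\<in>A. u n t) = u n t0 + (\<Sum>t\<in>A - {t0}. u n t)" by (rule sum.remove[OF fin_A t0(1)])
    also have "(\<Sum>t\<in>A - {t0}. u n t) = rest n" unfolding rest_def by (intro sum.cong) (auto simp: u_def)
    finally show ?thesis using rest[of n] by (simp add: u_def)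
  qed
  have ul: "(\<lambda>n. real (u n t) / real n) \<longlonglongrightarrow> Q t" if "t \<in> A" for t
  proof (cases "t = t0")
    case False then show ?thesis using fl[of "Q t"] Q_nonneg[OF that] by (simp add: u_def)
  next
    case True
    have "(\<lambda>n. 1 - (\<Sum>t\<in>A - {t0}. real (nat \<lfloor>real n * Q t\<rfloor>) / real n)) \<longlonglongrightarrow> 1 - (\<Sum>t\<in>A - {t0}. Q t)"
      using Q_nonneg by (intro tendsto_diff tendsto_const tendsto_sum fl) auto
    then have "(\<lambda>n. 1 - (\<Sum>t\<in>A - {t0}. real (nat \<lfloor>real n * Q t\<rfloor>) / real n)) \<longlonglongrightarrow> Q t0" by (simp add: Qr)
    then show ?thesis unfolding True
    proof (rule Lim_transform_eventually)
      show "\<forall>\<^sub>F n in sequentially. 1 - (\<Sum>t\<in>A - {t0}. real (nat \<lfloor>real n * Q t\<rfloor>) / real n) = real (u n t0) / real n"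
        using eventually_ge_at_top[of 1]
      proof eventually_elim
        case (elim n)
        then show ?case using rest[of n]
          by (simp add: u_def of_nat_diff diff_divide_distrib rest_def sum_divide_distrib)
      qed
    qed
  qed
  have "adapted A B R (\<lambda>x x'. D (x, x')) Q m u"
    unfolding adapted_def
  proof (intro conjI allI ballI impI)
    show "m n x x' = m n x' x" if "x \<in> B" "x' \<in> B" for n x x'
      using D_swap[of "(x, x')"] that by (simp add: m_def q_def)
    show "(\<lambda>n. real (m n x x) / real n) \<longlonglongrightarrow> D (x, x) / 2" if "x \<in> B" for x
      using ml[OF that that] by (simp add: q_def)
    show "(\<lambda>n. real (m n x x') / real n) \<longlonglongrightarrow> D (x, x')" if "x \<in> B" "x' \<in> B" "x \<noteq> x'" for x x'
      using ml[OF that(1,2)] that(3) by (simp add: q_def)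
    show "m n x x' = 0" if "D (x, x') = 0" for n x x'
      using that by (auto simp: m_def q_def)
    show "u n t = 0" if "Q t = 0" for n t
      using that t0 by (auto simp: u_def)
  qed (use tot usum ul in auto)
  then show ?thesis by blast
qed

text \<open>Gibbs' inequality from \<open>ln z \<le> z - 1\<close>. Total mass of \<open>q\<close>
  below 1 is allowed, as it is only restricted by \<open>q\<close> being the masses of disjoint sets
  under a probability measure.\<close>

lemma rel_entropy_nonneg:
  assumes "finite S" "\<And>x. x \<in> S \<Longrightarrow> 0 \<le> p x" "\<And>x. x \<in> S \<Longrightarrow> 0 \<le> q x" "(\<Sum>x\<in>S. p x) = 1" "(\<Sum>x\<in>S. q x) \<le> 1"
  shows "0 \<le> rel_entropy_on S p q"
proof (cases "\<exists>x\<in>S. p x \<noteq> 0 \<and> q x = 0")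
  case False
  have "p x - q x \<le> p x * ln (p x / q x)" if x: "x \<in> S" for x
  proof (cases "p x = 0")
    case True then show ?thesis using assms(3)[OF x] by simp
  next
    case pn: False
    then have p: "0 < p x" and q: "0 < q x" using assms(2,3)[OF x] False x by (auto simp: less_le)
    have "ln (q x / p x) \<le> q x / p x - 1" using p q by (intro ln_le_minus_one) simp
    then have "1 - q x / p x \<le> ln (p x / q x)" using p q by (simp add: ln_div)
    then have "p x * (1 - q x / p x) \<le> p x * ln (p x / q x)" using p by (intro mult_left_mono) auto
    then show ?thesis using p by (simp add: right_diff_distrib)
  qed
  then have "(\<Sum>x\<in>S. p x - q x) \<le> (\<Sum>x\<in>S. p x * ln (p x / q x))" by (rule sum_mono)
  then have "0 \<le> (\<Sum>x\<in>S. p x * ln (p x / q x))" using assms(4,5) by (simp add: sum_subtractf)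
  then show ?thesis using False by (simp add: rel_entropy_on_def)
qed (simp add: rel_entropy_on_def)

lemma sum_singleton_measure_le:
  assumes M: "M \<in> prob_measures" and "finite A" "\<And>t. t \<in> A \<Longrightarrow> E t \<in> sets borel" "disjoint_family_on E A"
  shows "(\<Sum>t\<in>A. measure M (E t)) \<le> 1"
proof -
  interpret prob_space M using M by (simp add: space_prob_algebra)
  have s: "sets M = sets borel" using M by (simp add: space_prob_algebra)
  have "(\<Sum>t\<in>A. measure M (E t)) = prob (\<Union>t\<in>A. E t)"
    using assms s by (intro finite_measure_finite_Union[symmetric]) auto
  then show ?thesis by simp
qed

lemma rate_u_eq:
  assumes deg: "mean_degree \<mu> = ennreal d" and "d \<noteq> 0"
    and sym: "\<And>x x'. x \<in> B \<Longrightarrow> x' \<in> B \<Longrightarrow> mean_degree_marked \<mu> x x' = mean_degree_marked \<mu> x' x"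
    and D: "D = (\<lambda>x x'. enn2real (mean_degree_marked \<mu> x x'))"
  shows "rate_u A B R \<nu> chi d \<mu> = ereal (entropy_on A (root_law \<mu>) + (\<Sum>(x, x')\<in>B \<times> B. s_fun (D x x')))
    - bc_entropy A B R D (root_law \<mu>) \<mu>
    + ereal (d / 2) * rel_entropy_on (ordered_pairs B R) (pair_law D d) (sorted_law B R chi)
    + rel_entropy_on A (root_law \<mu>) (\<lambda>t. measure \<nu> {t})"
proof -
  have c: "(mean_degree \<mu> \<noteq> ennreal d \<or>
      (\<exists>x\<in>B. \<exists>x'\<in>B. mean_degree_marked \<mu> x x' \<noteq> mean_degree_marked \<mu> x' x)) = False"
    using deg sym by blast
  have "(d = 0) = False" using \<open>d \<noteq> 0\<close> by simp
  then show ?thesis unfolding rate_u_def Let_def D c by (simp only: if_False)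
qed

text \<open>Every admissible \<open>\<mu>\<close> defines an independent model: its marks lie in
  \<open>A\<close> and \<open>B\<close> almost surely, so its root law has mass 1 and its marked
  mean degrees add up to \<open>d\<close>. Then \<open>bc_entropy_along_le\<close> bounds the
  entropy, and the other two summands are relative entropies.\<close>

lemma rate_u_nonneg:
  fixes A :: "'a::metric_space set" and B :: "'b::metric_space set"
  assumes A: "finite A" and B: "finite B" and R: "linear_order_on B R"
    and nu: "\<nu> \<in> prob_measures" and chi: "chi \<in> prob_measures" and d: "0 \<le> d"
    and mu: "\<mu> \<in> prob_measures" and AE: "AE g in \<mu>. marks_in A B g"
  shows "0 \<le> rate_u A B R \<nu> chi d \<mu>"
proof -
  interpret prob_space \<mu> using mu by (simp add: space_prob_algebra)
  have s: "sets \<mu> = sets borel" using mu by (simp add: space_prob_algebra)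
  have mc: "measurable \<mu> N = measurable borel N" for N :: "'z measure" by (rule measurable_cong_sets[OF s refl])
  let ?D = "\<lambda>x x'. enn2real (mean_degree_marked \<mu> x x')"
  let ?Q = "root_law \<mu>"
  have rm: "root_mark \<in> borel_measurable \<mu>" unfolding mc by (rule measurable_root_mark)
  have Qeq: "?Q t = prob (root_mark -` {t} \<inter> space \<mu>)" for t
    unfolding root_law_def by (rule measure_distr[OF rm]) simp
  have Qsum: "(\<Sum>t\<in>A. ?Q t) = 1"
  proof -
    have "(\<Sum>t\<in>A. ?Q t) = prob (\<Union>t\<in>A. root_mark -` {t} \<inter> space \<mu>)"
      unfolding Qeq using A rm by (intro finite_measure_finite_Union[symmetric])
        (auto simp: disjoint_family_on_def intro!: measurable_sets[OF rm])
    also have "(\<Union>t\<in>A. root_mark -` {t} \<inter> space \<mu>) = {g \<in> space \<mu>. root_mark g \<in> A}" by auto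
    also have "prob \<dots> = 1"
    proof (rule prob_Collect_eq_1[THEN iffD2])
      have "root_mark -` A \<inter> space \<mu> \<in> events"
        using A by (intro measurable_sets[OF rm] borel_closed finite_imp_closed)
      then show "{g \<in> space \<mu>. root_mark g \<in> A} \<in> events" by (simp add: vimage_def Int_def conj_commute)
      show "AE g in \<mu>. root_mark g \<in> A" using AE
        by eventually_elim (rule marks_in_root_degree_marked_sum(1)[OF _ B])
    qed
    finally show ?thesis .
  qed
  have Hnu: "0 \<le> rel_entropy_on A ?Q (\<lambda>t. measure \<nu> {t})"
    by (rule rel_entropy_nonneg[OF A _ _ Qsum sum_singleton_measure_le[OF nu A]])
      (auto simp: root_law_def disjoint_family_on_def)
  show ?thesis
  proof (cases "mean_degree \<mu> \<noteq> ennreal d \<or> (\<exists>x\<in>B. \<exists>x'\<in>B. mean_degree_marked \<mu> x x' \<noteq> mean_degree_marked \<mu> x' x) \<or> d = 0")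
    case True
    then show ?thesis using Hnu by (auto simp: rate_u_def Let_def)
  next
    case False
    then have deg: "mean_degree \<mu> = ennreal d" and d0: "0 < d" using d by auto
    have sym: "mean_degree_marked \<mu> x x' = mean_degree_marked \<mu> x' x" if "x \<in> B" "x' \<in> B" for x x'
      using False that by blast
    have "mean_degree \<mu> = (\<integral>\<^sup>+ g. (\<Sum>(x, x')\<in>B \<times> B. of_nat (root_degree_marked x x' g)) \<partial>\<mu>)"
      unfolding mean_degree_def
    proof (rule nn_integral_cong_AE)
      show "AE g in \<mu>. of_nat (root_degree g) = (\<Sum>(x, x')\<in>B \<times> B. of_nat (root_degree_marked x x' g) :: ennreal)"
        using AE
      proof eventually_elim
        case (elim g)
        show ?case unfolding marks_in_root_degree_marked_sum(2)[OF elim B] by (simp add: case_prod_unfold)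
      qed
    qed
    also have "\<dots> = (\<Sum>(x, x')\<in>B \<times> B. mean_degree_marked \<mu> x x')"
    proof -
      have "(\<lambda>g. of_nat (root_degree_marked x x' g) :: ennreal) \<in> borel_measurable \<mu>" for x x'
        unfolding mc by (rule measurable_compose[OF measurable_root_degree_marked]) simp
      then show ?thesis unfolding mean_degree_marked_def case_prod_unfold
        by (intro nn_integral_sum)
    qed
    finally have dsum: "(\<Sum>y\<in>B \<times> B. mean_degree_marked \<mu> (fst y) (snd y)) = ennreal d"
      using deg by (simp add: case_prod_unfold)
    have fin: "mean_degree_marked \<mu> (fst y) (snd y) < \<infinity>" if "y \<in> B \<times> B" for y
    proof -
      have "mean_degree_marked \<mu> (fst y) (snd y) \<le> (\<Sum>y\<in>B \<times> B. mean_degree_marked \<mu> (fst y) (snd y))"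
        using that B by (intro member_le_sum) auto
      then show ?thesis unfolding dsum by (auto intro: le_less_trans)
    qed
    have Dsum: "(\<Sum>y\<in>B \<times> B. ?D (fst y) (snd y)) = d"
    proof -
      have "(\<Sum>y\<in>B \<times> B. ?D (fst y) (snd y)) = enn2real (\<Sum>y\<in>B \<times> B. mean_degree_marked \<mu> (fst y) (snd y))"
      proof -
        have "(\<Sum>y\<in>B \<times> B. mean_degree_marked \<mu> (fst y) (snd y)) =
            (\<Sum>y\<in>B \<times> B. ennreal (?D (fst y) (snd y)))"
          using fin by (intro sum.cong refl) (simp add: less_top)
        also have "\<dots> = ennreal (\<Sum>y\<in>B \<times> B. ?D (fst y) (snd y))"
          by (rule sum_ennreal) simp
        finally have eq: "(\<Sum>y\<in>B \<times> B. mean_degree_marked \<mu> (fst y) (snd y)) =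
            ennreal (\<Sum>y\<in>B \<times> B. ?D (fst y) (snd y))" .
        have "0 \<le> (\<Sum>y\<in>B \<times> B. ?D (fst y) (snd y))" by (rule sum_nonneg) simp
        then show ?thesis unfolding eq by (rule enn2real_ennreal[symmetric])
      qed
      then show ?thesis unfolding dsum using d by simp
    qed
    let ?DD = "\<lambda>y. ?D (fst y) (snd y)"
    have er: "er_model A B ?Q ?DD d"
      by unfold_locales (use A B Qsum Dsum d0 sym in \<open>auto simp: root_law_def\<close>)
    interpret er_model A B ?Q ?DD d by (rule er)
    obtain m u where mu: "adapted A B R (\<lambda>x x'. ?DD (x, x')) ?Q m u" using adapted_exists[OF R] by blast
    \<comment> \<open>Existence makes the chosen pair adapted, and the upper bound holds along any
      adapted pair.\<close>
    have ex: "\<exists>z. case z of (m, u) \<Rightarrow> adapted A B R ?D ?Q m u" using mu by (intro exI[of _ "(m, u)"]) simp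
    obtain m' u' where z: "(SOME z. case z of (m, u) \<Rightarrow> adapted A B R ?D ?Q m u) = (m', u')" by (metis surj_pair)
    have ad: "adapted A B R ?D ?Q m' u'" using someI_ex[OF ex] unfolding z by simp
    then have ec: "er_counts A B ?Q ?DD d R m' u'" using er R by (simp add: er_counts_def er_counts_axioms_def)
    have bc: "bc_entropy A B R ?D ?Q \<mu> \<le> ereal (entropy_on A ?Q + (\<Sum>(x, x')\<in>B \<times> B. s_fun (?D x x')))"
      unfolding bc_entropy_def z prod.case
      using bc_entropy_along_le[OF ec, of \<mu>] unfolding er_counts.free_entropy_def[OF ec] by simp
    have Hchi: "0 \<le> rel_entropy_on (ordered_pairs B R) (pair_law ?D d) (sorted_law B R chi)"
    proof (rule rel_entropy_nonneg)
      show fO: "finite (ordered_pairs B R)"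
        using B by (auto simp: ordered_pairs_def intro: finite_subset[of _ "B \<times> B"])
      show "0 \<le> pair_law ?D d y" for y using d by (auto simp: pair_law_def split: prod.splits)
      show "0 \<le> sorted_law B R chi y" for y by (simp add: sorted_law_def)
      have "(\<Sum>y\<in>B \<times> B. ?DD y / d) = (\<Sum>y\<in>ordered_pairs B R. pair_law ?D d y)"
        unfolding sum_ordered_pairs[OF B R]
      proof (rule sum.cong[OF refl], clarify)
        fix x x' assume "(x, x') \<in> ordered_pairs B R"
        then have "?D x' x = ?D x x'" using sym[of x x'] by (auto simp: ordered_pairs_def)
        then show "(if x = x' then ?DD (x, x) / d else ?DD (x, x') / d + ?DD (x', x) / d) = pair_law ?D d (x, x')"
          by (simp add: pair_law_def)
      qed
      moreover have "(\<Sum>y\<in>B \<times> B. ?DD y / d) = 1" using Dsum d0 by (simp flip: sum_divide_distrib)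
      ultimately show "(\<Sum>y\<in>ordered_pairs B R. pair_law ?D d y) = 1" by simp
      show "(\<Sum>y\<in>ordered_pairs B R. sorted_law B R chi y) \<le> 1"
        unfolding sorted_law_def
      proof (rule sum_singleton_measure_le[OF chi fO])
        show "{(x, x') \<in> B \<times> B. (if (x, x') \<in> R then (x, x') else (x', x)) = y} \<in> sets borel" for y
          by (rule borel_closed[OF finite_imp_closed[OF finite_subset[of _ "B \<times> B"]]]) (use B in auto)
      qed (auto simp: disjoint_family_on_def)
    qed
    \<comment> \<open>The entropy may be \<open>-\<infinity>\<close>; the difference is then
      \<open>\<infinity>\<close>.\<close>
    have 1: "0 \<le> ereal (entropy_on A ?Q + (\<Sum>(x, x')\<in>B \<times> B. s_fun (?D x x'))) - bc_entropy A B R ?D ?Q \<mu>"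
      using bc by (cases "bc_entropy A B R ?D ?Q \<mu>") auto
    have 2: "0 \<le> ereal (d / 2) * rel_entropy_on (ordered_pairs B R) (pair_law ?D d) (sorted_law B R chi)"
      using d Hchi by simp
    have "rate_u A B R \<nu> chi d \<mu> = ereal (entropy_on A ?Q + (\<Sum>(x, x')\<in>B \<times> B. s_fun (?D x x')))
         - bc_entropy A B R ?D ?Q \<mu>
         + ereal (d / 2) * rel_entropy_on (ordered_pairs B R) (pair_law ?D d) (sorted_law B R chi)
         + rel_entropy_on A ?Q (\<lambda>t. measure \<nu> {t})"
      using d0 sym by (intro rate_u_eq deg) auto
    also have "0 \<le> \<dots>" using 1 2 Hnu by (intro add_nonneg_nonneg)
    finally show ?thesis .
  qed
qed

text \<open>With \<open>x\<close> the mean degree, twice the additional term is the relative entropy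
  of Poisson(x) with respect to Poisson(d), nonnegative again by
  \<open>ln z \<le> z - 1\<close>.\<close>

lemma rate_ER_nonneg:
  fixes A :: "'a::metric_space set" and B :: "'b::metric_space set"
  assumes A: "finite A" and B: "finite B" and R: "linear_order_on B R"
    and nu: "\<nu> \<in> prob_measures" and chi: "chi \<in> prob_measures" and d: "0 < d"
    and mu: "\<mu> \<in> prob_measures" and AE: "AE g in \<mu>. marks_in A B g"
  shows "0 \<le> rate_ER A B R \<nu> chi d \<mu>"
proof (cases "mean_degree \<mu> = \<infinity>")
  case False
  define x where "x = enn2real (mean_degree \<mu>)"
  have x0: "0 \<le> x" by (simp add: x_def)
  have "0 \<le> x * ln (x / d) - x + d"
  proof (cases "x = 0")
    case False
    then have xp: "0 < x" using x0 by simp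
    have "ln (d / x) \<le> d / x - 1" using xp d by (intro ln_le_minus_one) simp
    then have "1 - d / x \<le> ln (x / d)" using xp d by (simp add: ln_div)
    then have "x * (1 - d / x) \<le> x * ln (x / d)" using xp by (intro mult_left_mono) auto
    then show ?thesis using xp by (simp add: right_diff_distrib)
  qed (use d in simp)
  then have "0 \<le> ereal (1 / 2 * (x * ln (x / d) - x + d))" by simp
  then show ?thesis using rate_u_nonneg[OF A B R nu chi x0 mu AE] False
    by (auto simp: rate_ER_def Let_def x_def)
qed (simp add: rate_ER_def)

section \<open>The rate of the projected tree\<close>

lemma rel_entropy_on_refl:
  assumes "\<And>x. x \<in> S \<Longrightarrow> p x = q x"
  shows "rel_entropy_on S p q = 0"
proof -
  have "(\<Sum>x\<in>S. p x * ln (p x / q x)) = 0"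
  proof (rule sum.neutral, rule ballI)
    fix x assume "x \<in> S"
    then show "p x * ln (p x / q x) = 0" using assms[of x] by (cases "q x = 0") auto
  qed
  moreover have "\<not> (\<exists>x\<in>S. p x \<noteq> 0 \<and> q x = 0)" using assms by auto
  ultimately show ?thesis by (simp add: rel_entropy_on_def)
qed

context projected_gw begin

lemma measure_distr_f: "measure (distr \<nu> borel f) {t} = vmark_prob t"
proof -
  have "f \<in> borel_measurable \<nu>" using f_meas measurable_cong_sets[OF sets_nu refl] by blast
  then show ?thesis by (simp add: measure_distr vmark_prob_def space_nu)
qed

lemma measure_distr_g: "measure (distr chi borel (map_prod g g)) {y} = emark_prob y"
proof -
  have "map_prod g g \<in> borel_measurable chi" using map_prod_g_meas measurable_cong_sets[OF sets_chi refl] by blast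
  then show ?thesis by (simp add: measure_distr emark_prob_def space_chi)
qed

text \<open>The fair coin and the sorting forget the same information, namely the order of the pair.
  Hence the edge law read off from the degrees of the tree is the sorted projected law, and the edge
  entropy term vanishes.\<close>

lemma sorted_law_distr:
  assumes R: "linear_order_on B R" and y: "y \<in> ordered_pairs B R"
  shows "sorted_law B R (distr chi borel (map_prod g g)) y = pair_law (\<lambda>x x'. D (x, x')) d y"
proof -
  obtain x x' where xx: "y = (x, x')" "x \<in> B" "x' \<in> B" "(x, x') \<in> R" using y by (auto simp: ordered_pairs_def)
  have m: "map_prod g g \<in> borel_measurable chi" using map_prod_g_meas measurable_cong_sets[OF sets_chi refl] by blast
  interpret prob_space chi by (rule prob_chi)
  interpret G: prob_space "distr chi borel (map_prod g g)" by (rule prob_space_distr[OF m])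
  have "{(z, z') \<in> B \<times> B. (if (z, z') \<in> R then (z, z') else (z', z)) = y} = {(x, x'), (x', x)}"
  proof -
    have "(x', x) \<in> R \<longleftrightarrow> x = x'" using R xx(4) by (auto simp: order_on_defs antisym_def)
    then show ?thesis using xx by (auto split: if_splits)
  qed
  then have "sorted_law B R (distr chi borel (map_prod g g)) y =
      (\<Sum>z\<in>{(x, x'), (x', x)}. measure (distr chi borel (map_prod g g)) {z})"
    unfolding sorted_law_def by (simp only:) (rule G.finite_measure_eq_sum_singleton, auto)
  also have "\<dots> = pair_law (\<lambda>x x'. D (x, x')) d y"
    unfolding measure_distr_g using d_pos
    by (cases "x = x'") (auto simp: pair_law_def xx(1) sym_emark_prob_def)
  finally show ?thesis .
qed

lemma rate_u_rho:
  assumes R: "linear_order_on B R"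
  shows "rate_u A B R (distr \<nu> borel f) (distr chi borel (map_prod g g)) d rho \<le> 0"
proof -
  interpret er: er_model A B vmark_prob D d by (rule er_model)
  have D: "(\<lambda>x x'. D (x, x')) = (\<lambda>x x'. enn2real (mean_degree_marked rho x x'))"
    using d_pos sym_emark_prob_nonneg by (simp add: mean_degree_marked_rho fun_eq_iff)
  have sym: "mean_degree_marked rho x x' = mean_degree_marked rho x' x" for x x'
    using sym_emark_prob_swap[of "(x, x')"] by (simp add: mean_degree_marked_rho)
  have Q: "root_law rho = vmark_prob" by (rule ext) (rule root_law_rho)
  obtain m u where mu: "adapted A B R (\<lambda>x x'. D (x, x')) vmark_prob m u" using er.adapted_exists[OF R] by blast
  have ex: "\<exists>z. case z of (m, u) \<Rightarrow> adapted A B R (\<lambda>x x'. D (x, x')) vmark_prob m u"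
    using mu by (intro exI[of _ "(m, u)"]) simp
  obtain m' u' where z: "(SOME z. case z of (m, u) \<Rightarrow> adapted A B R (\<lambda>x x'. D (x, x')) vmark_prob m u) = (m', u')"
    by (metis surj_pair)
  have ad: "adapted A B R (\<lambda>x x'. D (x, x')) vmark_prob m' u'" using someI_ex[OF ex] unfolding z by simp
  let ?F = "entropy_on A vmark_prob + (\<Sum>(x, x')\<in>B \<times> B. s_fun (D (x, x')))"
  have "ereal ?F \<le> bc_entropy A B R (\<lambda>x x'. D (x, x')) vmark_prob rho"
    unfolding bc_entropy_def z prod.case by (rule bc_entropy_rho[OF R ad])
  then have "ereal ?F - bc_entropy A B R (\<lambda>x x'. D (x, x')) vmark_prob rho \<le> ereal ?F - ereal ?F"
    by (intro ereal_minus_mono order_refl)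
  then have bc: "ereal ?F - bc_entropy A B R (\<lambda>x x'. D (x, x')) vmark_prob rho \<le> 0" by simp
  have H1: "rel_entropy_on A vmark_prob (\<lambda>t. measure (distr \<nu> borel f) {t}) = 0"
    by (rule rel_entropy_on_refl) (simp only: measure_distr_f)
  have H2: "rel_entropy_on (ordered_pairs B R) (pair_law (\<lambda>x x'. D (x, x')) d)
      (sorted_law B R (distr chi borel (map_prod g g))) = 0"
    by (rule rel_entropy_on_refl) (simp only: sorted_law_distr[OF R])
  have "d \<noteq> 0" using d_pos by simp
  show ?thesis
    unfolding rate_u_eq[OF mean_degree_rho \<open>d \<noteq> 0\<close> sym D] Q H1 H2 using bc by simp
qed

lemma rate_ER_rho:
  assumes R: "linear_order_on B R"
  shows "rate_ER A B R (distr \<nu> borel f) (distr chi borel (map_prod g g)) d rho \<le> 0"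
  using rate_u_rho[OF R] d_pos by (simp add: rate_ER_def Let_def mean_degree_rho zero_ereal_def[symmetric])

section \<open>Distance between the tree and its projection\<close>

lemma coord_rectangle:
  assumes a: "a \<in> sets borel" and b: "b \<in> sets borel"
  shows "{\<omega>. \<omega> w \<in> UNIV \<times> a \<times> b \<times> UNIV} \<in> sets gw_measure"
    and "measure gw_measure {\<omega>. \<omega> w \<in> UNIV \<times> a \<times> b \<times> UNIV} = measure \<nu> a * measure chi b"
proof -
  interpret prob_space gw_measure by (rule prob_gw_measure)
  interpret nu: prob_space \<nu> by (rule prob_nu)
  interpret chi: prob_space chi by (rule prob_chi)
  let ?b = "measure_pmf (bernoulli_pmf (1/2))"
  have p1: "prob_space (chi \<Otimes>\<^sub>M ?b)"
    by (intro prob_space_pair measure_pmf.prob_space_axioms prob_chi)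
  have p2: "prob_space (\<nu> \<Otimes>\<^sub>M chi \<Otimes>\<^sub>M ?b)"
    by (intro prob_space_pair measure_pmf.prob_space_axioms prob_nu prob_chi)
  note times = sigma_finite_measure.emeasure_pair_measure_Times[OF prob_space_imp_sigma_finite]
  have ab: "a \<in> sets \<nu>" "b \<in> sets chi" using a b by (auto simp: sets_nu sets_chi)
  let ?X = "UNIV \<times> a \<times> b \<times> UNIV"
  have s2: "b \<times> UNIV \<in> sets (chi \<Otimes>\<^sub>M ?b)" using ab by (intro pair_measureI) auto
  have s3: "a \<times> b \<times> UNIV \<in> sets (\<nu> \<Otimes>\<^sub>M chi \<Otimes>\<^sub>M ?b)" by (rule pair_measureI[OF ab(1) s2])
  have X: "?X \<in> sets coord_measure" by (rule pair_measureI[OF _ s3]) simp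
  have "emeasure coord_measure ?X = ennreal (measure \<nu> a * measure chi b)"
  proof -
    have u: "emeasure (measure_pmf p) UNIV = 1" for p :: "'z pmf" using measure_pmf.emeasure_space_1[of p] by simp
    have "emeasure coord_measure ?X = emeasure (measure_pmf (poisson_pmf d)) UNIV *
        emeasure (\<nu> \<Otimes>\<^sub>M chi \<Otimes>\<^sub>M ?b) (a \<times> b \<times> UNIV)"
      by (rule times[OF p2 _ s3]) simp
    also have "emeasure (\<nu> \<Otimes>\<^sub>M chi \<Otimes>\<^sub>M ?b) (a \<times> b \<times> UNIV) = emeasure \<nu> a * emeasure (chi \<Otimes>\<^sub>M ?b) (b \<times> UNIV)"
      by (rule times[OF p1 ab(1) s2])
    also have "emeasure (chi \<Otimes>\<^sub>M ?b) (b \<times> UNIV) = emeasure chi b * emeasure ?b UNIV"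
      by (rule times[OF measure_pmf.prob_space_axioms ab(2)]) simp
    finally have "emeasure coord_measure ?X = emeasure \<nu> a * emeasure chi b" unfolding u by simp
    also have "\<dots> = ennreal (measure \<nu> a * measure chi b)"
      by (simp add: nu.emeasure_eq_measure chi.emeasure_eq_measure ennreal_mult)
    finally show ?thesis .
  qed
  then have "emeasure gw_measure {\<omega>. \<omega> w \<in> ?X} = ennreal (measure \<nu> a * measure chi b)"
    using emeasure_cylinder[of "{w}" "\<lambda>_. ?X"] X by simp
  then show "measure gw_measure {\<omega>. \<omega> w \<in> ?X} = measure \<nu> a * measure chi b"
    by (simp add: emeasure_eq_measure)
  have "(\<lambda>\<omega>. \<omega> w) \<in> measurable gw_measure coord_measure"
    unfolding gw_space_def by (rule measurable_component_singleton) simp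
  from measurable_sets[OF this X] show "{\<omega>. \<omega> w \<in> ?X} \<in> sets gw_measure" by (simp add: vimage_def)
qed

text \<open>Here \<open>a\<close> and \<open>b\<close> are the sets where the projections may move
  marks far. When offspring numbers are at most \<open>L\<close>, only words over
  \<open>{..<L}\<close> of length at most \<open>r\<close> occur, so a union bound over this fixed
  finite set controls the event that some relevant mark is bad.\<close>

lemma levy_prokhorov_ugw_rho:
  fixes a :: "'a set" and b :: "('b \<times> 'b) set"
  assumes a: "a \<in> sets borel" and b: "b \<in> sets borel"
    and f: "\<And>t. t \<notin> a \<Longrightarrow> dist t (f t) < \<delta>"
    and g: "\<And>x x'. (x, x') \<notin> b \<Longrightarrow> dist x (g x) < \<delta> \<and> dist x' (g x') < \<delta>"
    and r: "0 < \<delta>" "1 / (1 + real r) + \<delta> < \<epsilon>"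
    and large: "measure gw_measure (- small_offspring r L) \<le> \<epsilon> / 2"
    and bad: "real (card {w. set w \<subseteq> {..<L} \<and> length w \<le> r}) * (measure \<nu> a + measure chi b) \<le> \<epsilon> / 2"
  shows "levy_prokhorov (ugw \<nu> chi d) rho \<le> \<epsilon>"
proof -
  interpret prob_space gw_measure by (rule prob_gw_measure)
  interpret nu: prob_space \<nu> by (rule prob_nu)
  interpret chi: prob_space chi by (rule prob_chi)
  let ?W = "{w. set w \<subseteq> {..<L} \<and> length w \<le> r}"
  have fW: "finite ?W" by (rule finite_lists_length_le) simp
  let ?E = "\<lambda>w. {\<omega>. \<omega> w \<in> UNIV \<times> a \<times> UNIV \<times> UNIV} \<union> {\<omega>. \<omega> w \<in> UNIV \<times> UNIV \<times> b \<times> UNIV}"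
  let ?B = "- small_offspring r L \<union> (\<Union>w\<in>?W. ?E w)"
  have U: "measure \<nu> UNIV = 1" "measure chi UNIV = 1"
    using nu.prob_space chi.prob_space by (simp_all add: space_nu space_chi)
  have Ea: "{\<omega>. \<omega> w \<in> UNIV \<times> a \<times> UNIV \<times> UNIV} \<in> events" and Eb: "{\<omega>. \<omega> w \<in> UNIV \<times> UNIV \<times> b \<times> UNIV} \<in> events" for w
    by (rule coord_rectangle(1)[OF a], simp) (rule coord_rectangle(1)[OF _ b], simp)
  have E: "?E w \<in> events" for w by (intro sets.Un Ea Eb)
  have EW: "(\<Union>w\<in>?W. ?E w) \<in> events" by (intro sets.finite_UN fW E)
  have "space gw_measure - small_offspring r L \<in> events"
    using sets_small_offspring by (intro sets.compl_sets) (simp add: sets_gw_measure)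
  then have S: "- small_offspring r L \<in> events" by (simp add: Compl_eq_Diff_UNIV)
  have pE: "prob (?E w) \<le> measure \<nu> a + measure chi b" for w
  proof -
    have "prob (?E w) \<le> prob {\<omega>. \<omega> w \<in> UNIV \<times> a \<times> UNIV \<times> UNIV} + prob {\<omega>. \<omega> w \<in> UNIV \<times> UNIV \<times> b \<times> UNIV}"
      by (rule measure_Un_le[OF Ea Eb])
    also have "\<dots> = measure \<nu> a + measure chi b"
      using coord_rectangle(2)[OF a, of UNIV w] coord_rectangle(2)[OF _ b, of UNIV w] U by simp
    finally show ?thesis .
  qed
  have pW: "prob (\<Union>w\<in>?W. ?E w) \<le> \<epsilon> / 2"
  proof -
    have "prob (\<Union>w\<in>?W. ?E w) \<le> (\<Sum>w\<in>?W. prob (?E w))" using fW E by (intro measure_UNION_le) auto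
    also have "\<dots> \<le> real (card ?W) * (measure \<nu> a + measure chi b)"
      using pE by (intro sum_bounded_above) auto
    finally show ?thesis using bad by linarith
  qed
  have e0: "0 < \<epsilon>"
  proof -
    have "0 \<le> 1 / (1 + real r)" by simp
    then show ?thesis using r by linarith
  qed
  show ?thesis unfolding ugw_def rho_def
  proof (rule levy_prokhorov_coupling[OF prob_gw_measure gw_class_meas gw_class_proj_meas e0])
    show "?B \<in> events" by (rule sets.Un[OF S EW])
    have "prob ?B \<le> prob (- small_offspring r L) + prob (\<Union>w\<in>?W. ?E w)" by (rule measure_Un_le[OF S EW])
    then show "prob ?B \<le> \<epsilon>" using large pW by linarith
  next
    fix \<omega> assume "\<omega> \<in> space gw_measure - ?B"
    then have so: "\<omega> \<in> small_offspring r L" and nE: "\<And>w. w \<in> ?W \<Longrightarrow> \<omega> \<notin> ?E w" by auto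
    have close: "dist (fst (snd (\<omega> w))) (fst (snd (proj \<omega> w))) < \<delta> \<and>
        dist (fst (gw_pair \<omega> w)) (fst (gw_pair (proj \<omega>) w)) < \<delta> \<and>
        dist (snd (gw_pair \<omega> w)) (snd (gw_pair (proj \<omega>) w)) < \<delta>"
      if "w \<in> verts (gw_tree \<omega>)" "length w \<le> r" for w
    proof -
      have "w \<in> ?W" using gw_ball_small_offspring[OF so, of w] that by (auto simp: gw_ball_def)
      then have nw: "\<omega> \<notin> ?E w" by (rule nE)
      obtain N t x1 x2 c where z: "\<omega> w = (N, t, (x1, x2), c)" by (metis surj_pair)
      have "t \<notin> a" "(x1, x2) \<notin> b" using nw by (auto simp: z)
      moreover have "gw_pair \<omega> w = (if c then (x1, x2) else (x2, x1))"
        by (simp add: z gw_pair_orient orient_def)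
      ultimately show ?thesis using f[of t] g[of x1 x2] by (auto simp: z)
    qed
    show "dist (gw_class \<omega>) (gw_class (proj \<omega>)) < \<epsilon>"
    proof (rule dist_iso_class_less[OF rooted_connected_gw_tree rooted_connected_gw_tree _ r])
      show "near r \<delta> (gw_tree \<omega>, []) (gw_tree (proj \<omega>), [])"
        by (rule near_gw_tree) (use close in auto)
    qed
  qed
qed

end

section \<open>Tagged partitions\<close>

lemma projection_eq:
  assumes P: "tagged_partition P" and C: "(C, t) \<in> set P" "x \<in> C"
  shows "projection P x = t"
  unfolding projection_def
proof (rule the_equality)
  show "\<exists>C. (C, t) \<in> set P \<and> x \<in> C" using C by blast
  fix t' assume "\<exists>C. (C, t') \<in> set P \<and> x \<in> C"
  then obtain C' where C': "(C', t') \<in> set P" "x \<in> C'" by blast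
  obtain i j where i: "i < length P" "P ! i = (C, t)" and j: "j < length P" "P ! j = (C', t')"
    using C(1) C'(1) by (auto simp: in_set_conv_nth)
  have "i = j"
  proof (rule ccontr)
    assume "i \<noteq> j"
    then have "fst (P ! i) \<inter> fst (P ! j) = {}" using P i(1) j(1) unfolding tagged_partition_def by blast
    then show False using i(2) j(2) C(2) C'(2) by auto
  qed
  then show "t' = t" using i j by simp
qed

lemma set_insert_last: "xs \<noteq> [] \<Longrightarrow> set xs = insert (last xs) (set (butlast xs))"
  by (induction xs rule: rev_induct) auto

text \<open>In the third claim the point \<open>x\<close> excludes an empty last cell, the one case
  in which the tag may lie outside.\<close>

lemma tagged_partitionD:
  assumes "tagged_partition P"
  shows "P \<noteq> []" and "(C, t) \<in> set P \<Longrightarrow> C \<in> sets borel" and "(C, t) \<in> set P \<Longrightarrow> x \<in> C \<Longrightarrow> t \<in> C"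
proof -
  have 1: "\<forall>(C, t)\<in>set P. C \<in> sets borel" and 2: "\<forall>(C, t)\<in>set (butlast P). t \<in> C"
    and 3: "fst (last P) \<noteq> {} \<longrightarrow> snd (last P) \<in> fst (last P)" and P: "P \<noteq> []"
    using assms unfolding tagged_partition_def by blast+
  show "P \<noteq> []" by (rule P)
  show "C \<in> sets borel" if "(C, t) \<in> set P" using bspec[OF 1 that] unfolding prod.case .
  show "t \<in> C" if "(C, t) \<in> set P" "x \<in> C"
  proof (cases "(C, t) = last P")
    case True
    then show ?thesis using 3 that(2) by (metis empty_iff fst_conv snd_conv)
  next
    case False
    then have "(C, t) \<in> set (butlast P)" using set_insert_last[OF P] that(1) by blast
    then show ?thesis using bspec[OF 2] by blast
  qed
qed

lemma tagged_partition_cell: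
  assumes "tagged_partition P"
  obtains C where "(C, projection P x) \<in> set P" "x \<in> C" "projection P x \<in> C"
proof -
  have "x \<in> (\<Union>(C, t)\<in>set P. C)" using assms unfolding tagged_partition_def by blast
  then obtain C t where C: "(C, t) \<in> set P" "x \<in> C" by auto
  have "t \<in> C" by (rule tagged_partitionD(3)[OF assms C])
  then show ?thesis using that[of C] C projection_eq[OF assms C] by simp
qed

lemma projection_in_tags: "tagged_partition P \<Longrightarrow> projection P x \<in> tags P"
  by (erule tagged_partition_cell[of P x]) (auto simp: tags_def)

lemma finite_tags: "finite (tags P)"
  by (rule finite_subset[of _ "snd ` set P"]) (auto simp: tags_def intro: rev_image_eqI)

lemma measurable_projection:
  assumes "tagged_partition P"
  shows "projection P \<in> borel_measurable borel"
proof (rule measurableI)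
  fix S :: "'a set"
  have "projection P -` S = (\<Union>p\<in>{p \<in> set P. snd p \<in> S}. fst p)"
  proof (intro equalityI subsetI)
    fix x assume x: "x \<in> projection P -` S"
    obtain C where C: "(C, projection P x) \<in> set P" "x \<in> C" by (rule tagged_partition_cell[OF assms])
    then show "x \<in> (\<Union>p\<in>{p \<in> set P. snd p \<in> S}. fst p)"
      using x by (intro UN_I[of "(C, projection P x)"]) auto
  qed (use projection_eq[OF assms] in auto)
  moreover have "fst p \<in> sets borel" if "p \<in> set P" for p
    using tagged_partitionD(2)[OF assms, of "fst p" "snd p"] that by simp
  ultimately show "projection P -` S \<inter> space borel \<in> sets borel" by auto
qed simp

lemma dist_projection_le:
  assumes P: "tagged_partition P" and diam: "\<And>C t y z. (C, t) \<in> set (butlast P) \<Longrightarrow> y \<in> C \<Longrightarrow> z \<in> C \<Longrightarrow> dist y z \<le> \<epsilon>"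
    and x: "x \<notin> fst (last P)"
  shows "dist x (projection P x) \<le> \<epsilon>"
proof -
  obtain C where C: "(C, projection P x) \<in> set P" "x \<in> C" "projection P x \<in> C"
    by (rule tagged_partition_cell[OF P])
  note set_insert_last[OF tagged_partitionD(1)[OF P]]
  moreover have "(C, projection P x) \<noteq> last P" using C(2) x by (metis fst_conv)
  ultimately have "(C, projection P x) \<in> set (butlast P)" using C(1) by auto
  then show ?thesis using diam C by blast
qed

lemma good_pairD:
  assumes "good_pair \<nu> chi \<epsilon> \<delta> P P'"
  shows "tagged_partition P" "tagged_partition P'"
    and "(C, t) \<in> set (butlast P) \<Longrightarrow> y \<in> C \<Longrightarrow> z \<in> C \<Longrightarrow> dist y z \<le> \<epsilon>"
    and "(C', t') \<in> set (butlast P') \<Longrightarrow> y' \<in> C' \<Longrightarrow> z' \<in> C' \<Longrightarrow> dist y' z' \<le> \<epsilon>"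
    and "measure \<nu> (fst (last P)) < \<delta>"
    and "measure chi (fst (last P') \<times> UNIV \<union> UNIV \<times> fst (last P')) < \<delta>"
proof -
  show "tagged_partition P" "tagged_partition P'" "measure \<nu> (fst (last P)) < \<delta>"
    "measure chi (fst (last P') \<times> UNIV \<union> UNIV \<times> fst (last P')) < \<delta>"
    using assms by (simp_all only: good_pair_def)
  have P: "\<forall>(C, t)\<in>set (butlast P). \<forall>x\<in>C. \<forall>y\<in>C. dist x y \<le> \<epsilon>"
    and P': "\<forall>(C, t)\<in>set (butlast P'). \<forall>(C', t')\<in>set (butlast P').
      \<forall>x\<in>C. \<forall>y\<in>C. \<forall>x'\<in>C'. \<forall>y'\<in>C'. max (dist x y) (dist x' y') \<le> \<epsilon>"
    using conjunct1[OF conjunct2[OF conjunct2[OF assms[unfolded good_pair_def]]]]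
      conjunct1[OF conjunct2[OF conjunct2[OF conjunct2[OF assms[unfolded good_pair_def]]]]] by - assumption+
  show "dist y z \<le> \<epsilon>" if C: "(C, t) \<in> set (butlast P)" "y \<in> C" "z \<in> C"
    using bspec[OF P C(1)] C(2,3) unfolding prod.case by blast
  show "dist y' z' \<le> \<epsilon>" if C: "(C', t') \<in> set (butlast P')" "y' \<in> C'" "z' \<in> C'"
  proof -
    have "\<forall>(C, t)\<in>set (butlast P'). \<forall>x\<in>C'. \<forall>y\<in>C'. \<forall>x'\<in>C. \<forall>y'\<in>C. max (dist x y) (dist x' y') \<le> \<epsilon>"
      using bspec[OF P' C(1)] unfolding prod.case .
    from bspec[OF this C(1)] have "max (dist y' z') (dist y' z') \<le> \<epsilon>"
      using C(2,3) unfolding prod.case by blast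
    then show ?thesis by simp
  qed
qed

lemma good_pair_projected_gw:
  assumes "good_pair \<nu> chi \<epsilon> \<delta> P P'" "\<nu> \<in> prob_measures" "chi \<in> prob_measures" "0 < d"
  shows "projected_gw \<nu> chi d (projection P) (projection P') (tags P) (tags P')"
proof -
  note P = good_pairD(1,2)[OF assms(1)]
  show ?thesis
    by unfold_locales (auto intro: assms(2-4) finite_tags projection_in_tags[OF P(1)] projection_in_tags[OF P(2)]
      measurable_projection[OF P(1)] measurable_projection[OF P(2)])
qed

text \<open>The order of choices matters: \<open>r\<close> depends on \<open>\<epsilon>\<close>,
  \<open>L\<close> on \<open>r\<close> and \<open>\<epsilon>\<close>, and both stay fixed while
  \<open>k\<close> grows. The number of words in the union bound is then a constant, against which
  the bad masses \<open>exp (- k^2)\<close> tend to zero.\<close>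

lemma eventually_levy_prokhorov_rho:
  fixes \<nu> :: "'a::polish_space measure" and chi :: "('b::polish_space \<times> 'b) measure"
  assumes nu: "\<nu> \<in> prob_measures" and chi: "chi \<in> prob_measures" and d: "0 < d"
    and good: "\<And>k. 1 \<le> k \<Longrightarrow> good_pair \<nu> chi (1 / (2 * real k)) (exp (- (real k)\<^sup>2)) (P k) (P' k)"
    and "0 < \<epsilon>"
  shows "\<forall>\<^sub>F k in sequentially. levy_prokhorov (ugw \<nu> chi d)
    (projected_gw.rho \<nu> chi d (projection (P k)) (projection (P' k))) < \<epsilon>"
proof -
  define e where "e = \<epsilon> / 2"
  have e: "0 < e" "e < \<epsilon>" using \<open>0 < \<epsilon>\<close> by (auto simp: e_def)
  obtain r where r: "1 / (1 + real r) < e"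
    using reals_Archimedean[OF e(1)] by (auto simp: inverse_eq_divide)
  \<comment> \<open>This instance supplies facts about \<open>gw_space\<close>, which involves no
    projection and hence no \<open>k\<close>.\<close>
  interpret P1: projected_gw \<nu> chi d "projection (P 1)" "projection (P' 1)" "tags (P 1)" "tags (P' 1)"
    by (rule good_pair_projected_gw[OF good nu chi d]) simp
  interpret GW: prob_space "gw_space \<nu> chi d" by (rule P1.prob_gw_measure)
  obtain L where L: "measure (gw_space \<nu> chi d) (- small_offspring r L) \<le> e / 2"
  proof -
    have so: "small_offspring r L \<in> GW.events" for L
      using sets_small_offspring by (simp add: P1.sets_gw_measure)
    have "(\<lambda>L. GW.prob (small_offspring r L)) \<longlonglongrightarrow> GW.prob (\<Union>L. small_offspring r L)"
      using so by (intro GW.finite_Lim_measure_incseq incseq_small_offspring) auto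
    also have "GW.prob (\<Union>L. small_offspring r L) = 1"
      using GW.prob_space by (simp add: UN_small_offspring)
    finally have "\<forall>\<^sub>F L in sequentially. 1 - e / 2 < GW.prob (small_offspring r L)"
      using e by (intro order_tendstoD) auto
    then obtain L where "1 - e / 2 < GW.prob (small_offspring r L)"
      using eventually_happens'[OF sequentially_bot] by blast
    moreover have "GW.prob (- small_offspring r L) = 1 - GW.prob (small_offspring r L)"
      using GW.prob_compl[OF so] by (simp add: Compl_eq_Diff_UNIV)
    ultimately show ?thesis by (intro that[of L]) simp
  qed
  define c where "c = real (card {w :: nat list. set w \<subseteq> {..<L} \<and> length w \<le> r})"
  have "(\<lambda>k. 1 / (1 + real r) + 1 / real k) \<longlonglongrightarrow> 1 / (1 + real r) + 0"
    by (intro tendsto_add tendsto_const lim_1_over_n)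
  then have 1: "\<forall>\<^sub>F k in sequentially. 1 / (1 + real r) + 1 / real k < e"
    using r by (intro order_tendstoD) auto
  have "filterlim (\<lambda>k. (real k)\<^sup>2) at_top sequentially"
    by (intro filterlim_pow_at_top filterlim_real_sequentially) simp
  then have "(\<lambda>k. exp (- (real k)\<^sup>2)) \<longlonglongrightarrow> 0"
    by (intro filterlim_compose[OF exp_at_bot]) (simp add: filterlim_uminus_at_bot)
  then have "(\<lambda>k. c * (exp (- (real k)\<^sup>2) + exp (- (real k)\<^sup>2))) \<longlonglongrightarrow> c * (0 + 0)"
    by (intro tendsto_mult tendsto_add tendsto_const)
  then have 2: "\<forall>\<^sub>F k in sequentially. c * (exp (- (real k)\<^sup>2) + exp (- (real k)\<^sup>2)) < e / 2"
    using e by (intro order_tendstoD) auto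
  show ?thesis using 1 2 eventually_ge_at_top[of 1]
  proof eventually_elim
    case (elim k)
    interpret Pk: projected_gw \<nu> chi d "projection (P k)" "projection (P' k)" "tags (P k)" "tags (P' k)"
      by (rule good_pair_projected_gw[OF good[OF elim(3)] nu chi d])
    note gd = good_pairD[OF good[OF elim(3)]]
    note tp = gd(1,2)
    let ?a = "fst (last (P k))" and ?a' = "fst (last (P' k))"
    let ?b = "?a' \<times> UNIV \<union> UNIV \<times> ?a'"
    have ms: "?a \<in> sets borel" "?a' \<in> sets borel"
      using tagged_partitionD(1)[OF tp(1)] tagged_partitionD(1)[OF tp(2)]
        tagged_partitionD(2)[OF tp(1), of ?a "snd (last (P k))"] tagged_partitionD(2)[OF tp(2), of ?a' "snd (last (P' k))"]
      by simp_all
    have b: "?b \<in> sets borel" unfolding borel_prod[symmetric] using ms by (intro sets.Un pair_measureI) auto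
    \<comment> \<open>Diameters are bounded by \<open>1 / (2 * k)\<close> with equality allowed,
      while \<open>near\<close> asks for strict inequality; \<open>1 / k\<close> leaves
      room.\<close>
    have lt: "1 / (2 * real k) < 1 / real k" using elim(3) by (simp add: field_simps)
    have d1: "dist t (projection (P k) t) < 1 / real k" if "t \<notin> ?a" for t
      by (rule order.strict_trans1[OF dist_projection_le[OF tp(1) gd(3) that] lt])
    have d2: "dist x (projection (P' k) x) < 1 / real k" if "x \<notin> ?a'" for x
      by (rule order.strict_trans1[OF dist_projection_le[OF tp(2) gd(4) that] lt])
    have "levy_prokhorov (ugw \<nu> chi d) Pk.rho \<le> e"
    proof (rule Pk.levy_prokhorov_ugw_rho[OF ms(1) b d1 _ _ elim(1) L])
      show "dist x (projection (P' k) x) < 1 / real k \<and> dist x' (projection (P' k) x') < 1 / real k"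
        if "(x, x') \<notin> ?b" for x x' using that d2 by auto
      show "0 < 1 / real k" using elim(3) by simp
      have "measure \<nu> ?a + measure chi ?b \<le> exp (- (real k)\<^sup>2) + exp (- (real k)\<^sup>2)" using gd(5,6) by linarith
      then have "c * (measure \<nu> ?a + measure chi ?b) \<le> c * (exp (- (real k)\<^sup>2) + exp (- (real k)\<^sup>2))"
        by (intro mult_left_mono) (auto simp: c_def)
      then show "real (card {w :: nat list. set w \<subseteq> {..<L} \<and> length w \<le> r}) * (measure \<nu> ?a + measure chi ?b) \<le> e / 2"
        using elim(2) unfolding c_def by linarith
    qed
    then show ?case using e by linarith
  qed
qed

section \<open>The rate functions of general marks\<close>

text \<open>The minimum is 0: nonnegativity of all approximating functions passes to the limit, and
  for every radius the points \<open>\<rho> k\<close> of rate at most 0 eventually lie in the ball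
  around \<open>\<mu>\<close>. Indices start at 1, where the good pairs do.\<close>

lemma is_arg_min_lower_limit:
  assumes mu: "\<mu> \<in> prob_measures"
    and nonneg: "\<And>k \<sigma>. 1 \<le> k \<Longrightarrow> \<sigma> \<in> prob_measures \<Longrightarrow> 0 \<le> I k \<sigma>"
    and rho: "\<And>k. 1 \<le> k \<Longrightarrow> \<rho> k \<in> prob_measures" "\<And>k. 1 \<le> k \<Longrightarrow> I k (\<rho> k) \<le> 0"
    and conv: "\<And>\<epsilon>. 0 < \<epsilon> \<Longrightarrow> \<forall>\<^sub>F k in sequentially. levy_prokhorov \<mu> (\<rho> k) < \<epsilon>"
  shows "is_arg_min (lower_limit I) (\<lambda>\<mu>. \<mu> \<in> prob_measures) \<mu>"
proof -
  have "0 \<le> lower_limit I \<sigma>" for \<sigma>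
    unfolding lower_limit_def
  proof (rule le_Limsup)
    show "\<forall>\<^sub>F \<delta> in at_right 0. 0 \<le> limsup (\<lambda>k. INF \<sigma>'\<in>{\<sigma>'\<in>prob_measures. levy_prokhorov \<sigma> \<sigma>' < \<delta>}. I k \<sigma>')"
    proof (rule always_eventually, rule allI, rule le_Limsup)
      show "\<forall>\<^sub>F k in sequentially. 0 \<le> (INF \<sigma>'\<in>{\<sigma>'\<in>prob_measures. levy_prokhorov \<sigma> \<sigma>' < \<delta>}. I k \<sigma>')" for \<delta>
        using eventually_ge_at_top[of 1] by eventually_elim (intro INF_greatest nonneg, auto)
    qed simp
  qed simp
  moreover have "lower_limit I \<mu> \<le> 0"
    unfolding lower_limit_def
  proof (rule Limsup_bounded)
    show "\<forall>\<^sub>F \<delta> in at_right 0. limsup (\<lambda>k. INF \<sigma>\<in>{\<sigma>\<in>prob_measures. levy_prokhorov \<mu> \<sigma> < \<delta>}. I k \<sigma>) \<le> 0"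
      using eventually_at_right_less[of "0 :: real"]
    proof eventually_elim
      case (elim \<delta>)
      show ?case
      proof (rule Limsup_bounded)
        show "\<forall>\<^sub>F k in sequentially. (INF \<sigma>\<in>{\<sigma>\<in>prob_measures. levy_prokhorov \<mu> \<sigma> < \<delta>}. I k \<sigma>) \<le> 0"
          using conv[OF elim] eventually_ge_at_top[of 1]
        proof eventually_elim
          case (elim k)
          then show ?case using rho by (intro INF_lower2[of "\<rho> k"]) auto
        qed
      qed
    qed
  qed
  ultimately have "\<not> lower_limit I \<sigma> < lower_limit I \<mu>" for \<sigma>
    by (meson leD order_trans)
  then show ?thesis using mu by (simp add: is_arg_min_def)
qed

theorem proposition3p6:
  fixes \<nu> :: "'a::polish_space measure" and chi :: "('b::polish_space \<times> 'b) measure" and d :: real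
    and P :: "nat \<Rightarrow> 'a tpartition" and P' :: "nat \<Rightarrow> 'b tpartition" and R :: "nat \<Rightarrow> ('b \<times> 'b) set"
  assumes "\<nu> \<in> prob_measures" and "chi \<in> prob_measures" and "d > 0"
    and "\<And>k. k \<ge> 1 \<Longrightarrow> good_pair \<nu> chi (1 / (2 * real k)) (exp (- (real k)\<^sup>2)) (P k) (P' k)"
    and "\<And>k. k \<ge> 1 \<Longrightarrow> linear_order_on (tags (P' k)) (R k)"
  shows "is_arg_min (rate_u_bar P P' R \<nu> chi d) (\<lambda>\<mu>. \<mu> \<in> prob_measures) (ugw \<nu> chi d) \<and>
         is_arg_min (rate_ER_bar P P' R \<nu> chi d) (\<lambda>\<mu>. \<mu> \<in> prob_measures) (ugw \<nu> chi d)"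
proof -
  let ?\<rho> = "\<lambda>k. projected_gw.rho \<nu> chi d (projection (P k)) (projection (P' k))"
  have gw: "projected_gw \<nu> chi d (projection (P k)) (projection (P' k)) (tags (P k)) (tags (P' k))" if "1 \<le> k" for k
    by (rule good_pair_projected_gw[OF assms(4)[OF that] assms(1-3)])
  have ugw: "ugw \<nu> chi d \<in> prob_measures" by (rule projected_gw.ugw_prob[OF gw[OF order_refl]])
  have rho: "?\<rho> k \<in> prob_measures" if "1 \<le> k" for k by (rule projected_gw.rho_prob[OF gw[OF that]])
  have marks: "AE g in ?\<rho> k. marks_in (tags (P k)) (tags (P' k)) g" if "1 \<le> k" for k
    by (rule projected_gw.AE_rho_marks_in[OF gw[OF that]])
  have conv: "\<forall>\<^sub>F k in sequentially. levy_prokhorov (ugw \<nu> chi d) (?\<rho> k) < \<epsilon>" if "0 < \<epsilon>" for \<epsilon>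
    by (rule eventually_levy_prokhorov_rho[OF assms(1-4) that])
  have law: "project_law (P k) \<nu> \<in> prob_measures" "project_law2 (P' k) chi \<in> prob_measures" if "1 \<le> k" for k
  proof -
    interpret projected_gw \<nu> chi d "projection (P k)" "projection (P' k)" "tags (P k)" "tags (P' k)"
      by (rule gw[OF that])
    have "projection (P k) \<in> borel_measurable \<nu>" "map_prod (projection (P' k)) (projection (P' k)) \<in> borel_measurable chi"
      using f_meas map_prod_g_meas measurable_cong_sets[OF sets_nu refl] measurable_cong_sets[OF sets_chi refl] by blast+
    then show "project_law (P k) \<nu> \<in> prob_measures" "project_law2 (P' k) chi \<in> prob_measures"
      unfolding project_law_def project_law2_def
      by (simp_all add: space_prob_algebra prob_space.prob_space_distr[OF prob_nu] prob_space.prob_space_distr[OF prob_chi])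
  qed
  have "is_arg_min (lower_limit (\<lambda>k. rate_u_k (P k) (P' k) (R k) \<nu> chi d)) (\<lambda>\<mu>. \<mu> \<in> prob_measures) (ugw \<nu> chi d)"
  proof (rule is_arg_min_lower_limit[OF ugw _ rho _ conv])
    fix k :: nat assume k: "1 \<le> k"
    \<comment> \<open>Off the measures supported on the tags \<open>extend_rate\<close> is
      \<open>\<infinity>\<close>, so nonnegativity is at stake only for supported ones, as
      \<open>rate_u_nonneg\<close> requires.\<close>
    show "0 \<le> rate_u_k (P k) (P' k) (R k) \<nu> chi d \<sigma>" if "\<sigma> \<in> prob_measures" for \<sigma>
      unfolding rate_u_k_def extend_rate_def
      using rate_u_nonneg[OF finite_tags finite_tags assms(5)[OF k] law[OF k] less_imp_le[OF assms(3)] that] by simp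
    show "rate_u_k (P k) (P' k) (R k) \<nu> chi d (?\<rho> k) \<le> 0"
      unfolding rate_u_k_def extend_rate_def project_law_def project_law2_def
      using marks[OF k] projected_gw.rate_u_rho[OF gw[OF k] assms(5)[OF k]] by simp
  qed
  moreover have "is_arg_min (lower_limit (\<lambda>k. rate_ER_k (P k) (P' k) (R k) \<nu> chi d)) (\<lambda>\<mu>. \<mu> \<in> prob_measures) (ugw \<nu> chi d)"
  proof (rule is_arg_min_lower_limit[OF ugw _ rho _ conv])
    fix k :: nat assume k: "1 \<le> k"
    show "0 \<le> rate_ER_k (P k) (P' k) (R k) \<nu> chi d \<sigma>" if "\<sigma> \<in> prob_measures" for \<sigma>
      unfolding rate_ER_k_def extend_rate_def
      using rate_ER_nonneg[OF finite_tags finite_tags assms(5)[OF k] law[OF k] assms(3) that] by simp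
    show "rate_ER_k (P k) (P' k) (R k) \<nu> chi d (?\<rho> k) \<le> 0"
      unfolding rate_ER_k_def extend_rate_def project_law_def project_law2_def
      using marks[OF k] projected_gw.rate_ER_rho[OF gw[OF k] assms(5)[OF k]] by simp
  qed
  ultimately show ?thesis unfolding rate_u_bar_def[abs_def] rate_ER_bar_def[abs_def] by simp
qed

end
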